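(* Let $\lambda\in\mathbb Z^{m|n}_{++}$ and choose a nonzero vector $\mathfrak m_\lambda\in L(\lambda)_\lambda$ in the irreducible $U_{q,F}(m|n)$-supermodule $L(\lambda)$. Fix the following ordering on the positive odd roots: $$\beta_1=\alpha_{m,m+1},\ \dots,\ \beta_m=\alpha_{1,m+1},\ \beta_{m+1}=\alpha_{m,m+2},\ \dots,\ \beta_{2m}=\alpha_{1,m+2},\ \dots,\ \beta_{mn}=\alpha_{1,m+n}.$$ Define recursively $\mathfrak m_\lambda^{(0)}=\mathfrak m_\lambda$ and, for $1\le k\le mn$, $$\mathfrak m_\lambda^{(k)}=\begin{cases}\mathfrak m_\lambda^{(k-1)},&\text{if } l\mid(\mathrm{wt}(\mathfrak m_\lambda^{(k-1)}),\beta_k)_s;\\ E_{-\beta_k}\mathfrak m_\lambda^{(k-1)},&\text{if } l\nmid(\mathrm{wt}(\mathfrak m_\lambda^{(k-1)}),\beta_k)_s.\end{cases}$$ Then, for all $0\le k\le mn$: (1) $\mathfrak m_\lambda^{(k)}\ne0$; (2) $E_{i,i+1}^{(M)}\,\mathfrak m_\lambda^{(k)}=0$ for all $M>0$ and $1\le i\le m+n-1$ with $i\ne m$; (3) $E_{-\beta_i}\,\mathfrak m_\lambda^{(k)}=0=E_{\beta_j}\,\mathfrak m_\lambda^{(k)}$ for all $1\le i\le k<j\le mn$.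
   Context: Let $m,n\ge 0$ be integers, $m+n>0$; $\bar i=\bar 0$ for $1\le i\le m$ and $\bar i=\bar 1$ for $m<i\le m+n$. Let $\epsilon_1,\dots,\epsilon_{m+n}$ be the standard basis of $\mathbb Z^{m+n}$ with bilinear form $(\epsilon_i,\epsilon_j)=(\epsilon_i,\epsilon_j)_s=(-1)^{\bar i}\delta_{ij}$, $\alpha_i=\epsilon_i-\epsilon_{i+1}$, $\alpha_{a,b}=\epsilon_a-\epsilon_b$; the root $\alpha_{a,b}$ is odd if $\bar a+\bar b=\bar1$. Let $\upsilon$ be an indeterminate, $\upsilon_a=\upsilon^{(-1)^{\bar a}}$, $\mathcal Z=\mathbb Z[\upsilon,\upsilon^{-1}]$, and $[X,Y]=XY-(-1)^{\bar X\bar Y}YX$ for homogeneous $X,Y$. $U_\upsilon(\mathfrak{gl}_{m|n})$ is the $\mathbb Q(\upsilon)$-superalgebra generated by $E_a,F_a$ ($1\le a<m+n$), $K_j^{\pm1}$ ($1\le j\le m+n$), with $E_m,F_m$ odd and the other generators even, subject to (whenever the indices make sense): $K_aK_b=K_bK_a$, $K_aK_a^{-1}=K_a^{-1}K_a=1$; $K_aE_b=\upsilon^{(\epsilon_a,\alpha_b)}E_bK_a$, $K_aF_b=\upsilon^{-(\epsilon_a,\alpha_b)}F_bK_a$; $[E_a,F_b]=\delta_{a,b}\frac{K_aK_{a+1}^{-1}-K_a^{-1}K_{a+1}}{\upsilon_a-\upsilon_a^{-1}}$; $E_aE_b=E_bE_a$, $F_aF_b=F_bF_a$ if $|a-b|>1$;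 for $a\ne m$, $|a-b|=1$: $E_a^2E_b-(\upsilon_a+\upsilon_a^{-1})E_aE_bE_a+E_bE_a^2=0$ and the same with $F$ in place of $E$; $E_m^2=F_m^2=[E_m,E_{m-1,m+2}]=[F_m,E_{m+2,m-1}]=0$, where $E_{m-1,m+2}=E_{m-1}E_mE_{m+1}-\upsilon E_{m-1}E_{m+1}E_m-\upsilon^{-1}E_mE_{m+1}E_{m-1}+E_{m+1}E_mE_{m-1}$ and $E_{m+2,m-1}=F_{m+1}F_mF_{m-1}-\upsilon^{-1}F_mF_{m+1}F_{m-1}-\upsilon F_{m-1}F_{m+1}F_m+F_{m-1}F_mF_{m+1}$. Root vectors: for $\alpha=\epsilon_a-\epsilon_b$, $E_\alpha=E_{a,b}$ is defined by $E_{a,a+1}=E_a$, $E_{a+1,a}=F_a$, and for $|a-b|>1$, with any $c$ strictly between $a$ and $b$ (the result does not depend on $c$): $E_{a,b}=E_{a,c}E_{c,b}-\upsilon_cE_{c,b}E_{a,c}$ if $a>b$, and $E_{a,b}=E_{a,c}E_{c,b}-\upsilon_c^{-1}E_{c,b}E_{a,c}$ if $a<b$. Put $[i]=\frac{\upsilon^i-\upsilon^{-i}}{\upsilon-\upsilon^{-1}}$, $[M]!=[1]\cdots[M]$, $X^{(M)}=X^M/[M]!$, ${s\brack t}=\prod_{i=1}^t\frac{\upsilon^{s-i+1}-\upsilon^{-s+i-1}}{\upsilon^i-\upsilon^{-i}}$ ($s\in\mathbb Z,t\in\mathbb N$), ${K_i;c\brack t}=\prod_{s=1}^t\frac{K_i\upsilon_i^{c-s+1}-K_i^{-1}\upsilon_i^{-c+s-1}}{\upsilon_i^s-\upsilon_i^{-s}}$,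 ${K_i\brack t}={K_i;0\brack t}$. $U_{\upsilon,\mathcal Z}$ is the $\mathcal Z$-subsuperalgebra generated by all $E_i^{(M)},F_i^{(M)},K_j^{\pm1},{K_j\brack t}$ ($t,M\in\mathbb N$). $U_{q,F}=U_{q,F}(m|n)=U_{\upsilon,\mathcal Z}\otimes_{\mathcal Z}F$ via $\upsilon\mapsto q$; $q_a=q^{(-1)^{\bar a}}$, and ${s\brack t}_q$ is the value of ${s\brack t}$ at $\upsilon=q$. $F$ is a field of characteristic $\ne2$ and $q\in F$ is nonzero; either $q$ is a primitive $l'$-th root of unity with $l'\ge3$, in which case $l=l'$ if $l'$ is odd and $l=l'/2$ if $l'$ is even, or $q$ is not a root of unity, in which case $l=\infty$ (and $\infty\mid x$ means $x=0$). For a $U_{q,F}$-supermodule $V$ and $\lambda\in\mathbb Z^{m+n}$, $V_\lambda=\{v\in V: K_av=q_a^{\lambda_a}v,\ {K_a;c\brack t}v={\lambda_a+c\brack t}_qv\ \forall a,\ t\in\mathbb N,\ c\in\mathbb Z\}$, and $\mathrm{wt}(v)=\lambda$ for $0\ne v\in V_\lambda$. $\mathbb Z^{m|n}_{++}=\{\lambda\in\mathbb Z^{m+n}:\lambda_1\ge\cdots\ge\lambda_m,\ \lambda_{m+1}\ge\cdots\ge\lambda_{m+n}\}$. For $\lambda\in\mathbb Z^{m|n}_{++}$, $L(\lambda)$ is the unique irreducible quotient of $U_{q,F}\otimes_{U_{q,F}^{\ge0}}F_\lambda$, where $U_{q,F}^{\ge0}$ is the subalgebra generated by all $E_i^{(M)},K_j^{\pm1},{K_j\brack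 t}$ and $F_\lambda$ is the one-dimensional supermodule of weight $\lambda$ on which all $E_i^{(M)}$, $M>0$, act as $0$. It is finite dimensional. *)

theory Defs
  imports
    "HOL-Library.Poly_Mapping"
    "HOL-Library.FuncSet"
    "HOL-Library.Z2"
    "HOL-Computational_Algebra.Computational_Algebra"
    "HOL-Algebra.Algebra"
    "HOL-Algebra.Algebraic_Closure_Type"
    "HOL-Algebra.Free_Abelian_Groups"
begin

section \<open>Superalgebras and supermodules\<close>

text \<open>A superring is a ring record together with its homogeneous parts, indexed by
  \<open>\<int>/2 = bit\<close>.  As everywhere in HOL-Algebra, the \<open>mult\<close> and \<open>one\<close> fields of a module
  record carry no meaning.  Over a superalgebra containing the ground field (as even central
  elements), the vector space structure of a module is part of its structure as a module over
  the underlying ring.\<close>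

record 'a sring = "'a ring" +
  part :: "bit \<Rightarrow> 'a set"

record ('r, 'v) smod = "('r, 'v) module" +
  mpart :: "bit \<Rightarrow> 'v set"

definition supermodule :: "'r sring \<Rightarrow> ('r, 'v) smod \<Rightarrow> bool" where
  "supermodule A V \<longleftrightarrow>
     abelian_group V \<and>
     (\<forall>a\<in>carrier A. \<forall>x\<in>carrier V. a \<odot>\<^bsub>V\<^esub> x \<in> carrier V) \<and>
     (\<forall>a\<in>carrier A. \<forall>b\<in>carrier A. \<forall>x\<in>carrier V.
        (a \<oplus>\<^bsub>A\<^esub> b) \<odot>\<^bsub>V\<^esub> x = (a \<odot>\<^bsub>V\<^esub> x) \<oplus>\<^bsub>V\<^esub> (b \<odot>\<^bsub>V\<^esub> x)) \<and>
     (\<forall>a\<in>carrier A. \<forall>x\<in>carrier V. \<forall>y\<in>carrier V.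
        a \<odot>\<^bsub>V\<^esub> (x \<oplus>\<^bsub>V\<^esub> y) = (a \<odot>\<^bsub>V\<^esub> x) \<oplus>\<^bsub>V\<^esub> (a \<odot>\<^bsub>V\<^esub> y)) \<and>
     (\<forall>a\<in>carrier A. \<forall>b\<in>carrier A. \<forall>x\<in>carrier V.
        (a \<otimes>\<^bsub>A\<^esub> b) \<odot>\<^bsub>V\<^esub> x = a \<odot>\<^bsub>V\<^esub> (b \<odot>\<^bsub>V\<^esub> x)) \<and>
     (\<forall>x\<in>carrier V. \<one>\<^bsub>A\<^esub> \<odot>\<^bsub>V\<^esub> x = x) \<and>
     (\<forall>p. additive_subgroup (mpart V p) V) \<and>
     mpart V 0 \<inter> mpart V 1 = {\<zero>\<^bsub>V\<^esub>} \<and>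
     mpart V 0 <+>\<^bsub>V\<^esub> mpart V 1 = carrier V \<and>
     (\<forall>p r. \<forall>a\<in>part A p. \<forall>x\<in>mpart V r. a \<odot>\<^bsub>V\<^esub> x \<in> mpart V (p + r))"

definition subsupermodule :: "'r sring \<Rightarrow> ('r, 'v) smod \<Rightarrow> 'v set \<Rightarrow> bool" where
  "subsupermodule A V W \<longleftrightarrow>
     additive_subgroup W V \<and>
     (\<forall>a\<in>carrier A. \<forall>x\<in>W. a \<odot>\<^bsub>V\<^esub> x \<in> W) \<and>
     (W \<inter> mpart V 0) <+>\<^bsub>V\<^esub> (W \<inter> mpart V 1) = W"

definition irreducible_supermodule :: "'r sring \<Rightarrow> ('r, 'v) smod \<Rightarrow> bool" where
  "irreducible_supermodule A V \<longleftrightarrow>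
     supermodule A V \<and> carrier V \<noteq> {\<zero>\<^bsub>V\<^esub>} \<and>
     (\<forall>W. subsupermodule A V W \<longrightarrow> W = {\<zero>\<^bsub>V\<^esub>} \<or> W = carrier V)"

text \<open>Even homomorphisms; their images are exactly the quotients by subsupermodules.\<close>

definition smod_hom :: "'r sring \<Rightarrow> ('r, 'v) smod \<Rightarrow> ('r, 'w) smod \<Rightarrow> ('v \<Rightarrow> 'w) set" where
  "smod_hom A V W = {\<phi>.
     \<phi> \<in> carrier V \<rightarrow> carrier W \<and>
     (\<forall>x\<in>carrier V. \<forall>y\<in>carrier V. \<phi> (x \<oplus>\<^bsub>V\<^esub> y) = \<phi> x \<oplus>\<^bsub>W\<^esub> \<phi> y) \<and>
     (\<forall>a\<in>carrier A. \<forall>x\<in>carrier V. \<phi> (a \<odot>\<^bsub>V\<^esub> x) = a \<odot>\<^bsub>W\<^esub> \<phi> x) \<and>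
     (\<forall>p. \<phi> ` mpart V p \<subseteq> mpart W p)}"


section \<open>Tensor products over a not necessarily commutative ring\<close>

text \<open>\<open>M \<otimes>\<^sub>R N\<close> as the free abelian group on \<open>M \<times> N\<close> modulo the biadditivity and balancing
  relations; \<open>ra\<close> is the right action of \<open>R\<close> on \<open>M\<close> and \<open>la\<close> the left action on \<open>N\<close>.\<close>

definition tensor_rels ::
  "('a, 'c) ring_scheme \<Rightarrow> ('b, 'd) ring_scheme \<Rightarrow> 'r set \<Rightarrow> ('a \<Rightarrow> 'r \<Rightarrow> 'a) \<Rightarrow> ('r \<Rightarrow> 'b \<Rightarrow> 'b)
     \<Rightarrow> ('a \<times> 'b \<Rightarrow>\<^sub>0 int) set" where
  "tensor_rels M N R ra la =
     {frag_of (x \<oplus>\<^bsub>M\<^esub> x', y) - frag_of (x, y) - frag_of (x', y) | x x' y.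
        x \<in> carrier M \<and> x' \<in> carrier M \<and> y \<in> carrier N} \<union>
     {frag_of (x, y \<oplus>\<^bsub>N\<^esub> y') - frag_of (x, y) - frag_of (x, y') | x y y'.
        x \<in> carrier M \<and> y \<in> carrier N \<and> y' \<in> carrier N} \<union>
     {frag_of (ra x r, y) - frag_of (x, la r y) | x y r.
        x \<in> carrier M \<and> y \<in> carrier N \<and> r \<in> R}"

definition tensor_ker ::
  "('a, 'c) ring_scheme \<Rightarrow> ('b, 'd) ring_scheme \<Rightarrow> 'r set \<Rightarrow> ('a \<Rightarrow> 'r \<Rightarrow> 'a) \<Rightarrow> ('r \<Rightarrow> 'b \<Rightarrow> 'b)
     \<Rightarrow> ('a \<times> 'b \<Rightarrow>\<^sub>0 int) set" where
  "tensor_ker M N R ra la =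
     generate (free_Abelian_group (carrier M \<times> carrier N)) (tensor_rels M N R ra la)"

definition tensor_group ::
  "('a, 'c) ring_scheme \<Rightarrow> ('b, 'd) ring_scheme \<Rightarrow> 'r set \<Rightarrow> ('a \<Rightarrow> 'r \<Rightarrow> 'a) \<Rightarrow> ('r \<Rightarrow> 'b \<Rightarrow> 'b)
     \<Rightarrow> ('a \<times> 'b \<Rightarrow>\<^sub>0 int) set monoid" where
  "tensor_group M N R ra la =
     free_Abelian_group (carrier M \<times> carrier N) Mod tensor_ker M N R ra la"

definition tensor_class ::
  "('a, 'c) ring_scheme \<Rightarrow> ('b, 'd) ring_scheme \<Rightarrow> 'r set \<Rightarrow> ('a \<Rightarrow> 'r \<Rightarrow> 'a) \<Rightarrow> ('r \<Rightarrow> 'b \<Rightarrow> 'b)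
     \<Rightarrow> ('a \<times> 'b \<Rightarrow>\<^sub>0 int) \<Rightarrow> ('a \<times> 'b \<Rightarrow>\<^sub>0 int) set" where
  "tensor_class M N R ra la c =
     tensor_ker M N R ra la #>\<^bsub>free_Abelian_group (carrier M \<times> carrier N)\<^esub> c"


section \<open>The field \<open>\<rat>(\<upsilon>)\<close>, the ring \<open>\<int>[\<upsilon>,\<upsilon>\<inverse>]\<close> and Gaussian binomials\<close>

type_synonym qv = "rat poly fract"

definition ups :: qv where
  "ups = Fraction_Field.Fract [:0, 1:] 1"

text \<open>The Laurent polynomial \<open>\<Sum>k. z\<^sub>k \<upsilon>\<^sup>k\<close> is represented by its finitely supported
  coefficient function; \<open>laurent_eval x\<close> is the ring homomorphism with \<open>\<upsilon> \<mapsto> x\<close>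
  (for \<open>x \<noteq> 0\<close>).\<close>

type_synonym laurent = "int \<Rightarrow>\<^sub>0 int"

definition laurent_eval :: "'k::field \<Rightarrow> laurent \<Rightarrow> 'k" where
  "laurent_eval x z = (\<Sum>k\<in>Poly_Mapping.keys z. of_int (Poly_Mapping.lookup z k) * x powi k)"

text \<open>The value at \<open>\<upsilon> = q\<close> of an element of \<open>\<int>[\<upsilon>,\<upsilon>\<inverse>] \<subseteq> \<rat>(\<upsilon>)\<close>.\<close>

definition specialize :: "'f::field \<Rightarrow> qv \<Rightarrow> 'f" where
  "specialize q x = laurent_eval q (THE z. laurent_eval ups z = x)"

definition qint :: "nat \<Rightarrow> qv" where
  "qint i = (ups powi int i - ups powi (- int i)) / (ups - inverse ups)"

definition qfact :: "nat \<Rightarrow> qv" where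
  "qfact M = (\<Prod>i=1..M. qint i)"

definition qbinom :: "int \<Rightarrow> nat \<Rightarrow> qv" where
  "qbinom s t = (\<Prod>i=1..t. (ups powi (s - int i + 1) - ups powi (- s + int i - 1))
                            / (ups powi int i - ups powi (- int i)))"


section \<open>Weights and roots\<close>

definition ipar :: "nat \<Rightarrow> nat \<Rightarrow> bit" where
  "ipar m i = (if i \<le> m then 0 else 1)"

definition isgn :: "nat \<Rightarrow> nat \<Rightarrow> int" where
  "isgn m i = (if ipar m i = 0 then 1 else - 1)"

text \<open>Elements of \<open>\<int>\<^sup>m\<^sup>+\<^sup>n\<close> are functions, \<open>undefined\<close> outside \<open>{1..m+n}\<close>.\<close>

definition wlat :: "nat \<Rightarrow> nat \<Rightarrow> (nat \<Rightarrow> int) set" where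
  "wlat m n = {1..m+n} \<rightarrow>\<^sub>E UNIV"

definition eps :: "nat \<Rightarrow> nat \<Rightarrow> nat \<Rightarrow> nat \<Rightarrow> int" where
  "eps m n i = (\<lambda>j\<in>{1..m+n}. if j = i then 1 else 0)"

definition alpha :: "nat \<Rightarrow> nat \<Rightarrow> nat \<Rightarrow> nat \<Rightarrow> nat \<Rightarrow> int" where
  "alpha m n a b = (\<lambda>j\<in>{1..m+n}. eps m n a j - eps m n b j)"

definition sform :: "nat \<Rightarrow> nat \<Rightarrow> (nat \<Rightarrow> int) \<Rightarrow> (nat \<Rightarrow> int) \<Rightarrow> int" where
  "sform m n x y = (\<Sum>i=1..m+n. isgn m i * x i * y i)"

definition dominant :: "nat \<Rightarrow> nat \<Rightarrow> (nat \<Rightarrow> int) set" where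
  "dominant m n = {lam \<in> wlat m n.
     (\<forall>i. 1 \<le> i \<and> i < m \<longrightarrow> lam (i + 1) \<le> lam i) \<and>
     (\<forall>i. m < i \<and> i < m + n \<longrightarrow> lam (i + 1) \<le> lam i)}"

text \<open>\<open>\<beta>\<^sub>k = \<alpha>\<^sub>a\<^sub>,\<^sub>b\<close> where \<open>a\<close> runs through \<open>m, \<dots>, 1\<close> for \<open>b = m+1\<close>, then for \<open>b = m+2\<close>, etc.\<close>

definition beta_fst :: "nat \<Rightarrow> nat \<Rightarrow> nat" where
  "beta_fst m k = m - (k - 1) mod m"

definition beta_snd :: "nat \<Rightarrow> nat \<Rightarrow> nat" where
  "beta_snd m k = m + 1 + (k - 1) div m"

definition beta :: "nat \<Rightarrow> nat \<Rightarrow> nat \<Rightarrow> nat \<Rightarrow> int" where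
  "beta m n k = alpha m n (beta_fst m k) (beta_snd m k)"


section \<open>The quantum supergroup \<open>U\<^sub>\<upsilon>(gl(m|n))\<close>\<close>

text \<open>\<open>gL j\<close> stands for \<open>K\<^sub>j\<^sup>-\<^sup>1\<close>.\<close>

datatype gen = gE nat | gF nat | gK nat | gL nat

datatype gword = Word (letters: "gen list")

instantiation gword :: monoid_add
begin
definition zero_gword :: gword where "0 = Word []"
definition plus_gword :: "gword \<Rightarrow> gword \<Rightarrow> gword"
  where "u + w = Word (letters u @ letters w)"
instance
  by standard (simp_all add: zero_gword_def plus_gword_def)
end

text \<open>The free \<open>\<rat>(\<upsilon>)\<close>-algebra: the product on \<open>gword \<Rightarrow>\<^sub>0 qv\<close> is the convolution
  product of the monoid algebra of the free monoid \<open>gword\<close>.\<close>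

type_synonym falg = "gword \<Rightarrow>\<^sub>0 qv"

definition scal :: "qv \<Rightarrow> falg" where
  "scal c = Poly_Mapping.single 0 c"

definition letter :: "gen \<Rightarrow> falg" where
  "letter g = Poly_Mapping.single (Word [g]) 1"

abbreviation "xE a \<equiv> letter (gE a)"
abbreviation "xF a \<equiv> letter (gF a)"
abbreviation "xK a \<equiv> letter (gK a)"
abbreviation "xL a \<equiv> letter (gL a)"

definition gens :: "nat \<Rightarrow> nat \<Rightarrow> gen set" where
  "gens m n = gE ` {1..<m+n} \<union> gF ` {1..<m+n} \<union> gK ` {1..m+n} \<union> gL ` {1..m+n}"

definition gen_par :: "nat \<Rightarrow> gen \<Rightarrow> bit" where
  "gen_par m g = (if g = gE m \<or> g = gF m then 1 else 0)"

definition word_par :: "nat \<Rightarrow> gword \<Rightarrow> bit" where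
  "word_par m w = (\<Sum>g\<leftarrow>letters w. gen_par m g)"

definition free_alg :: "nat \<Rightarrow> nat \<Rightarrow> falg ring" where
  "free_alg m n = ring_of_type_algebra
     \<lparr>carrier := {x. \<forall>w\<in>Poly_Mapping.keys x. set (letters w) \<subseteq> gens m n}\<rparr>"

definition upsa :: "nat \<Rightarrow> nat \<Rightarrow> qv" where
  "upsa m a = ups powi isgn m a"

text \<open>\<open>[x,y]\<close> for \<open>x\<close>, \<open>y\<close> homogeneous of parity \<open>p\<close>, \<open>r\<close>.\<close>

definition scomm :: "bit \<Rightarrow> bit \<Rightarrow> falg \<Rightarrow> falg \<Rightarrow> falg" where
  "scomm p r x y = x * y - (if p * r = 0 then 1 else - 1) * y * x"

text \<open>The elements \<open>E\<^sub>m\<^sub>-\<^sub>1\<^sub>,\<^sub>m\<^sub>+\<^sub>2\<close> and \<open>E\<^sub>m\<^sub>+\<^sub>2\<^sub>,\<^sub>m\<^sub>-\<^sub>1\<close> of the last defining relations, both odd.\<close>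

definition oddE :: "nat \<Rightarrow> falg" where
  "oddE m = xE (m-1) * xE m * xE (m+1) - scal ups * xE (m-1) * xE (m+1) * xE m
            - scal (inverse ups) * xE m * xE (m+1) * xE (m-1) + xE (m+1) * xE m * xE (m-1)"

definition oddF :: "nat \<Rightarrow> falg" where
  "oddF m = xF (m+1) * xF m * xF (m-1) - scal (inverse ups) * xF m * xF (m+1) * xF (m-1)
            - scal ups * xF (m-1) * xF (m+1) * xF m + xF (m-1) * xF m * xF (m+1)"

text \<open>An element \<open>x\<close> of this set stands for the relation \<open>x = 0\<close>.\<close>

definition rels :: "nat \<Rightarrow> nat \<Rightarrow> falg set" where
  "rels m n =
     {xK a * xK b - xK b * xK a | a b. a \<in> {1..m+n} \<and> b \<in> {1..m+n}} \<union>
     {xK a * xL a - 1 | a. a \<in> {1..m+n}} \<union>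
     {xL a * xK a - 1 | a. a \<in> {1..m+n}} \<union>
     {xK a * xE b - scal (ups powi sform m n (eps m n a) (alpha m n b (b+1))) * xE b * xK a | a b.
        a \<in> {1..m+n} \<and> b \<in> {1..<m+n}} \<union>
     {xK a * xF b - scal (ups powi (- sform m n (eps m n a) (alpha m n b (b+1)))) * xF b * xK a | a b.
        a \<in> {1..m+n} \<and> b \<in> {1..<m+n}} \<union>
     {scomm (gen_par m (gE a)) (gen_par m (gF b)) (xE a) (xF b)
        - (if a = b then scal (1 / (upsa m a - inverse (upsa m a)))
                          * (xK a * xL (a+1) - xL a * xK (a+1)) else 0) | a b.
        a \<in> {1..<m+n} \<and> b \<in> {1..<m+n}} \<union>
     {xE a * xE b - xE b * xE a | a b.
        a \<in> {1..<m+n} \<and> b \<in> {1..<m+n} \<and> \<bar>int a - int b\<bar> > 1} \<union>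
     {xF a * xF b - xF b * xF a | a b.
        a \<in> {1..<m+n} \<and> b \<in> {1..<m+n} \<and> \<bar>int a - int b\<bar> > 1} \<union>
     {xE a ^ 2 * xE b - scal (upsa m a + inverse (upsa m a)) * xE a * xE b * xE a
        + xE b * xE a ^ 2 | a b.
        a \<in> {1..<m+n} \<and> b \<in> {1..<m+n} \<and> a \<noteq> m \<and> \<bar>int a - int b\<bar> = 1} \<union>
     {xF a ^ 2 * xF b - scal (upsa m a + inverse (upsa m a)) * xF a * xF b * xF a
        + xF b * xF a ^ 2 | a b.
        a \<in> {1..<m+n} \<and> b \<in> {1..<m+n} \<and> a \<noteq> m \<and> \<bar>int a - int b\<bar> = 1} \<union>
     (if m \<ge> 1 \<and> n \<ge> 1 then {xE m ^ 2, xF m ^ 2} else {}) \<union>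
     (if m \<ge> 2 \<and> n \<ge> 2 then {scomm 1 1 (xE m) (oddE m), scomm 1 1 (xF m) (oddF m)} else {})"

definition rel_ideal :: "nat \<Rightarrow> nat \<Rightarrow> falg set" where
  "rel_ideal m n = Idl\<^bsub>free_alg m n\<^esub> (rels m n)"

type_synonym uelt = "falg set"

definition cls :: "nat \<Rightarrow> nat \<Rightarrow> falg \<Rightarrow> uelt" where
  "cls m n x = rel_ideal m n +>\<^bsub>free_alg m n\<^esub> x"

definition Uups :: "nat \<Rightarrow> nat \<Rightarrow> uelt sring" where
  "Uups m n = ring.extend (free_alg m n Quot rel_ideal m n)
     (sring.fields (\<lambda>p. cls m n ` {x \<in> carrier (free_alg m n).
                                 \<forall>w\<in>Poly_Mapping.keys x. word_par m w = p}))"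

text \<open>\<open>rootvec m a b\<close> represents \<open>E\<^sub>a\<^sub>,\<^sub>b\<close>.  The class in \<open>Uups m n\<close> does not depend on the choice
  of the intermediate index \<open>c\<close>; here it is \<open>max a b - 1\<close>.\<close>

function rootvec :: "nat \<Rightarrow> nat \<Rightarrow> nat \<Rightarrow> falg" where
  "rootvec m a b =
     (if b = a + 1 then xE a
      else if a = b + 1 then xF b
      else if a < b then
        (let c = b - 1 in
          rootvec m a c * rootvec m c b - scal (inverse (upsa m c)) * rootvec m c b * rootvec m a c)
      else if b < a then
        (let c = a - 1 in
          rootvec m a c * rootvec m c b - scal (upsa m c) * rootvec m c b * rootvec m a c)
      else 0)"
  by pat_completeness auto
termination
  by (relation "measure (\<lambda>(m, a, b). (a - b) + (b - a))") auto

declare rootvec.simps [simp del]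

definition divpow :: "falg \<Rightarrow> nat \<Rightarrow> falg" where
  "divpow x M = scal (1 / qfact M) * x ^ M"

text \<open>\<open>Kbinom m a c t\<close> represents the bracket with upper entry \<open>K\<^sub>a; c\<close> and lower entry \<open>t\<close>; its
  factors commute only modulo the relations, hence the ordered product.\<close>

definition Kbinom :: "nat \<Rightarrow> nat \<Rightarrow> int \<Rightarrow> nat \<Rightarrow> falg" where
  "Kbinom m a c t = (\<Prod>s\<leftarrow>[1..<t+1].
     scal (1 / (upsa m a powi int s - upsa m a powi (- int s)))
       * (scal (upsa m a powi (c - int s + 1)) * xK a
          - scal (upsa m a powi (- c + int s - 1)) * xL a))"


section \<open>The integral form and its base change\<close>

text \<open>The \<open>\<int>[\<upsilon>,\<upsilon>\<inverse>]\<close>-subalgebra generated by a set is the subring generated by this set and the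
  scalars.\<close>

definition UZ :: "nat \<Rightarrow> nat \<Rightarrow> uelt sring" where
  "UZ m n =
    (let A = generate_ring (Uups m n)
       ((\<lambda>z. cls m n (scal (laurent_eval ups z))) ` UNIV \<union>
        cls m n ` ({divpow (xE i) M | i M. i \<in> {1..<m+n}} \<union>
                   {divpow (xF i) M | i M. i \<in> {1..<m+n}} \<union>
                   {xK j | j. j \<in> {1..m+n}} \<union> {xL j | j. j \<in> {1..m+n}} \<union>
                   {Kbinom m j 0 t | j t. j \<in> {1..m+n}}))
     in (Uups m n) \<lparr>carrier := A, part := (\<lambda>p. part (Uups m n) p \<inter> A)\<rparr>)"

definition UZ_act :: "nat \<Rightarrow> nat \<Rightarrow> uelt \<Rightarrow> laurent \<Rightarrow> uelt" where
  "UZ_act m n x z = cls m n (scal (laurent_eval ups z)) \<otimes>\<^bsub>Uups m n\<^esub> x"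

type_synonym 'f uqelt = "(uelt \<times> 'f \<Rightarrow>\<^sub>0 int) set"

definition bc_class :: "nat \<Rightarrow> nat \<Rightarrow> 'f::field \<Rightarrow> (uelt \<times> 'f \<Rightarrow>\<^sub>0 int) \<Rightarrow> 'f uqelt" where
  "bc_class m n q = tensor_class (UZ m n) (ring_of_type_algebra :: 'f ring) UNIV
      (UZ_act m n) (\<lambda>z f. laurent_eval q z * f)"

definition bc_group :: "nat \<Rightarrow> nat \<Rightarrow> 'f::field \<Rightarrow> 'f uqelt monoid" where
  "bc_group m n q = tensor_group (UZ m n) (ring_of_type_algebra :: 'f ring) UNIV
      (UZ_act m n) (\<lambda>z f. laurent_eval q z * f)"

text \<open>\<open>(a \<otimes> f)(b \<otimes> g) = ab \<otimes> fg\<close>, extended biadditively and passed to cosets.\<close>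

definition Uq :: "nat \<Rightarrow> nat \<Rightarrow> 'f::field \<Rightarrow> 'f uqelt sring" where
  "Uq m n q =
     \<lparr>carrier = carrier (bc_group m n q),
      monoid.mult = (\<lambda>P Q. \<Union>x\<in>P. \<Union>y\<in>Q. bc_class m n q
         (frag_extend (\<lambda>(a, f). frag_extend (\<lambda>(b, g). frag_of (a \<otimes>\<^bsub>Uups m n\<^esub> b, f * g)) y) x)),
      monoid.one = bc_class m n q (frag_of (\<one>\<^bsub>Uups m n\<^esub>, 1)),
      ring.zero = \<one>\<^bsub>bc_group m n q\<^esub>,
      add = monoid.mult (bc_group m n q),
      part = (\<lambda>p. generate (bc_group m n q)
                 {bc_class m n q (frag_of (a, f)) | a f. a \<in> part (UZ m n) p})\<rparr>"

text \<open>The images \<open>x \<otimes> 1\<close> and \<open>1 \<otimes> c\<close> in \<open>U\<^sub>q\<close>.\<close>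

definition elq :: "nat \<Rightarrow> nat \<Rightarrow> 'f::field \<Rightarrow> falg \<Rightarrow> 'f uqelt" where
  "elq m n q x = bc_class m n q (frag_of (cls m n x, 1))"

definition scq :: "nat \<Rightarrow> nat \<Rightarrow> 'f::field \<Rightarrow> 'f \<Rightarrow> 'f uqelt" where
  "scq m n q c = bc_class m n q (frag_of (\<one>\<^bsub>Uups m n\<^esub>, c))"

definition Uq_ge0 :: "nat \<Rightarrow> nat \<Rightarrow> 'f::field \<Rightarrow> 'f uqelt sring" where
  "Uq_ge0 m n q =
    (let B = generate_ring (Uq m n q)
       (scq m n q ` UNIV \<union>
        elq m n q ` ({divpow (xE i) M | i M. i \<in> {1..<m+n}} \<union>
                     {xK j | j. j \<in> {1..m+n}} \<union> {xL j | j. j \<in> {1..m+n}} \<union>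
                     {Kbinom m j 0 t | j t. j \<in> {1..m+n}}))
     in (Uq m n q) \<lparr>carrier := B, part := (\<lambda>p. part (Uq m n q) p \<inter> B)\<rparr>)"


section \<open>Weight spaces and the modules \<open>L(\<lambda>)\<close>\<close>

definition qa :: "nat \<Rightarrow> 'f::field \<Rightarrow> nat \<Rightarrow> 'f" where
  "qa m q a = q powi isgn m a"

definition weight_space ::
  "nat \<Rightarrow> nat \<Rightarrow> 'f::field \<Rightarrow> ('f uqelt, 'v) smod \<Rightarrow> (nat \<Rightarrow> int) \<Rightarrow> 'v set" where
  "weight_space m n q V lam = {v \<in> carrier V. \<forall>a\<in>{1..m+n}.
      elq m n q (xK a) \<odot>\<^bsub>V\<^esub> v = scq m n q (qa m q a powi lam a) \<odot>\<^bsub>V\<^esub> v \<and>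
      (\<forall>t c. elq m n q (Kbinom m a c t) \<odot>\<^bsub>V\<^esub> v
               = scq m n q (specialize q (qbinom (lam a + c) t)) \<odot>\<^bsub>V\<^esub> v)}"

text \<open>A nonzero vector lies in at most one weight space, so the choice operator picks its weight.\<close>

definition wt ::
  "nat \<Rightarrow> nat \<Rightarrow> 'f::field \<Rightarrow> ('f uqelt, 'v) smod \<Rightarrow> 'v \<Rightarrow> (nat \<Rightarrow> int)" where
  "wt m n q V v = (SOME \<mu>. \<mu> \<in> wlat m n \<and> v \<in> weight_space m n q V \<mu>)"

text \<open>\<open>N\<close> is a one-dimensional module \<open>F\<^sub>\<lambda>\<close>, realized on the vector space \<open>F\<close> itself and
  placed in either parity.\<close>

definition is_F_lambda ::
  "nat \<Rightarrow> nat \<Rightarrow> 'f::field \<Rightarrow> (nat \<Rightarrow> int) \<Rightarrow> ('f uqelt, 'f) smod \<Rightarrow> bool" where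
  "is_F_lambda m n q lam N \<longleftrightarrow>
     supermodule (Uq_ge0 m n q) N \<and>
     carrier N = UNIV \<and> \<zero>\<^bsub>N\<^esub> = 0 \<and> (\<forall>x y. x \<oplus>\<^bsub>N\<^esub> y = x + y) \<and>
     (\<forall>c x. scq m n q c \<odot>\<^bsub>N\<^esub> x = c * x) \<and>
     weight_space m n q N lam = UNIV \<and>
     (\<forall>i\<in>{1..<m+n}. \<forall>M>0. \<forall>x. elq m n q (divpow (xE i) M) \<odot>\<^bsub>N\<^esub> x = 0)"

text \<open>\<open>A \<otimes>\<^sub>B N\<close> for a subalgebra \<open>B\<close> of \<open>A\<close> and a \<open>B\<close>-supermodule \<open>N\<close>.\<close>

definition induced_module ::
  "'r sring \<Rightarrow> 'r sring \<Rightarrow> ('r, 'w) smod \<Rightarrow> ('r, ('r \<times> 'w \<Rightarrow>\<^sub>0 int) set) smod" where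
  "induced_module A B N =
    (let G = tensor_group A N (carrier B) (monoid.mult A) (module.smult N);
         cl = tensor_class A N (carrier B) (monoid.mult A) (module.smult N)
     in \<lparr>carrier = carrier G, monoid.mult = undefined, monoid.one = undefined,
         ring.zero = \<one>\<^bsub>G\<^esub>, add = monoid.mult G,
         module.smult = (\<lambda>u P. \<Union>x\<in>P. cl (frag_extend (\<lambda>(a, w). frag_of (u \<otimes>\<^bsub>A\<^esub> a, w)) x)),
         mpart = (\<lambda>r. generate G {cl (frag_of (a, w)) | a w p s.
                                a \<in> part A p \<and> w \<in> mpart N s \<and> p + s = r})\<rparr>)"

text \<open>\<open>V\<close> is the irreducible quotient \<open>L(\<lambda>)\<close> of the induced module (up to isomorphism).\<close>

definition is_L ::
  "nat \<Rightarrow> nat \<Rightarrow> 'f::field \<Rightarrow> (nat \<Rightarrow> int) \<Rightarrow> ('f uqelt, 'v) smod \<Rightarrow> bool" where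
  "is_L m n q lam V \<longleftrightarrow>
     irreducible_supermodule (Uq m n q) V \<and>
     (\<exists>N. is_F_lambda m n q lam N \<and>
       (\<exists>\<phi>\<in>smod_hom (Uq m n q) (induced_module (Uq m n q) (Uq_ge0 m n q) N) V.
          \<phi> ` carrier (induced_module (Uq m n q) (Uq_ge0 m n q) N) = carrier V))"


section \<open>The odd reflections of a highest weight vector\<close>

definition primitive_root :: "'f::field \<Rightarrow> nat \<Rightarrow> bool" where
  "primitive_root q l' \<longleftrightarrow> l' > 0 \<and> q ^ l' = 1 \<and> (\<forall>k. 0 < k \<and> k < l' \<longrightarrow> q ^ k \<noteq> 1)"

text \<open>\<open>l = \<infinity>\<close> is encoded as \<open>l = 0\<close>; indeed \<open>0 dvd x\<close> means \<open>x = 0\<close>.\<close>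

definition quantum_char :: "'f::field \<Rightarrow> nat \<Rightarrow> bool" where
  "quantum_char q l \<longleftrightarrow>
     (\<exists>l'\<ge>3. primitive_root q l' \<and> l = (if odd l' then l' else l' div 2)) \<or>
     ((\<forall>k>0. q ^ k \<noteq> 1) \<and> l = 0)"

definition E_beta :: "nat \<Rightarrow> nat \<Rightarrow> 'f::field \<Rightarrow> nat \<Rightarrow> 'f uqelt" where
  "E_beta m n q k = elq m n q (rootvec m (beta_fst m k) (beta_snd m k))"

definition E_minus_beta :: "nat \<Rightarrow> nat \<Rightarrow> 'f::field \<Rightarrow> nat \<Rightarrow> 'f uqelt" where
  "E_minus_beta m n q k = elq m n q (rootvec m (beta_snd m k) (beta_fst m k))"

primrec odd_vec ::
  "nat \<Rightarrow> nat \<Rightarrow> 'f::field \<Rightarrow> nat \<Rightarrow> ('f uqelt, 'v) smod \<Rightarrow> 'v \<Rightarrow> nat \<Rightarrow> 'v" where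
  "odd_vec m n q l V v 0 = v"
| "odd_vec m n q l V v (Suc k) =
     (let u = odd_vec m n q l V v k in
      if int l dvd sform m n (wt m n q V u) (beta m n (Suc k)) then u
      else E_minus_beta m n q (Suc k) \<odot>\<^bsub>V\<^esub> u)"

end

theory Submission imports Defs begin

text \<open>
The theorem is proved by odd reflections.  Stage \<open>k\<close> of the process has a system of raising
operators: the divided powers \<open>E\<^sub>i\<^sup>(\<^sup>M\<^sup>)\<close> with \<open>i \<noteq> m\<close>, the \<open>E\<^sub>\<beta>\<close> for the odd roots \<open>\<beta>\<close> of
rank \<open>> k\<close> and the \<open>E\<^sub>-\<^sub>\<beta>\<close> for those of rank \<open>\<le> k\<close>; the lowering operators are the opposite ones.
Assertions (1)--(3) say that the vector of stage \<open>k\<close> is nonzero and killed by all raising operators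
of stage \<open>k\<close>, that is, singular of stage \<open>k\<close>.

Let \<open>u \<noteq> 0\<close> be singular of stage \<open>k\<close> and of weight \<open>\<nu>\<close>, let \<open>\<beta>\<close> be the root of rank \<open>k + 1\<close> and
\<open>w = E\<^sub>-\<^sub>\<beta> u\<close>.  The commutation relations show that \<open>w\<close> is killed by all raising operators of stage
\<open>k + 1\<close>, and that \<open>E\<^sub>\<beta> w\<close> is the multiple of \<open>u\<close> by the quantum integer of \<open>z = (\<nu>,\<beta>)\<close>.
If \<open>q\<^sup>z \<noteq> q\<^sup>-\<^sup>z\<close> (equivalently, \<open>l\<close> does not divide \<open>z\<close>), then \<open>w \<noteq> 0\<close> is the next vector.
If \<open>q\<^sup>z = q\<^sup>-\<^sup>z\<close>, then \<open>w\<close> is also killed by the raising operators of stage \<open>k\<close>, while its height is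
smaller than that of \<open>u\<close>.  In an irreducible module this forces \<open>w = 0\<close>, so that \<open>u\<close> itself is
singular of stage \<open>k + 1\<close>.  This is \<open>odd_reflection\<close>.

The last step, and the fact that every vector of the weight space of \<open>\<lambda>\<close> is singular of stage \<open>0\<close>,
rest on \<open>singular_generates\<close>: a nonzero singular vector generates an irreducible module by lowering
operators alone, so its height is maximal.  The proof replaces a triangular decomposition of the
algebra by an induction.  Give every root a height for which all raising operators of stage \<open>k\<close>
have positive height.  The span of all vectors obtained from singular ones by lowering operators is
stable under a raising operator \<open>e\<close> at a given depth below the top if all raising operators preserve
it at smaller depth: for a lowering operator \<open>f\<close>, the product \<open>e f\<close> is a combination of products in
which raising operators act only at smaller depth (\<open>raising_lowering_preserves\<close>).  That
needs explicit commutation relations between odd root vectors, between these and the divided powers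
(\<open>eD_RE\<close>, \<open>eD_RF\<close>, \<open>RE_fD\<close>, \<open>RF_fD\<close>), and Kac's formula \<open>kac\<close> for \<open>E\<^sub>i\<^sup>(\<^sup>M\<^sup>) F\<^sub>i\<^sup>(\<^sup>N\<^sup>)\<close>, all
with coefficients in \<open>\<int>[\<upsilon>,\<upsilon>\<^sup>-\<^sup>1]\<close>, so that they survive the specialization at a root of unity.

All of this is derived in two locales: \<open>qgl_rel\<close> for the defining relations and \<open>qgl_module\<close> for an
irreducible graded module over the integral form.  The remaining parts show that the quantum
supergroup, its base change and the module \<open>L(\<lambda>)\<close> are instances, and extract a singular vector of
weight \<open>\<lambda>\<close> from the induced module (\<open>highest_weight_vector\<close>).
\<close>

section \<open>Algebras over a field and q-commutators\<close>

text \<open>The scalars act through a function \<open>sc\<close> rather than through a type class of algebras, because the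
field is \<open>\<rat>(\<upsilon>)\<close> and the same algebra is also used with its opposite product.\<close>

locale sc_algebra =
  fixes sc :: "'c::field \<Rightarrow> 'a::{ring,monoid_mult} \<Rightarrow> 'a"
  assumes sc_add_right: "sc c (x + y) = sc c x + sc c y"
    and sc_add_left: "sc (c + d) x = sc c x + sc d x"
    and sc_sc: "sc c (sc d x) = sc (c * d) x"
    and sc_one [simp]: "sc 1 x = x"
    and mult_sc_left: "sc c x * y = sc c (x * y)"
    and mult_sc_right: "x * sc c y = sc c (x * y)"
begin

lemma sc_zero_left [simp]: "sc 0 x = 0"
  using sc_add_left[of 0 0 x] by simp

lemma sc_zero_right [simp]: "sc c 0 = 0"
  using sc_add_right[of c 0 0] by simp

lemma sc_minus_right: "sc c (- x) = - sc c x"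
  using sc_add_right[of c "-x" x] by (simp add: eq_neg_iff_add_eq_0)

lemma sc_minus_left: "sc (- c) x = - sc c x"
  using sc_add_left[of "-c" c x] by (simp add: eq_neg_iff_add_eq_0)

lemma sc_diff_right: "sc c (x - y) = sc c x - sc c y"
  using sc_add_right[of c x "-y"] by (simp add: sc_minus_right)

lemma sc_diff_left: "sc (c - d) x = sc c x - sc d x"
  using sc_add_left[of c "-d" x] by (simp add: sc_minus_left)

lemmas sc_simps = sc_add_right sc_diff_right sc_minus_right sc_sc mult_sc_left mult_sc_right
  distrib_left distrib_right left_diff_distrib right_diff_distrib mult.assoc

lemma sc_cancel: "c \<noteq> 0 \<Longrightarrow> sc c x = sc c y \<longleftrightarrow> x = y"
  by (metis field_class.field_inverse sc_one sc_sc)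

lemma sc_eq_0: "c \<noteq> 0 \<Longrightarrow> sc c x = 0 \<longleftrightarrow> x = 0"
  using sc_cancel[of c x 0] by simp

lemma assoc_sc: "x * y = sc c (y * x) \<Longrightarrow> x * (y * w) = sc c (y * (x * w))"
  by (simp add: mult.assoc[symmetric] mult_sc_left)

definition qc :: "'c \<Rightarrow> 'a \<Rightarrow> 'a \<Rightarrow> 'a" where
  "qc c x y = x * y - sc c (y * x)"

lemma qc_0 [simp]: "qc c 0 x = 0" "qc c x 0 = 0" by (simp_all add: qc_def)

text \<open>This is what makes iterated q-commutators along a chain of simple roots independent of the bracketing.\<close>

lemma qc_jacobi: "x * z = z * x \<Longrightarrow> qc a (qc b x y) z = qc b x (qc a y z)"
proof -
  assume c: "x * z = z * x"
  have c': "z * (x * w) = x * (z * w)" for w using c by (metis mult.assoc)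
  show ?thesis unfolding qc_def using c by (simp add: sc_simps algebra_simps c')
qed

lemma comm_mult:
  assumes "x * z = sc s (z * x)" "y * z = sc t (z * y)"
  shows "(x * y) * z = sc (s * t) (z * (x * y))"
proof -
  have "x * y * z = x * sc t (z * y)" using assms by (simp add: mult.assoc)
  also have "\<dots> = sc t ((x * z) * y)" by (simp add: sc_simps)
  also have "\<dots> = sc (s * t) (z * (x * y))" using assms by (simp add: sc_simps mult.commute)
  finally show ?thesis .
qed

lemma qc_comm:
  assumes "x * z = sc s (z * x)" "y * z = sc t (z * y)"
  shows "qc c x y * z = sc (s * t) (z * qc c x y)"
  unfolding qc_def using comm_mult[OF assms] comm_mult[OF assms(2,1)]
  by (simp add: sc_simps mult.commute)

lemma qc_commute:
  assumes "z * x = x * z" "z * y = y * z"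
  shows "z * qc c x y = qc c x y * z"
  using qc_comm[of x z 1 y 1 c] assms by simp

lemma mult_commute3:
  fixes x y z :: 'a
  assumes "z * x = x * z" "z * y = y * z"
  shows "z * (x * y) = (x * y) * z"
  using comm_mult[of x z 1 y 1] assms by simp

text \<open>Commuting \<open>z\<close> past a q-commutator whose left entry q-commutes with \<open>z\<close> only up to an
error \<open>g\<close>. Almost all relations between root vectors come from this and its two companions by
induction on the root.\<close>

lemma qc_err_left:
  assumes "x * z = sc s (z * x) + g" "y * z = sc t (z * y)"
  shows "qc c x y * z = sc (s * t) (z * qc c x y) + (sc t (g * y) - sc c (y * g))"
proof -
  have 1: "x * y * z = sc (s * t) (z * (x * y)) + sc t (g * y)"
  proof -
    have "x * y * z = sc t ((x * z) * y)" using assms(2) by (simp add: sc_simps)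
    thus ?thesis using assms(1) by (simp add: sc_simps mult.commute)
  qed
  have 2: "y * x * z = sc (s * t) (z * (y * x)) + y * g"
  proof -
    have "y * x * z = sc s ((y * z) * x) + y * g" using assms(1) by (simp add: sc_simps)
    thus ?thesis using assms(2) by (simp add: sc_simps)
  qed
  show ?thesis unfolding qc_def using 1 2 by (simp add: sc_simps algebra_simps)
qed

lemma qc_err_right:
  assumes "x * z = sc s (z * x)" "y * z = sc t (z * y) + g"
  shows "qc c x y * z = sc (s * t) (z * qc c x y) + (x * g - sc (c * s) (g * x))"
proof -
  have 1: "x * y * z = sc (s * t) (z * (x * y)) + x * g"
  proof -
    have "x * y * z = sc t ((x * z) * y) + x * g" using assms(2) by (simp add: sc_simps)
    thus ?thesis using assms(1) by (simp add: sc_simps mult.commute)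
  qed
  have 2: "y * x * z = sc (s * t) (z * (y * x)) + sc s (g * x)"
  proof -
    have "y * x * z = sc s ((y * z) * x)" using assms(1) by (simp add: sc_simps)
    thus ?thesis using assms(2) by (simp add: sc_simps)
  qed
  show ?thesis unfolding qc_def using 1 2 by (simp add: sc_simps algebra_simps)
qed

end

section \<open>The defining relations and the root vectors\<close>

text \<open>The coordinates of the root \<open>\<epsilon>\<^sub>a - \<epsilon>\<^sub>b\<close>.\<close>

definition rt :: "nat \<Rightarrow> nat \<Rightarrow> nat \<Rightarrow> int" where
  "rt a b j = of_bool (j = a) - of_bool (j = b)"

locale qgl = sc_algebra sc for sc :: "'c::field \<Rightarrow> 'a::{ring,monoid_mult} \<Rightarrow> 'a" +
  fixes m r :: nat and v :: 'c and E F K L :: "nat \<Rightarrow> 'a"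
begin

text \<open>\<open>va i\<close> is \<open>\<upsilon>\<^sub>i\<close>, and \<open>et i\<close> is the sign in the
supercommutator of \<open>E\<^sub>i\<close> and \<open>F\<^sub>i\<close>; only \<open>E\<^sub>m\<close> and
\<open>F\<^sub>m\<close> are odd.\<close>

definition va :: "nat \<Rightarrow> 'c" where "va i = (if i \<le> m then v else inverse v)"
definition et :: "nat \<Rightarrow> 'c" where "et i = (if i = m then - 1 else 1)"

definition kap :: "nat \<Rightarrow> nat \<Rightarrow> 'a" where
  "kap a b = K a * L b - L a * K b"

text \<open>\<open>RE a b\<close> and \<open>RF a b\<close> are the root vectors
\<open>E\<^sub>a\<^sub>,\<^sub>b\<close> and \<open>E\<^sub>b\<^sub>,\<^sub>a\<close> for
\<open>a < b\<close>, with the intermediate index \<open>b - 1\<close>. Below, an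
\<^emph>\<open>odd position\<close> is a pair \<open>(a, b)\<close> with \<open>a \<le> m < b\<close>.\<close>

primrec RE :: "nat \<Rightarrow> nat \<Rightarrow> 'a" where
  "RE a 0 = 0"
| "RE a (Suc b) = (if a = b then E a else qc (inverse (va b)) (RE a b) (E b))"

primrec RF :: "nat \<Rightarrow> nat \<Rightarrow> 'a" where
  "RF a 0 = 0"
| "RF a (Suc b) = (if a = b then F a else qc (va b) (F b) (RF a b))"

text \<open>\<open>x\<close> has weight \<open>g\<close> under conjugation by the \<open>K\<^sub>a\<close>.\<close>

definition wtd :: "(nat \<Rightarrow> int) \<Rightarrow> 'a \<Rightarrow> bool" where
  "wtd g x \<longleftrightarrow> (\<forall>a\<in>{1..r}. K a * x = sc (va a powi g a) (x * K a))"

end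

text \<open>The last two axioms are the relations of \<open>E\<^sub>m\<close> with
\<open>E\<^sub>m\<^sub>-\<^sub>1\<^sub>,\<^sub>m\<^sub>+\<^sub>2\<close> and of \<open>F\<^sub>m\<close> with
\<open>E\<^sub>m\<^sub>+\<^sub>2\<^sub>,\<^sub>m\<^sub>-\<^sub>1\<close>. The set of axioms is symmetric under
exchanging \<open>E\<close> with \<open>F\<close>, \<open>K\<close> with \<open>L\<close>, inverting
\<open>\<upsilon>\<close> and reversing the product; this is exploited through \<open>dual\<close>.\<close>

locale qgl_rel = qgl sc m r v E F K L
  for sc :: "'c::field \<Rightarrow> 'a::{ring,monoid_mult} \<Rightarrow> 'a"
    and m r :: nat and v :: 'c and E F K L :: "nat \<Rightarrow> 'a" +
  assumes v0: "v \<noteq> 0" and vroot: "\<And>j. j > 0 \<Longrightarrow> v ^ j \<noteq> 1"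
    and KK: "\<And>a b. \<lbrakk>a \<in> {1..r}; b \<in> {1..r}\<rbrakk> \<Longrightarrow> K a * K b = K b * K a"
    and KL: "\<And>a. a \<in> {1..r} \<Longrightarrow> K a * L a = 1"
    and LK: "\<And>a. a \<in> {1..r} \<Longrightarrow> L a * K a = 1"
    and KE: "\<And>a b. \<lbrakk>a \<in> {1..r}; b \<in> {1..<r}\<rbrakk> \<Longrightarrow> K a * E b = sc (va a powi rt b (b+1) a) (E b * K a)"
    and KF: "\<And>a b. \<lbrakk>a \<in> {1..r}; b \<in> {1..<r}\<rbrakk> \<Longrightarrow> K a * F b = sc (va a powi rt (b+1) b a) (F b * K a)"
    and EF: "\<And>a. a \<in> {1..<r} \<Longrightarrow>
        E a * F a = sc (et a) (F a * E a) + sc (1 / (va a - inverse (va a))) (kap a (a+1))"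
    and EF': "\<And>a b. \<lbrakk>a \<in> {1..<r}; b \<in> {1..<r}; a \<noteq> b\<rbrakk> \<Longrightarrow> E a * F b = F b * E a"
    and EE: "\<And>a b. \<lbrakk>a \<in> {1..<r}; b \<in> {1..<r}; Suc a < b\<rbrakk> \<Longrightarrow> E a * E b = E b * E a"
    and FF: "\<And>a b. \<lbrakk>a \<in> {1..<r}; b \<in> {1..<r}; Suc a < b\<rbrakk> \<Longrightarrow> F a * F b = F b * F a"
    and serreE: "\<And>a b. \<lbrakk>a \<in> {1..<r}; b \<in> {1..<r}; a \<noteq> m; b = Suc a \<or> a = Suc b\<rbrakk> \<Longrightarrow>
        E a * (E a * E b) + E b * (E a * E a) = sc (va a + inverse (va a)) (E a * (E b * E a))"
    and serreF: "\<And>a b. \<lbrakk>a \<in> {1..<r}; b \<in> {1..<r}; a \<noteq> m; b = Suc a \<or> a = Suc b\<rbrakk> \<Longrightarrow>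
        F a * (F a * F b) + F b * (F a * F a) = sc (va a + inverse (va a)) (F a * (F b * F a))"
    and Em2: "m \<in> {1..<r} \<Longrightarrow> E m * E m = 0"
    and Fm2: "m \<in> {1..<r} \<Longrightarrow> F m * F m = 0"
    and oddE: "\<lbrakk>1 < m; m + 1 < r\<rbrakk> \<Longrightarrow> E m * RE (m-1) (m+2) = - (RE (m-1) (m+2) * E m)"
    and oddF: "\<lbrakk>1 < m; m + 1 < r\<rbrakk> \<Longrightarrow> F m * RF (m-1) (m+2) = - (RF (m-1) (m+2) * F m)"
begin

lemma va0 [simp]: "va i \<noteq> 0" using v0 by (auto simp: va_def)

lemma va_sq [simp]: "va i * va i \<noteq> 1" "va i ^ 2 \<noteq> 1" "va i - inverse (va i) \<noteq> 0"
proof -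
  show 1: "va i * va i \<noteq> 1" using vroot[of 2] v0
    by (auto simp: va_def power2_eq_square field_simps)
  show "va i ^ 2 \<noteq> 1" using 1 by (simp add: power2_eq_square)
  show "va i - inverse (va i) \<noteq> 0"
    using 1 by (metis eq_iff_diff_eq_0 right_inverse va0)
qed

lemma v_sq [simp]: "1 + v * v \<noteq> 0" "v * v \<noteq> 1" "v - inverse v \<noteq> 0"
proof -
  show "1 + v * v \<noteq> 0"
  proof
    assume a: "1 + v * v = 0"
    have "v ^ 4 = (v * v) * (v * v)" by (simp add: numeral_eq_Suc)
    also have "v * v = - 1" using a by (simp add: eq_neg_iff_add_eq_0 add.commute)
    finally show False using vroot[of 4] by simp
  qed
  show "v * v \<noteq> 1" using vroot[of 2] by (simp add: power2_eq_square)
  thus "v - inverse v \<noteq> 0" using v0 by (metis eq_iff_diff_eq_0 right_inverse)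
qed

lemma va_p: "1 + va i * va i \<noteq> 0"
proof (cases "i \<le> m")
  case False
  show ?thesis
  proof
    assume "1 + va i * va i = 0"
    hence "v * v * (1 + inverse v * inverse v) = 0" using False by (simp add: va_def)
    moreover have "v * v * (1 + inverse v * inverse v) = 1 + v * v" using v0 by (simp add: field_simps)
    ultimately show False by simp
  qed
qed (simp add: va_def)

lemma et_sq [simp]: "et i * et i = 1" by (simp add: et_def)

lemma va_Suc: "a \<noteq> m \<Longrightarrow> va (Suc a) = va a" by (auto simp: va_def)

lemma K_inv: "\<lbrakk>a \<in> {1..r}; K a * x = sc c (x * K a); c \<noteq> 0\<rbrakk> \<Longrightarrow> L a * x = sc (inverse c) (x * L a)"
proof -
  assume a: "a \<in> {1..r}" "K a * x = sc c (x * K a)" "c \<noteq> 0"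
  have "x * L a = L a * (K a * x) * L a" using LK[OF a(1)] by (simp add: mult.assoc[symmetric])
  also have "\<dots> = sc c (L a * x)" using a(2) KL[OF a(1)] by (simp add: sc_simps)
  finally show ?thesis using a(3) by (simp add: sc_sc)
qed

lemma KLc: "\<lbrakk>a \<in> {1..r}; b \<in> {1..r}\<rbrakk> \<Longrightarrow> K a * L b = L b * K a"
  using K_inv[of b "K a" 1] KK[of b a] by simp

lemma LLc: "\<lbrakk>a \<in> {1..r}; b \<in> {1..r}\<rbrakk> \<Longrightarrow> L a * L b = L b * L a"
  using K_inv[of a "L b" 1] KLc[of a b] by simp

lemma wtdD: "\<lbrakk>wtd g x; a \<in> {1..r}\<rbrakk> \<Longrightarrow> K a * x = sc (va a powi g a) (x * K a)"
  by (simp add: wtd_def)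

lemma wtdL: "\<lbrakk>wtd g x; a \<in> {1..r}\<rbrakk> \<Longrightarrow> L a * x = sc (va a powi (- g a)) (x * L a)"
  using K_inv[OF _ wtdD] by (simp add: power_int_minus)

lemma wtd_mult: "wtd g x \<Longrightarrow> wtd h y \<Longrightarrow> wtd (\<lambda>i. g i + h i) (x * y)"
  unfolding wtd_def
proof
  fix a assume a: "\<forall>a\<in>{1..r}. K a * x = sc (va a powi g a) (x * K a)"
     "\<forall>a\<in>{1..r}. K a * y = sc (va a powi h a) (y * K a)" "a \<in> {1..r}"
  have "K a * (x * y) = sc (va a powi g a) (x * (K a * y))" using a by (metis mult.assoc mult_sc_left)
  thus "K a * (x * y) = sc (va a powi (g a + h a)) (x * y * K a)"
    using a by (simp add: sc_simps power_int_add)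
qed

lemma wtd_cong: "wtd g x \<Longrightarrow> (\<And>i. i \<in> {1..r} \<Longrightarrow> g i = h i) \<Longrightarrow> wtd h x"
  unfolding wtd_def by auto

lemma wtd_sc: "wtd g x \<Longrightarrow> wtd g (sc c x)"
  unfolding wtd_def by (auto simp: sc_simps mult.commute)

lemma wtd_diff: "wtd g x \<Longrightarrow> wtd g y \<Longrightarrow> wtd g (x - y)"
  unfolding wtd_def by (auto simp: sc_simps)

lemma wtd_1: "wtd (\<lambda>i. 0) 1" unfolding wtd_def by simp
lemma wtd_K: "a \<in> {1..r} \<Longrightarrow> wtd (\<lambda>i. 0) (K a)" unfolding wtd_def by (simp add: KK)
lemma wtd_qc: "wtd g x \<Longrightarrow> wtd h y \<Longrightarrow> wtd (\<lambda>i. g i + h i) (qc c x y)"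
  unfolding qc_def
  using wtd_diff[OF wtd_mult wtd_sc[OF wtd_cong[OF wtd_mult]]] by (simp add: add.commute)

lemma wtd_E: "b \<in> {1..<r} \<Longrightarrow> wtd (rt b (b+1)) (E b)" unfolding wtd_def by (simp add: KE)
lemma wtd_F: "b \<in> {1..<r} \<Longrightarrow> wtd (rt (b+1) b) (F b)" unfolding wtd_def by (simp add: KF)

lemma wtd_RE: "1 \<le> a \<Longrightarrow> a < b \<Longrightarrow> b \<le> r \<Longrightarrow> wtd (rt a b) (RE a b)"
proof (induction b)
  case (Suc b)
  show ?case
  proof (cases "a = b")
    case True thus ?thesis using Suc.prems wtd_E[of b] by simp
  next
    case False
    hence "wtd (\<lambda>i. rt a b i + rt b (b+1) i) (RE a (Suc b))"
      using Suc wtd_E[of b] by (simp add: wtd_qc)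
    thus ?thesis by (rule wtd_cong) (simp add: rt_def)
  qed
qed simp

lemma wtd_RF: "1 \<le> a \<Longrightarrow> a < b \<Longrightarrow> b \<le> r \<Longrightarrow> wtd (rt b a) (RF a b)"
proof (induction b)
  case (Suc b)
  show ?case
  proof (cases "a = b")
    case True thus ?thesis using Suc.prems wtd_F[of b] by simp
  next
    case False
    hence "wtd (\<lambda>i. rt (b+1) b i + rt b a i) (RF a (Suc b))"
      using Suc wtd_F[of b] by (simp add: wtd_qc)
    thus ?thesis by (rule wtd_cong) (simp add: rt_def)
  qed
qed simp

lemma KL_wt: "\<lbrakk>wtd g x; a \<in> {1..r}; b \<in> {1..r}\<rbrakk> \<Longrightarrow>
   (K a * L b) * x = sc (va a powi g a * va b powi (- g b)) (x * (K a * L b))"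
  using comm_mult[OF wtdD wtdL, of g x a g b] by simp

lemma LK_wt: "\<lbrakk>wtd g x; a \<in> {1..r}; b \<in> {1..r}\<rbrakk> \<Longrightarrow>
   (L a * K b) * x = sc (va a powi (- g a) * va b powi g b) (x * (L a * K b))"
  using comm_mult[OF wtdL wtdD, of g x a g b] by simp

lemma EEc: "\<lbrakk>a \<in> {1..<r}; b \<in> {1..<r}; Suc a < b \<or> Suc b < a\<rbrakk> \<Longrightarrow> E a * E b = E b * E a"
  using EE by force

lemma RE_0: "b \<le> a \<Longrightarrow> RE a b = 0"
  by (induction b) (auto simp: qc_def)

lemma RF_0: "b \<le> a \<Longrightarrow> RF a b = 0"
  by (induction b) (auto simp: qc_def)

lemma RE_comm: "(\<And>j. a \<le> j \<Longrightarrow> j < b \<Longrightarrow> z * E j = E j * z) \<Longrightarrow> z * RE a b = RE a b * z"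
proof (induction b)
  case (Suc b) thus ?case by (cases "a \<le> b") (auto intro: qc_commute simp: RE_0)
qed simp

lemma RF_comm: "(\<And>j. a \<le> j \<Longrightarrow> j < b \<Longrightarrow> z * F j = F j * z) \<Longrightarrow> z * RF a b = RF a b * z"
proof (induction b)
  case (Suc b) thus ?case by (cases "a \<le> b") (auto intro: qc_commute simp: RF_0)
qed simp

lemma RE_E_far: "\<lbrakk>1 \<le> a; b \<le> r; i \<in> {1..<r}; Suc i < a \<or> b < i\<rbrakk> \<Longrightarrow> E i * RE a b = RE a b * E i"
  by (rule RE_comm) (rule EEc; auto)

lemma RE_F_far: "\<lbrakk>1 \<le> a; b \<le> r; i \<in> {1..<r}; i < a \<or> b \<le> i\<rbrakk> \<Longrightarrow> F i * RE a b = RE a b * F i"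
  by (rule RE_comm) (rule EF'[symmetric]; auto)

lemma RE_RE_far: "\<lbrakk>1 \<le> a; b < c; d \<le> r\<rbrakk> \<Longrightarrow> RE a b * RE c d = RE c d * RE a b"
  by (rule RE_comm) (rule RE_E_far[symmetric]; auto)

text \<open>The root vector does not depend on the intermediate index.\<close>

lemma RE_split: "\<lbrakk>1 \<le> a; a < c; c < b; b \<le> r\<rbrakk> \<Longrightarrow> RE a b = qc (inverse (va c)) (RE a c) (RE c b)"
proof (induction b)
  case (Suc b)
  show ?case
  proof (cases "b = c")
    case True thus ?thesis using Suc.prems by simp
  next
    case False
    have "RE a c * E b = E b * RE a c" using RE_E_far[of a c b] Suc.prems False by simp
    thus ?thesis using Suc False by (simp add: qc_jacobi)
  qed
qed simp

lemma RE_first: "\<lbrakk>1 \<le> a; Suc a < b; b \<le> r\<rbrakk> \<Longrightarrow> RE a b = qc (inverse (va (Suc a))) (E a) (RE (Suc a) b)"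
  using RE_split[of a "Suc a" b] by simp

text \<open>Commuting with \<open>F\<^sub>a\<close> removes the first simple root from the chain, commuting with
\<open>F\<^sub>c\<close> removes the last one, and an inner \<open>F\<^sub>i\<close> commutes up to sign,
since it would have to break the chain.\<close>

lemma RE_F_first:
  assumes "1 \<le> a" "Suc a < b" "b \<le> r"
  shows "RE a b * F a = sc (et a) (F a * RE a b) - sc (et a) (RE (Suc a) b * (L a * K (Suc a)))"
proof -
  let ?x0 = "RE (Suc a) b" and ?d = "1 / (va a - inverse (va a))" and ?c = "inverse (va (Suc a))"
  have a: "a \<in> {1..<r}" "a \<in> {1..r}" "Suc a \<in> {1..r}" using assms by auto
  have x0: "?x0 * F a = sc 1 (F a * ?x0)" using RE_F_far[of "Suc a" b a] assms by simp
  have w: "wtd (rt (Suc a) b) ?x0" using wtd_RE assms by simp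
  have k2: "?x0 * kap a (a+1) = ?x0 * (K a * L (Suc a)) - ?x0 * (L a * K (Suc a))" unfolding kap_def by (simp add: right_diff_distrib)
  have k: "kap a (a+1) * ?x0 = sc ?c (?x0 * (K a * L (Suc a))) - sc (va (Suc a)) (?x0 * (L a * K (Suc a)))"
    unfolding kap_def using KL_wt[OF w a(2,3)] LK_wt[OF w a(2,3)] assms
    by (simp add: left_diff_distrib rt_def power_int_minus)
  have c: "?d * (va (Suc a) - ?c) = et a" 
    using va_Suc[of a] va_sq(3)[of a] unfolding et_def
    by (auto simp: va_def divide_simps v0 eq_neg_iff_add_eq_0 nonzero_eq_divide_eq)
  have "RE a b * F a = sc (et a * 1) (F a * RE a b)
      + (sc 1 (sc ?d (kap a (a+1)) * ?x0) - sc ?c (?x0 * sc ?d (kap a (a+1))))"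
    unfolding RE_first[OF assms] by (rule qc_err_left[OF EF[OF a(1)] x0])
  also have "sc 1 (sc ?d (kap a (a+1)) * ?x0) - sc ?c (?x0 * sc ?d (kap a (a+1)))
      = - sc (?d * (va (Suc a) - ?c)) (?x0 * (L a * K (Suc a)))"
    using k k2 by (simp add: mult_sc_left mult_sc_right sc_sc sc_diff_right sc_diff_left right_diff_distrib mult.commute diff_divide_distrib)
  finally show ?thesis using c by simp
qed

lemma RE_F_last:
  assumes "1 \<le> a" "a < c" "Suc c \<le> r"
  shows "RE a (Suc c) * F c = sc (et c) (F c * RE a (Suc c)) + sc (inverse (va c)) (RE a c * (K c * L (Suc c)))"
proof -
  let ?x0 = "RE a c" and ?d = "1 / (va c - inverse (va c))" and ?c = "inverse (va c)"
  have a: "c \<in> {1..<r}" "c \<in> {1..r}" "Suc c \<in> {1..r}" using assms by auto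
  have x0: "?x0 * F c = sc 1 (F c * ?x0)" using RE_F_far[of a c c] assms by simp
  have w: "wtd (rt a c) ?x0" using wtd_RE assms by simp
  have k2: "?x0 * kap c (c+1) = ?x0 * (K c * L (Suc c)) - ?x0 * (L c * K (Suc c))" unfolding kap_def by (simp add: right_diff_distrib)
  have k: "kap c (c+1) * ?x0 = sc ?c (?x0 * (K c * L (Suc c))) - sc (va c) (?x0 * (L c * K (Suc c)))"
    unfolding kap_def using KL_wt[OF w a(2,3)] LK_wt[OF w a(2,3)] assms
    by (simp add: left_diff_distrib rt_def power_int_minus)
  have c: "?d * (1 - ?c * ?c) = ?c" using va_sq(1)[of c] by (simp add: field_simps)
  have "RE a (Suc c) * F c = sc (1 * et c) (F c * RE a (Suc c))
      + (?x0 * sc ?d (kap c (c+1)) - sc (?c * 1) (sc ?d (kap c (c+1)) * ?x0))"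
    using assms qc_err_right[OF x0 EF[OF a(1)], of ?c] by simp
  also have "?x0 * sc ?d (kap c (c+1)) - sc (?c * 1) (sc ?d (kap c (c+1)) * ?x0)
      = sc (?d * (1 - ?c * ?c)) (?x0 * (K c * L (Suc c)))"
    using k k2 by (simp add: mult_sc_left mult_sc_right sc_sc sc_diff_right sc_diff_left right_diff_distrib mult.commute mult.left_commute)
  finally show ?thesis using c by simp
qed

lemma RE_F_mid:
  assumes "1 \<le> a" "a < i" "Suc i < b" "b \<le> r"
  shows "RE a b * F i = sc (et i) (F i * RE a b)"
proof -
  have i: "i \<in> {1..r}" "Suc i \<in> {1..r}" using assms by auto
  let ?c = "inverse (va i)" and ?g = "- sc (et i) (RE (Suc i) b * (L i * K (Suc i)))"
  have 1: "RE a i * F i = sc 1 (F i * RE a i)" using RE_F_far[of a i i] assms by simp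
  have 2: "RE i b * F i = sc (et i) (F i * RE i b) + ?g" using RE_F_first[of i b] assms by simp
  have w: "wtd (rt a i) (RE a i)" using wtd_RE assms by simp
  have 3: "RE (Suc i) b * (L i * K (Suc i)) * RE a i = sc (va i) (RE a i * (RE (Suc i) b * (L i * K (Suc i))))"
    using LK_wt[OF w i] RE_RE_far[of a i "Suc i" b] assms
    by (simp add: rt_def sc_simps) (simp add: mult.assoc[symmetric])
  have s: "RE a b = qc ?c (RE a i) (RE i b)" using RE_split assms by simp
  have "RE a b * F i = sc (1 * et i) (F i * RE a b) + (RE a i * ?g - sc (?c * 1) (?g * RE a i))"
    unfolding s by (rule qc_err_right[OF 1 2])
  also have "RE a i * ?g - sc (?c * 1) (?g * RE a i) = 0"
  proof -
    have h: "?c * (et i * va i) = et i" by simp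
    have "?g * RE a i = - sc (et i * va i) (RE a i * (RE (Suc i) b * (L i * K (Suc i))))"
      by (simp only: mult_minus_left mult_sc_left 3 sc_sc)
    thus ?thesis by (simp only: mult_1_right mult_minus_right mult_sc_right sc_minus_right sc_sc h) simp
  qed
  finally show ?thesis by simp
qed

text \<open>An even simple root at an end of the chain q-commutes with the root vector. For a chain of two simple roots
this is the Serre relation.\<close>

lemma RE_E_first:
  assumes "1 \<le> a" "Suc a < b" "b \<le> r" "a \<noteq> m"
  shows "E a * RE a b = sc (va a) (RE a b * E a)"
proof -
  have a: "a \<in> {1..<r}" "Suc a \<in> {1..<r}" using assms by auto
  let ?W = "qc (inverse (va a)) (E a) (E (Suc a))"
  have "E a * ?W = E a * (E a * E (Suc a)) - sc (inverse (va a)) (E a * (E (Suc a) * E a))"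
    unfolding qc_def by (simp add: sc_simps)
  also have "E a * (E a * E (Suc a)) = sc (va a + inverse (va a)) (E a * (E (Suc a) * E a)) - E (Suc a) * (E a * E a)"
    using serreE[OF a assms(4)] by (simp add: algebra_simps)
  finally have W: "E a * ?W = sc (va a) (?W * E a)"
    unfolding qc_def by (simp add: sc_simps sc_add_left)
  show ?thesis
  proof (cases "b = Suc (Suc a)")
    case True thus ?thesis using W va_Suc[OF assms(4)] by simp
  next
    case False
    have "RE a b = qc (inverse (va (Suc (Suc a)))) (RE a (Suc (Suc a))) (RE (Suc (Suc a)) b)"
      using RE_split[of a "Suc (Suc a)" b] False assms by simp
    also have "RE a (Suc (Suc a)) = ?W" using va_Suc[OF assms(4)] by simp
    finally have s: "RE a b = qc (inverse (va (Suc (Suc a)))) ?W (RE (Suc (Suc a)) b)" .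
    have 1: "?W * E a = sc (inverse (va a)) (E a * ?W)" using W by (simp add: sc_sc)
    have 2: "RE (Suc (Suc a)) b * E a = sc 1 (E a * RE (Suc (Suc a)) b)"
      using RE_E_far[of "Suc (Suc a)" b a] assms by simp
    have "RE a b * E a = sc (inverse (va a)) (E a * RE a b)"
      unfolding s using qc_comm[OF 1 2] by simp
    thus ?thesis by (simp add: sc_sc)
  qed
qed

lemma RE_E_last:
  assumes "1 \<le> a" "a < c" "Suc c \<le> r" "c \<noteq> m"
  shows "E c * RE a (Suc c) = sc (inverse (va c)) (RE a (Suc c) * E c)"
proof -
  obtain b where b: "c = Suc b" using assms by (cases c) auto
  have a: "c \<in> {1..<r}" "b \<in> {1..<r}" using assms b by auto
  let ?W = "qc (inverse (va c)) (E b) (E c)"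
  have "?W * E c = E b * (E c * E c) - sc (inverse (va c)) (E c * (E b * E c))"
    unfolding qc_def by (simp add: sc_simps)
  also have "E b * (E c * E c) = sc (va c + inverse (va c)) (E c * (E b * E c)) - E c * (E c * E b)"
    using serreE[OF a assms(4)] b by (simp add: algebra_simps)
  finally have "?W * E c = sc (va c) (E c * ?W)"
    unfolding qc_def by (simp add: sc_simps sc_add_left)
  hence W: "E c * ?W = sc (inverse (va c)) (?W * E c)" by (simp add: sc_sc)
  show ?thesis
  proof (cases "a = b")
    case True thus ?thesis using W b by simp
  next
    case False
    have "RE a (Suc c) = qc (inverse (va b)) (RE a b) (RE b (Suc c))"
      using RE_split[of a b "Suc c"] False assms b by simp
    also have "RE b (Suc c) = ?W" using b by simp
    finally have s: "RE a (Suc c) = qc (inverse (va b)) (RE a b) ?W" .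
    have 1: "?W * E c = sc (va c) (E c * ?W)" using W by (simp add: sc_sc)
    have 2: "RE a b * E c = sc 1 (E c * RE a b)"
      using RE_E_far[of a b c] assms b by simp
    have "RE a (Suc c) * E c = sc (va c) (E c * RE a (Suc c))"
      unfolding s using qc_comm[OF 2 1] by simp
    thus ?thesis by (simp add: sc_sc)
  qed
qed

end

context sc_algebra begin
text \<open>Two ways of moving \<open>B\<close> past the threefold q-commutator of \<open>A\<close>, \<open>B\<close>,
\<open>C\<close> give two equations for the commutator \<open>T\<close> of the twofold ones. As
\<open>p + 1/p\<close> does not vanish, they can be solved for \<open>T\<close>, and \<open>B\<close>
commutes.\<close>

lemma serre_mid:
  assumes p: "p \<noteq> 0" "1 + p * p \<noteq> 0"
    and x0: "B * x0 = sc (inverse p) (x0 * B)" and Z: "B * Z = sc p (Z * B)"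
    and Xd: "x0 = qc (inverse p) A B" and Zd: "Z = qc (inverse p) B C"
    and AC: "A * C = C * A"
  shows "B * qc (inverse p) x0 C = qc (inverse p) x0 C * B"
proof -
  let ?P = "inverse p" let ?W = "qc ?P x0 C"
  have W2: "?W = qc ?P A Z" using qc_jacobi[OF AC] Xd Zd by simp
  have BC: "B * C = Z + sc ?P (C * B)" unfolding Zd qc_def by simp
  have BA: "B * A = sc p (A * B) - sc p x0" unfolding Xd qc_def using p by (simp add: sc_simps)
  define T where "T = x0 * Z - Z * x0"
  have e1: "B * ?W = sc ?P T + sc (?P * ?P) (?W * B)"
  proof -
    have 1: "B * (x0 * C) = sc ?P (x0 * Z) + sc (?P * ?P) (x0 * (C * B))"
      unfolding assoc_sc[OF x0] BC by (simp add: sc_simps)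
    have 2: "B * (C * x0) = Z * x0 + sc (?P * ?P) (C * (x0 * B))"
      unfolding mult.assoc[symmetric] BC by (simp add: sc_simps x0)
    show ?thesis unfolding qc_def T_def
      by (simp only: right_diff_distrib left_diff_distrib mult_sc_left mult_sc_right mult.assoc 1 2 sc_add_right sc_diff_right sc_sc) simp
  qed
  have e2: "B * ?W = sc (p * p) (?W * B) - sc p T"
  proof -
    have 1: "B * (A * Z) = sc (p * p) (A * (Z * B)) - sc p (x0 * Z)"
      unfolding mult.assoc[symmetric] BA by (simp add: sc_simps Z)
    have 2: "B * (Z * A) = sc (p * p) (Z * (A * B)) - sc (p * p) (Z * x0)"
      unfolding assoc_sc[OF Z] BA by (simp add: sc_simps)
    have 3: "?P * (p * p) = p" "p * p * ?P = p" using p by simp_all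
    show ?thesis unfolding W2 unfolding qc_def T_def
      by (simp only: right_diff_distrib left_diff_distrib mult_sc_left mult_sc_right mult.assoc 1 2 sc_add_right sc_diff_right sc_sc 3) 
        (use p in simp)
  qed
  have nz: "p + ?P \<noteq> 0"
  proof
    assume "p + ?P = 0"
    hence "p * (p + ?P) = 0" by simp
    thus False using p by (simp add: distrib_left add.commute)
  qed
  have "sc p T + sc ?P T = sc (p * p) (?W * B) - sc (?P * ?P) (?W * B)"
    using e1 e2 by (simp add: eq_diff_eq diff_eq_eq add.commute add.left_commute)
  hence "sc (p + ?P) T = sc (p * p - ?P * ?P) (?W * B)"
    by (simp only: sc_add_left sc_diff_left)
  also have "p * p - ?P * ?P = (p + ?P) * (p - ?P)" by (simp add: square_diff_square_factored)
  finally have T: "T = sc (p - ?P) (?W * B)" using nz by (simp add: sc_sc[symmetric] sc_cancel)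
  have "B * ?W = sc (?P * (p - ?P) + ?P * ?P) (?W * B)"
    unfolding e1 T by (simp add: sc_add_left sc_sc)
  also have "?P * (p - ?P) + ?P * ?P = 1" using p by (simp add: right_diff_distrib)
  finally show ?thesis by simp
qed
end

context qgl_rel begin
text \<open>The chain is split around \<open>i - 1, i, i + 1\<close>; this part is \<open>serre_mid\<close>, and the
outer parts commute with \<open>E\<^sub>i\<close>.\<close>

lemma RE_E_mid:
  assumes "1 \<le> a" "a < i" "Suc i < b" "b \<le> r" "i \<noteq> m"
  shows "E i * RE a b = RE a b * E i"
proof -
  obtain j where j: "i = Suc j" using assms by (cases i) auto
  have va': "va (Suc i) = va i" using va_Suc assms by simp
  have x0: "E i * RE j (Suc i) = sc (inverse (va i)) (RE j (Suc i) * E i)"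
    using RE_E_last[of j i] assms j by simp
  have Z: "E i * RE i (Suc (Suc i)) = sc (va i) (RE i (Suc (Suc i)) * E i)"
    using RE_E_first[of i "Suc (Suc i)"] assms by simp
  have AC: "E j * E (Suc i) = E (Suc i) * E j" using EE[of j "Suc i"] assms j by simp
  have WR: "RE j (Suc (Suc i)) = qc (inverse (va i)) (RE j (Suc i)) (E (Suc i))" using j va' by simp
  have W: "E i * RE j (Suc (Suc i)) = RE j (Suc (Suc i)) * E i"
    unfolding WR by (rule serre_mid[OF va0 va_p x0 Z _ _ AC]) (use j va' in simp_all)
  have W3: "E i * RE j b = RE j b * E i"
  proof (cases "b = Suc (Suc i)")
    case False
    hence "RE j b = qc (inverse (va (Suc (Suc i)))) (RE j (Suc (Suc i))) (RE (Suc (Suc i)) b)"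
      using RE_split[of j "Suc (Suc i)" b] assms j by (simp del: RE.simps)
    thus ?thesis using qc_commute[OF W RE_E_far[of "Suc (Suc i)" b i]] assms by simp
  qed (use W in simp)
  show ?thesis
  proof (cases "a = j")
    case False
    hence "RE a b = qc (inverse (va j)) (RE a j) (RE j b)"
      using RE_split[of a j b] assms j by simp
    thus ?thesis using qc_commute[OF RE_E_far[of a j i] W3] assms j by simp
  qed (use W3 in simp)
qed

end

section \<open>Relations between positive odd root vectors\<close>

context sc_algebra begin

lemma qc_err_both:
  assumes "x * z = sc s (z * x) + g" "y * z = sc t (z * y) + h"
  shows "qc c x y * z = sc (s * t) (z * qc c x y) + (sc t (g * y) - sc c (y * g)) + (x * h - sc (c * s) (h * x))"
proof -
  have 1: "x * y * z = sc (s * t) (z * (x * y)) + sc t (g * y) + x * h"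
  proof -
    have "x * y * z = sc t ((x * z) * y) + x * h" using assms(2) by (simp add: sc_simps)
    thus ?thesis using assms(1) by (simp add: sc_simps mult.commute)
  qed
  have 2: "y * x * z = sc (s * t) (z * (y * x)) + sc s (h * x) + y * g"
  proof -
    have "y * x * z = sc s ((y * z) * x) + y * g" using assms(1) by (simp add: sc_simps)
    thus ?thesis using assms(2) by (simp add: sc_simps)
  qed
  show ?thesis unfolding qc_def using 1 2 by (simp add: sc_simps algebra_simps)
qed

text \<open>If \<open>x0\<close> squares to zero and \<open>Y\<close> is its q-commutator with an even \<open>e\<close>
that q-commutes with \<open>Y\<close>, then \<open>Y\<close> squares to zero too: moving \<open>e\<close>
through the relation between \<open>x0\<close> and \<open>Y\<close> leaves \<open>Y * Y\<close> times
\<open>t + 1/t\<close>.\<close>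

lemma row_raise:
  assumes t: "t \<noteq> 0" "1 + t * t \<noteq> 0" and XX: "x0 * x0 = 0"
    and Yd: "Y = qc (inverse t) e x0" and eY: "e * Y = sc t (Y * e)"
  shows "Y * x0 = - sc (inverse t) (x0 * Y)" "Y * Y = 0"
proof -
  have eX: "e * x0 = Y + sc (inverse t) (x0 * e)" unfolding Yd qc_def by simp
  have XX': "x0 * (x0 * w) = 0" for w using XX by (simp add: mult.assoc[symmetric])
  have 1: "x0 * Y = x0 * (e * x0)" unfolding Yd qc_def by (simp add: sc_simps XX')
  have 2: "Y * x0 = - sc (inverse t) (x0 * (e * x0))"
    unfolding Yd qc_def by (simp add: left_diff_distrib mult_sc_left mult.assoc XX)
  show c: "Y * x0 = - sc (inverse t) (x0 * Y)" using 1 2 by simp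
  have a: "e * (x0 * Y) = Y * Y + x0 * (Y * e)"
    unfolding mult.assoc[symmetric] eX using t by (simp add: sc_simps eY)
  have b: "e * (Y * x0) = sc t (Y * Y) + Y * (x0 * e)"
    unfolding assoc_sc[OF eY] eX using t by (simp add: sc_simps)
  have "sc t (Y * Y) + Y * (x0 * e) = - sc (inverse t) (Y * Y + x0 * (Y * e))"
    using a b c by (simp add: sc_simps)
  moreover have "Y * (x0 * e) = - sc (inverse t) (x0 * (Y * e))"
    using c by (simp add: mult.assoc[symmetric] mult_sc_left)
  ultimately have "sc t (Y * Y) + sc (inverse t) (Y * Y) = 0"
    by (simp add: sc_add_right algebra_simps)
  hence "sc (t + inverse t) (Y * Y) = 0" by (simp add: sc_add_left)
  moreover have "t + inverse t \<noteq> 0"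
  proof
    assume "t + inverse t = 0"
    hence "t * (t + inverse t) = 0" by simp
    thus False using t by (simp add: distrib_left add.commute)
  qed
  ultimately show "Y * Y = 0" by (simp add: sc_eq_0)
qed

lemma col_raise:
  assumes t: "t \<noteq> 0" "1 + t * t \<noteq> 0" and XX: "x0 * x0 = 0"
    and Yd: "Y = qc t x0 e" and eY: "e * Y = sc t (Y * e)"
  shows "x0 * Y = - sc t (Y * x0)" "Y * Y = 0"
proof -
  have Xe: "x0 * e = Y + sc t (e * x0)" unfolding Yd qc_def by simp
  have Ye: "Y * e = sc (inverse t) (e * Y)" using eY t by (simp add: sc_sc)
  have XX': "x0 * (x0 * w) = 0" for w using XX by (simp add: mult.assoc[symmetric])
  have 1: "x0 * Y = - sc t (x0 * (e * x0))" unfolding Yd qc_def by (simp add: right_diff_distrib mult_sc_right XX')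
  have 2: "Y * x0 = x0 * (e * x0)"
    unfolding Yd qc_def by (simp add: left_diff_distrib mult_sc_left mult.assoc XX)
  show c: "x0 * Y = - sc t (Y * x0)" using 1 2 by simp
  have a: "x0 * Y * e = sc (inverse t) (Y * Y) + e * (x0 * Y)"
  proof -
    have "x0 * Y * e = sc (inverse t) ((x0 * e) * Y)" by (simp add: mult.assoc Ye mult_sc_right)
    thus ?thesis unfolding Xe using t by (simp add: sc_simps)
  qed
  have b: "Y * x0 * e = Y * Y + e * (Y * x0)"
  proof -
    have "Y * x0 * e = Y * Y + sc t ((Y * e) * x0)" by (simp add: mult.assoc Xe distrib_left mult_sc_right)
    thus ?thesis unfolding Ye using t by (simp add: sc_simps)
  qed
  have "sc (inverse t) (Y * Y) + e * (x0 * Y) = - sc t (Y * Y + e * (Y * x0))"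
    using a b c by (simp add: mult_sc_left)
  moreover have "e * (x0 * Y) = - sc t (e * (Y * x0))" using c by (simp add: mult_sc_right)
  ultimately have "sc t (Y * Y) + sc (inverse t) (Y * Y) = 0"
    by (simp add: sc_add_right algebra_simps)
  hence "sc (t + inverse t) (Y * Y) = 0" by (simp add: sc_add_left)
  moreover have "t + inverse t \<noteq> 0"
  proof
    assume "t + inverse t = 0"
    hence "t * (t + inverse t) = 0" by simp
    thus False using t by (simp add: distrib_left add.commute)
  qed
  ultimately show "Y * Y = 0" by (simp add: sc_eq_0)
qed

text \<open>The only pairs of positive odd root vectors with a quadratic error term are those whose positions cross; the
term arises by applying the q-commutator with \<open>e\<close> to a relation between vectors in one row.\<close>

lemma crossing:
  assumes t: "t \<noteq> 0" and PQ: "P * Q = - sc t (Q * P)"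
    and P': "P' = qc (inverse t) e P" and Q': "Q' = qc (inverse t) e Q"
    and QP: "Q' * P = - (P * Q')"
  shows "P' * Q = - (Q * P') + sc (t - inverse t) (P * Q')"
proof -
  have eP: "e * P = P' + sc (inverse t) (P * e)" unfolding P' qc_def by simp
  have eQ: "e * Q = Q' + sc (inverse t) (Q * e)" unfolding Q' qc_def by simp
  have 1: "e * (P * Q) = P' * Q + sc (inverse t) (P * Q') + sc (inverse t * inverse t) (P * (Q * e))"
    unfolding mult.assoc[symmetric] eP by (simp add: sc_simps eQ)
  have h: "t * (inverse t * inverse t) = inverse t" using t by simp
  have 2: "sc t (e * (Q * P)) = - sc t (P * Q') + Q * P' + sc (inverse t) (Q * (P * e))"
    unfolding mult.assoc[symmetric] eQ using t by (simp add: sc_simps eP QP h)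
  have 3: "e * (P * Q) = - sc t (e * (Q * P))" by (simp add: PQ mult_sc_right)
  have 4: "sc (inverse t * inverse t) (P * (Q * e)) = - sc (inverse t) (Q * (P * e))"
  proof -
    have "P * (Q * e) = - sc t (Q * (P * e))" by (simp add: mult.assoc[symmetric] PQ mult_sc_left)
    thus ?thesis using t by (simp add: sc_simps)
  qed
  show ?thesis using 1 2 3 4 by (simp add: sc_diff_left algebra_simps)
qed

end

context qgl_rel begin

lemma RE_row: "\<lbrakk>1 \<le> a; a < m; m < b; b \<le> r\<rbrakk> \<Longrightarrow> RE a b = qc (inverse v) (E a) (RE (Suc a) b)"
  using RE_first[of a b] by (simp add: va_def)

lemma RE_col: "\<lbrakk>a \<le> m; m < b\<rbrakk> \<Longrightarrow> RE a (Suc b) = qc v (RE a b) (E b)"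
  by (simp add: va_def)

text \<open>Every odd position is reached from \<open>(m, m+1)\<close> by first increasing the column and then decreasing
the row.\<close>

lemma odd_induct [consumes 4, case_names base row col]:
  assumes "1 \<le> a" "a \<le> m" "m < b" "b \<le> r"
    and base: "\<lbrakk>1 \<le> m; m < r\<rbrakk> \<Longrightarrow> P m (Suc m)"
    and row: "\<And>a b. \<lbrakk>1 \<le> a; a < m; m < b; b \<le> r; P (Suc a) b\<rbrakk> \<Longrightarrow> P a b"
    and col: "\<And>a b. \<lbrakk>1 \<le> a; a \<le> m; m < b; b < r; P a b\<rbrakk> \<Longrightarrow> P a (Suc b)"
  shows "P a b"
proof -
  have m: "1 \<le> m" using assms(1,2) by simp
  have 1: "P m b" using assms(3,4)
  proof (induction b)
    case (Suc b)
    show ?case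
    proof (cases "b = m")
      case True
      show ?thesis unfolding True by (rule base) (use m Suc.prems True in linarith)+
    next
      case False
      show ?thesis by (rule col) (use m Suc.prems False Suc.IH in \<open>simp_all (no_asm_simp)\<close>)
    qed
  qed simp
  show ?thesis using assms(2,1)
  proof (induction a rule: inc_induct)
    case (step n)
    show ?case by (rule row) (use step assms(3,4) in \<open>simp_all (no_asm_simp)\<close>)
  qed (rule 1)
qed

lemma RE_sq: "\<lbrakk>1 \<le> a; a \<le> m; m < b; b \<le> r\<rbrakk> \<Longrightarrow> RE a b * RE a b = 0"
proof (induction rule: odd_induct)
  case base thus ?case using Em2 by simp
next
  case (row a b)
  show ?case using row_raise(2)[OF v0 _ row(5) RE_row[OF row(1-4)]] RE_E_first[of a b] row by (simp add: va_def)
next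
  case (col a b)
  show ?case using col_raise(2)[OF v0 _ col(5) RE_col[OF col(2,3)]] RE_E_last[of a b] col by (simp add: va_def)
qed

lemma RE_super_comm:
  assumes z: "\<And>j. \<lbrakk>c \<le> j; j < d; j \<noteq> m\<rbrakk> \<Longrightarrow> z * E j = E j * z" and zm: "z * E m = - (E m * z)"
    and c: "c \<le> m" "m < d"
  shows "z * RE c d = - (RE c d * z)"
  using z c(2)
proof (induction d)
  case (Suc d)
  show ?case
  proof (cases "d = m")
    case True
    have 1: "E m * z = sc (-1) (z * E m)" using zm by (simp add: sc_minus_left)
    have 2: "RE c m * z = sc 1 (z * RE c m)" using RE_comm[of c m z] Suc.prems c True by simp
    show ?thesis using qc_comm[OF 2 1] True zm by (auto simp: sc_minus_left)
  next
    case False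
    hence IH: "z * RE c d = - (RE c d * z)" using Suc by simp
    have 1: "RE c d * z = sc (-1) (z * RE c d)" using IH by (simp add: sc_minus_left)
    have 2: "E d * z = sc 1 (z * E d)" using Suc.prems(1)[of d] False Suc.prems c by simp
    show ?thesis using qc_comm[OF 1 2] False c Suc.prems by (auto simp: sc_minus_left)
  qed
qed simp

text \<open>The extension of the odd Serre relation from the chain \<open>m-1, m, m+1\<close> to all chains with
\<open>m\<close> in the interior.\<close>

lemma RE_Em:
  assumes "1 \<le> a" "a < m" "Suc m < b" "b \<le> r"
  shows "E m * RE a b = - (RE a b * E m)"
proof -
  obtain j where j: "m = Suc j" using assms by (cases m) auto
  have 0: "E m * RE j (m+2) = - (RE j (m+2) * E m)" using oddE assms j by simp
  have 1: "E m * RE j b = - (RE j b * E m)"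
  proof (cases "b = m + 2")
    case False
    have s: "RE j b = qc (inverse (va (m+2))) (RE j (m+2)) (RE (m+2) b)"
      using RE_split[of j "m+2" b] assms j False by simp
    have a: "RE j (m+2) * E m = sc (-1) (E m * RE j (m+2))" using 0 by (simp add: sc_minus_left)
    have b: "RE (m+2) b * E m = sc 1 (E m * RE (m+2) b)" using RE_E_far[of "m+2" b m] assms by simp
    show ?thesis unfolding s using qc_comm[OF a b, of "inverse (va (m+2))"] by (simp add: sc_minus_left del: RE.simps)
  qed (use 0 in simp)
  show ?thesis
  proof (cases "a = j")
    case False
    have s: "RE a b = qc (inverse (va j)) (RE a j) (RE j b)"
      using RE_split[of a j b] assms j False by simp
    have a: "RE j b * E m = sc (-1) (E m * RE j b)" using 1 by (simp add: sc_minus_left)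
    have b: "RE a j * E m = sc 1 (E m * RE a j)" using RE_E_far[of a j m] assms j by simp
    show ?thesis unfolding s using qc_comm[OF b a, of "inverse (va j)"] by (simp add: sc_minus_left)
  qed (use 1 in simp)
qed

text \<open>For two odd positions there are four configurations: nested, same column, same row, and crossing.\<close>

lemma RE_RE_nested:
  assumes "1 \<le> a" "a < c" "c \<le> m" "m < d" "d < b" "b \<le> r"
  shows "RE a b * RE c d = - (RE c d * RE a b)"
  by (rule RE_super_comm) (use assms RE_E_mid[of a _ b] RE_Em[of a b] in auto)

lemma RE_RE_col:
  assumes "1 \<le> a" "a < c" "c \<le> m" "m < b" "b \<le> r"
  shows "RE a b * RE c b = - sc (inverse v) (RE c b * RE a b)"
proof -
  obtain k where k: "c = Suc k" using assms by (cases c) auto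
  have "a \<le> k" using assms k by simp
  thus ?thesis using \<open>1 \<le> a\<close>
  proof (induction a rule: inc_induct)
    case base
    show ?case unfolding k
      by (rule row_raise(1)[where e = "E k"])
        (use assms k RE_sq[of c b] RE_row[of k b] RE_E_first[of k b] v0 in \<open>simp_all add: va_def\<close>)
  next
    case (step n)
    have a: "E n * RE c b = sc 1 (RE c b * E n)" using RE_E_far[of c b n] assms step k by simp
    have b: "RE (Suc n) b * RE c b = sc (- inverse v) (RE c b * RE (Suc n) b)"
      using step by (simp add: sc_minus_left)
    show ?case using qc_comm[OF a b, of "inverse v"] RE_row[of n b] assms step k by (simp add: sc_minus_left)
  qed
qed

lemma RE_RE_row:
  assumes "1 \<le> a" "a \<le> m" "m < b" "b < d" "d \<le> r"
  shows "RE a b * RE a d = - sc v (RE a d * RE a b)"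
  using \<open>b < d\<close> \<open>d \<le> r\<close>
proof (induction d)
  case (Suc d)
  show ?case
  proof (cases "d = b")
    case True
    show ?thesis unfolding True
      by (rule col_raise(1)[where e = "E b"])
        (use assms Suc.prems True RE_sq[of a b] RE_col[of a b] RE_E_last[of a b] v0 in \<open>simp_all add: va_def del: RE.simps\<close>)
  next
    case False
    hence IH: "RE a b * RE a d = - sc v (RE a d * RE a b)" using Suc by simp
    have a: "RE a d * RE a b = sc (- inverse v) (RE a b * RE a d)"
      using IH v0 by (simp add: sc_minus_left sc_minus_right sc_sc)
    have b: "E d * RE a b = sc 1 (RE a b * E d)" using RE_E_far[of a b d] assms Suc.prems False by simp
    have "RE a (Suc d) * RE a b = - sc (inverse v) (RE a b * RE a (Suc d))"
      using qc_comm[OF a b, of v] RE_col[of a d] assms Suc.prems by (simp add: sc_minus_left del: RE.simps)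
    thus ?thesis using v0 by (simp add: sc_minus_left sc_minus_right sc_sc)
  qed
qed simp

lemma RE_RE_cross:
  assumes "1 \<le> a" "a < c" "c \<le> m" "m < b" "b < d" "d \<le> r"
  shows "RE a b * RE c d = - (RE c d * RE a b) + sc (v - inverse v) (RE c b * RE a d)"
proof -
  obtain k where k: "c = Suc k" using assms by (cases c) auto
  have "a \<le> k" using assms k by simp
  thus ?thesis using \<open>1 \<le> a\<close>
  proof (induction a rule: inc_induct)
    case base
    show ?case unfolding k
      by (rule crossing[where e = "E k"])
        (use assms k base RE_RE_row[of c b d] RE_RE_nested[of k c b d] RE_row[of k b] RE_row[of k d] v0 in simp_all)
  next
    case (step n)
    have a: "E n * RE c d = sc 1 (RE c d * E n)" using RE_E_far[of c d n] assms step k by simp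
    have a': "E n * RE c b = RE c b * E n" using RE_E_far[of c b n] assms step k by simp
    have b: "RE (Suc n) b * RE c d = sc (- 1) (RE c d * RE (Suc n) b) + sc (v - inverse v) (RE c b * RE (Suc n) d)"
      using step by (simp add: sc_minus_left)
    have "RE n b * RE c d = sc (1 * -1) (RE c d * RE n b) + (E n * sc (v - inverse v) (RE c b * RE (Suc n) d)
        - sc (inverse v * 1) (sc (v - inverse v) (RE c b * RE (Suc n) d) * E n))"
      using qc_err_right[OF a b, of "inverse v"] RE_row[of n b] assms step k by simp
    also have "E n * sc w (RE c b * RE (Suc n) d) - sc (inverse v * 1) (sc w (RE c b * RE (Suc n) d) * E n)
        = sc w (RE c b * RE n d)" for w
    proof -
      have 1: "RE n d = qc (inverse v) (E n) (RE (Suc n) d)" using RE_row[of n d] assms step k by simp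
      have 2: "E n * (RE c b * w) = RE c b * (E n * w)" for w using a' by (simp add: mult.assoc[symmetric])
      show ?thesis unfolding 1 qc_def
        by (simp add: 2 mult_sc_right mult_sc_left mult.assoc right_diff_distrib sc_diff_right sc_sc mult.commute)
    qed
    finally show ?case by (simp add: sc_minus_left)
  qed
qed

end

section \<open>Duality\<close>

text \<open>A copy of the type for the opposite ring. The duality that exchanges \<open>E\<close> and \<open>F\<close> is
an anti-automorphism, so it becomes an interpretation of \<open>qgl_rel\<close> only over the opposite ring.\<close>

datatype 'a opp = Opp (unopp: 'a)

instantiation opp :: (times) times
begin
definition times_opp :: "'a opp \<Rightarrow> 'a opp \<Rightarrow> 'a opp" where "x * y = Opp (unopp y * unopp x)"
instance ..
end

instance opp :: (semigroup_mult) semigroup_mult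
  by standard (simp add: times_opp_def mult.assoc)

instantiation opp :: (ab_group_add) ab_group_add
begin
definition zero_opp :: "'a opp" where "0 = Opp 0"
definition plus_opp :: "'a opp \<Rightarrow> 'a opp \<Rightarrow> 'a opp" where "x + y = Opp (unopp x + unopp y)"
definition minus_opp :: "'a opp \<Rightarrow> 'a opp \<Rightarrow> 'a opp" where "x - y = Opp (unopp x - unopp y)"
definition uminus_opp :: "'a opp \<Rightarrow> 'a opp" where "- x = Opp (- unopp x)"
instance
  by standard (auto simp: zero_opp_def plus_opp_def minus_opp_def uminus_opp_def algebra_simps opp.expand)
end

instance opp :: (ring) ring
  by standard (auto simp: plus_opp_def times_opp_def distrib_left distrib_right)

instantiation opp :: (monoid_mult) monoid_mult
begin
definition one_opp :: "'a opp" where "1 = Opp 1"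
instance by standard (auto simp: one_opp_def times_opp_def)
end

lemmas opp_simps = times_opp_def zero_opp_def plus_opp_def minus_opp_def uminus_opp_def one_opp_def

context sc_algebra begin

definition sco :: "'c \<Rightarrow> 'a opp \<Rightarrow> 'a opp" where "sco c x = Opp (sc c (unopp x))"

lemma sco_Opp: "sco c (Opp x) = Opp (sc c x)" by (simp add: sco_def)

lemma sc_algebra_opp: "sc_algebra sco"
  by unfold_locales (auto simp: sco_def opp_simps sc_simps sc_add_left)

end

context qgl_rel begin

lemma kap_opp: "\<lbrakk>a \<in> {1..r}; b \<in> {1..r}\<rbrakk> \<Longrightarrow> K b * L a - L b * K a = - kap a b"
  unfolding kap_def using KLc[of a b] KLc[of b a] by simp

text \<open>Reversing the product turns the recursion of positive root vectors into that of negative ones; this is why the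
two recursions list their factors in opposite order.\<close>

lemma dual_RE: "qgl.RE sco m (inverse v) (\<lambda>i. Opp (F i)) a b = Opp (RF a b)"
proof -
  interpret d: sc_algebra sco by (rule sc_algebra_opp)
  interpret d: qgl sco m r "inverse v" "\<lambda>i. Opp (F i)" "\<lambda>i. Opp (E i)" "\<lambda>i. Opp (L i)" "\<lambda>i. Opp (K i)" ..
  have va: "d.va i = inverse (va i)" for i by (simp add: d.va_def va_def)
  show ?thesis
    by (induction b) (auto simp: zero_opp_def d.qc_def qc_def va sco_Opp opp_simps)
qed

lemma dual_RF: "qgl.RF sco m (inverse v) (\<lambda>i. Opp (E i)) a b = Opp (RE a b)"
proof -
  interpret d: sc_algebra sco by (rule sc_algebra_opp)
  interpret d: qgl sco m r "inverse v" "\<lambda>i. Opp (F i)" "\<lambda>i. Opp (E i)" "\<lambda>i. Opp (L i)" "\<lambda>i. Opp (K i)" ..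
  have va: "d.va i = inverse (va i)" for i by (simp add: d.va_def va_def)
  show ?thesis
    by (induction b) (auto simp: zero_opp_def d.qc_def qc_def va sco_Opp opp_simps)
qed

lemma dual: "qgl_rel sco m r (inverse v) (\<lambda>i. Opp (F i)) (\<lambda>i. Opp (E i)) (\<lambda>i. Opp (L i)) (\<lambda>i. Opp (K i))"
proof -
  interpret d: sc_algebra sco by (rule sc_algebra_opp)
  interpret d: qgl sco m r "inverse v" "\<lambda>i. Opp (F i)" "\<lambda>i. Opp (E i)" "\<lambda>i. Opp (L i)" "\<lambda>i. Opp (K i)" ..
  have va: "d.va i = inverse (va i)" for i by (simp add: d.va_def va_def)
  have LX: "x0 * L a = sc (inverse (va a) powi - g) (L a * x0)"
    if "wtd h x0" "h a = g" "a \<in> {1..r}" for x0 h a g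
    using wtdL[OF that(1,3)] that(2) 
    by (simp add: sc_sc power_int_inverse power_int_minus)
  show ?thesis
  proof (unfold_locales, goal_cases)
    case 1 thus ?case using v0 by simp
  next
    case (2 j) thus ?case using vroot[of j] v0 by (metis inverse_eq_1_iff power_inverse)
  next
    case (3 a b) thus ?case using LLc[of a b] by (simp add: opp_simps)
  next
    case (4 a) thus ?case using KL[of a] by (simp add: opp_simps)
  next
    case (5 a) thus ?case using LK[of a] by (simp add: opp_simps)
  next
    case (6 a b)
    have "rt (b+1) b a = - rt b (b+1) a" by (simp add: rt_def)
    thus ?case using LX[OF wtd_F[of b] refl, of a] 6 by (simp add: opp_simps va sco_Opp)
  next
    case (7 a b)
    have "rt (b+1) b a = - rt b (b+1) a" by (simp add: rt_def)
    thus ?case using LX[OF wtd_E[of b] refl, of a] 7 by (simp add: opp_simps va sco_Opp)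
  next
    case (8 a)
    have k: "d.kap a (a+1) = Opp (- kap a (a+1))"
      unfolding d.kap_def using kap_opp[of a "a+1"] 8 by (simp add: opp_simps)
    have e: "1 / (inverse (va a) - va a) = - (1 / (va a - inverse (va a)))"
      using minus_divide_right[of 1 "va a - inverse (va a)"] by simp
    show ?case unfolding va inverse_inverse_eq k e using EF[OF 8]
      by (simp only: opp_simps sco_Opp opp.sel sc_minus_right sc_minus_left minus_minus)
  next
    case (9 a b) thus ?case using EF'[of b a] by (simp add: opp_simps)
  next
    case (10 a b) thus ?case using FF[of a b] by (simp add: opp_simps)
  next
    case (11 a b) thus ?case using EE[of a b] by (simp add: opp_simps)
  next
    case (12 a b) thus ?case using serreF[of a b] 
      by (simp add: opp_simps va sco_Opp mult.assoc add.commute)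
  next
    case (13 a b) thus ?case using serreE[of a b] 
      by (simp add: opp_simps va sco_Opp mult.assoc add.commute)
  next
    case 14 thus ?case using Fm2 by (simp add: opp_simps)
  next
    case 15 thus ?case using Em2 by (simp add: opp_simps)
  next
    case 16 thus ?case using oddF unfolding dual_RE by (simp add: opp_simps)
  next
    case 17 thus ?case using oddE unfolding dual_RF by (simp add: opp_simps)
  qed
qed

lemma dual_va: "qgl.va m (inverse v) i = inverse (va i)"
proof -
  interpret d: qgl_rel sco m r "inverse v" "\<lambda>i. Opp (F i)" "\<lambda>i. Opp (E i)" "\<lambda>i. Opp (L i)" "\<lambda>i. Opp (K i)" by (rule dual)
  show ?thesis by (simp add: d.va_def va_def)
qed

lemma dual_qc: "sc_algebra.qc sco c (Opp x) (Opp y) = Opp (y * x - sc c (x * y))"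
proof -
  interpret d: sc_algebra sco by (rule sc_algebra_opp)
  show ?thesis by (simp add: d.qc_def opp_simps sco_Opp)
qed

lemmas dual_simps = dual_RE dual_RF dual_va dual_qc opp_simps sco_Opp opp.sel opp.inject inverse_inverse_eq

text \<open>Each statement about \<open>RE\<close> read in the opposite ring.\<close>

lemmas RF_first = qgl_rel.RE_first[OF dual, unfolded dual_simps]
lemmas RF_split = qgl_rel.RE_split[OF dual, unfolded dual_simps]
lemmas RF_E_first = qgl_rel.RE_F_first[OF dual, unfolded dual_simps]
lemmas RF_E_last = qgl_rel.RE_F_last[OF dual, unfolded dual_simps]
lemmas RF_sq = qgl_rel.RE_sq[OF dual, unfolded dual_simps]
lemmas RF_super_comm = qgl_rel.RE_super_comm[OF dual, unfolded dual_simps]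
lemmas RF_RF_nested = qgl_rel.RE_RE_nested[OF dual, unfolded dual_simps]
lemmas RF_RF_col = qgl_rel.RE_RE_col[OF dual, unfolded dual_simps]
lemmas RF_RF_row = qgl_rel.RE_RE_row[OF dual, unfolded dual_simps]
lemmas RF_RF_cross = qgl_rel.RE_RE_cross[OF dual, unfolded dual_simps]
end

section \<open>Anticommutators of positive and negative odd root vectors\<close>

context qgl_rel begin

definition dl :: 'c where "dl = 1 / (v - inverse v)"

lemma va_lo: "i \<le> m \<Longrightarrow> va i = v" and va_hi: "m < i \<Longrightarrow> va i = inverse v"
  by (simp_all add: va_def)

lemma wt_KL_comm: "\<lbrakk>wtd g x; a \<in> {1..r}; b \<in> {1..r}; g a = 0; g b = 0\<rbrakk> \<Longrightarrow> (K a * L b) * x = x * (K a * L b)"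
  using KL_wt[of g x a b] by simp

lemma wt_LK_comm: "\<lbrakk>wtd g x; a \<in> {1..r}; b \<in> {1..r}; g a = 0; g b = 0\<rbrakk> \<Longrightarrow> (L a * K b) * x = x * (L a * K b)"
  using LK_wt[of g x a b] by simp

text \<open>The rank one relation for the odd root of position \<open>(a, b)\<close>. It is proved together with its
consequences along the row and the column, by induction on the position, in which it is the hypothesis of the
auxiliary lemmas.\<close>

definition RE_RF_diag :: "nat \<Rightarrow> nat \<Rightarrow> bool" where
  "RE_RF_diag a b \<longleftrightarrow> RE a b * RF a b = - (RF a b * RE a b) + sc dl (kap a b)"

text \<open>From the diagonal relation at \<open>(a, b)\<close> one moves along the row by q-commuting with the even
vectors \<open>F\<^sub>d\<close>, which commute with the positive root vector. The error term is an even root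
vector times a torus element.\<close>

lemma RE_RF_row_of:
  assumes ab: "1 \<le> a" "a \<le> m" "m < b" and d: "b < d" "d \<le> r" and P: "RE_RF_diag a b"
  shows "RE a b * RF a d = - (RF a d * RE a b) + sc (inverse v) (RF b d * (K a * L b))"
  using d
proof (induction d)
  case (Suc d)
  have d: "d \<in> {1..<r}" and r: "a \<in> {1..r}" "b \<in> {1..r}" "d \<in> {1..r}" using assms Suc.prems by auto
  have F: "F d * RE a b = sc 1 (RE a b * F d)" using RE_F_far[of a b d] assms Suc.prems by simp
  have RFd: "RF a (Suc d) = qc (inverse v) (F d) (RF a d)" using assms Suc.prems by (simp add: va_hi)
  show ?case
  proof (cases "d = b")
    case True
    have x: "RF a b * RE a b = sc (-1) (RE a b * RF a b) + sc dl (kap a b)"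
      using P unfolding RE_RF_diag_def by (simp add: sc_minus_left)
    have k1: "K a * L b * F b = sc (inverse v) (F b * (K a * L b))"
      using KL_wt[OF wtd_F[of b] r(1,2)] d True ab by (simp add: rt_def va_hi)
    have k2: "L a * K b * F b = sc v (F b * (L a * K b))"
      using LK_wt[OF wtd_F[of b] r(1,2)] d True ab by (simp add: rt_def va_hi)
    have k: "kap a b * F b = sc (inverse v) (F b * (K a * L b)) - sc v (F b * (L a * K b))"
      unfolding kap_def left_diff_distrib k1 k2 ..
    have "RF a (Suc b) * RE a b = sc (1 * -1) (RE a b * RF a (Suc b))
       + (F b * sc dl (kap a b) - sc (inverse v * 1) (sc dl (kap a b) * F b))"
      using qc_err_right[OF F[unfolded True] x, of "inverse v"] RFd[unfolded True] by simp
    also have "F b * sc dl (kap a b) - sc (inverse v * 1) (sc dl (kap a b) * F b)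
       = sc dl (F b * (K a * L b)) - sc dl (F b * (L a * K b))
          - sc (inverse v) (sc dl (sc (inverse v) (F b * (K a * L b)) - sc v (F b * (L a * K b))))"
      by (simp only: mult_sc_left mult_sc_right k mult_1_right) (simp add: kap_def right_diff_distrib sc_diff_right)
    also have "\<dots> = sc (dl - inverse v * (dl * inverse v)) (F b * (K a * L b))"
    proof -
      have h: "inverse v * (dl * v) = dl" using v0 by simp
      show ?thesis by (simp add: sc_diff_right sc_sc sc_diff_left h)
    qed
    also have "dl - inverse v * (dl * inverse v) = inverse v * (dl * (v - inverse v))"
      unfolding right_diff_distrib using v0 by simp
    also have "\<dots> = inverse v" unfolding dl_def using v_sq(3) by simp
    finally show ?thesis using True by (simp add: sc_minus_left)
  next
    case False
    have x: "RF a d * RE a b = sc (-1) (RE a b * RF a d) + sc (inverse v) (RF b d * (K a * L b))"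
      using Suc False by (simp add: sc_minus_left)
    have c: "K a * L b * F d = F d * (K a * L b)"
      using wt_KL_comm[OF wtd_F[OF d] r(1,2)] False Suc.prems ab by (simp add: rt_def)
    have "RF a (Suc d) * RE a b = sc (1 * -1) (RE a b * RF a (Suc d))
       + (F d * sc (inverse v) (RF b d * (K a * L b)) - sc (inverse v * 1) (sc (inverse v) (RF b d * (K a * L b)) * F d))"
      using qc_err_right[OF F x, of "inverse v"] RFd by simp
    also have "F d * sc (inverse v) (RF b d * (K a * L b)) - sc (inverse v * 1) (sc (inverse v) (RF b d * (K a * L b)) * F d)
        = sc (inverse v) (qc (inverse v) (F d) (RF b d) * (K a * L b))"
      unfolding qc_def using c by (simp add: sc_simps)
    also have "qc (inverse v) (F d) (RF b d) = RF b (Suc d)" using False Suc.prems ab by (simp add: va_hi)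
    finally show ?thesis by (simp add: sc_minus_left)
  qed
qed simp

lemma RE_RF_col_of:
  assumes ab: "1 \<le> c" "c < a" "a \<le> m" "m < b" "b \<le> r" and P: "RE_RF_diag a b"
  shows "RE a b * RF c b = - (RF c b * RE a b) + RF c a * (L a * K b)"
proof -
  obtain k where k: "a = Suc k" using ab by (cases a) auto
  have "c \<le> k" using ab k by simp
  thus ?thesis using \<open>1 \<le> c\<close>
  proof (induction c rule: inc_induct)
    case base
    have r: "k \<in> {1..<r}" "a \<in> {1..r}" "b \<in> {1..r}" using ab k base by auto
    have F: "F k * RE a b = sc 1 (RE a b * F k)" using RE_F_far[of a b k] ab k base by simp
    have x: "RF a b * RE a b = sc (-1) (RE a b * RF a b) + sc dl (kap a b)"
      using P unfolding RE_RF_diag_def by (simp add: sc_minus_left)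
    have R: "RF k b = qc v (RF a b) (F k)" unfolding qc_def using RF_first[of k b] ab k base by (simp add: va_lo)
    have k1: "K a * L b * F k = sc v (F k * (K a * L b))"
      using KL_wt[OF wtd_F[OF r(1)] r(2,3)] k ab by (simp add: rt_def va_lo)
    have k2: "L a * K b * F k = sc (inverse v) (F k * (L a * K b))"
      using LK_wt[OF wtd_F[OF r(1)] r(2,3)] k ab by (simp add: rt_def va_lo power_int_minus)
    have kk: "kap a b * F k = sc v (F k * (K a * L b)) - sc (inverse v) (F k * (L a * K b))"
      unfolding kap_def left_diff_distrib k1 k2 ..
    have "RF k b * RE a b = sc (-1 * 1) (RE a b * RF k b) + (sc 1 (sc dl (kap a b) * F k) - sc v (F k * sc dl (kap a b)))"
      unfolding R by (rule qc_err_left[OF x F])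
    also have "sc 1 (sc dl (kap a b) * F k) - sc v (F k * sc dl (kap a b))
      = sc dl (sc v (F k * (K a * L b)) - sc (inverse v) (F k * (L a * K b)))
       - sc v (sc dl (F k * (K a * L b) - F k * (L a * K b)))"
      by (simp only: mult_sc_left mult_sc_right kk sc_one) (simp add: kap_def right_diff_distrib)
    also have "\<dots> = sc (v * dl - dl * inverse v) (F k * (L a * K b))"
      using v0 by (simp add: sc_diff_right sc_sc sc_diff_left mult.commute)
    also have "v * dl - dl * inverse v = 1" unfolding dl_def using v_sq(3) by (simp add: diff_divide_distrib[symmetric])
    finally show ?case using k by (simp add: sc_minus_left)
  next
    case (step n)
    have r: "n \<in> {1..<r}" "a \<in> {1..r}" "b \<in> {1..r}" using ab k step by auto
    have F: "F n * RE a b = sc 1 (RE a b * F n)" using RE_F_far[of a b n] ab k step by simp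
    have x: "RF (Suc n) b * RE a b = sc (-1) (RE a b * RF (Suc n) b) + RF (Suc n) a * (L a * K b)"
      using step by (simp add: sc_minus_left)
    have R: "RF n b = qc v (RF (Suc n) b) (F n)" unfolding qc_def using RF_first[of n b] ab k step by (simp add: va_lo)
    have R': "RF n a = qc v (RF (Suc n) a) (F n)" unfolding qc_def using RF_first[of n a] ab k step by (simp add: va_lo)
    have c: "L a * K b * F n = F n * (L a * K b)"
      using wt_LK_comm[OF wtd_F[OF r(1)] r(2,3)] ab k step by (simp add: rt_def)
    have "RF n b * RE a b = sc (-1 * 1) (RE a b * RF n b) + (sc 1 (RF (Suc n) a * (L a * K b) * F n) - sc v (F n * (RF (Suc n) a * (L a * K b))))"
      unfolding R by (rule qc_err_left[OF x F])
    also have "sc 1 (RF (Suc n) a * (L a * K b) * F n) - sc v (F n * (RF (Suc n) a * (L a * K b))) = RF n a * (L a * K b)"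
      unfolding R' qc_def using c by (simp add: sc_simps)
    finally show ?case by (simp add: sc_minus_left)
  qed
qed

text \<open>At the next position, one error term comes from the even simple root vector and the other from the row or
column relation of the previous position; their torus factors combine to \<open>kap\<close> of the longer
root.\<close>

lemma RE_RF_diag:
  assumes "1 \<le> a" "a \<le> m" "m < b" "b \<le> r"
  shows "RE_RF_diag a b"
  using assms
proof (induction rule: odd_induct)
  case base
  thus ?case using EF[of m] by (simp add: RE_RF_diag_def et_def va_lo dl_def sc_minus_left)
next
  case (row a b)
  let ?l = "Suc a" let ?x0 = "RE ?l b" and ?Y = "RF ?l b"
  have r: "a \<in> {1..<r}" "a \<in> {1..r}" "?l \<in> {1..r}" "b \<in> {1..r}" using row by auto
  have R: "RE a b = qc (inverse v) (E a) ?x0" using RE_row row by simp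
  have e: "E a * RF a b = sc 1 (RF a b * E a) + (- (L ?l * K a * ?Y))"
    using RF_E_first[of a b] row by (simp add: et_def)
  have x: "?x0 * RF a b = sc (-1) (RF a b * ?x0) + F a * (L ?l * K b)"
    using RE_RF_col_of[of a ?l b] row by (simp add: sc_minus_left)
  have l1: "?x0 * (L ?l * K a) = sc v ((L ?l * K a) * ?x0)"
    using LK_wt[OF wtd_RE[of ?l b], of ?l a] row r v0 by (simp add: rt_def va_lo sc_sc power_int_minus)
  have l2: "L ?l * K b * E a = sc v (E a * (L ?l * K b))"
    using LK_wt[OF wtd_E[of a], of ?l b] row r by (simp add: rt_def va_lo)
  have g1: "?x0 * (L ?l * K a * ?Y) = sc v ((L ?l * K a) * (?x0 * ?Y))"
    by (simp only: mult.assoc[symmetric] l1[unfolded mult.assoc[symmetric]] mult_sc_left)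
  have "RE a b * RF a b = sc (1 * -1) (RF a b * RE a b)
     + (sc (-1) (- (L ?l * K a * ?Y) * ?x0) - sc (inverse v) (?x0 * - (L ?l * K a * ?Y)))
     + (E a * (F a * (L ?l * K b)) - sc (inverse v * 1) (F a * (L ?l * K b) * E a))"
    unfolding R by (rule qc_err_both[OF e x])
  also have "sc (-1) (- (L ?l * K a * ?Y) * ?x0) - sc (inverse v) (?x0 * - (L ?l * K a * ?Y))
      = (L ?l * K a) * (?Y * ?x0 + ?x0 * ?Y)"
    using v0 by (simp add: g1[unfolded mult.assoc] sc_minus_left sc_minus_right sc_sc distrib_left mult.assoc)
  also have "?Y * ?x0 + ?x0 * ?Y = sc dl (kap ?l b)" using row(5) unfolding RE_RF_diag_def by simp
  also have "E a * (F a * (L ?l * K b)) - sc (inverse v * 1) (F a * (L ?l * K b) * E a)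
     = (E a * F a - F a * E a) * (L ?l * K b)"
    using v0 l2 by (simp add: mult.assoc left_diff_distrib mult_sc_right sc_sc)
  also have "E a * F a - F a * E a = sc dl (kap a ?l)" using EF[OF r(1)] row by (simp add: et_def va_lo dl_def)
  finally have "RE a b * RF a b = - (RF a b * RE a b) + sc dl ((L ?l * K a) * kap ?l b + kap a ?l * (L ?l * K b))"
    by (simp add: sc_minus_left mult_sc_right mult_sc_left sc_add_right add.assoc)
  also have "(L ?l * K a) * kap ?l b + kap a ?l * (L ?l * K b) = kap a b"
  proof -
    have 1: "L ?l * K a * (K ?l * L b) = K a * L b"
    proof -
      have "L ?l * K a * (K ?l * L b) = K a * (L ?l * K ?l) * L b"
        using KLc[OF r(2,3)] by (metis mult.assoc)
      thus ?thesis using LK[OF r(3)] by simp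
    qed
    have 2: "L a * K ?l * (L ?l * K b) = L a * K b" 
    proof -
      have "L a * K ?l * (L ?l * K b) = L a * (K ?l * L ?l) * K b" by (simp only: mult.assoc)
      thus ?thesis using KL[OF r(3)] by simp
    qed
    have 3: "L ?l * K a * (L ?l * K b) = K a * L ?l * (L ?l * K b)" using KLc[OF r(2,3)] by simp
    show ?thesis unfolding kap_def right_diff_distrib left_diff_distrib 1 2 3 by simp
  qed
  finally show ?case unfolding RE_RF_diag_def .
next
  case (col a b)
  let ?l = "Suc b" let ?x0 = "RE a b" and ?Y = "RF a b"
  have r: "b \<in> {1..<r}" "a \<in> {1..r}" "b \<in> {1..r}" "?l \<in> {1..r}" using col by auto
  have R: "RE a ?l = qc v ?x0 (E b)" using RE_col col by simp
  have e: "E b * RF a ?l = sc 1 (RF a ?l * E b) + ?Y * (L b * K ?l)"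
  proof -
    have "K ?l * L b * ?Y = sc v (?Y * (K ?l * L b))"
      using KL_wt[OF wtd_RF[of a b], of ?l b] col r by (simp add: rt_def va_hi power_int_minus)
    thus ?thesis using RF_E_last[of a b] col KLc[OF r(4,3)] v0 by (simp add: et_def va_hi sc_sc del: RF.simps)
  qed
  have x: "?x0 * RF a ?l = sc (-1) (RF a ?l * ?x0) + sc (inverse v) (F b * (K a * L b))"
    using RE_RF_row_of[of a b ?l] col by (simp add: sc_minus_left)
  have l1: "L b * K ?l * ?x0 = sc (inverse v) (?x0 * (L b * K ?l))"
    using LK_wt[OF wtd_RE[of a b], of b ?l] col r by (simp add: rt_def va_hi power_int_minus)
  have l2: "K a * L b * E b = sc v (E b * (K a * L b))"
    using KL_wt[OF wtd_E[of b], of a b] col r by (simp add: rt_def va_hi power_int_minus)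
  have "RE a ?l * RF a ?l = sc (-1 * 1) (RF a ?l * RE a ?l)
     + (sc 1 (sc (inverse v) (F b * (K a * L b)) * E b) - sc v (E b * sc (inverse v) (F b * (K a * L b))))
     + (?x0 * (?Y * (L b * K ?l)) - sc (v * -1) (?Y * (L b * K ?l) * ?x0))"
    unfolding R by (rule qc_err_both[OF x e])
  also have "sc 1 (sc (inverse v) (F b * (K a * L b)) * E b) - sc v (E b * sc (inverse v) (F b * (K a * L b)))
     = - ((E b * F b - F b * E b) * (K a * L b))"
    using v0 l2 by (simp add: mult.assoc left_diff_distrib mult_sc_right mult_sc_left sc_sc)
  also have "?x0 * (?Y * (L b * K ?l)) - sc (v * -1) (?Y * (L b * K ?l) * ?x0) = (?x0 * ?Y + ?Y * ?x0) * (L b * K ?l)"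
    using v0 l1 by (simp add: mult.assoc distrib_right mult_sc_right sc_sc sc_minus_left)
  also have "?x0 * ?Y + ?Y * ?x0 = sc dl (kap a b)" using col(5) unfolding RE_RF_diag_def by simp
  also have "E b * F b - F b * E b = - sc dl (kap b ?l)"
  proof -
    have "1 / (inverse v - v) = - (1 / (v - inverse v))"
      using minus_divide_right[of 1 "v - inverse v"] by simp
    hence "1 / (va b - inverse (va b)) = - dl" using col by (simp add: va_hi dl_def)
    thus ?thesis using EF[OF r(1)] col by (simp add: et_def sc_minus_left)
  qed
  finally have "RE a ?l * RF a ?l = - (RF a ?l * RE a ?l) + sc dl (kap b ?l * (K a * L b) + kap a b * (L b * K ?l))"
    by (simp add: sc_minus_left mult_sc_right mult_sc_left sc_add_right add.assoc del: RE.simps RF.simps)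
  also have "kap b ?l * (K a * L b) + kap a b * (L b * K ?l) = kap a ?l"
  proof -
    have 1: "K b * L ?l * (K a * L b) = K a * L ?l"
    proof -
      have "K b * L ?l * (K a * L b) = K b * (K a * L ?l) * L b" using KLc[OF r(2,4)] by (metis mult.assoc)
      also have "\<dots> = K a * (K b * L ?l) * L b" using KK[OF r(2,3)] by (metis mult.assoc)
      also have "\<dots> = K a * L ?l * (K b * L b)" using KLc[OF r(3,4)] by (metis mult.assoc)
      finally show ?thesis using KL[OF r(3)] by simp
    qed
    have 2: "L a * K b * (L b * K ?l) = L a * K ?l"
    proof -
      have "L a * K b * (L b * K ?l) = L a * (K b * L b) * K ?l" by (simp only: mult.assoc)
      thus ?thesis using KL[OF r(3)] by simp
    qed
    have 3: "K a * L b * (L b * K ?l) = L b * K ?l * (K a * L b)"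
      using comm_mult[of "K a" "L b * K ?l" 1 "L b" 1] mult_commute3[of "K a" "L b" "K ?l"] mult_commute3[of "L b" "L b" "K ?l"]
        KLc[OF r(2,3)] KK[OF r(2,4)] KLc[OF r(4,3)] by simp
    show ?thesis unfolding kap_def right_diff_distrib left_diff_distrib 1 2 3 by simp
  qed
  finally show ?case unfolding RE_RF_diag_def .
qed

lemma RE_RF_eq: "\<lbrakk>1 \<le> a; a \<le> m; m < b; b \<le> r\<rbrakk> \<Longrightarrow> RE a b * RF a b = - (RF a b * RE a b) + sc dl (kap a b)"
  using RE_RF_diag RE_RF_diag_def by simp

lemma RE_RF_row: "\<lbrakk>1 \<le> a; a \<le> m; m < b; b < d; d \<le> r\<rbrakk> \<Longrightarrow>
    RE a b * RF a d = - (RF a d * RE a b) + sc (inverse v) (RF b d * (K a * L b))"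
  using RE_RF_row_of RE_RF_diag by simp

lemma RE_RF_col: "\<lbrakk>1 \<le> c; c < a; a \<le> m; m < b; b \<le> r\<rbrakk> \<Longrightarrow>
    RE a b * RF c b = - (RF c b * RE a b) + RF c a * (L a * K b)"
  using RE_RF_col_of RE_RF_diag by simp

text \<open>The inner root vector is a chain of simple ones that all commute or anticommute with the outer root vector;
\<open>RF_super_comm\<close> is stated for the opposite ring.\<close>

lemma RE_RF_nested:
  assumes "1 \<le> a" "a < c" "c \<le> m" "m < d" "d < b" "b \<le> r"
  shows "RE a b * RF c d = - (RF c d * RE a b)"
proof -
  have "RF c d * unopp (Opp (RE a b)) = - (unopp (Opp (RE a b)) * RF c d)"
    by (rule RF_super_comm) (use assms RE_F_mid[of a _ b] in \<open>auto simp: et_def sc_minus_left\<close>)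
  thus ?thesis by simp
qed

lemmas RF_RE_row = qgl_rel.RE_RF_row[OF dual, unfolded dual_simps]
lemmas RF_RE_col = qgl_rel.RE_RF_col[OF dual, unfolded dual_simps]
lemmas RF_RE_nested = qgl_rel.RE_RF_nested[OF dual, unfolded dual_simps]

text \<open>The crossing case is obtained by splitting off an even root vector that commutes with \<open>RE a b\<close>;
the error term is a product of two even root vectors and a torus element.\<close>

lemma RE_RF_cross:
  assumes "1 \<le> c" "c < a" "a \<le> m" "m < d" "d < b" "b \<le> r"
  shows "RE a b * RF c d = - (RF c d * RE a b) + sc (1 - v * v) (RF c a * (K d * L a) * RE d b)"
proof -
  have r: "a \<in> {1..r}" "d \<in> {1..r}" using assms by auto
  let ?g = "sc v ((K d * L a) * RE d b)"
  have R: "RF c d = qc v (RF a d) (RF c a)"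
    unfolding qc_def using RF_split[of c a d] assms by (simp add: va_lo)
  have 1: "RF a d * RE a b = sc (-1) (RE a b * RF a d) + ?g"
    using RF_RE_row[of a d b] assms KLc[OF r(2,1)] by (simp add: sc_minus_left)
  have F: "RF c a * x0 = x0 * RF c a" if "\<And>i. \<lbrakk>c \<le> i; i < a\<rbrakk> \<Longrightarrow> F i * x0 = x0 * F i" for x0
    using RF_comm[of c a x0] that by simp
  have 2: "RF c a * RE a b = sc 1 (RE a b * RF c a)"
    using F[of "RE a b"] RE_F_far[of a b] assms by simp
  have 3: "RF c a * RE d b = RE d b * RF c a"
    using F[of "RE d b"] RE_F_far[of d b] assms by simp
  have 4: "(K d * L a) * RF c a = sc (inverse v) (RF c a * (K d * L a))"
    using KL_wt[OF wtd_RF[of c a] r(2,1)] assms by (simp add: rt_def va_lo power_int_minus)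
  have "RF c d * RE a b = sc (-1 * 1) (RE a b * RF c d) + (sc 1 (?g * RF c a) - sc v (RF c a * ?g))"
    unfolding R by (rule qc_err_left[OF 1 2])
  also have "?g * RF c a = RF c a * (K d * L a) * RE d b"
  proof -
    have "?g * RF c a = sc v ((K d * L a) * (RE d b * RF c a))" by (simp add: mult_sc_left mult.assoc)
    also have "\<dots> = sc v ((K d * L a) * RF c a * RE d b)" by (simp only: 3[symmetric] mult.assoc)
    finally show ?thesis unfolding 4 using v0 by (simp add: mult_sc_left sc_sc)
  qed
  also have "RF c a * ?g = sc v (RF c a * (K d * L a) * RE d b)" by (simp add: mult_sc_right mult.assoc)
  finally show ?thesis by (simp add: sc_minus_left sc_sc sc_diff_left)
qed

lemmas RF_RE_cross = qgl_rel.RE_RF_cross[OF dual, unfolded dual_simps]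

end

section \<open>Divided powers and Gaussian binomials\<close>

text \<open>Numerators of the quantum integers; \<open>qi q i\<close> is the quantum integer and \<open>qf q M\<close>
the quantum factorial.\<close>

definition qn :: "'c::field \<Rightarrow> nat \<Rightarrow> 'c" where
  "qn q i = q ^ i - inverse q ^ i"

definition qi :: "'c::field \<Rightarrow> nat \<Rightarrow> 'c" where
  "qi q i = qn q i / (q - inverse q)"

definition qf :: "'c::field \<Rightarrow> nat \<Rightarrow> 'c" where
  "qf q M = (\<Prod>i=1..M. qi q i)"

lemma qn_powi: "q powi int i - q powi (- int i) = qn q i"
  by (simp add: qn_def power_int_minus power_inverse)

lemma qn_0 [simp]: "qn q 0 = 0" by (simp add: qn_def)
lemma qi_0 [simp]: "qi q 0 = 0" by (simp add: qi_def)

lemma qi_inverse: "qi (inverse q) i = qi q i"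
proof -
  have "qi (inverse q) i = (- qn q i) / (- (q - inverse q))"
    unfolding qi_def qn_def by simp
  also have "\<dots> = qi q i" unfolding qi_def by (rule minus_divide_divide)
  finally show ?thesis .
qed

lemma qf_inverse: "qf (inverse q) = qf q"
  by (rule ext) (simp add: qf_def qi_inverse)

lemma qf_0 [simp]: "qf q 0 = 1" by (simp add: qf_def)

lemma qf_Suc: "qf q (Suc M) = qf q M * qi q (Suc M)" by (simp add: qf_def)

lemma qi_Suc:
  assumes "q - inverse q \<noteq> 0"
  shows "qi q (Suc M) = q ^ M + inverse q * qi q M"
proof -
  have "qn q (Suc M) = (q - inverse q) * q ^ M + inverse q * qn q M"
    unfolding qn_def by (simp add: algebra_simps)
  thus ?thesis unfolding qi_def using assms by (simp add: add_divide_distrib)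
qed

context sc_algebra begin

definition dp :: "'c \<Rightarrow> 'a \<Rightarrow> nat \<Rightarrow> 'a" where
  "dp q x M = sc (1 / qf q M) (x ^ M)"

lemma dp_0 [simp]: "dp q x 0 = 1" by (simp add: dp_def)

lemma dp_1: "q - inverse q \<noteq> 0 \<Longrightarrow> dp q x (Suc 0) = x" by (simp add: dp_def qf_def qi_def qn_def)

lemma dp_inverse: "dp (inverse q) = dp q" by (intro ext) (simp add: dp_def qf_inverse)

lemma pow_comm: "x * y = y * x \<Longrightarrow> x ^ M * y = y * x ^ (M::nat)" for x y :: 'a
proof (induction M)
  case (Suc M)
  thus ?case by (metis mult.assoc power_Suc)
qed simp

lemma dp_comm: "x * y = y * x \<Longrightarrow> dp q x M * y = y * dp q x M"
  unfolding dp_def by (simp add: mult_sc_left mult_sc_right pow_comm)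

lemma dp_comm2: "x * y = y * x \<Longrightarrow> dp q x M * dp q y N = dp q y N * dp q x M"
  by (rule dp_comm) (simp add: dp_comm)

text \<open>If \<open>e\<close> moves past \<open>x0\<close> up to an error \<open>Y\<close> and past \<open>Y\<close>
without error, the errors of a power add up to a quantum integer, which the divided power absorbs. The result
has coefficients in \<open>\<int>[\<upsilon>,\<upsilon>\<^sup>-\<^sup>1]\<close>.\<close>

lemma dp_left:
  assumes nz: "\<And>M. M > 0 \<Longrightarrow> qi t M \<noteq> 0" and t: "t - inverse t \<noteq> 0"
    and x0: "e * x0 = sc (w * t) (x0 * e) + Y" and Y: "e * Y = sc (w * inverse t) (Y * e)"
  shows "dp t e (Suc M) * x0 = sc ((w * t) ^ Suc M) (x0 * dp t e (Suc M)) + sc (w ^ M) (Y * dp t e M)"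
proof -
  have *: "e ^ Suc M * x0 = sc ((w * t) ^ Suc M) (x0 * e ^ Suc M) + sc (w ^ M * qi t (Suc M)) (Y * e ^ M)" for M
  proof (induction M)
    case 0
    thus ?case using x0 t by (simp add: qi_def qn_def)
  next
    case (Suc M)
    have "e ^ Suc (Suc M) * x0 = e * (e ^ Suc M * x0)" by (simp add: mult.assoc)
    also have "\<dots> = sc ((w * t) ^ Suc M) (e * x0 * e ^ Suc M) + sc (w ^ M * qi t (Suc M)) (e * Y * e ^ M)"
      unfolding Suc by (simp add: distrib_left mult_sc_right mult.assoc)
    also have "\<dots> = sc ((w * t) ^ Suc (Suc M)) (x0 * e ^ Suc (Suc M))
        + (sc ((w * t) ^ Suc M) (Y * e ^ Suc M) + sc (w ^ M * qi t (Suc M) * (w * inverse t)) (Y * e ^ Suc M))"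
      unfolding x0 Y by (simp only: distrib_right sc_add_right mult_sc_left sc_sc mult.assoc[of _ e] mult.assoc[of _ _ "e ^ Suc M"] power_Suc add.assoc)
        (simp only: mult.assoc mult.commute mult.left_commute)
    also have "sc ((w * t) ^ Suc M) (Y * e ^ Suc M) + sc (w ^ M * qi t (Suc M) * (w * inverse t)) (Y * e ^ Suc M)
       = sc (w ^ Suc M * qi t (Suc (Suc M))) (Y * e ^ Suc M)"
      unfolding sc_add_left[symmetric] qi_Suc[OF t, of "Suc M"]
      by (simp add: power_mult_distrib algebra_simps)
    finally show ?case .
  qed
  have q: "qi t (Suc M) \<noteq> 0" using nz by simp
  have "sc (1 / qf t (Suc M)) (e ^ Suc M * x0) = sc ((w * t) ^ Suc M) (sc (1 / qf t (Suc M)) (x0 * e ^ Suc M))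
     + sc (w ^ M) (sc (1 / qf t M) (Y * e ^ M))"
    unfolding * sc_add_right sc_sc qf_Suc using q by (simp add: field_simps)
  thus ?thesis unfolding dp_def by (simp add: mult_sc_left mult_sc_right)
qed

lemma dp_opp: "sc_algebra.dp sco t (Opp f) M = Opp (dp t f M)"
proof -
  interpret d: sc_algebra sco by (rule sc_algebra_opp)
  have "Opp f ^ M = Opp (f ^ M)"
    by (induction M) (simp_all add: one_opp_def times_opp_def power_commutes)
  thus ?thesis unfolding d.dp_def dp_def by (simp add: sco_Opp)
qed

lemma dp_right:
  assumes nz: "\<And>M. M > 0 \<Longrightarrow> qi t M \<noteq> 0" and t: "t - inverse t \<noteq> 0"
    and x0: "x0 * f = sc (w * t) (f * x0) + Y" and Y: "Y * f = sc (w * inverse t) (f * Y)"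
  shows "x0 * dp t f (Suc M) = sc ((w * t) ^ Suc M) (dp t f (Suc M) * x0) + sc (w ^ M) (dp t f M * Y)"
proof -
  interpret d: sc_algebra sco by (rule sc_algebra_opp)
  have "d.dp t (Opp f) (Suc M) * Opp x0 = sco ((w * t) ^ Suc M) (Opp x0 * d.dp t (Opp f) (Suc M)) + sco (w ^ M) (Opp Y * d.dp t (Opp f) M)"
    by (rule d.dp_left[OF nz t]) (use x0 Y in \<open>simp_all add: opp_simps sco_Opp\<close>)
  thus ?thesis unfolding dp_opp by (simp add: opp_simps sco_Opp)
qed

text \<open>The factor of a Gaussian binomial in the torus element \<open>k\<close>, whose inverse is \<open>ki\<close>;
\<open>kb\<close> is the binomial itself. The inverse is a separate argument, as for the generators
\<open>K\<^sub>a\<close> and \<open>L\<^sub>a\<close>.\<close>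

definition br :: "'c \<Rightarrow> 'a \<Rightarrow> 'a \<Rightarrow> int \<Rightarrow> 'a" where
  "br q k ki c = sc (q powi c) k - sc (q powi (- c)) ki"

definition kb :: "'c \<Rightarrow> 'a \<Rightarrow> 'a \<Rightarrow> int \<Rightarrow> nat \<Rightarrow> 'a" where
  "kb q k ki c t = (\<Prod>s\<leftarrow>[1..<t+1]. sc (1 / (q powi int s - q powi (- int s)))
      (sc (q powi (c - int s + 1)) k - sc (q powi (- c + int s - 1)) ki))"

lemma kb_0 [simp]: "kb q k ki c 0 = 1" by (simp add: kb_def)

lemma kb_Suc: "kb q k ki c (Suc t) = sc (1 / qn q (Suc t)) (kb q k ki c t * br q k ki (c - int t))"
proof -
  have e: "c - int (Suc t) + 1 = c - int t" "- c + int (Suc t) - 1 = - (c - int t)" by simp_all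
  have u: "[1..<Suc t + 1] = [1..<t + 1] @ [Suc t]" by simp
  show ?thesis unfolding kb_def br_def qn_powi
    by (simp only: u map_append list.map prod_list.append prod_list.Cons prod_list.Nil mult_1_right mult_sc_right e)
qed

lemma br_comm: "k * ki = ki * k \<Longrightarrow> br q k ki c * br q k ki d = br q k ki d * br q k ki c"
  unfolding br_def by (simp add: sc_simps) (simp add: algebra_simps)

lemma br_kb_comm: "k * ki = ki * k \<Longrightarrow> br q k ki c * kb q k ki d t = kb q k ki d t * br q k ki c"
proof (induction t)
  case (Suc t)
  have "br q k ki c * (kb q k ki d t * br q k ki (d - int t)) = (kb q k ki d t * br q k ki (d - int t)) * br q k ki c"
    by (rule mult_commute3) (use Suc br_comm in auto)
  thus ?case unfolding kb_Suc by (simp add: mult_sc_right mult_sc_left)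
qed simp

lemma kb_Suc': "k * ki = ki * k \<Longrightarrow> kb q k ki c (Suc t) = sc (1 / qn q (Suc t)) (br q k ki c * kb q k ki (c - 1) t)"
proof (induction t)
  case (Suc t)
  have e: "c - 1 - int t = c - int (Suc t)" by simp
  have "kb q k ki c (Suc (Suc t)) = sc (1 / qn q (Suc (Suc t)))
      (sc (1 / qn q (Suc t)) (br q k ki c * kb q k ki (c - 1) t) * br q k ki (c - int (Suc t)))"
    unfolding kb_Suc[of q k ki c "Suc t"] Suc(1)[OF Suc(2)] ..
  also have "\<dots> = sc (1 / qn q (Suc (Suc t))) (br q k ki c * kb q k ki (c - 1) (Suc t))"
    unfolding kb_Suc[of q k ki "c - 1" t] e by (simp add: mult_sc_left mult_sc_right mult.assoc)
  finally show ?case .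
qed (simp add: kb_Suc)

lemma br_lin: "br q k ki (c + 1) = sc (q powi (int t + 1)) (br q k ki (c - int t))
     + sc (q powi (int t - c) * qn q (Suc t)) ki" if "q \<noteq> 0"
proof -
  have 1: "q powi (int t + 1) * q powi (c - int t) = q powi (c + 1)"
    using that by (simp add: power_int_add[symmetric] algebra_simps)
  have 2: "q powi (int t - c) * qn q (Suc t)
     = q powi (int t + 1) * q powi (- (c - int t)) - q powi (- (c + 1))"
    unfolding right_diff_distrib qn_powi[symmetric] using that by (simp add: power_int_add[symmetric] algebra_simps)
  show ?thesis unfolding br_def sc_diff_right sc_sc 1 2 sc_diff_left by simp
qed

text \<open>Pascal's rule.\<close>

lemma kb_shift:
  assumes q: "q \<noteq> 0" "qn q (Suc t) \<noteq> 0" and k: "k * ki = ki * k"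
  shows "kb q k ki (c + 1) (Suc t) = sc (q powi (int t + 1)) (kb q k ki c (Suc t)) + sc (q powi (int t - c)) (ki * kb q k ki c t)"
proof -
  let ?n = "qn q (Suc t)"
  have "kb q k ki (c + 1) (Suc t) = sc (1 / ?n) (br q k ki (c + 1) * kb q k ki c t)"
    using kb_Suc'[OF k, of q "c + 1" t] by simp
  also have "\<dots> = sc (1 / ?n) (sc (q powi (int t + 1)) (br q k ki (c - int t) * kb q k ki c t)
      + sc (q powi (int t - c) * ?n) (ki * kb q k ki c t))"
    unfolding br_lin[OF q(1), of k ki c t] by (simp only: distrib_right mult_sc_left)
  also have "br q k ki (c - int t) * kb q k ki c t = kb q k ki c t * br q k ki (c - int t)"
    by (rule br_kb_comm[OF k])
  also have "sc (1 / ?n) (sc (q powi (int t + 1)) (kb q k ki c t * br q k ki (c - int t))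
      + sc (q powi (int t - c) * ?n) (ki * kb q k ki c t))
     = sc (q powi (int t + 1)) (kb q k ki c (Suc t)) + sc (q powi (int t - c)) (ki * kb q k ki c t)"
  proof -
    have h: "1 / ?n * (q powi (int t - c) * ?n) = q powi (int t - c)" using q(2) by simp
    show ?thesis unfolding sc_add_right sc_sc h kb_Suc by (simp only: mult.commute)
  qed
  finally show ?thesis .
qed

text \<open>By Pascal's rule, a subalgebra over \<open>\<int>[\<upsilon>,\<upsilon>\<^sup>-\<^sup>1]\<close> that contains
the binomials with \<open>c = 0\<close> contains those for all \<open>c\<close>.\<close>

lemma kb_closed:
  assumes q: "q \<noteq> 0" "\<And>s. s > 0 \<Longrightarrow> qn q s \<noteq> 0" and k: "k * ki = ki * k"
    and B: "\<And>x y. x \<in> B \<Longrightarrow> y \<in> B \<Longrightarrow> x + y \<in> B" "\<And>x y. x \<in> B \<Longrightarrow> y \<in> B \<Longrightarrow> x - y \<in> B"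
      "\<And>x y. x \<in> B \<Longrightarrow> y \<in> B \<Longrightarrow> x * y \<in> B" "\<And>x j. x \<in> B \<Longrightarrow> sc (q powi j) x \<in> B"
    and ki: "ki \<in> B" and T: "\<And>s. s \<le> t \<Longrightarrow> kb q k ki 0 s \<in> B"
  shows "kb q k ki c t \<in> B"
  using T
proof (induction t arbitrary: c)
  case (Suc t)
  have IH: "kb q k ki c t \<in> B" for c using Suc by simp
  have 0: "kb q k ki 0 (Suc t) \<in> B" using Suc.prems by simp
  have sh: "kb q k ki (c + 1) (Suc t) = sc (q powi (int t + 1)) (kb q k ki c (Suc t)) + sc (q powi (int t - c)) (ki * kb q k ki c t)" for c
    by (rule kb_shift) (use q k in auto)
  have up: "kb q k ki c (Suc t) \<in> B \<Longrightarrow> kb q k ki (c + 1) (Suc t) \<in> B" for c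
    unfolding sh by (intro B IH ki)
  have down: "kb q k ki (c - 1) (Suc t) \<in> B" if "kb q k ki c (Suc t) \<in> B" for c
  proof -
    have h: "q powi (- (int t + 1)) * q powi (int t + 1) = 1" using q(1) by (simp add: power_int_add[symmetric])
    have sh': "kb q k ki c (Suc t) = sc (q powi (int t + 1)) (kb q k ki (c - 1) (Suc t)) + sc (q powi (int t - (c - 1))) (ki * kb q k ki (c - 1) t)"
      using sh[of "c - 1"] by simp
    have "sc (q powi (- (int t + 1))) (kb q k ki c (Suc t) - sc (q powi (int t - (c - 1))) (ki * kb q k ki (c - 1) t))
      = kb q k ki (c - 1) (Suc t)"
      unfolding sh' add_diff_cancel_right' sc_sc h sc_one ..
    moreover have "\<dots> \<in> B" 
      unfolding calculation[symmetric] by (intro B IH ki that)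
    ultimately show ?thesis by simp
  qed
  show ?case
    by (induction c rule: int_induct[where k = 0]) (use 0 up down in auto)
qed simp

lemma br_wt:
  assumes q: "q \<noteq> 0" and "k * x = sc (q powi g) (x * k)" "ki * x = sc (q powi (- g)) (x * ki)"
  shows "br q k ki c * x = x * br q k ki (c + g)"
  unfolding br_def using assms
  by (simp add: left_diff_distrib right_diff_distrib mult_sc_left mult_sc_right sc_sc power_int_add[symmetric])

lemma kb_wt:
  assumes q: "q \<noteq> 0" and "k * x = sc (q powi g) (x * k)" "ki * x = sc (q powi (- g)) (x * ki)"
  shows "kb q k ki c t * x = x * kb q k ki (c + g) t"
proof (induction t)
  case (Suc t)
  have e: "c + g - int t = c - int t + g" by simp
  show ?case unfolding kb_Suc mult_sc_left mult.assoc br_wt[OF assms] mult_sc_right e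
    by (simp only: mult.assoc[symmetric] Suc)
qed simp

text \<open>Divided powers with negative exponent are zero, so that sums need no bounds depending on both exponents.\<close>

definition dpi :: "'c \<Rightarrow> 'a \<Rightarrow> int \<Rightarrow> 'a" where
  "dpi q x j = (if j < 0 then 0 else dp q x (nat j))"

context
  fixes q :: 'c and e f k ki :: 'a
  assumes q0: "q \<noteq> 0" and qn: "\<And>s. s > 0 \<Longrightarrow> qn q s \<noteq> 0"
    and kki: "k * ki = 1" "ki * k = 1"
    and ke: "k * e = sc (q powi 2) (e * k)" and kie: "ki * e = sc (q powi (- 2)) (e * ki)"
    and kf: "k * f = sc (q powi (- 2)) (f * k)" and kif: "ki * f = sc (q powi 2) (f * ki)"
    and ef: "e * f = f * e + sc (1 / (q - inverse q)) (k - ki)"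
begin

lemma qd: "q - inverse q \<noteq> 0" using qn[of 1] by (simp add: qn_def)

lemma qi_nz: "s > 0 \<Longrightarrow> qi q s \<noteq> 0"
  using qn[of s] qd by (simp add: qi_def)

lemma e_dp: "e * dp q e M = sc (qi q (Suc M)) (dp q e (Suc M))"
  unfolding dp_def mult_sc_right sc_sc qf_Suc using qi_nz[of "Suc M"] by simp

text \<open>The case of one \<open>e\<close> in the rank one algebra. The closed form rests on an identity between three
brackets, checked on the coefficients of \<open>k\<close> and of its inverse.\<close>

lemma e_pow_f: "e * f ^ Suc N = f ^ Suc N * e + sc (qi q (Suc N) / (q - inverse q)) (f ^ N * br q k ki (- int N))"
proof (induction N)
  case 0 thus ?case using ef qd by (simp add: qi_def qn_def br_def)
next
  case (Suc N)
  have bf: "br q k ki (- int N) * f = f * br q k ki (- int N - 2)"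
    using br_wt[OF q0 kf, of ki "- int N"] kif by simp
  have fc: "f ^ j * (f * x) = f ^ Suc j * x" for j x
    by (simp add: mult.assoc[symmetric] power_commutes)
  have k0: "k - ki = br q k ki 0" by (simp add: br_def)
  have "e * f ^ Suc (Suc N) = (e * f ^ Suc N) * f" by (simp add: mult.assoc power_commutes)
  also have "\<dots> = f ^ Suc N * (e * f) + sc (qi q (Suc N) / (q - inverse q)) (f ^ N * (br q k ki (- int N) * f))"
    unfolding Suc by (simp only: distrib_right mult_sc_left mult.assoc)
  also have "\<dots> = f ^ Suc (Suc N) * e + (sc (1 / (q - inverse q)) (f ^ Suc N * br q k ki 0)
      + sc (qi q (Suc N) / (q - inverse q)) (f ^ Suc N * br q k ki (- int N - 2)))"
    unfolding bf ef k0 by (simp only: distrib_left mult_sc_right fc add.assoc)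
  also have "sc (1 / (q - inverse q)) (f ^ Suc N * br q k ki 0)
      + sc (qi q (Suc N) / (q - inverse q)) (f ^ Suc N * br q k ki (- int N - 2))
    = sc (1 / (q - inverse q)) (f ^ Suc N * (br q k ki 0 + sc (qi q (Suc N)) (br q k ki (- int N - 2))))"
    by (simp add: distrib_left mult_sc_right sc_add_right sc_sc)
  also have "br q k ki 0 + sc (qi q (Suc N)) (br q k ki (- int N - 2)) = sc (qi q (Suc (Suc N))) (br q k ki (- int (Suc N)))"
  proof -
    define s where "s = q ^ Suc N"
    define u where "u = inverse q ^ Suc N"
    have su: "s * u = 1" using q0 unfolding s_def u_def power_mult_distrib[symmetric] by simp
    have n: "qn q (Suc N) = s - u" "qn q (Suc (Suc N)) = q * s - inverse q * u"
      by (simp_all add: qn_def s_def u_def)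
    have p: "q powi (- int N - 2) = inverse q * u" "q powi (- (- int N - 2)) = q * s"
       "q powi (- int (Suc N)) = u" "q powi (- (- int (Suc N))) = s"
    proof -
      have 1: "q powi (int (N + 2)) = q * s" by (simp only: power_int_of_nat) (simp add: s_def)
      have 2: "- (- int N - 2) = int (N + 2)" "- int N - 2 = - int (N + 2)" by simp_all
      have 3: "inverse q * u = inverse (q * s)" unfolding s_def u_def by (simp add: power_inverse)
      show "q powi (- (- int N - 2)) = q * s" unfolding 2(2) minus_minus 1 ..
      show "q powi (- int N - 2) = inverse q * u" unfolding 2 3 1[symmetric] by (rule power_int_minus)
      show "q powi (- (- int (Suc N))) = s" by (simp only: minus_minus power_int_of_nat s_def)
      show "q powi (- int (Suc N)) = u" by (simp only: power_int_minus power_int_of_nat u_def power_inverse)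
    qed
    have uu: "(q - inverse q) + (s - u) * (inverse q * u) = (q * s - inverse q * u) * u"
    proof -
      have "(s - u) * (inverse q * u) = inverse q * (s * u) - inverse q * u * u"
        "(q * s - inverse q * u) * u = q * (s * u) - inverse q * u * u" by (simp_all add: algebra_simps)
      thus ?thesis unfolding su by simp
    qed
    have ss: "(q - inverse q) + (s - u) * (q * s) = (q * s - inverse q * u) * s"
    proof -
      have "(s - u) * (q * s) = q * s * s - q * (s * u)"
        "(q * s - inverse q * u) * s = q * s * s - inverse q * (s * u)" by (simp_all add: algebra_simps)
      thus ?thesis unfolding su by simp
    qed
    have c1: "1 + qi q (Suc N) * (inverse q * u) = qi q (Suc (Suc N)) * u"
    proof -
      have "(q - inverse q) * (1 + qi q (Suc N) * (inverse q * u)) = (q - inverse q) * (qi q (Suc (Suc N)) * u)"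
        unfolding qi_def n using uu qd by (simp add: distrib_left)
      thus ?thesis using qd mult_left_cancel by blast
    qed
    have c2: "1 + qi q (Suc N) * (q * s) = qi q (Suc (Suc N)) * s"
    proof -
      have "(q - inverse q) * (1 + qi q (Suc N) * (q * s)) = (q - inverse q) * (qi q (Suc (Suc N)) * s)"
        unfolding qi_def n using ss qd by (simp add: distrib_left)
      thus ?thesis using qd mult_left_cancel by blast
    qed
    have "br q k ki 0 + sc (qi q (Suc N)) (br q k ki (- int N - 2)) =
      sc (1 + qi q (Suc N) * (inverse q * u)) k - sc (1 + qi q (Suc N) * (q * s)) ki"
      unfolding br_def p by (simp add: sc_diff_right sc_sc sc_add_left)
    also have "\<dots> = sc (qi q (Suc (Suc N))) (br q k ki (- int (Suc N)))"
      unfolding c1 c2 br_def p by (simp only: sc_diff_right sc_sc)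
    finally show ?thesis .
  qed
  finally show ?case by (simp only: mult_sc_right sc_sc) simp
qed

lemma e_dpi_f: "e * dpi q f j = dpi q f j * e + sc (1 / (q - inverse q)) (dpi q f (j - 1) * br q k ki (1 - j))"
proof (cases "j \<le> 0")
  case True thus ?thesis by (auto simp: dpi_def)
next
  case False
  then obtain N where N: "j = int (Suc N)"
    using zero_less_imp_eq_int[of j] gr0_implies_Suc by (metis not_le)
  have j1: "j - 1 = int N" "1 - j = - int N" using N by simp_all
  have h: "1 / (qf q N * qi q (Suc N)) * (qi q (Suc N) / (q - inverse q)) = 1 / (q - inverse q) * (1 / qf q N)"
    using qi_nz[of "Suc N"] by simp
  have "e * dp q f (Suc N) = dp q f (Suc N) * e + sc (1 / (q - inverse q)) (dp q f N * br q k ki (- int N))"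
    unfolding dp_def mult_sc_right mult_sc_left e_pow_f sc_add_right sc_sc qf_Suc h ..
  thus ?thesis unfolding j1 unfolding N dpi_def by (simp del: of_nat_Suc)
qed

text \<open>The recursion for the torus parts of the coefficients in the next formula.\<close>

lemma kac_id:
  assumes "t \<le> M"
  shows "sc (qi q (M - t)) (br q k ki (int t - int M - int N)) + sc (qi q (Suc t)) (br q k ki (int (Suc t) - int N))
     = sc (qi q (Suc M)) (br q k ki (2 * int t - int M - int N + 1))"
proof -
  define P where "P j = q powi j" for j :: int
  have PP: "P a * P b = P (a + b)" for a b unfolding P_def using q0 by (simp add: power_int_add)
  have n: "qn q s = P (int s) - P (- int s)" for s unfolding P_def qn_powi ..
  have e: "int (M - t) = int M - int t" using assms by simp
  let ?d = "q - inverse q"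
  have 1: "qi q (M - t) * P (int t - int M - int N) + qi q (Suc t) * P (int (Suc t) - int N) = qi q (Suc M) * P (2 * int t - int M - int N + 1)"
    unfolding qi_def times_divide_eq_left add_divide_distrib[symmetric] n e left_diff_distrib PP by (simp add: algebra_simps)
  have 2: "qi q (M - t) * P (- (int t - int M - int N)) + qi q (Suc t) * P (- (int (Suc t) - int N)) = qi q (Suc M) * P (- (2 * int t - int M - int N + 1))"
    unfolding qi_def times_divide_eq_left add_divide_distrib[symmetric] n e left_diff_distrib PP by (simp add: algebra_simps)
  show ?thesis unfolding br_def P_def[symmetric] sc_diff_right sc_sc 1[symmetric] 2[symmetric] sc_add_left by simp
qed

text \<open>Kac's formula for the product of two divided powers in the quantum algebra of rank one, by induction on
\<open>M\<close>: multiplying by \<open>e\<close> sends the summand \<open>t\<close> to the summands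
\<open>t\<close> and \<open>t + 1\<close>, and \<open>kac_id\<close> collects the two contributions to each.\<close>

lemma kac: "dp q e M * dp q f N = (\<Sum>t\<le>M. dpi q f (int N - int t) * kb q k ki (2 * int t - int M - int N) t * dp q e (M - t))"
proof (induction M)
  case 0 thus ?case by (simp add: dpi_def)
next
  case (Suc M)
  have kk: "k * ki = ki * k" using kki by simp
  let ?d = "1 / (q - inverse q)"
  define A where "A t = dpi q f (int N - int t) * kb q k ki (2 * int t - int M - int N - 2) t * dp q e (Suc M - t)" for t
  define B where "B t = sc ?d (dpi q f (int N - int (Suc t)) * (br q k ki (int (Suc t) - int N) * kb q k ki (2 * int t - int M - int N) t) * dp q e (M - t))" for t
  define C where "C t = dpi q f (int N - int t) * kb q k ki (2 * int t - int (Suc M) - int N) t * dp q e (Suc M - t)" for t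
  have trm: "e * (dpi q f (int N - int t) * kb q k ki (2 * int t - int M - int N) t * dp q e (M - t)) = sc (qi q (Suc M - t)) (A t) + B t"
    if "t \<le> M" for t
  proof -
    have ek: "e * kb q k ki (2 * int t - int M - int N) t = kb q k ki (2 * int t - int M - int N - 2) t * e"
      using kb_wt[OF q0 ke, of ki "2 * int t - int M - int N - 2" t] kie by simp
    have ee: "e * dp q e (M - t) = sc (qi q (Suc M - t)) (dp q e (Suc M - t))"
      using e_dp[of "M - t"] that by (simp add: Suc_diff_le)
    have j: "int N - int t - 1 = int N - int (Suc t)" "1 - (int N - int t) = int (Suc t) - int N" by simp_all
    let ?k = "kb q k ki (2 * int t - int M - int N) t"
    have "e * (dpi q f (int N - int t) * ?k * dp q e (M - t)) = (e * dpi q f (int N - int t)) * ?k * dp q e (M - t)"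
      by (simp only: mult.assoc)
    also have "\<dots> = dpi q f (int N - int t) * (e * ?k) * dp q e (M - t) + B t"
      unfolding e_dpi_f j B_def by (simp only: distrib_right mult_sc_left mult.assoc)
    also have "dpi q f (int N - int t) * (e * ?k) * dp q e (M - t) = sc (qi q (Suc M - t)) (A t)"
      unfolding ek A_def by (simp only: mult.assoc ee mult_sc_right)
    finally show ?thesis .
  qed
  have AC: "sc (qi q (M - t)) (A (Suc t)) + B t = sc (qi q (Suc M)) (C (Suc t))" if "t \<le> M" for t
  proof -
    let ?c = "2 * int t - int M - int N" and ?n = "qn q (Suc t)"
    have n: "?n \<noteq> 0" using qn by simp
    have d: "?d = 1 / ?n * qi q (Suc t)" unfolding qi_def using n by simp
    have c1: "2 * int (Suc t) - int M - int N - 2 = ?c" "2 * int (Suc t) - int (Suc M) - int N = ?c + 1" by simp_all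
    have c2: "?c - int t = int t - int M - int N" by simp
    have K1: "kb q k ki ?c (Suc t) = sc (1 / ?n) (br q k ki (int t - int M - int N) * kb q k ki ?c t)"
      unfolding kb_Suc c2 by (simp only: br_kb_comm[OF kk])
    have K2: "kb q k ki (?c + 1) (Suc t) = sc (1 / ?n) (br q k ki (?c + 1) * kb q k ki ?c t)"
      using kb_Suc'[OF kk, of q "?c + 1" t] by simp
    have "sc (qi q (M - t)) (kb q k ki ?c (Suc t)) + sc ?d (br q k ki (int (Suc t) - int N) * kb q k ki ?c t)
       = sc (1 / ?n) ((sc (qi q (M - t)) (br q k ki (int t - int M - int N)) + sc (qi q (Suc t)) (br q k ki (int (Suc t) - int N))) * kb q k ki ?c t)"
      unfolding K1 d by (simp only: distrib_right mult_sc_left sc_add_right sc_sc mult.commute)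
    also have "\<dots> = sc (qi q (Suc M)) (kb q k ki (?c + 1) (Suc t))"
      unfolding kac_id[OF that] K2 by (simp only: mult_sc_left sc_sc mult.commute)
    finally have *: "sc (qi q (M - t)) (kb q k ki ?c (Suc t)) + sc ?d (br q k ki (int (Suc t) - int N) * kb q k ki ?c t)
      = sc (qi q (Suc M)) (kb q k ki (?c + 1) (Suc t))" .
    have "sc (qi q (M - t)) (A (Suc t)) + B t = dpi q f (int N - int (Suc t)) *
       (sc (qi q (M - t)) (kb q k ki ?c (Suc t)) + sc ?d (br q k ki (int (Suc t) - int N) * kb q k ki ?c t)) * dp q e (M - t)"
      unfolding A_def B_def c1 by (simp only: distrib_right distrib_left mult_sc_left mult_sc_right diff_Suc_Suc)
    thus ?thesis unfolding * C_def c1 by (simp only: mult_sc_left mult_sc_right diff_Suc_Suc)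
  qed
  have "sc (qi q (Suc M)) (dp q e (Suc M) * dp q f N) = e * (dp q e M * dp q f N)"
    by (simp only: mult.assoc[symmetric] e_dp mult_sc_left)
  also have "\<dots> = (\<Sum>t\<le>M. sc (qi q (Suc M - t)) (A t) + B t)"
    unfolding Suc sum_distrib_left by (rule sum.cong) (use trm in auto)
  also have "\<dots> = (\<Sum>t\<le>M. sc (qi q (Suc M - t)) (A t)) + (\<Sum>t\<le>M. B t)" by (rule sum.distrib)
  also have "(\<Sum>t\<le>M. sc (qi q (Suc M - t)) (A t)) = (\<Sum>t\<le>Suc M. sc (qi q (Suc M - t)) (A t))" by simp
  also have "\<dots> = sc (qi q (Suc M)) (A 0) + (\<Sum>t\<le>M. sc (qi q (M - t)) (A (Suc t)))"
    by (simp only: sum.atMost_Suc_shift diff_zero diff_Suc_Suc)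
  also have "\<dots> + (\<Sum>t\<le>M. B t) = sc (qi q (Suc M)) (C 0) + (\<Sum>t\<le>M. sc (qi q (M - t)) (A (Suc t)) + B t)"
    by (simp add: A_def C_def sum.distrib)
  also have "(\<Sum>t\<le>M. sc (qi q (M - t)) (A (Suc t)) + B t) = (\<Sum>t\<le>M. sc (qi q (Suc M)) (C (Suc t)))"
    by (rule sum.cong) (use AC in auto)
  also have "\<dots> = sc (qi q (Suc M)) (\<Sum>t\<le>M. C (Suc t))"
  proof -
    have "sc c (sum g S) = (\<Sum>x\<in>S. sc c (g x))" for c and g :: "nat \<Rightarrow> 'a" and S
      by (induction S rule: infinite_finite_induct) (auto simp: sc_add_right)
    thus ?thesis by simp
  qed
  also have "sc (qi q (Suc M)) (C 0) + sc (qi q (Suc M)) (\<Sum>t\<le>M. C (Suc t)) = sc (qi q (Suc M)) (\<Sum>t\<le>Suc M. C t)"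
    by (simp only: sum.atMost_Suc_shift sc_add_right)
  finally show ?case unfolding C_def using sc_cancel[OF qi_nz[of "Suc M"]] by simp
qed

end
end

section \<open>Divided powers of the generators\<close>

context qgl_rel begin

lemma qn_v: "s > 0 \<Longrightarrow> qn v s \<noteq> 0"
proof
  assume s: "s > 0" "qn v s = 0"
  have "v ^ (s + s) = v ^ s * v ^ s" by (rule power_add)
  also have "\<dots> = v ^ s * inverse v ^ s" using s(2) by (simp add: qn_def)
  also have "\<dots> = 1" using v0 unfolding power_mult_distrib[symmetric] by simp
  finally show False using vroot[of "s + s"] s(1) by simp
qed

lemma qn_va: "s > 0 \<Longrightarrow> qn (va i) s \<noteq> 0"
  using qn_v[of s] by (auto simp: va_def qn_def)

lemma qi_v: "s > 0 \<Longrightarrow> qi v s \<noteq> 0"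
  using qn_v[of s] v_sq(3) by (simp add: qi_def)

lemma inv_v: "inverse v - inverse (inverse v) \<noteq> 0" using v_sq(3) by (metis inverse_inverse_eq right_minus_eq)

lemma dp_va: "dp (va i) = dp v" by (simp add: va_def dp_inverse)

text \<open>All divided powers use the quantum factorials of \<open>\<upsilon>\<close>; these are invariant under
\<open>\<upsilon> \<mapsto> \<upsilon>\<^sup>-\<^sup>1\<close>, so \<open>\<upsilon>\<^sub>i\<close> would
give the same. \<open>kp i\<close> are the Gaussian binomials in
\<open>K\<^sub>i K\<^sub>i\<^sub>+\<^sub>1\<^sup>-\<^sup>1\<close> that occur in the formula of Kac.\<close>

definition eD :: "nat \<Rightarrow> nat \<Rightarrow> 'a" where "eD i M = dp v (E i) M"
definition fD :: "nat \<Rightarrow> nat \<Rightarrow> 'a" where "fD i M = dp v (F i) M"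
definition kB :: "nat \<Rightarrow> int \<Rightarrow> nat \<Rightarrow> 'a" where "kB a c t = kb (va a) (K a) (L a) c t"
definition kp :: "nat \<Rightarrow> int \<Rightarrow> nat \<Rightarrow> 'a" where
  "kp i c t = kb (va i) (K i * L (Suc i)) (L i * K (Suc i)) c t"
definition fDi :: "nat \<Rightarrow> int \<Rightarrow> 'a" where "fDi i j = (if j < 0 then 0 else fD i (nat j))"

lemma eD_0 [simp]: "eD i 0 = 1" and fD_0 [simp]: "fD i 0 = 1" by (simp_all add: eD_def fD_def)
lemma eD_1: "eD i (Suc 0) = E i" and fD_1: "fD i (Suc 0) = F i"
  by (simp_all add: eD_def fD_def dp_1[OF v_sq(3)])

lemma eD_m: "m \<in> {1..<r} \<Longrightarrow> 1 < M \<Longrightarrow> eD m M = 0"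
  and fD_m: "m \<in> {1..<r} \<Longrightarrow> 1 < M \<Longrightarrow> fD m M = 0"
proof -
  have *: "x ^ M = 0" if x: "x * x = 0" "1 < M" for x :: 'a
  proof -
    have M: "M = Suc (Suc (M - 2))" using x(2) by simp
    have "x ^ M = x * x * x ^ (M - 2)" by (subst M) (simp add: mult.assoc)
    thus ?thesis unfolding x(1) by simp
  qed
  show "m \<in> {1..<r} \<Longrightarrow> 1 < M \<Longrightarrow> eD m M = 0" "m \<in> {1..<r} \<Longrightarrow> 1 < M \<Longrightarrow> fD m M = 0"
    by (simp_all add: eD_def fD_def dp_def *[OF Em2] *[OF Fm2])
qed

lemma wtd_pow: "wtd g x \<Longrightarrow> wtd (\<lambda>j. int M * g j) (x ^ M)"
proof (induction M)
  case 0 thus ?case using wtd_1 by simp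
next
  case (Suc M)
  show ?case using wtd_mult[OF Suc.prems Suc.IH[OF Suc.prems]] by (simp add: algebra_simps)
qed

lemma wtd_eD: "i \<in> {1..<r} \<Longrightarrow> wtd (\<lambda>j. int M * rt i (Suc i) j) (eD i M)"
  unfolding eD_def dp_def by (intro wtd_sc wtd_pow) (use wtd_E[of i] in simp)

lemma wtd_fD: "i \<in> {1..<r} \<Longrightarrow> wtd (\<lambda>j. int M * rt (Suc i) i j) (fD i M)"
  unfolding fD_def dp_def by (intro wtd_sc wtd_pow) (use wtd_F[of i] in simp)

lemma kB_wt: "a \<in> {1..r} \<Longrightarrow> wtd g x \<Longrightarrow> kB a c t * x = x * kB a (c + g a) t"
  unfolding kB_def by (rule kb_wt[OF va0 wtdD wtdL])

lemma kp_wt: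
  assumes "i \<in> {1..<r}" "i \<noteq> m" "wtd g x"
  shows "kp i c t * x = x * kp i (c + (g i - g (Suc i))) t"
proof -
  have r: "i \<in> {1..r}" "Suc i \<in> {1..r}" using assms by auto
  have 1: "va i powi g i * va (Suc i) powi - g (Suc i) = va i powi (g i - g (Suc i))"
    unfolding va_Suc[OF assms(2)] by (simp add: power_int_add[symmetric])
  have 2: "va i powi - g i * va (Suc i) powi g (Suc i) = va i powi - (g i - g (Suc i))"
    unfolding va_Suc[OF assms(2)] by (simp add: power_int_add[symmetric])
  show ?thesis unfolding kp_def
    by (rule kb_wt[OF va0]) (use KL_wt[OF assms(3) r] LK_wt[OF assms(3) r] 1 2 in simp_all)
qed

lemma wtd_kp: assumes "i \<in> {1..<r}" "i \<noteq> m" shows "wtd (\<lambda>j. 0) (kp i c t)"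
  unfolding wtd_def
proof
  fix a assume a: "a \<in> {1..r}"
  show "K a * kp i c t = sc (va a powi 0) (kp i c t * K a)"
    using kp_wt[OF assms wtd_K[OF a], of c t] by simp
qed

lemma KLLK: assumes "a \<in> {1..r}" "b \<in> {1..r}"
  shows "(K a * L b) * (L a * K b) = 1" "(L a * K b) * (K a * L b) = 1"
proof -
  have "(K a * L b) * (L a * K b) = K a * (L a * L b) * K b" by (simp only: mult.assoc LLc[OF assms])
  also have "\<dots> = (K a * L a) * (L b * K b)" by (simp only: mult.assoc)
  finally show "(K a * L b) * (L a * K b) = 1" using KL[OF assms(1)] LK[OF assms(2)] by simp
  have "(L a * K b) * (K a * L b) = L a * (K a * K b) * L b" by (simp only: mult.assoc KK[OF assms])
  also have "\<dots> = (L a * K a) * (K b * L b)" by (simp only: mult.assoc)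
  finally show "(L a * K b) * (K a * L b) = 1" using LK[OF assms(1)] KL[OF assms(2)] by simp
qed

lemma eD_fD_same:
  assumes "i \<in> {1..<r}" "i \<noteq> m"
  shows "eD i M * fD i N = (\<Sum>t\<le>M. fDi i (int N - int t) * kp i (2 * int t - int M - int N) t * eD i (M - t))"
proof -
  have r: "i \<in> {1..r}" "Suc i \<in> {1..r}" using assms by auto
  have vs: "va (Suc i) = va i" using va_Suc assms by simp
  have d: "dpi (va i) (F i) = fDi i" by (intro ext) (simp add: dpi_def fDi_def fD_def dp_va)
  have e: "E i * F i = F i * E i + sc (1 / (va i - inverse (va i))) (K i * L (Suc i) - L i * K (Suc i))"
    using EF[OF assms(1)] assms(2) by (simp add: et_def kap_def)
  have p1: "va i powi rt i (i+1) i * va (Suc i) powi (- rt i (i+1) (Suc i)) = va i powi 2"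
    "va i powi (- rt i (i+1) i) * va (Suc i) powi rt i (i+1) (Suc i) = va i powi (- 2)"
    "va i powi rt (i+1) i i * va (Suc i) powi (- rt (i+1) i (Suc i)) = va i powi (- 2)"
    "va i powi (- rt (i+1) i i) * va (Suc i) powi rt (i+1) i (Suc i) = va i powi 2"
    unfolding vs by (simp_all add: rt_def power2_eq_square power_int_minus)
  note w = KL_wt[OF wtd_E[OF assms(1)] r, unfolded p1] LK_wt[OF wtd_E[OF assms(1)] r, unfolded p1]
    KL_wt[OF wtd_F[OF assms(1)] r, unfolded p1] LK_wt[OF wtd_F[OF assms(1)] r, unfolded p1]
  show ?thesis
    unfolding eD_def fD_def kp_def d[symmetric] dp_va[of i, symmetric]
    by (rule kac[OF va0 qn_va KLLK[OF r] w e])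
qed

lemma eD_fD_diff: "\<lbrakk>i \<in> {1..<r}; j \<in> {1..<r}; i \<noteq> j\<rbrakk> \<Longrightarrow> eD i M * fD j N = fD j N * eD i M"
  unfolding eD_def fD_def by (rule dp_comm2) (rule EF')

definition oddpos :: "nat \<Rightarrow> nat \<Rightarrow> bool" where
  "oddpos a b \<longleftrightarrow> 1 \<le> a \<and> a \<le> m \<and> m < b \<and> b \<le> r"

text \<open>A single \<open>E\<^sub>i\<close> gives an error term only if the simple root extends the chain at one of its
ends; \<open>dp_left\<close> passes to divided powers.\<close>

lemma eD_RE:
  assumes i: "i \<in> {1..<r}" "i \<noteq> m" and ab: "oddpos a b"
  shows "\<exists>c Z. eD i (Suc M) * RE a b = sc (v powi c) (RE a b * eD i (Suc M)) + Z * eD i M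
     \<and> (Z = 0 \<or> (1 < a \<and> i = a - 1 \<and> Z = RE (a - 1) b) \<or> (b < r \<and> i = b \<and> Z = - sc (v powi -1) (RE a (Suc b))))"
proof -
  have ab': "1 \<le> a" "a \<le> m" "m < b" "b \<le> r" using ab by (auto simp: oddpos_def)
  have pc: "v ^ j = v powi int j" "inverse v ^ j = v powi (- int j)" for j
    by (simp_all add: power_int_minus power_inverse)
  consider "i = a - 1" "1 < a" | "i = b" "b < r" | "i = a \<or> Suc i = b" | "Suc i < a \<or> b < i \<or> (a < i \<and> Suc i < b)"
    using i ab' by fastforce
  thus ?thesis
  proof cases
    case 1
    hence s: "Suc i = a" "a - 1 = i" by auto
    have Z: "RE (a - 1) b = qc (inverse v) (E i) (RE a b)" using RE_row[of i b] 1 ab' i s by auto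
    have x: "E i * RE a b = sc (1 * inverse v) (RE a b * E i) + RE (a - 1) b" unfolding Z qc_def by simp
    have z: "E i * RE (a - 1) b = sc (1 * inverse (inverse v)) (RE (a - 1) b * E i)"
      using RE_E_first[of i b] s ab' i by (simp add: va_lo)
    have "dp (inverse v) (E i) (Suc M) * RE a b = sc ((1 * inverse v) ^ Suc M) (RE a b * dp (inverse v) (E i) (Suc M)) + sc (1 ^ M) (RE (a - 1) b * dp (inverse v) (E i) M)"
      by (rule dp_left[OF _ inv_v x z]) (simp add: qi_inverse qi_v)
    thus ?thesis unfolding dp_inverse eD_def[symmetric] mult_1_left pc using 1 by (auto intro!: exI[of _ "- int (Suc M)"] exI[of _ "RE (a - 1) b"])
  next
    case 2
    have Z: "RE a (Suc b) = qc v (RE a b) (E i)" using RE_col[of a b] 2 ab' by simp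
    have x: "E i * RE a b = sc (1 * inverse v) (RE a b * E i) + (- sc (v powi -1) (RE a (Suc b)))" 
      unfolding Z qc_def using v0 by (simp add: sc_diff_right sc_sc power_int_minus)
    have z: "E i * (- sc (v powi -1) (RE a (Suc b))) = sc (1 * inverse (inverse v)) (- sc (v powi -1) (RE a (Suc b)) * E i)"
      using RE_E_last[of a b] 2 ab' i by (simp add: va_hi mult_sc_left mult_sc_right sc_minus_right sc_sc mult.commute del: RE.simps)
    have "dp (inverse v) (E i) (Suc M) * RE a b = sc ((1 * inverse v) ^ Suc M) (RE a b * dp (inverse v) (E i) (Suc M)) + sc (1 ^ M) (- sc (v powi -1) (RE a (Suc b)) * dp (inverse v) (E i) M)"
      by (rule dp_left[OF _ inv_v x z]) (simp add: qi_inverse qi_v)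
    hence "dp (inverse v) (E i) (Suc M) * RE a b = sc ((1 * inverse v) ^ Suc M) (RE a b * dp (inverse v) (E i) (Suc M)) + (- sc (v powi -1) (RE a (Suc b)) * dp (inverse v) (E i) M)"
      by simp
    thus ?thesis unfolding dp_inverse eD_def[symmetric] mult_1_left pc using 2 by blast
  next
    case 3
    have x: "E i * RE a b = sc (1 * v) (RE a b * E i) + 0"
    proof (cases "i = a")
      case True thus ?thesis using RE_E_first[of a b] ab' i by (simp add: va_lo)
    next
      case False thus ?thesis using RE_E_last[of a i] 3 ab' i by (auto simp: va_hi simp del: RE.simps)
    qed
    have "dp v (E i) (Suc M) * RE a b = sc ((1 * v) ^ Suc M) (RE a b * dp v (E i) (Suc M)) + sc (1 ^ M) (0 * dp v (E i) M)"
      by (rule dp_left[OF _ v_sq(3) x]) (simp_all add: qi_v)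
    hence "eD i (Suc M) * RE a b = sc (v powi int (Suc M)) (RE a b * eD i (Suc M)) + 0 * eD i M"
      unfolding eD_def[symmetric] mult_1_left pc by (simp del: of_nat_Suc)
    thus ?thesis by blast
  next
    case 4
    have "E i * RE a b = RE a b * E i" using 4 RE_E_far[of a b i] RE_E_mid[of a i b] i ab' by auto
    hence "eD i (Suc M) * RE a b = sc (v powi 0) (RE a b * eD i (Suc M)) + 0 * eD i M"
      unfolding eD_def by (simp add: dp_comm)
    thus ?thesis by blast
  qed
qed

text \<open>A single \<open>F\<^sub>i\<close> gives an error term only if the simple root is an end of the chain, which is
then shortened; \<open>dp_right\<close> passes to divided powers.\<close>

lemma RE_fD:
  assumes i: "i \<in> {1..<r}" "i \<noteq> m" and ab: "oddpos a b"
  shows "\<exists>c G. RE a b * fD i (Suc N) = fD i (Suc N) * RE a b + sc (v powi c) (fD i N * G)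
     \<and> (G = 0 \<or> (a < m \<and> i = a \<and> G = - (RE (Suc a) b * (L a * K (Suc a))))
        \<or> (Suc m < b \<and> Suc i = b \<and> G = sc (v powi 1) (RE a (b - 1) * (K (b - 1) * L b))))"
proof -
  have ab': "1 \<le> a" "a \<le> m" "m < b" "b \<le> r" using ab by (auto simp: oddpos_def)
  have main: ?thesis if x: "RE a b * F i = F i * RE a b + G" and g: "G * F i = sc (v * v) (F i * G)"
    and G: "(G = 0 \<or> (a < m \<and> i = a \<and> G = - (RE (Suc a) b * (L a * K (Suc a))))
        \<or> (Suc m < b \<and> Suc i = b \<and> G = sc (v powi 1) (RE a (b - 1) * (K (b - 1) * L b))))" for G
  proof -
    have "RE a b * dp (inverse v) (F i) (Suc N) = sc ((v * inverse v) ^ Suc N) (dp (inverse v) (F i) (Suc N) * RE a b) + sc (v ^ N) (dp (inverse v) (F i) N * G)"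
      by (rule dp_right[OF _ inv_v]) (use x g v0 in \<open>simp_all add: qi_inverse qi_v\<close>)
    hence "RE a b * fD i (Suc N) = fD i (Suc N) * RE a b + sc (v powi int N) (fD i N * G)"
      using v0 unfolding dp_inverse fD_def by simp
    thus ?thesis using G by blast
  qed
  consider "i = a" "a < m" | "Suc i = b" "Suc m < b" | "i < a \<or> b \<le> i \<or> (a < i \<and> Suc i < b)"
    using i ab' by fastforce
  thus ?thesis
  proof cases
    case 1
    have r: "a \<in> {1..r}" "Suc a \<in> {1..r}" using 1 ab' by auto
    have w: "L a * K (Suc a) * F a = sc (v * v) (F a * (L a * K (Suc a)))"
      using LK_wt[OF wtd_F[OF i(1)[unfolded 1]] r] 1 by (simp add: rt_def va_lo)
    have f: "RE (Suc a) b * F a = F a * RE (Suc a) b" using RE_F_far[of "Suc a" b a] 1 ab' by simp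
    have "(RE (Suc a) b * (L a * K (Suc a))) * F a = sc (v * v) (F a * (RE (Suc a) b * (L a * K (Suc a))))"
      using comm_mult[of "RE (Suc a) b" "F a" 1, OF _ w] f by simp
    thus ?thesis using main[of "- (RE (Suc a) b * (L a * K (Suc a)))"] RE_F_first[of a b] 1 ab' i
      by (simp add: et_def sc_minus_right)
  next
    case 2
    have b: "b - 1 = i" "b = Suc i" "m < i" "a < i" using 2 ab' by auto
    have r: "i \<in> {1..r}" "Suc i \<in> {1..r}" using i by auto
    have w: "K i * L (Suc i) * F i = sc (v * v) (F i * (K i * L (Suc i)))"
      using KL_wt[OF wtd_F[OF i(1)] r] b by (simp add: rt_def va_hi power_int_minus)
    have f: "RE a i * F i = F i * RE a i" using RE_F_far[of a i i] b ab' by simp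
    have "(RE a i * (K i * L (Suc i))) * F i = sc (v * v) (F i * (RE a i * (K i * L (Suc i))))"
      using comm_mult[of "RE a i" "F i" 1, OF _ w] f by simp
    hence g: "sc (v powi 1) (RE a (b - 1) * (K (b - 1) * L b)) * F i = sc (v * v) (F i * sc (v powi 1) (RE a (b - 1) * (K (b - 1) * L b)))"
      unfolding b(1) unfolding b(2) by (simp add: mult_sc_left mult_sc_right sc_sc mult.commute)
    have x: "RE a b * F i = F i * RE a b + sc (v powi 1) (RE a (b - 1) * (K (b - 1) * L b))"
      using RE_F_last[of a i] b ab' i by (simp add: et_def va_hi del: RE.simps)
    show ?thesis by (rule main[OF x g]) (use 2 in simp)
  next
    case 3
    have "RE a b * F i = F i * RE a b" using 3 RE_F_far[of a b i] RE_F_mid[of a i b] i ab' by (auto simp: et_def)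
    thus ?thesis using main[of 0] by simp
  qed
qed

lemma RF_fD:
  assumes i: "i \<in> {1..<r}" "i \<noteq> m" and ab: "oddpos a b"
  shows "\<exists>c Z. RF a b * fD i (Suc M) = sc (v powi c) (fD i (Suc M) * RF a b) + fD i M * Z
     \<and> (Z = 0 \<or> (1 < a \<and> i = a - 1 \<and> Z = RF (a - 1) b) \<or> (b < r \<and> i = b \<and> Z = - sc (v powi 1) (RF a (Suc b))))"
proof -
  interpret d: qgl_rel sco m r "inverse v" "\<lambda>i. Opp (F i)" "\<lambda>i. Opp (E i)" "\<lambda>i. Opp (L i)" "\<lambda>i. Opp (K i)" by (rule dual)
  have e: "d.eD i j = Opp (fD i j)" for j unfolding d.eD_def fD_def by (simp add: dp_opp dp_inverse)
  have p: "inverse v powi c = v powi (- c)" for c by (simp add: power_int_inverse power_int_minus)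
  obtain c Z where Z: "d.eD i (Suc M) * d.RE a b = sco (inverse v powi c) (d.RE a b * d.eD i (Suc M)) + Z * d.eD i M"
    "Z = 0 \<or> (1 < a \<and> i = a - 1 \<and> Z = d.RE (a - 1) b) \<or> (b < r \<and> i = b \<and> Z = - sco (inverse v powi -1) (d.RE a (Suc b)))"
    using d.eD_RE[OF i] ab unfolding d.oddpos_def oddpos_def by blast
  have "RF a b * fD i (Suc M) = sc (v powi (- c)) (fD i (Suc M) * RF a b) + fD i M * unopp Z"
    using Z(1) unfolding e dual_RE p by (simp add: opp_simps sco_def)
  moreover have "unopp Z = 0 \<or> (1 < a \<and> i = a - 1 \<and> unopp Z = RF (a - 1) b) \<or> (b < r \<and> i = b \<and> unopp Z = - sc (v powi 1) (RF a (Suc b)))"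
    using Z(2) unfolding dual_RE p by (auto simp: opp_simps sco_def)
  ultimately show ?thesis by blast
qed

lemma eD_RF:
  assumes i: "i \<in> {1..<r}" "i \<noteq> m" and ab: "oddpos a b"
  shows "\<exists>c G. eD i (Suc N) * RF a b = RF a b * eD i (Suc N) + sc (v powi c) (G * eD i N)
     \<and> (G = 0 \<or> (a < m \<and> i = a \<and> G = - ((L (Suc a) * K a) * RF (Suc a) b))
        \<or> (Suc m < b \<and> Suc i = b \<and> G = sc (v powi -1) ((K b * L (b - 1)) * RF a (b - 1))))"
proof -
  interpret d: qgl_rel sco m r "inverse v" "\<lambda>i. Opp (F i)" "\<lambda>i. Opp (E i)" "\<lambda>i. Opp (L i)" "\<lambda>i. Opp (K i)" by (rule dual)
  have e: "d.fD i j = Opp (eD i j)" for j unfolding d.fD_def eD_def by (simp add: dp_opp dp_inverse)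
  have p: "inverse v powi c = v powi (- c)" for c by (simp add: power_int_inverse power_int_minus)
  obtain c G where G: "d.RE a b * d.fD i (Suc N) = d.fD i (Suc N) * d.RE a b + sco (inverse v powi c) (d.fD i N * G)"
     "G = 0 \<or> (a < m \<and> i = a \<and> G = - (d.RE (Suc a) b * (Opp (K a) * Opp (L (Suc a)))))
        \<or> (Suc m < b \<and> Suc i = b \<and> G = sco (inverse v powi 1) (d.RE a (b - 1) * (Opp (L (b - 1)) * Opp (K b))))"
    using d.RE_fD[OF i] ab unfolding d.oddpos_def oddpos_def by blast
  have "eD i (Suc N) * RF a b = RF a b * eD i (Suc N) + sc (v powi (- c)) (unopp G * eD i N)"
    using G(1) unfolding e dual_RE p by (simp add: opp_simps sco_def)
  moreover have "unopp G = 0 \<or> (a < m \<and> i = a \<and> unopp G = - ((L (Suc a) * K a) * RF (Suc a) b))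
        \<or> (Suc m < b \<and> Suc i = b \<and> unopp G = sc (v powi -1) ((K b * L (b - 1)) * RF a (b - 1)))"
    using G(2) unfolding dual_RE p by (auto simp: opp_simps sco_def)
  ultimately show ?thesis by blast
qed

end

section \<open>Irreducible modules over the integral form\<close>

text \<open>A module over the \<open>\<int>[\<upsilon>,\<upsilon>\<^sup>-\<^sup>1]\<close>-algebra \<open>ZZ\<close> on
which \<open>\<upsilon>\<close> acts as \<open>q\<close>. The action is a function on the generic algebra,
meaningful on \<open>ZZ\<close> only, so that all computations take place over
\<open>\<rat>(\<upsilon>)\<close>. \<open>B s t\<close> is the value at \<open>q\<close> of the Gaussian
binomial of \<open>s\<close> and \<open>t\<close>; the axioms fix it where it separates weights.
\<open>mp\<close> is the grading by parity, and \<open>irr\<close> irreducibility as a graded module.\<close>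

locale qgl_module = qgl_rel sc m r v E F K L + abelian_group V
  for sc :: "'c::field \<Rightarrow> 'a::{ring,monoid_mult} \<Rightarrow> 'a"
    and m r :: nat and v :: 'c and E F K L :: "nat \<Rightarrow> 'a"
    and V :: "('w, 'z) ring_scheme" (structure) +
  fixes ZZ :: "'a set" and act :: "'a \<Rightarrow> 'w \<Rightarrow> 'w" and fs :: "'f::field \<Rightarrow> 'w \<Rightarrow> 'w"
    and q :: 'f and B :: "int \<Rightarrow> nat \<Rightarrow> 'f" and mp :: "bit \<Rightarrow> 'w set"
  assumes ZZ_1: "1 \<in> ZZ" and ZZ_add: "\<And>x y. x \<in> ZZ \<Longrightarrow> y \<in> ZZ \<Longrightarrow> x + y \<in> ZZ"
    and ZZ_diff: "\<And>x y. x \<in> ZZ \<Longrightarrow> y \<in> ZZ \<Longrightarrow> x - y \<in> ZZ"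
    and ZZ_mult: "\<And>x y. x \<in> ZZ \<Longrightarrow> y \<in> ZZ \<Longrightarrow> x * y \<in> ZZ"
    and ZZ_sc: "\<And>x j. x \<in> ZZ \<Longrightarrow> sc (v powi j) x \<in> ZZ"
    and ZZ_eD: "\<And>i M. i \<in> {1..<r} \<Longrightarrow> eD i M \<in> ZZ" and ZZ_fD: "\<And>i M. i \<in> {1..<r} \<Longrightarrow> fD i M \<in> ZZ"
    and ZZ_K: "\<And>a. a \<in> {1..r} \<Longrightarrow> K a \<in> ZZ" and ZZ_L: "\<And>a. a \<in> {1..r} \<Longrightarrow> L a \<in> ZZ"
    and ZZ_kB0: "\<And>a t. a \<in> {1..r} \<Longrightarrow> kB a 0 t \<in> ZZ"
    and act_closed: "\<And>u x. u \<in> ZZ \<Longrightarrow> x \<in> carrier V \<Longrightarrow> act u x \<in> carrier V"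
    and act_vadd: "\<And>u x y. u \<in> ZZ \<Longrightarrow> x \<in> carrier V \<Longrightarrow> y \<in> carrier V \<Longrightarrow> act u (x \<oplus> y) = act u x \<oplus> act u y"
    and act_add: "\<And>u w x. u \<in> ZZ \<Longrightarrow> w \<in> ZZ \<Longrightarrow> x \<in> carrier V \<Longrightarrow> act (u + w) x = act u x \<oplus> act w x"
    and act_mult: "\<And>u w x. u \<in> ZZ \<Longrightarrow> w \<in> ZZ \<Longrightarrow> x \<in> carrier V \<Longrightarrow> act (u * w) x = act u (act w x)"
    and act_1: "\<And>x. x \<in> carrier V \<Longrightarrow> act 1 x = x"
    and act_sc: "\<And>u x j. u \<in> ZZ \<Longrightarrow> x \<in> carrier V \<Longrightarrow> act (sc (v powi j) u) x = fs (q powi j) (act u x)"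
    and fs_closed: "\<And>x c. x \<in> carrier V \<Longrightarrow> fs c x \<in> carrier V"
    and fs_vadd: "\<And>x y c. x \<in> carrier V \<Longrightarrow> y \<in> carrier V \<Longrightarrow> fs c (x \<oplus> y) = fs c x \<oplus> fs c y"
    and fs_add: "\<And>x c d. x \<in> carrier V \<Longrightarrow> fs (c + d) x = fs c x \<oplus> fs d x"
    and fs_fs: "\<And>x c d. x \<in> carrier V \<Longrightarrow> fs c (fs d x) = fs (c * d) x"
    and fs_1: "\<And>x. x \<in> carrier V \<Longrightarrow> fs 1 x = x"
    and act_fs: "\<And>u x c. u \<in> ZZ \<Longrightarrow> x \<in> carrier V \<Longrightarrow> act u (fs c x) = fs c (act u x)"
    and q0: "q \<noteq> 0" and q2: "q \<noteq> inverse q"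
    and B_0: "\<And>t. t > 0 \<Longrightarrow> B 0 t = 0" and B_t: "\<And>t. B (int t) t = 1"
    and mp_sub: "\<And>p. additive_subgroup (mp p) V" and mp_int: "mp 0 \<inter> mp 1 = {\<zero>}"
    and mp_sum: "\<And>x. x \<in> carrier V \<Longrightarrow> \<exists>y\<in>mp 0. \<exists>z\<in>mp 1. x = y \<oplus> z"
    and fs_mp: "\<And>x c p. x \<in> mp p \<Longrightarrow> fs c x \<in> mp p"
    and eD_mp: "\<And>x i M p. i \<in> {1..<r} \<Longrightarrow> i \<noteq> m \<Longrightarrow> x \<in> mp p \<Longrightarrow> act (eD i M) x \<in> mp p"
    and fD_mp: "\<And>x i M p. i \<in> {1..<r} \<Longrightarrow> i \<noteq> m \<Longrightarrow> x \<in> mp p \<Longrightarrow> act (fD i M) x \<in> mp p"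
    and Em_mp: "\<And>x p. m \<in> {1..<r} \<Longrightarrow> x \<in> mp p \<Longrightarrow> act (E m) x \<in> mp (p + 1)"
    and Fm_mp: "\<And>x p. m \<in> {1..<r} \<Longrightarrow> x \<in> mp p \<Longrightarrow> act (F m) x \<in> mp (p + 1)"
    and K_mp: "\<And>x a p. a \<in> {1..r} \<Longrightarrow> x \<in> mp p \<Longrightarrow> act (K a) x \<in> mp p"
    and L_mp: "\<And>x a p. a \<in> {1..r} \<Longrightarrow> x \<in> mp p \<Longrightarrow> act (L a) x \<in> mp p"
    and kB0_mp: "\<And>x a t p. a \<in> {1..r} \<Longrightarrow> x \<in> mp p \<Longrightarrow> act (kB a 0 t) x \<in> mp p"
    and irr: "\<And>W. \<lbrakk>W \<subseteq> carrier V; \<zero> \<in> W; \<And>x y. x \<in> W \<Longrightarrow> y \<in> W \<Longrightarrow> x \<oplus> y \<in> W;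
        \<And>c x. x \<in> W \<Longrightarrow> fs c x \<in> W;
        \<And>x. x \<in> W \<Longrightarrow> \<exists>y\<in>W \<inter> mp 0. \<exists>z\<in>W \<inter> mp 1. x = y \<oplus> z;
        \<And>i M x. i \<in> {1..<r} \<Longrightarrow> x \<in> W \<Longrightarrow> act (eD i M) x \<in> W;
        \<And>i M x. i \<in> {1..<r} \<Longrightarrow> x \<in> W \<Longrightarrow> act (fD i M) x \<in> W;
        \<And>a x. a \<in> {1..r} \<Longrightarrow> x \<in> W \<Longrightarrow> act (K a) x \<in> W;
        \<And>a x. a \<in> {1..r} \<Longrightarrow> x \<in> W \<Longrightarrow> act (L a) x \<in> W;
        \<And>a t x. a \<in> {1..r} \<Longrightarrow> x \<in> W \<Longrightarrow> act (kB a 0 t) x \<in> W\<rbrakk>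
        \<Longrightarrow> W = {\<zero>} \<or> W = carrier V"
begin

lemma ZZ_0: "0 \<in> ZZ" using ZZ_diff[OF ZZ_1 ZZ_1] by simp
lemma ZZ_minus: "x \<in> ZZ \<Longrightarrow> - x \<in> ZZ" using ZZ_diff[OF ZZ_0, of x] by simp
lemma ZZ_sum: "(\<And>i. i \<in> A \<Longrightarrow> g i \<in> ZZ) \<Longrightarrow> sum g A \<in> ZZ"
  by (induction A rule: infinite_finite_induct) (auto intro: ZZ_0 ZZ_add)

lemma cancel_zero: "x \<in> carrier V \<Longrightarrow> x = x \<oplus> x \<Longrightarrow> x = \<zero>"
  using add.r_cancel_one' by blast

lemma fs_zero: "fs c \<zero> = \<zero>"
  by (rule cancel_zero) (simp_all add: fs_closed fs_vadd[symmetric])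
lemma fs_0: "x \<in> carrier V \<Longrightarrow> fs 0 x = \<zero>"
  by (rule cancel_zero) (simp_all add: fs_closed fs_add[symmetric])
lemma act_zero: "u \<in> ZZ \<Longrightarrow> act u \<zero> = \<zero>"
  by (rule cancel_zero) (simp_all add: act_closed act_vadd[symmetric])
lemma act_0: "x \<in> carrier V \<Longrightarrow> act 0 x = \<zero>"
  by (rule cancel_zero) (simp_all add: act_closed ZZ_0 act_add[OF ZZ_0 ZZ_0, symmetric])
lemma fs_m1: "x \<in> carrier V \<Longrightarrow> fs (- 1) x \<oplus> x = \<zero>"
  using fs_add[of x "-1" 1] by (simp add: fs_0 fs_1)
lemma fs_m1': "x \<in> carrier V \<Longrightarrow> x \<oplus> fs (- 1) x = \<zero>"
  using fs_add[of x 1 "-1"] by (simp add: fs_0 fs_1)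
lemma act_minus: "u \<in> ZZ \<Longrightarrow> x \<in> carrier V \<Longrightarrow> act (- u) x = fs (- 1) (act u x)"
  by (rule add.r_cancel[of _ "act u x"])
     (simp_all add: act_closed ZZ_minus fs_closed act_add[symmetric] act_0 fs_m1)
lemma act_diff: "u \<in> ZZ \<Longrightarrow> w \<in> ZZ \<Longrightarrow> x \<in> carrier V \<Longrightarrow> act (u - w) x = act u x \<oplus> fs (- 1) (act w x)"
  using act_add[of u "-w" x] by (simp add: ZZ_minus act_minus)

lemma fs_eq_0: "x \<in> carrier V \<Longrightarrow> fs c x = \<zero> \<Longrightarrow> c \<noteq> 0 \<Longrightarrow> x = \<zero>"
  using fs_fs[of x "inverse c" c] by (simp add: fs_zero fs_1)

lemma fs_inj: "x \<in> carrier V \<Longrightarrow> x \<noteq> \<zero> \<Longrightarrow> fs c x = fs d x \<Longrightarrow> c = d"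
proof -
  assume x: "x \<in> carrier V" "x \<noteq> \<zero>" "fs c x = fs d x"
  have "fs (c - d) x = \<zero>" using fs_add[OF x(1), of c "-d"] fs_add[OF x(1), of d "-d"] x by (simp add: fs_0)
  hence "\<not> c - d \<noteq> 0" using fs_eq_0[OF x(1)] x(2) by blast
  thus "c = d" by simp
qed

definition qa :: "nat \<Rightarrow> 'f" where "qa a = (if a \<le> m then q else inverse q)"

lemma va_v: "va a powi g = v powi (if a \<le> m then g else - g)"
  by (simp add: va_def power_int_inverse power_int_minus)
lemma qa_q: "qa a powi g = q powi (if a \<le> m then g else - g)"
  by (simp add: qa_def power_int_inverse power_int_minus)
lemma qa0: "qa a \<noteq> 0" using q0 by (simp add: qa_def)

lemma ZZ_sc_va: "x \<in> ZZ \<Longrightarrow> sc (va a powi g) x \<in> ZZ" unfolding va_v by (rule ZZ_sc)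
lemma act_sc_va: "u \<in> ZZ \<Longrightarrow> x \<in> carrier V \<Longrightarrow> act (sc (va a powi g) u) x = fs (qa a powi g) (act u x)"
  unfolding va_v qa_q by (rule act_sc)

lemma ZZ_E: "i \<in> {1..<r} \<Longrightarrow> E i \<in> ZZ" using ZZ_eD[of i "Suc 0"] by (simp only: eD_1)
lemma ZZ_F: "i \<in> {1..<r} \<Longrightarrow> F i \<in> ZZ" using ZZ_fD[of i "Suc 0"] by (simp only: fD_1)

lemma ZZ_qc: "x \<in> ZZ \<Longrightarrow> y \<in> ZZ \<Longrightarrow> qc (va a powi g) x y \<in> ZZ"
  unfolding qc_def by (intro ZZ_diff ZZ_sc_va ZZ_mult)

lemma ZZ_RE: "1 \<le> a \<Longrightarrow> a < b \<Longrightarrow> b \<le> r \<Longrightarrow> RE a b \<in> ZZ"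
proof (induction b)
  case (Suc b)
  thus ?case using ZZ_E[of b] ZZ_qc[of "RE a b" "E b" b "-1"] by (auto simp: power_int_minus)
qed simp

lemma ZZ_RF: "1 \<le> a \<Longrightarrow> a < b \<Longrightarrow> b \<le> r \<Longrightarrow> RF a b \<in> ZZ"
proof (induction b)
  case (Suc b)
  thus ?case using ZZ_F[of b] ZZ_qc[of "F b" "RF a b" b 1] by auto
qed simp

lemma ZZ_KL: "a \<in> {1..r} \<Longrightarrow> b \<in> {1..r} \<Longrightarrow> K a * L b \<in> ZZ" "a \<in> {1..r} \<Longrightarrow> b \<in> {1..r} \<Longrightarrow> L a * K b \<in> ZZ"
  by (simp_all add: ZZ_mult ZZ_K ZZ_L)

lemma ZZ_kB: "a \<in> {1..r} \<Longrightarrow> kB a c t \<in> ZZ"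
  unfolding kB_def
  by (rule kb_closed[OF va0 qn_va])
    (auto simp: KL LK kB_def[symmetric] intro: ZZ_add ZZ_diff ZZ_mult ZZ_sc_va ZZ_L ZZ_kB0)

lemma kp_shift_mem: 
  assumes i: "i \<in> {1..<r}" "i \<noteq> m" and t: "\<And>s. s \<le> t \<Longrightarrow> kp i 0 s \<in> ZZ"
  shows "kp i c t \<in> ZZ"
proof -
  have rr: "i \<in> {1..r}" "Suc i \<in> {1..r}" using i by auto
  show ?thesis
  unfolding kp_def
  by (rule kb_closed[OF va0 qn_va])
    (use t rr in \<open>auto simp: KLLK kp_def[symmetric] intro: ZZ_add ZZ_diff ZZ_mult ZZ_sc_va ZZ_KL\<close>)
qed

lemma ZZ_fDi: "i \<in> {1..<r} \<Longrightarrow> fDi i j \<in> ZZ"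
  by (simp add: fDi_def ZZ_fD ZZ_0)

text \<open>Solving Kac's formula with \<open>M = N = t\<close> for the summand of index \<open>t\<close> exhibits the
binomial of \<open>K\<^sub>i K\<^sub>i\<^sub>+\<^sub>1\<^sup>-\<^sup>1\<close> as an element of the integral
form.\<close>

lemma ZZ_kp:
  assumes i: "i \<in> {1..<r}" "i \<noteq> m"
  shows "kp i c t \<in> ZZ"
proof -
  have "kp i 0 t \<in> ZZ" for t
  proof (induction t rule: less_induct)
    case (less t)
    have s: "kp i c s \<in> ZZ" if "s < t" for c s
      by (rule kp_shift_mem[OF i]) (use less that in auto)
    have "{..t} = insert t {..<t}" by auto
    hence "eD i t * fD i t = fDi i (int t - int t) * kp i (2 * int t - int t - int t) t * eD i (t - t) +
      (\<Sum>s<t. fDi i (int t - int s) * kp i (2 * int s - int t - int t) s * eD i (t - s))"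
      using eD_fD_same[OF i, of t t] by simp
    hence "kp i 0 t = eD i t * fD i t - (\<Sum>s<t. fDi i (int t - int s) * kp i (2 * int s - int t - int t) s * eD i (t - s))"
      by (simp add: fDi_def)
    also have "\<dots> \<in> ZZ"
      by (intro ZZ_diff ZZ_sum ZZ_mult ZZ_eD ZZ_fD ZZ_fDi i s) auto
    finally show ?case .
  qed
  thus ?thesis using kp_shift_mem[OF i] by simp
qed

definition wspace :: "(nat \<Rightarrow> int) \<Rightarrow> 'w set" where
  "wspace n = {x \<in> carrier V. \<forall>a\<in>{1..r}. act (K a) x = fs (qa a powi n a) x \<and>
     (\<forall>t c. act (kB a c t) x = fs (B (n a + c) t) x)}"

lemma wspace_carrier: "x \<in> wspace n \<Longrightarrow> x \<in> carrier V" by (simp add: wspace_def)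

lemma wspace_cong: "x \<in> wspace n \<Longrightarrow> (\<And>a. a \<in> {1..r} \<Longrightarrow> n a = n' a) \<Longrightarrow> x \<in> wspace n'"
  by (simp add: wspace_def)

lemma wspace_0: "\<zero> \<in> wspace n"
  by (simp add: wspace_def act_zero fs_zero ZZ_K ZZ_kB)

lemma wspace_add: "x \<in> wspace n \<Longrightarrow> y \<in> wspace n \<Longrightarrow> x \<oplus> y \<in> wspace n"
  by (simp add: wspace_def act_vadd fs_vadd ZZ_K ZZ_kB)

lemma wspace_fs: "x \<in> wspace n \<Longrightarrow> fs c x \<in> wspace n"
  by (simp add: wspace_def act_fs fs_fs ZZ_K ZZ_kB fs_closed mult.commute)

lemma wspace_act:
  assumes u: "u \<in> ZZ" "wtd g u" and x: "x \<in> wspace n"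
  shows "act u x \<in> wspace (\<lambda>i. n i + g i)"
proof -
  have xc: "x \<in> carrier V" using x by (rule wspace_carrier)
  have "act (K a) (act u x) = fs (qa a powi (n a + g a)) (act u x) \<and>
     act (kB a c t) (act u x) = fs (B (n a + g a + c) t) (act u x)" if a: "a \<in> {1..r}" for a c t
  proof
    have "act (K a) (act u x) = act (sc (va a powi g a) (u * K a)) x"
      using wtdD[OF u(2) a] u a xc by (simp add: act_mult[symmetric] ZZ_K)
    also have "\<dots> = fs (qa a powi g a) (act u (fs (qa a powi n a) x))"
      using x a u xc by (simp add: act_sc_va ZZ_mult ZZ_K act_mult wspace_def)
    finally show "act (K a) (act u x) = fs (qa a powi (n a + g a)) (act u x)"
      using u xc qa0[of a] by (simp add: act_fs fs_fs act_closed power_int_add mult.commute)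
    have "act (kB a c t) (act u x) = act (u * kB a (c + g a) t) x"
      using kB_wt[OF a u(2)] u a xc by (simp add: act_mult[symmetric] ZZ_kB)
    also have "\<dots> = fs (B (n a + (c + g a)) t) (act u x)"
      using x a u xc by (simp add: act_mult ZZ_kB wspace_def act_fs)
    finally show "act (kB a c t) (act u x) = fs (B (n a + g a + c) t) (act u x)"
      by (simp add: algebra_simps)
  qed
  thus ?thesis using act_closed[OF u(1) xc] by (simp add: wspace_def)
qed

lemma wspace_K: "x \<in> wspace n \<Longrightarrow> a \<in> {1..r} \<Longrightarrow> act (K a) x = fs (qa a powi n a) x"
  by (simp add: wspace_def)

lemma wspace_L: 
  assumes x: "x \<in> wspace n" and a: "a \<in> {1..r}" shows "act (L a) x = fs (qa a powi (- n a)) x"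
proof -
  have xc: "x \<in> carrier V" using x by (rule wspace_carrier)
  have "x = act (L a) (act (K a) x)" using LK[OF a] a xc by (simp add: act_mult[symmetric] ZZ_K ZZ_L act_1)
  also have "\<dots> = fs (qa a powi n a) (act (L a) x)" using x a xc by (simp add: wspace_K act_fs ZZ_L)
  finally have "fs (qa a powi (- n a)) x = fs (qa a powi (- n a)) (fs (qa a powi n a) (act (L a) x))" by simp
  also have "\<dots> = act (L a) x" using a xc qa0[of a]
    by (simp add: fs_fs act_closed ZZ_L power_int_add[symmetric] fs_1)
  finally show ?thesis by simp
qed

lemma wspace_KL: "x \<in> wspace n \<Longrightarrow> a \<in> {1..r} \<Longrightarrow> b \<in> {1..r} \<Longrightarrow> act (K a * L b) x = fs (qa a powi n a * qa b powi (- n b)) x"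
  using wspace_carrier[of x n] by (simp add: act_mult ZZ_K ZZ_L wspace_K wspace_L act_fs fs_fs mult.commute)
lemma wspace_LK: "x \<in> wspace n \<Longrightarrow> a \<in> {1..r} \<Longrightarrow> b \<in> {1..r} \<Longrightarrow> act (L a * K b) x = fs (qa a powi (- n a) * qa b powi n b) x"
  using wspace_carrier[of x n] by (simp add: act_mult ZZ_K ZZ_L wspace_K wspace_L act_fs fs_fs mult.commute)

text \<open>These operators cut out the component of weight \<open>n\<close> of a sum of weight vectors. Acting by scalars
on all weight spaces, they commute with each other there, and they are closed under composition.\<close>

definition sep :: "(nat \<Rightarrow> int) \<Rightarrow> ('w \<Rightarrow> 'w) \<Rightarrow> bool" where
  "sep n T \<longleftrightarrow> (\<forall>x\<in>carrier V. T x \<in> carrier V) \<and> (\<forall>x\<in>carrier V. \<forall>y\<in>carrier V. T (x \<oplus> y) = T x \<oplus> T y) \<and>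
     (\<forall>n'. \<forall>x\<in>wspace n'. \<exists>c. T x = fs c x) \<and> (\<forall>x\<in>wspace n. T x = x)"

text \<open>At a root of unity the eigenvalues of the \<open>K\<^sub>a\<close> do not separate the weights, but the
binomials do: the binomial of lower entry \<open>t = x - y > 0\<close> takes the value 1 at
\<open>t\<close> and 0 at 0. According to the sign of the difference, this operator or its complement is used.\<close>

lemma separate:
  assumes "a \<in> {1..r}" "n a \<noteq> n' a"
  shows "\<exists>T. sep n T \<and> (\<forall>x\<in>wspace n'. T x = \<zero>)"
proof (cases "n' a < n a")
  case True
  define t where "t = nat (n a - n' a)"
  have t: "int t = n a + (- n' a)" "t > 0" using True by (auto simp: t_def)
  have z: "n' a + - n' a = 0" by simp
  show ?thesis
  proof (rule exI[of _ "act (kB a (- n' a) t)"], intro conjI ballI)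
    show "sep n (act (kB a (- n' a) t))" unfolding sep_def
    proof (intro conjI ballI allI)
      fix x assume "x \<in> wspace n"
      hence "act (kB a (- n' a) t) x = fs (B (n a + (- n' a)) t) x" "x \<in> carrier V" using assms unfolding wspace_def by auto
      thus "act (kB a (- n' a) t) x = x" unfolding t(1)[symmetric] by (simp add: B_t fs_1)
    qed (use assms in \<open>auto simp: act_vadd act_closed ZZ_kB wspace_def\<close>)
    fix x assume "x \<in> wspace n'"
    hence "act (kB a (- n' a) t) x = fs (B (n' a + (- n' a)) t) x" "x \<in> carrier V" using assms unfolding wspace_def by auto
    thus "act (kB a (- n' a) t) x = \<zero>" unfolding z by (simp add: B_0 t fs_0)
  qed
next
  case False
  define t where "t = nat (n' a - n a)"
  have t: "int t = n' a + (- n a)" "t > 0" using False assms by (auto simp: t_def)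
  have z: "n a + - n a = 0" by simp
  let ?T = "\<lambda>x. x \<oplus> fs (- 1) (act (kB a (- n a) t) x)"
  have kx: "act (kB a (- n a) t) x = fs (B (n'' a + (- n a)) t) x" "x \<in> carrier V" if "x \<in> wspace n''" for x n''
    using that assms unfolding wspace_def by auto
  show ?thesis
  proof (rule exI[of _ ?T], intro conjI ballI)
    show "sep n ?T" unfolding sep_def
    proof (intro conjI ballI allI)
      fix x y assume "x \<in> carrier V" "y \<in> carrier V"
      thus "?T (x \<oplus> y) = ?T x \<oplus> ?T y"
        using assms by (simp add: act_vadd ZZ_kB fs_vadd act_closed fs_closed a_ac)
    next
      fix n'' x assume "x \<in> wspace n''"
      note k = kx[OF this]
      have "?T x = fs (1 + (- 1) * B (n'' a + (- n a)) t) x" unfolding k(1) using k(2) by (simp only: fs_add fs_fs fs_1)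
      thus "\<exists>c. ?T x = fs c x" by blast
    next
      fix x assume "x \<in> wspace n"
      note k = kx[OF this]
      show "?T x = x" unfolding k(1) z using k(2) by (simp add: B_0 t fs_0 fs_zero)
    qed (use assms in \<open>auto simp: act_closed ZZ_kB fs_closed\<close>)
    fix x assume "x \<in> wspace n'"
    note k = kx[OF this]
    show "?T x = \<zero>" unfolding k(1) t(1)[symmetric] using k(2) by (simp add: B_t fs_1 fs_m1')
  qed
qed

end

section \<open>Heights, raising and lowering operators\<close>

context qgl_module begin

text \<open>The number of the root in the given ordering of the positive odd roots.\<close>

definition odd_rank :: "nat \<Rightarrow> nat \<Rightarrow> nat" where
  "odd_rank a b = (b - m - 1) * m + (m - a) + 1"

text \<open>The height of a weight depends linearly on it, and is chosen such that the odd root of rank \<open>j\<close>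
has height \<open>2 (j - k) - 1\<close>: positive exactly for \<open>j > k\<close>. The even simple
roots then have positive height because the rank grows in the same directions.\<close>

definition height_coeff :: "nat \<Rightarrow> nat \<Rightarrow> int" where
  "height_coeff k i = (if i \<le> m then 2 * (int m - int i) else 2 * int k - 1 - 2 * int (max 1 m) * (int i - int m - 1))"

definition height :: "nat \<Rightarrow> (nat \<Rightarrow> int) \<Rightarrow> int" where
  "height k n = (\<Sum>i\<in>{1..r}. height_coeff k i * n i)"

lemma height_add: "height k (\<lambda>i. n i + n' i) = height k n + height k n'"
  by (simp add: height_def distrib_left sum.distrib)

lemma height_scale: "height k (\<lambda>i. c * n i) = c * height k n"
  by (simp add: height_def sum_distrib_left mult.left_commute)

lemma height_cong: "(\<And>i. i \<in> {1..r} \<Longrightarrow> n i = n' i) \<Longrightarrow> height k n = height k n'"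
  by (simp add: height_def)

lemma height_rt: "a \<in> {1..r} \<Longrightarrow> b \<in> {1..r} \<Longrightarrow> height k (rt a b) = height_coeff k a - height_coeff k b"
proof -
  assume a: "a \<in> {1..r}" "b \<in> {1..r}"
  have "height k (rt a b) = (\<Sum>i\<in>{1..r}. (if i = a then height_coeff k i else 0) - (if i = b then height_coeff k i else 0))"
    unfolding height_def rt_def by (intro sum.cong) auto
  also have "\<dots> = height_coeff k a - height_coeff k b" using a by (simp add: sum_subtractf)
  finally show ?thesis .
qed

lemma height_odd: "oddpos a b \<Longrightarrow> height k (rt a b) = 2 * (int (odd_rank a b) - int k) - 1"
proof -
  assume ab: "oddpos a b"
  have 1: "height k (rt a b) = height_coeff k a - height_coeff k b" using ab by (intro height_rt) (auto simp: oddpos_def)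
  have b: "int (b - m - 1) = int b - int m - 1" "int (m - a) = int m - int a" "max 1 m = m"
    using ab by (auto simp: oddpos_def)
  have i: "int (odd_rank a b) = (int b - int m - 1) * int m + (int m - int a) + 1"
    unfolding odd_rank_def using b(1,2) by (simp only: of_nat_add of_nat_mult of_nat_1)
  show ?thesis unfolding 1 height_coeff_def i b(3) using ab by (simp add: oddpos_def algebra_simps)
qed

lemma height_odd': "oddpos a b \<Longrightarrow> height k (rt b a) = 1 - 2 * (int (odd_rank a b) - int k)"
proof -
  assume ab: "oddpos a b"
  have "height k (rt b a) = - height k (rt a b)" using ab by (simp add: height_rt oddpos_def)
  thus ?thesis using height_odd[OF ab] by simp
qed

lemma height_even: "i \<in> {1..<r} \<Longrightarrow> i \<noteq> m \<Longrightarrow> height k (rt i (Suc i)) > 0"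
proof -
  assume i: "i \<in> {1..<r}" "i \<noteq> m"
  have "height k (rt i (Suc i)) = height_coeff k i - height_coeff k (Suc i)" using i by (intro height_rt) auto
  also have "\<dots> > 0" using i unfolding height_coeff_def by (auto simp: algebra_simps)
  finally show ?thesis .
qed

lemma height_even': "i \<in> {1..<r} \<Longrightarrow> i \<noteq> m \<Longrightarrow> height k (rt (Suc i) i) < 0"
  using height_even[of i k] by (simp add: height_rt)

lemma odd_rank_less:
  assumes "oddpos a b" "oddpos c d"
  shows "odd_rank a b < odd_rank c d \<longleftrightarrow> b < d \<or> (b = d \<and> c < a)"
proof -
  have *: "odd_rank a b < odd_rank c d" if "oddpos a b" "oddpos c d" "b < d" for a b c d
  proof -
    have "(b - m - 1) + 1 \<le> d - m - 1" using that by (auto simp: oddpos_def)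
    hence "((b - m - 1) + 1) * m \<le> (d - m - 1) * m" by (rule mult_le_mono1)
    moreover have "m - a < m" using that by (auto simp: oddpos_def)
    ultimately show ?thesis unfolding odd_rank_def by (simp add: algebra_simps)
  qed
  have "odd_rank a b < odd_rank c d \<longleftrightarrow> c < a" if "b = d"
    using assms that unfolding odd_rank_def oddpos_def by auto
  thus ?thesis using *[OF assms] *[OF assms(2,1)] by (metis linorder_less_linear not_less_iff_gr_or_eq)
qed

lemma odd_rank_le:
  assumes "oddpos a b" "oddpos c d"
  shows "odd_rank a b \<le> odd_rank c d \<longleftrightarrow> b < d \<or> (b = d \<and> c \<le> a)"
  using odd_rank_less[OF assms(2,1)] by auto

text \<open>The letters of stage \<open>k\<close>, with their weights. Divided powers with exponent 0 are excluded, so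
that every raising letter has positive and every lowering letter negative height.\<close>

inductive raising :: "nat \<Rightarrow> (nat \<Rightarrow> int) \<Rightarrow> 'a \<Rightarrow> bool" for k where
  raising_e: "\<lbrakk>i \<in> {1..<r}; i \<noteq> m\<rbrakk> \<Longrightarrow> raising k (\<lambda>j. int (Suc M) * rt i (Suc i) j) (eD i (Suc M))"
| raising_X: "\<lbrakk>oddpos a b; k < odd_rank a b\<rbrakk> \<Longrightarrow> raising k (rt a b) (RE a b)"
| raising_Y: "\<lbrakk>oddpos a b; odd_rank a b \<le> k\<rbrakk> \<Longrightarrow> raising k (rt b a) (RF a b)"

inductive lowering :: "nat \<Rightarrow> (nat \<Rightarrow> int) \<Rightarrow> 'a \<Rightarrow> bool" for k where
  lowering_f: "\<lbrakk>i \<in> {1..<r}; i \<noteq> m\<rbrakk> \<Longrightarrow> lowering k (\<lambda>j. int (Suc M) * rt (Suc i) i j) (fD i (Suc M))"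
| lowering_X: "\<lbrakk>oddpos a b; odd_rank a b \<le> k\<rbrakk> \<Longrightarrow> lowering k (rt a b) (RE a b)"
| lowering_Y: "\<lbrakk>oddpos a b; k < odd_rank a b\<rbrakk> \<Longrightarrow> lowering k (rt b a) (RF a b)"

lemma oddpos_RE: "oddpos a b \<Longrightarrow> RE a b \<in> ZZ \<and> wtd (rt a b) (RE a b)"
  by (simp add: oddpos_def ZZ_RE wtd_RE)
lemma oddpos_RF: "oddpos a b \<Longrightarrow> RF a b \<in> ZZ \<and> wtd (rt b a) (RF a b)"
  by (simp add: oddpos_def ZZ_RF wtd_RF)

lemma raising_ZZ: "raising k g u \<Longrightarrow> u \<in> ZZ" "raising k g u \<Longrightarrow> wtd g u"
  by (induction rule: raising.induct) (use oddpos_RE oddpos_RF ZZ_eD wtd_eD in \<open>auto simp del: of_nat_Suc\<close>)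
lemma lowering_ZZ: "lowering k g u \<Longrightarrow> u \<in> ZZ" "lowering k g u \<Longrightarrow> wtd g u"
  by (induction rule: lowering.induct) (use oddpos_RE oddpos_RF ZZ_fD wtd_fD in \<open>auto simp del: of_nat_Suc\<close>)

lemma lowering_height: "lowering k g u \<Longrightarrow> height k g < 0"
  by (induction rule: lowering.induct) (simp_all add: height_scale height_even' height_odd height_odd' mult_pos_neg del: of_nat_Suc)

definition killed :: "nat \<Rightarrow> 'w \<Rightarrow> bool" where
  "killed k x \<longleftrightarrow> (\<forall>g u. raising k g u \<longrightarrow> act u x = \<zero>)"

definition singular :: "nat \<Rightarrow> (nat \<Rightarrow> int) \<Rightarrow> 'w set" where
  "singular k n = {x \<in> wspace n. killed k x}"

text \<open>Only lowering letters are applied to the singular vectors. The last rule makes the predicate depend only on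
the values of the weight at \<open>1, \<dots>, r\<close>.\<close>

inductive sing_span :: "nat \<Rightarrow> (nat \<Rightarrow> int) \<Rightarrow> (nat \<Rightarrow> int) \<Rightarrow> 'w \<Rightarrow> bool" for k n0 where
  sing_span_base: "x \<in> singular k n0 \<Longrightarrow> sing_span k n0 n0 x"
| sing_span_0: "sing_span k n0 n \<zero>"
| sing_span_add: "sing_span k n0 n x \<Longrightarrow> sing_span k n0 n y \<Longrightarrow> sing_span k n0 n (x \<oplus> y)"
| sing_span_neg: "sing_span k n0 n x \<Longrightarrow> lowering k g u \<Longrightarrow> sing_span k n0 (\<lambda>i. n i + g i) (act u x)"
| sing_span_eq: "sing_span k n0 n x \<Longrightarrow> (\<And>i. i \<in> {1..r} \<Longrightarrow> n i = n' i) \<Longrightarrow> sing_span k n0 n' x"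

lemma sing_span_wspace: "sing_span k n0 n x \<Longrightarrow> x \<in> wspace n"
proof (induction rule: sing_span.induct)
  case (sing_span_eq n x n') thus ?case using wspace_cong by blast
qed (auto simp: singular_def wspace_0 wspace_add intro: wspace_act lowering_ZZ)

lemma sing_span_carrier: "sing_span k n0 n x \<Longrightarrow> x \<in> carrier V"
  using sing_span_wspace wspace_carrier by blast

lemma singular_fs: "x \<in> singular k n \<Longrightarrow> fs c x \<in> singular k n"
  by (auto simp: singular_def killed_def wspace_fs act_fs raising_ZZ wspace_carrier fs_zero)

lemma sing_span_fs: "sing_span k n0 n x \<Longrightarrow> sing_span k n0 n (fs c x)"
proof (induction rule: sing_span.induct)
  case (sing_span_base x) thus ?case by (intro sing_span.sing_span_base singular_fs)
next
  case (sing_span_neg n x g u) thus ?case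
    using sing_span.sing_span_neg[OF sing_span_neg.IH sing_span_neg.hyps(2)] sing_span_carrier lowering_ZZ(1) by (simp add: act_fs)
next
  case (sing_span_eq n x n') thus ?case using sing_span.sing_span_eq by blast
qed (auto simp: fs_zero fs_vadd sing_span_carrier intro: sing_span.intros)

lemma singular_kp: 
  assumes x: "x \<in> singular k n" and i: "i \<in> {1..<r}" "i \<noteq> m" shows "act (kp i c t) x \<in> singular k n"
proof -
  have xc: "x \<in> carrier V" using x wspace_carrier by (auto simp: singular_def)
  have "act u (act (kp i c t) x) = \<zero>" if p: "raising k g u" for g u
  proof -
    have "u * kp i c t = kp i (c - (g i - g (Suc i))) t * u"
      using kp_wt[OF i raising_ZZ(2)[OF p], of "c - (g i - g (Suc i))" t] by simp
    hence "act u (act (kp i c t) x) = act (kp i (c - (g i - g (Suc i))) t) (act u x)"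
      using xc raising_ZZ(1)[OF p] i by (simp add: act_mult[symmetric] ZZ_kp)
    also have "act u x = \<zero>" using x p by (auto simp: singular_def killed_def)
    finally show ?thesis using act_zero[OF ZZ_kp[OF i]] by simp
  qed
  moreover have "act (kp i c t) x \<in> wspace n"
    using wspace_act[OF ZZ_kp[OF i] wtd_kp[OF i], of x n c t] x by (simp add: singular_def)
  ultimately show ?thesis by (auto simp: singular_def killed_def)
qed

lemma sing_span_kp:
  assumes i: "i \<in> {1..<r}" "i \<noteq> m"
  shows "sing_span k n0 n x \<Longrightarrow> sing_span k n0 n (act (kp i c t) x)"
proof (induction arbitrary: c rule: sing_span.induct)
  case (sing_span_base x) thus ?case by (intro sing_span.sing_span_base singular_kp i)
next
  case (sing_span_neg n x g u)
  have "act (kp i c t) (act u x) = act u (act (kp i (c + (g i - g (Suc i))) t) x)"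
    using kp_wt[OF i lowering_ZZ(2)[OF sing_span_neg.hyps(2)], of c t] sing_span_carrier[OF sing_span_neg.hyps(1)] lowering_ZZ(1)[OF sing_span_neg.hyps(2)] i
    by (simp add: act_mult[symmetric] ZZ_kp)
  thus ?case using sing_span.sing_span_neg[OF sing_span_neg.IH sing_span_neg.hyps(2)] by simp
next
  case (sing_span_eq n x n') thus ?case using sing_span.sing_span_eq by blast
qed (auto simp: act_zero[OF ZZ_kp[OF i]] act_vadd[OF ZZ_kp[OF i]] sing_span_carrier intro: sing_span.sing_span_0 sing_span.sing_span_add)

text \<open>Lowering letters decrease the height strictly, so at the top height the span contains only the singular
vectors.\<close>

lemma sing_span_top: "sing_span k n0 n x \<Longrightarrow> height k n \<ge> height k n0 \<Longrightarrow> x = \<zero> \<or> (x \<in> singular k n0 \<and> (\<forall>i\<in>{1..r}. n i = n0 i))"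
proof (induction rule: sing_span.induct)
  case (sing_span_add n x y)
  thus ?case by (auto simp: sing_span_carrier singular_def wspace_add killed_def act_vadd act_zero raising_ZZ wspace_carrier)
next
  case (sing_span_neg n x g u)
  have h: "height k n > height k n0" using sing_span_neg.prems lowering_height[OF sing_span_neg.hyps(2)] by (simp add: height_add)
  hence "x = \<zero>" using sing_span_neg.IH height_cong[of n n0 k] by auto
  thus ?case using lowering_ZZ(1)[OF sing_span_neg.hyps(2)] by (simp add: act_zero)
next
  case (sing_span_eq n x n')
  thus ?case using height_cong[of n n' k] by auto
qed auto

text \<open>The depth of a weight is its distance in height from the top weight \<open>n0\<close>; \<open>H\<close> bounds
the depth at which \<open>u\<close> is applied. The induction on depth establishes this property for raising
letters and larger and larger \<open>H\<close>.\<close>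

definition preserves :: "nat \<Rightarrow> (nat \<Rightarrow> int) \<Rightarrow> int \<Rightarrow> (nat \<Rightarrow> int) \<Rightarrow> 'a \<Rightarrow> bool" where
  "preserves k n0 H g u \<longleftrightarrow> u \<in> ZZ \<and> (\<forall>n x. sing_span k n0 n x \<longrightarrow> height k n0 - height k n < H \<longrightarrow> sing_span k n0 (\<lambda>i. n i + g i) (act u x))"

lemma preserves_ZZ: "preserves k n0 H g u \<Longrightarrow> u \<in> ZZ" by (simp add: preserves_def)

lemma preserves_lowering: "lowering k g u \<Longrightarrow> preserves k n0 H g u"
  by (auto simp: preserves_def lowering_ZZ intro: sing_span_neg)

text \<open>The right factor acts first; if it does not decrease the height, the left factor still acts at depth less than
\<open>H\<close>.\<close>

lemma preserves_mult: 
  assumes u: "preserves k n0 H g u" and w: "preserves k n0 H h w" and p: "height k h \<ge> 0"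
  shows "preserves k n0 H (\<lambda>i. g i + h i) (u * w)"
  unfolding preserves_def
proof (intro conjI allI impI)
  show "u * w \<in> ZZ" using u w by (simp add: preserves_def ZZ_mult)
  fix n x assume x: "sing_span k n0 n x" "height k n0 - height k n < H"
  have "sing_span k n0 (\<lambda>i. n i + h i) (act w x)" using w x by (simp add: preserves_def)
  moreover have "height k n0 - height k (\<lambda>i. n i + h i) < H" using x p by (simp add: height_add)
  ultimately have "sing_span k n0 (\<lambda>i. n i + h i + g i) (act u (act w x))" using u by (auto simp: preserves_def)
  hence "sing_span k n0 (\<lambda>i. n i + (g i + h i)) (act u (act w x))" by (rule sing_span_eq) simp
  thus "sing_span k n0 (\<lambda>i. n i + (g i + h i)) (act (u * w) x)"
    using u w x sing_span_carrier by (simp add: preserves_def act_mult)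
qed

text \<open>A lowering letter on the left may be applied at any depth.\<close>

lemma preserves_lowering_mult: 
  assumes u: "lowering k g u" and w: "preserves k n0 H h w"
  shows "preserves k n0 H (\<lambda>i. g i + h i) (u * w)"
  unfolding preserves_def
proof (intro conjI allI impI)
  show "u * w \<in> ZZ" using u w by (simp add: preserves_def ZZ_mult lowering_ZZ)
  fix n x assume x: "sing_span k n0 n x" "height k n0 - height k n < H"
  have "sing_span k n0 (\<lambda>i. n i + h i) (act w x)" using w x by (simp add: preserves_def)
  hence "sing_span k n0 (\<lambda>i. n i + h i + g i) (act u (act w x))" using u by (rule sing_span_neg)
  hence "sing_span k n0 (\<lambda>i. n i + (g i + h i)) (act u (act w x))" by (rule sing_span_eq) simp
  thus "sing_span k n0 (\<lambda>i. n i + (g i + h i)) (act (u * w) x)"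
    using u w x sing_span_carrier by (simp add: preserves_def act_mult lowering_ZZ)
qed

lemma preserves_0: "preserves k n0 H g 0"
  by (auto simp: preserves_def ZZ_0 act_0 sing_span_carrier intro: sing_span_0)
lemma preserves_add: "preserves k n0 H g u \<Longrightarrow> preserves k n0 H g w \<Longrightarrow> preserves k n0 H g (u + w)"
  by (auto simp: preserves_def ZZ_add act_add sing_span_carrier intro: sing_span_add)
lemma preserves_minus: "preserves k n0 H g u \<Longrightarrow> preserves k n0 H g (- u)"
  by (auto simp: preserves_def ZZ_minus act_minus sing_span_carrier intro: sing_span_fs)
lemma preserves_diff: "preserves k n0 H g u \<Longrightarrow> preserves k n0 H g w \<Longrightarrow> preserves k n0 H g (u - w)"
  using preserves_add[OF _ preserves_minus, of k n0 H g u w] by simp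
lemma preserves_sc: "preserves k n0 H g u \<Longrightarrow> preserves k n0 H g (sc (v powi j) u)"
  by (auto simp: preserves_def ZZ_sc act_sc sing_span_carrier intro: sing_span_fs)
lemma preserves_sc1: "preserves k n0 H g u \<Longrightarrow> preserves k n0 H g (sc v u)"
  using preserves_sc[of k n0 H g u 1] by simp
lemma preserves_sci: "preserves k n0 H g u \<Longrightarrow> preserves k n0 H g (sc (inverse v) u)"
  using preserves_sc[of k n0 H g u "-1"] by (simp add: power_int_minus)
lemma preserves_sum: "(\<And>i. i \<in> A \<Longrightarrow> preserves k n0 H g (w i)) \<Longrightarrow> preserves k n0 H g (sum w A)"
  by (induction A rule: infinite_finite_induct) (auto intro: preserves_0 preserves_add)
lemma preserves_eq: "preserves k n0 H g u \<Longrightarrow> (\<And>i. i \<in> {1..r} \<Longrightarrow> g i = h i) \<Longrightarrow> preserves k n0 H h u"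
proof -
  assume g: "preserves k n0 H g u" "\<And>i. i \<in> {1..r} \<Longrightarrow> g i = h i"
  have "sing_span k n0 (\<lambda>i. n i + h i) (act u x)" if "sing_span k n0 n x" "height k n0 - height k n < H" for n x
    by (rule sing_span_eq[of k n0 "\<lambda>i. n i + g i"]) (use g that in \<open>auto simp: preserves_def\<close>)
  thus ?thesis using g(1) by (simp add: preserves_def)
qed
lemma preserves_1: "preserves k n0 H (\<lambda>i. 0) 1"
  by (auto simp: preserves_def ZZ_1 act_1 sing_span_carrier)
lemma preserves_KL: "a \<in> {1..r} \<Longrightarrow> b \<in> {1..r} \<Longrightarrow> preserves k n0 H (\<lambda>i. 0) (K a * L b)"
  unfolding preserves_def using sing_span_fs by (auto simp: ZZ_KL wspace_KL[OF sing_span_wspace])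
lemma preserves_LK: "a \<in> {1..r} \<Longrightarrow> b \<in> {1..r} \<Longrightarrow> preserves k n0 H (\<lambda>i. 0) (L a * K b)"
  unfolding preserves_def using sing_span_fs by (auto simp: ZZ_KL wspace_LK[OF sing_span_wspace])
lemma preserves_kp: "i \<in> {1..<r} \<Longrightarrow> i \<noteq> m \<Longrightarrow> preserves k n0 H (\<lambda>i. 0) (kp i c t)"
  unfolding preserves_def using sing_span_kp by (auto simp: ZZ_kp)

lemma preserves_fD: "i \<in> {1..<r} \<Longrightarrow> i \<noteq> m \<Longrightarrow> preserves k n0 H (\<lambda>j. int M * rt (Suc i) i j) (fD i M)"
  by (cases M) (use preserves_1 preserves_lowering[OF lowering_f] in \<open>auto simp del: of_nat_Suc\<close>)

lemma qa_KL: assumes "oddpos a b" 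
  shows "qa a powi x * qa b powi (- y) = q powi (x + y)" "qa a powi (- x) * qa b powi y = q powi (- (x + y))"
  using assms q0 unfolding qa_q oddpos_def by (simp_all add: power_int_add[symmetric])

text \<open>The quantum integer of the torus element of an odd root acts on a weight space by the quantum integer of the
pairing of the weight with the root. Division by \<open>\<upsilon> - \<upsilon>\<^sup>-\<^sup>1\<close> is
not possible in the integral form; the element belongs to it because it is an anticommutator, and its
eigenvalue is found after multiplication by \<open>\<upsilon> - \<upsilon>\<^sup>-\<^sup>1\<close>.\<close>

lemma act_kap:
  assumes ab: "oddpos a b" and x: "x \<in> wspace n"
  shows "sc dl (kap a b) \<in> ZZ"
    "act (sc dl (kap a b)) x = fs ((q powi (n a + n b) - q powi (- (n a + n b))) / (q - inverse q)) x"
proof -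
  let ?D = "sc dl (kap a b)" and ?z = "n a + n b"
  have ab': "1 \<le> a" "a \<le> m" "m < b" "b \<le> r" "a \<in> {1..r}" "b \<in> {1..r}" using ab by (auto simp: oddpos_def)
  have xc: "x \<in> carrier V" using x by (rule wspace_carrier)
  have "?D = RE a b * RF a b + RF a b * RE a b" using RE_RF_eq[OF ab'(1-4)] by simp
  thus D: "?D \<in> ZZ" using ab' by (simp add: ZZ_add ZZ_mult ZZ_RE ZZ_RF)
  have e: "sc (v powi 1) ?D - sc (v powi (-1)) ?D = K a * L b - L a * K b"
  proof -
    have "sc (v powi 1) ?D - sc (v powi (-1)) ?D = sc ((v - inverse v) * dl) (kap a b)"
      by (simp add: sc_diff_left[symmetric] sc_sc power_int_minus left_diff_distrib)
    also have "(v - inverse v) * dl = 1" unfolding dl_def using v_sq(3) by simp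
    finally show ?thesis by (simp add: kap_def)
  qed
  have "fs (q powi 1 + (- 1) * q powi (-1)) (act ?D x) = act (sc (v powi 1) ?D - sc (v powi (-1)) ?D) x"
    using D xc act_closed[OF D xc] by (simp only: act_diff ZZ_sc act_sc fs_add fs_fs)
  also have "\<dots> = fs (qa a powi n a * qa b powi (- n b)) x \<oplus> fs (-1) (fs (qa a powi (- n a) * qa b powi n b) x)"
    unfolding e using xc ab' x by (simp only: act_diff ZZ_KL wspace_KL[OF x] wspace_LK[OF x])
  also have "\<dots> = fs (q powi ?z + (-1) * q powi (- ?z)) x"
    unfolding qa_KL[OF ab] using xc by (simp only: fs_add fs_fs)
  finally have "fs (q - inverse q) (act ?D x) = fs (q powi ?z - q powi (- ?z)) x" by (simp add: power_int_minus)
  hence "fs (inverse (q - inverse q)) (fs (q - inverse q) (act ?D x)) = fs (inverse (q - inverse q)) (fs (q powi ?z - q powi (- ?z)) x)" by simp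
  moreover have "q - inverse q \<noteq> 0" using q2 by simp
  ultimately show "act ?D x = fs ((q powi ?z - q powi (- ?z)) / (q - inverse q)) x"
    using act_closed[OF D xc] xc by (simp add: fs_fs fs_1 divide_inverse mult.commute)
qed

lemma preserves_kap: "oddpos a b \<Longrightarrow> preserves k n0 H (\<lambda>i. 0) (sc dl (kap a b))"
  unfolding preserves_def using sing_span_fs act_kap[OF _ wspace_0] by (auto simp: act_kap[OF _ sing_span_wspace])

end

section \<open>Straightening a raising letter past a lowering letter\<close>

context qgl_module begin

lemma preserves_all_mult: 
  assumes u: "\<And>H. preserves k n0 H g u" and w: "preserves k n0 H h w"
  shows "preserves k n0 H (\<lambda>i. g i + h i) (u * w)"
  unfolding preserves_def
proof (intro conjI allI impI)
  show "u * w \<in> ZZ" using u w by (auto simp: preserves_def ZZ_mult)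
  fix n x assume x: "sing_span k n0 n x" "height k n0 - height k n < H"
  have 1: "sing_span k n0 (\<lambda>i. n i + h i) (act w x)" using w x by (simp add: preserves_def)
  have "sing_span k n0 (\<lambda>i. n i + h i + g i) (act u (act w x))"
    using u[of "height k n0 - height k (\<lambda>i. n i + h i) + 1"] 1 by (simp add: preserves_def)
  hence "sing_span k n0 (\<lambda>i. n i + (g i + h i)) (act u (act w x))" by (rule sing_span_eq) simp
  thus "sing_span k n0 (\<lambda>i. n i + (g i + h i)) (act (u * w) x)"
    using u w x sing_span_carrier by (auto simp: preserves_def act_mult)
qed

lemma preserves_qc: "preserves k n0 H g (x * y) \<Longrightarrow> preserves k n0 H g (y * x) \<Longrightarrow> preserves k n0 H g (qc (va a powi j) x y)"
  unfolding qc_def va_v by (intro preserves_diff preserves_sc)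

lemma height_rt_even: "1 \<le> a \<Longrightarrow> a < b \<Longrightarrow> b \<le> r \<Longrightarrow> b \<le> m \<or> m < a \<Longrightarrow> height k (rt a b) \<ge> 0"
proof -
  assume a: "1 \<le> a" "a < b" "b \<le> r" "b \<le> m \<or> m < a"
  have "height_coeff k b \<le> height_coeff k a"
  proof (cases "b \<le> m")
    case False
    have "int (max 1 m) * (int a - int m - 1) \<le> int (max 1 m) * (int b - int m - 1)"
      by (rule mult_left_mono) (use a in auto)
    thus ?thesis using a False unfolding height_coeff_def by simp
  qed (use a in \<open>simp add: height_coeff_def\<close>)
  thus ?thesis using height_rt[of a b k] a by simp
qed

text \<open>Even negative root vectors occur in the error terms; they are polynomials in lowering letters.\<close>

lemma preserves_RF_even: "1 \<le> a \<Longrightarrow> a < b \<Longrightarrow> b \<le> r \<Longrightarrow> b \<le> m \<or> m < a \<Longrightarrow> preserves k n0 H (rt b a) (RF a b)"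
proof (induction b arbitrary: H)
  case (Suc b)
  have F: "preserves k n0 H (rt (Suc b) b) (F b)" if "b \<noteq> m" for H
    using preserves_fD[of b k n0 H 1] Suc.prems that by (simp add: fD_1)
  show ?case
  proof (cases "a = b")
    case True thus ?thesis using F Suc.prems by auto
  next
    case False
    hence b: "b \<noteq> m" and R: "preserves k n0 H (rt b a) (RF a b)" for H using Suc by auto
    have 1: "preserves k n0 H (rt (Suc b) a) (F b * RF a b)"
      by (rule preserves_eq[OF preserves_all_mult[OF F R]]) (use b in \<open>auto simp: rt_def\<close>)
    have 2: "preserves k n0 H (rt (Suc b) a) (RF a b * F b)"
      by (rule preserves_eq[OF preserves_all_mult[OF R F]]) (use b in \<open>auto simp: rt_def\<close>)
    show ?thesis using preserves_qc[OF 1 2, of b 1] False by simp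
  qed
qed simp

context
  fixes k :: nat and n0 :: "nat \<Rightarrow> int" and H :: int
  assumes IH: "\<And>g u. raising k g u \<Longrightarrow> preserves k n0 H g u"
begin

lemma gX: "oddpos a b \<Longrightarrow> preserves k n0 H (rt a b) (RE a b)"
  using IH[OF raising_X] preserves_lowering[OF lowering_X] by (cases "odd_rank a b \<le> k") auto

lemma gY: "oddpos a b \<Longrightarrow> preserves k n0 H (rt b a) (RF a b)"
  using IH[OF raising_Y] preserves_lowering[OF lowering_Y] by (cases "odd_rank a b \<le> k") auto

lemma gE: "i \<in> {1..<r} \<Longrightarrow> i \<noteq> m \<Longrightarrow> preserves k n0 H (\<lambda>j. int M * rt i (Suc i) j) (eD i M)"
  by (cases M) (use preserves_1 IH[OF raising_e] in \<open>auto simp del: of_nat_Suc\<close>)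

lemma heightE: "i \<in> {1..<r} \<Longrightarrow> i \<noteq> m \<Longrightarrow> 0 \<le> height k (\<lambda>j. int M * rt i (Suc i) j)"
  by (simp add: height_scale height_even less_imp_le)

lemma gR: "1 \<le> a \<Longrightarrow> a < b \<Longrightarrow> b \<le> r \<Longrightarrow> b \<le> m \<or> m < a \<Longrightarrow> preserves k n0 H (rt a b) (RE a b)"
proof (induction b)
  case (Suc b)
  have E: "preserves k n0 H (rt b (Suc b)) (E b)" "height k (rt b (Suc b)) \<ge> 0" if "b \<noteq> m"
    using gE[of b 1] height_even[of b k] Suc.prems that by (simp_all add: eD_1)
  show ?case
  proof (cases "a = b")
    case True thus ?thesis using E Suc.prems by auto
  next
    case False
    hence b: "b \<noteq> m" and R: "preserves k n0 H (rt a b) (RE a b)" and h: "height k (rt a b) \<ge> 0" using Suc height_rt_even[of a b k] by auto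
    have 1: "preserves k n0 H (rt a (Suc b)) (RE a b * E b)"
      by (rule preserves_eq[OF preserves_mult[OF R E(1)]]) (use b E in \<open>auto simp: rt_def\<close>)
    have 2: "preserves k n0 H (rt a (Suc b)) (E b * RE a b)"
      by (rule preserves_eq[OF preserves_mult[OF E(1) R]]) (use b h in \<open>auto simp: rt_def\<close>)
    show ?thesis using preserves_qc[OF 1 2, of b "-1"] False by (simp add: power_int_minus)
  qed
qed simp

text \<open>The cases of the pairs: the even letters are called \<open>e\<close>, \<open>f\<close>, the odd root vectors
\<open>X\<close> (positive) and \<open>Y\<close> (negative). In each product the raising letter is moved to
the right, where the hypothesis of the induction on depth applies to it; the error terms consist of letters of
either kind, in an order for which \<open>preserves_mult\<close> or \<open>preserves_lowering_mult\<close>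
applies.\<close>

lemma case_ef:
  assumes "i \<in> {1..<r}" "i \<noteq> m" "j \<in> {1..<r}" "j \<noteq> m"
  shows "preserves k n0 H (\<lambda>l. int (Suc M) * rt i (Suc i) l + int (Suc N) * rt (Suc j) j l) (eD i (Suc M) * fD j (Suc N))"
proof (cases "i = j")
  case False
  have "preserves k n0 H (\<lambda>l. int (Suc N) * rt (Suc j) j l + int (Suc M) * rt i (Suc i) l) (fD j (Suc N) * eD i (Suc M))"
    by (rule preserves_all_mult[OF preserves_fD gE]) (use assms in auto)
  thus ?thesis using eD_fD_diff[of i j "Suc M" "Suc N"] assms False by (simp add: add.commute del: of_nat_Suc)
next
  case True
  have "preserves k n0 H (\<lambda>l. int (Suc M) * rt i (Suc i) l + int (Suc N) * rt (Suc i) i l)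
     (fDi i (int (Suc N) - int t) * kp i (2 * int t - int (Suc M) - int (Suc N)) t * eD i (Suc M - t))"
    if t: "t \<le> Suc M" for t
  proof (cases "t \<le> Suc N")
    case False thus ?thesis by (simp add: fDi_def preserves_0)
  next
    case tN: True
    have f: "fDi i (int (Suc N) - int t) = fD i (Suc N - t)" using tN by (simp add: fDi_def nat_diff_distrib del: of_nat_Suc)
    have 1: "preserves k n0 H' (\<lambda>l. int (Suc N - t) * rt (Suc i) i l + 0) (fD i (Suc N - t) * kp i (2 * int t - int (Suc M) - int (Suc N)) t)" for H'
      by (rule preserves_all_mult[OF preserves_fD preserves_kp]) (use assms in auto)
    have 2: "preserves k n0 H (\<lambda>l. (int (Suc N - t) * rt (Suc i) i l + 0) + int (Suc M - t) * rt i (Suc i) l)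
       (fD i (Suc N - t) * kp i (2 * int t - int (Suc M) - int (Suc N)) t * eD i (Suc M - t))"
      by (rule preserves_all_mult[OF 1 gE]) (use assms in auto)
    show ?thesis unfolding f
      by (rule preserves_eq[OF 2]) (use t tN in \<open>auto simp: rt_def of_nat_diff simp del: of_nat_Suc\<close>)
  qed
  thus ?thesis using eD_fD_same[of i "Suc M" "Suc N"] assms True
    by (simp del: of_nat_Suc sum.atMost_Suc) (rule preserves_sum, simp)
qed

lemma case_eX:
  assumes i: "i \<in> {1..<r}" "i \<noteq> m" and ab: "oddpos a b" and n: "lowering k (rt a b) (RE a b)"
  shows "preserves k n0 H (\<lambda>l. int (Suc M) * rt i (Suc i) l + rt a b l) (eD i (Suc M) * RE a b)"
proof -
  obtain c Z where Z: "eD i (Suc M) * RE a b = sc (v powi c) (RE a b * eD i (Suc M)) + Z * eD i M"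
     "Z = 0 \<or> (1 < a \<and> i = a - 1 \<and> Z = RE (a - 1) b) \<or> (b < r \<and> i = b \<and> Z = - sc (v powi -1) (RE a (Suc b)))"
    using eD_RE[OF i ab] by blast
  let ?w = "\<lambda>l. int (Suc M) * rt i (Suc i) l + rt a b l"
  have 1: "preserves k n0 H ?w (RE a b * eD i (Suc M))"
    by (rule preserves_eq[OF preserves_lowering_mult[OF n gE[OF i]]]) simp
  have 2: "preserves k n0 H (\<lambda>l. rt i (Suc i) l + rt a b l) Z"
    using Z(2)
  proof (elim disjE conjE)
    assume a: "1 < a" "i = a - 1" "Z = RE (a - 1) b"
    show ?thesis unfolding a(3)
      by (rule preserves_eq[OF gX]) (use a ab in \<open>auto simp: oddpos_def rt_def\<close>)
  next
    assume a: "b < r" "i = b" "Z = - sc (v powi -1) (RE a (Suc b))"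
    show ?thesis unfolding a(3)
      by (intro preserves_minus preserves_sc, rule preserves_eq[OF gX]) (use a ab in \<open>auto simp: oddpos_def rt_def\<close>)
  qed (simp add: preserves_0)
  have "preserves k n0 H ?w (Z * eD i M)"
    by (rule preserves_eq[OF preserves_mult[OF 2 gE[OF i, of M]]]) (use heightE[OF i] in \<open>auto simp: algebra_simps\<close>)
  thus ?thesis unfolding Z(1) using 1 by (intro preserves_add preserves_sc)
qed

lemma case_eY:
  assumes i: "i \<in> {1..<r}" "i \<noteq> m" and ab: "oddpos a b" and n: "lowering k (rt b a) (RF a b)"
  shows "preserves k n0 H (\<lambda>l. int (Suc M) * rt i (Suc i) l + rt b a l) (eD i (Suc M) * RF a b)"
proof -
  obtain c G where Z: "eD i (Suc M) * RF a b = RF a b * eD i (Suc M) + sc (v powi c) (G * eD i M)"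
     "G = 0 \<or> (a < m \<and> i = a \<and> G = - ((L (Suc a) * K a) * RF (Suc a) b))
        \<or> (Suc m < b \<and> Suc i = b \<and> G = sc (v powi -1) ((K b * L (b - 1)) * RF a (b - 1)))"
    using eD_RF[OF i ab] by blast
  let ?w = "\<lambda>l. int (Suc M) * rt i (Suc i) l + rt b a l"
  have 1: "preserves k n0 H ?w (RF a b * eD i (Suc M))"
    by (rule preserves_eq[OF preserves_lowering_mult[OF n gE[OF i]]]) simp
  have 2: "preserves k n0 H (\<lambda>l. rt i (Suc i) l + rt b a l) G"
    using Z(2)
  proof (elim disjE conjE)
    assume a: "a < m" "i = a" "G = - ((L (Suc a) * K a) * RF (Suc a) b)"
    show ?thesis unfolding a(3)
      by (intro preserves_minus, rule preserves_eq[OF preserves_all_mult[OF preserves_LK gY]]) (use a ab in \<open>auto simp: oddpos_def rt_def\<close>)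
  next
    assume a: "Suc m < b" "Suc i = b" "G = sc (v powi -1) ((K b * L (b - 1)) * RF a (b - 1))"
    show ?thesis unfolding a(3)
      by (intro preserves_sc, rule preserves_eq[OF preserves_all_mult[OF preserves_KL gY]]) (use a ab in \<open>auto simp: oddpos_def rt_def\<close>)
  qed (simp add: preserves_0)
  have "preserves k n0 H ?w (G * eD i M)"
    by (rule preserves_eq[OF preserves_mult[OF 2 gE[OF i, of M]]]) (use heightE[OF i] in \<open>auto simp: algebra_simps\<close>)
  thus ?thesis unfolding Z(1) using 1 by (intro preserves_add preserves_sc)
qed

lemma case_Xf:
  assumes i: "i \<in> {1..<r}" "i \<noteq> m" and ab: "oddpos a b"
  shows "preserves k n0 H (\<lambda>l. rt a b l + int (Suc N) * rt (Suc i) i l) (RE a b * fD i (Suc N))"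
proof -
  obtain c G where Z: "RE a b * fD i (Suc N) = fD i (Suc N) * RE a b + sc (v powi c) (fD i N * G)"
     "G = 0 \<or> (a < m \<and> i = a \<and> G = - (RE (Suc a) b * (L a * K (Suc a))))
        \<or> (Suc m < b \<and> Suc i = b \<and> G = sc (v powi 1) (RE a (b - 1) * (K (b - 1) * L b)))"
    using RE_fD[OF i ab] by blast
  let ?w = "\<lambda>l. rt a b l + int (Suc N) * rt (Suc i) i l"
  have 1: "preserves k n0 H ?w (fD i (Suc N) * RE a b)"
    by (rule preserves_eq[OF preserves_all_mult[OF preserves_fD[OF i] gX[OF ab]]]) simp
  have 2: "preserves k n0 H (\<lambda>l. rt a b l + rt (Suc i) i l) G"
    using Z(2)
  proof (elim disjE conjE)
    assume a: "a < m" "i = a" "G = - (RE (Suc a) b * (L a * K (Suc a)))"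
    have o: "oddpos (Suc a) b" using a ab by (auto simp: oddpos_def)
    show ?thesis unfolding a(3)
      by (intro preserves_minus, rule preserves_eq[OF preserves_mult[OF gX[OF o] preserves_LK]]) (use a ab in \<open>auto simp: oddpos_def rt_def height_def\<close>)
  next
    assume a: "Suc m < b" "Suc i = b" "G = sc (v powi 1) (RE a (b - 1) * (K (b - 1) * L b))"
    have o: "oddpos a (b - 1)" using a ab by (auto simp: oddpos_def)
    show ?thesis unfolding a(3)
      by (intro preserves_sc, rule preserves_eq[OF preserves_mult[OF gX[OF o] preserves_KL]]) (use a ab in \<open>auto simp: oddpos_def rt_def height_def\<close>)
  qed (simp add: preserves_0)
  have "preserves k n0 H ?w (fD i N * G)"
    by (rule preserves_eq[OF preserves_all_mult[OF preserves_fD[OF i] 2]]) (auto simp: algebra_simps)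
  thus ?thesis unfolding Z(1) using 1 by (intro preserves_add preserves_sc)
qed

lemma case_Yf:
  assumes i: "i \<in> {1..<r}" "i \<noteq> m" and ab: "oddpos a b"
  shows "preserves k n0 H (\<lambda>l. rt b a l + int (Suc N) * rt (Suc i) i l) (RF a b * fD i (Suc N))"
proof -
  obtain c Z where Z: "RF a b * fD i (Suc N) = sc (v powi c) (fD i (Suc N) * RF a b) + fD i N * Z"
     "Z = 0 \<or> (1 < a \<and> i = a - 1 \<and> Z = RF (a - 1) b) \<or> (b < r \<and> i = b \<and> Z = - sc (v powi 1) (RF a (Suc b)))"
    using RF_fD[OF i ab] by blast
  let ?w = "\<lambda>l. rt b a l + int (Suc N) * rt (Suc i) i l"
  have 1: "preserves k n0 H ?w (fD i (Suc N) * RF a b)"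
    by (rule preserves_eq[OF preserves_all_mult[OF preserves_fD[OF i] gY[OF ab]]]) simp
  have 2: "preserves k n0 H (\<lambda>l. rt b a l + rt (Suc i) i l) Z"
    using Z(2)
  proof (elim disjE conjE)
    assume a: "1 < a" "i = a - 1" "Z = RF (a - 1) b"
    show ?thesis unfolding a(3)
      by (rule preserves_eq[OF gY]) (use a ab in \<open>auto simp: oddpos_def rt_def\<close>)
  next
    assume a: "b < r" "i = b" "Z = - sc (v powi 1) (RF a (Suc b))"
    show ?thesis unfolding a(3)
      by (intro preserves_minus preserves_sc, rule preserves_eq[OF gY]) (use a ab in \<open>auto simp: oddpos_def rt_def\<close>)
  qed (simp add: preserves_0)
  have "preserves k n0 H ?w (fD i N * Z)"
    by (rule preserves_eq[OF preserves_all_mult[OF preserves_fD[OF i] 2]]) (auto simp: algebra_simps)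
  thus ?thesis unfolding Z(1) using 1 by (intro preserves_add preserves_sc)
qed

text \<open>Both letters are positive root vectors on different sides of rank \<open>k\<close>. If their positions cross,
the error term contains the vector of an intermediate position; the order of its two factors is the one with
the lowering letter on the left.\<close>

lemma case_XX:
  assumes p: "oddpos a b" "k < odd_rank a b" and n: "oddpos c d" "odd_rank c d \<le> k"
  shows "preserves k n0 H (\<lambda>l. rt a b l + rt c d l) (RE a b * RE c d)"
proof -
  let ?w = "\<lambda>l. rt a b l + rt c d l"
  have o: "1 \<le> a" "a \<le> m" "m < b" "b \<le> r" "1 \<le> c" "c \<le> m" "m < d" "d \<le> r" using p n by (auto simp: oddpos_def)
  have "odd_rank c d < odd_rank a b" using p n by simp
  hence le: "d < b \<or> d = b \<and> a < c" using odd_rank_less[OF n(1) p(1)] by simp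
  have 1: "preserves k n0 H ?w (RE c d * RE a b)"
    by (rule preserves_eq[OF preserves_lowering_mult[OF lowering_X[OF n] gX[OF p(1)]]]) simp
  consider "d = b" "a < c" | "d < b" "a = c" | "d < b" "a < c" | "d < b" "c < a" using le by linarith
  thus ?thesis
  proof cases
    case 1
    thus ?thesis using RE_RE_col[of a c b] o \<open>preserves k n0 H ?w (RE c d * RE a b)\<close> by (simp add: preserves_minus preserves_sci)
  next
    case 2
    have "RE a b * RE c d = - sc (inverse v) (RE c d * RE a b)"
      using RE_RE_row[of a d b] o 2 v0 by (simp add: sc_minus_right sc_sc)
    thus ?thesis using 1 by (simp add: preserves_minus preserves_sci)
  next
    case 3
    thus ?thesis using RE_RE_nested[of a c d b] o 1 by (simp add: preserves_minus)
  next
    case 4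
    have oo: "oddpos a d" "oddpos c b" using o by (auto simp: oddpos_def)
    have i1: "odd_rank a d \<le> k" using odd_rank_less[OF oo(1) n(1)] 4 n by simp
    have 2: "preserves k n0 H ?w (RE a d * RE c b)"
      by (rule preserves_eq[OF preserves_lowering_mult[OF lowering_X[OF oo(1) i1] gX[OF oo(2)]]]) (simp add: rt_def)
    have "RE a b * RE c d = - (RE c d * RE a b) + (sc v (RE a d * RE c b) - sc (inverse v) (RE a d * RE c b))"
      using RE_RE_cross[of c a d b] o 4 by (simp add: sc_diff_left algebra_simps)
    thus ?thesis using 1 2 by (simp add: preserves_minus preserves_sci preserves_sc1 preserves_add preserves_diff)
  qed
qed

lemma case_YY:
  assumes p: "oddpos a b" "odd_rank a b \<le> k" and n: "oddpos c d" "k < odd_rank c d"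
  shows "preserves k n0 H (\<lambda>l. rt b a l + rt d c l) (RF a b * RF c d)"
proof -
  let ?w = "\<lambda>l. rt b a l + rt d c l"
  have o: "1 \<le> a" "a \<le> m" "m < b" "b \<le> r" "1 \<le> c" "c \<le> m" "m < d" "d \<le> r" using p n by (auto simp: oddpos_def)
  have "odd_rank a b < odd_rank c d" using p n by simp
  hence le: "b < d \<or> b = d \<and> c < a" using odd_rank_less[OF p(1) n(1)] by simp
  have 1: "preserves k n0 H ?w (RF c d * RF a b)"
    by (rule preserves_eq[OF preserves_lowering_mult[OF lowering_Y[OF n] gY[OF p(1)]]]) simp
  consider "d = b" "c < a" | "b < d" "a = c" | "b < d" "c < a" | "b < d" "a < c" using le by linarith
  thus ?thesis
  proof cases
    case a: 1
    thus ?thesis using RF_RF_col[of c a b] o 1 by (simp add: preserves_minus preserves_sc1)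
  next
    case 2
    have "RF a d * RF a b = - sc (inverse v) (RF a b * RF a d)" using RF_RF_row[of a b d] o 2 by simp
    hence "RF a b * RF c d = - sc v (RF c d * RF a b)"
      using 2 v0 by (simp add: sc_minus_right sc_sc)
    thus ?thesis using 1 by (simp add: preserves_minus preserves_sc1)
  next
    case 3
    have "RF a b * RF c d = - (RF c d * RF a b)" using RF_RF_nested[of c a b d] o 3 by simp
    thus ?thesis using 1 by (simp add: preserves_minus)
  next
    case 4
    have oo: "oddpos a d" "oddpos c b" using o by (auto simp: oddpos_def)
    have i1: "k < odd_rank a d" using odd_rank_less[OF n(1) oo(1)] 4 n by simp
    have 2: "preserves k n0 H ?w (RF a d * RF c b)"
      by (rule preserves_eq[OF preserves_lowering_mult[OF lowering_Y[OF oo(1) i1] gY[OF oo(2)]]]) (simp add: rt_def)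
    have "RF a b * RF c d = - (RF c d * RF a b) + (sc (inverse v) (RF a d * RF c b) - sc v (RF a d * RF c b))"
      using RF_RF_cross[of a c b d] o 4 by (simp add: sc_diff_left algebra_simps)
    thus ?thesis using 1 2 by (simp add: preserves_minus preserves_sci preserves_sc1 preserves_add preserves_diff)
  qed
qed

text \<open>The error terms consist of even root vectors and torus elements only.\<close>

lemma RE_RF_preserves:
  assumes p: "oddpos a b" and n: "oddpos c d"
  shows "\<exists>G. RE a b * RF c d = - (RF c d * RE a b) + G \<and> preserves k n0 H (\<lambda>l. rt a b l + rt d c l) G"
proof -
  let ?w = "\<lambda>l. rt a b l + rt d c l"
  have o: "1 \<le> a" "a \<le> m" "m < b" "b \<le> r" "1 \<le> c" "c \<le> m" "m < d" "d \<le> r" using p n by (auto simp: oddpos_def)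
  have oi: "a \<in> {1..r}" "b \<in> {1..r}" "c \<in> {1..r}" "d \<in> {1..r}" using o by auto
  \<comment> \<open>the diagonal case, two rows, two columns, two nestings and two crossings\<close>
  consider "a = c" "b = d" | "a = c" "b < d" | "a = c" "d < b" | "b = d" "c < a" | "b = d" "a < c"
    | "a < c" "d < b" | "c < a" "b < d" | "a < c" "b < d" | "c < a" "d < b" by linarith
  thus ?thesis
  proof cases
    case 1
    have "preserves k n0 H ?w (sc dl (kap a b))"
      by (rule preserves_eq[OF preserves_kap[OF p]]) (use 1 in \<open>simp add: rt_def\<close>)
    thus ?thesis using RE_RF_eq[of a b] o 1 by auto
  next
    case 2
    have "preserves k n0 H ?w (sc (inverse v) (RF b d * (K a * L b)))"
      by (intro preserves_sci, rule preserves_eq[OF preserves_all_mult[OF preserves_RF_even preserves_KL]]) (use o 2 in \<open>auto simp: rt_def\<close>)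
    thus ?thesis using RE_RF_row[of a b d] o 2 by auto
  next
    case 3
    have "preserves k n0 H ?w (sc v (K d * L a * RE d b))"
      by (intro preserves_sc1, rule preserves_eq[OF preserves_all_mult[OF preserves_KL gR]]) (use o 3 in \<open>auto simp: rt_def\<close>)
    thus ?thesis using RF_RE_row[of a d b] o 3 by auto
  next
    case 4
    have "preserves k n0 H ?w (RF c a * (L a * K b))"
      by (rule preserves_eq[OF preserves_all_mult[OF preserves_RF_even preserves_LK]]) (use o 4 in \<open>auto simp: rt_def\<close>)
    thus ?thesis using RE_RF_col[of c a b] o 4 by auto
  next
    case 5
    have "preserves k n0 H ?w (L b * K c * RE a c)"
      by (rule preserves_eq[OF preserves_all_mult[OF preserves_LK gR]]) (use o 5 in \<open>auto simp: rt_def\<close>)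
    thus ?thesis using RF_RE_col[of a c b] o 5 by auto
  next
    case 6
    have "RE a b * RF c d = - (RF c d * RE a b) + 0" using RE_RF_nested[of a c d b] o 6 by simp
    thus ?thesis using preserves_0 by blast
  next
    case 7
    have "RE a b * RF c d = - (RF c d * RE a b) + 0" using RF_RE_nested[of c a b d] o 7 by simp
    thus ?thesis using preserves_0 by blast
  next
    case 8
    let ?G = "RF b d * (K c * L b * RE a c)"
    have 1: "preserves k n0 H (rt a c) (K c * L b * RE a c)"
      by (rule preserves_eq[OF preserves_all_mult[OF preserves_KL gR]]) (use o 8 in \<open>auto simp: rt_def\<close>)
    have "preserves k n0 H ?w ?G"
      by (rule preserves_eq[OF preserves_all_mult[OF preserves_RF_even 1]]) (use o 8 in \<open>auto simp: rt_def\<close>)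
    hence "preserves k n0 H ?w (?G - sc (v powi -2) ?G)" by (intro preserves_diff preserves_sc)
    moreover have "sc (1 - inverse v * inverse v) ?G = ?G - sc (v powi -2) ?G"
      by (simp add: sc_diff_left power_int_minus power2_eq_square)
    ultimately show ?thesis using RF_RE_cross[of a c b d] o 8 by auto
  next
    case 9
    let ?G = "RF c a * (K d * L a) * RE d b"
    have 1: "preserves k n0 H' (rt a c) (RF c a * (K d * L a))" for H'
      by (rule preserves_eq[OF preserves_all_mult[OF preserves_RF_even preserves_KL]]) (use o 9 in \<open>auto simp: rt_def\<close>)
    have "preserves k n0 H ?w ?G"
      by (rule preserves_eq[OF preserves_all_mult[OF 1 gR]]) (use o 9 in \<open>auto simp: rt_def\<close>)
    hence "preserves k n0 H ?w (?G - sc (v powi 2) ?G)" by (intro preserves_diff preserves_sc)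
    moreover have "sc (1 - v * v) ?G = ?G - sc (v powi 2) ?G"
      by (simp add: sc_diff_left power2_eq_square)
    ultimately show ?thesis using RE_RF_cross[of c a d b] o 9 by auto
  qed
qed

lemma case_XY:
  assumes p: "oddpos a b" "k < odd_rank a b" and n: "oddpos c d" "k < odd_rank c d"
  shows "preserves k n0 H (\<lambda>l. rt a b l + rt d c l) (RE a b * RF c d)"
proof -
  obtain G where G: "RE a b * RF c d = - (RF c d * RE a b) + G" "preserves k n0 H (\<lambda>l. rt a b l + rt d c l) G"
    using RE_RF_preserves[OF p(1) n(1)] by blast
  have "preserves k n0 H (\<lambda>l. rt a b l + rt d c l) (RF c d * RE a b)"
    by (rule preserves_eq[OF preserves_lowering_mult[OF lowering_Y[OF n] gX[OF p(1)]]]) simp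
  thus ?thesis unfolding G(1) using G(2) by (intro preserves_add preserves_minus)
qed

lemma case_YX:
  assumes p: "oddpos a b" "odd_rank a b \<le> k" and n: "oddpos c d" "odd_rank c d \<le> k"
  shows "preserves k n0 H (\<lambda>l. rt d c l + rt a b l) (RF c d * RE a b)"
proof -
  obtain G where G: "RE a b * RF c d = - (RF c d * RE a b) + G" "preserves k n0 H (\<lambda>l. rt a b l + rt d c l) G"
    using RE_RF_preserves[OF p(1) n(1)] by blast
  have G': "RF c d * RE a b = - (RE a b * RF c d) + G" using G(1) by simp
  have 1: "preserves k n0 H (\<lambda>l. rt a b l + rt d c l) (RE a b * RF c d)"
    by (rule preserves_eq[OF preserves_lowering_mult[OF lowering_X[OF p] gY[OF n(1)]]]) simp
  have "preserves k n0 H (\<lambda>l. rt a b l + rt d c l) (RF c d * RE a b)"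
    unfolding G' using 1 G(2) by (intro preserves_add preserves_minus)
  thus ?thesis by (rule preserves_eq) simp
qed

lemma raising_lowering_preserves: "raising k g u \<Longrightarrow> lowering k h w \<Longrightarrow> preserves k n0 H (\<lambda>l. g l + h l) (u * w)"
proof (induction rule: raising.induct)
  case (raising_e i M)
  from raising_e(3) show ?case
    by cases (use raising_e(1,2) case_ef case_eX case_eY lowering_X lowering_Y in auto)
next
  case (raising_X a b)
  from raising_X(3) show ?case
    by cases (use raising_X(1,2) case_Xf case_XX case_XY in auto)
next
  case (raising_Y a b)
  from raising_Y(3) show ?case
    by cases (use raising_Y(1,2) case_Yf case_YY case_YX in auto)
qed

text \<open>The outermost lowering letter is applied to a vector of depth less than \<open>H\<close>, where
\<open>raising_lowering_preserves\<close> moves the raising letter past it; sums are treated by induction on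
the construction of the vector.\<close>

lemma preserves_step:
  assumes p: "raising k g u"
  shows "preserves k n0 (H + 1) g u"
  unfolding preserves_def
proof (intro conjI allI impI)
  show "u \<in> ZZ" using p by (rule raising_ZZ)
  fix n x assume "sing_span k n0 n x" "height k n0 - height k n < H + 1"
  thus "sing_span k n0 (\<lambda>i. n i + g i) (act u x)"
  proof (induction rule: sing_span.induct)
    case (sing_span_base x) thus ?case using p by (auto simp: singular_def killed_def intro: sing_span_0)
  next
    case (sing_span_0 n) thus ?case using act_zero[OF raising_ZZ(1)[OF p]] by (auto intro: sing_span.sing_span_0)
  next
    case (sing_span_add n x y) thus ?case
      using act_vadd[OF raising_ZZ(1)[OF p]] sing_span_carrier by (auto intro: sing_span.sing_span_add)
  next
    case (sing_span_neg n x h w)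
    have "height k n0 - height k n < H" using sing_span_neg.prems lowering_height[OF sing_span_neg.hyps(2)] by (simp add: height_add)
    hence "sing_span k n0 (\<lambda>i. n i + (g i + h i)) (act (u * w) x)"
      using raising_lowering_preserves[OF p sing_span_neg.hyps(2)] sing_span_neg.hyps(1) by (simp add: preserves_def)
    hence "sing_span k n0 (\<lambda>i. n i + (g i + h i)) (act u (act w x))"
      using sing_span_carrier[OF sing_span_neg.hyps(1)] raising_ZZ(1)[OF p] lowering_ZZ(1)[OF sing_span_neg.hyps(2)] by (simp add: act_mult)
    thus ?case by (rule sing_span_eq) simp
  next
    case (sing_span_eq n x n')
    have "height k n = height k n'" by (rule height_cong) (rule sing_span_eq.hyps)
    hence "sing_span k n0 (\<lambda>i. n i + g i) (act u x)" using sing_span_eq.IH sing_span_eq.prems by simp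
    thus ?case by (rule sing_span.sing_span_eq) (simp add: sing_span_eq.hyps)
  qed
qed

end

text \<open>Above the top height there is only the zero vector, which starts the induction on depth.\<close>

lemma raising_preserves: "raising k g u \<Longrightarrow> preserves k n0 H g u"
proof -
  have *: "raising k g u \<Longrightarrow> preserves k n0 (int h) g u" for h g u
  proof (induction h arbitrary: g u)
    case 0
    have "sing_span k n0 (\<lambda>i. n i + g i) (act u x)" if "sing_span k n0 n x" "height k n0 - height k n < 0" for n x
    proof -
      have "x = \<zero>" using sing_span_top[OF that(1)] that(2) height_cong[of n n0 k] by auto
      thus ?thesis using act_zero[OF raising_ZZ(1)[OF 0]] by (auto intro: sing_span_0)
    qed
    thus ?case using raising_ZZ(1)[OF 0] by (simp add: preserves_def)
  next
    case (Suc h)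
    have "preserves k n0 (int h + 1) g u" by (rule preserves_step) (use Suc in auto)
    thus ?case by (simp add: add.commute)
  qed
  assume "raising k g u"
  from *[OF this, of "nat H"] show ?thesis unfolding preserves_def by auto
qed

end

section \<open>Parity\<close>

text \<open>Addition of parities under a name of its own: sums of bits are otherwise rewritten into Boolean conditions.\<close>

definition bplus :: "bit \<Rightarrow> bit \<Rightarrow> bit" where "bplus s p = s + p"

lemma bplus_comm: "bplus s p = bplus p s" and bplus_assoc: "bplus (bplus s p) t = bplus s (bplus p t)"
  and bplus_0: "bplus s 0 = s"
  unfolding bplus_def by (rule add.commute, rule add.assoc, rule add.right_neutral)

lemma bplus_1: "bplus 0 1 = 1" "bplus 1 1 = 0" by (simp_all add: bplus_def)

context qgl_module begin

definition homog :: "bit \<Rightarrow> 'a \<Rightarrow> bool" where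
  "homog p u \<longleftrightarrow> u \<in> ZZ \<and> (\<forall>s x. x \<in> mp s \<longrightarrow> act u x \<in> mp (bplus s p))"

lemma mp_carrier: "x \<in> mp p \<Longrightarrow> x \<in> carrier V"
  using additive_subgroup.a_Hcarr[OF mp_sub] .
lemma mp_0: "\<zero> \<in> mp p" by (rule additive_subgroup.zero_closed[OF mp_sub])
lemma mp_add: "x \<in> mp p \<Longrightarrow> y \<in> mp p \<Longrightarrow> x \<oplus> y \<in> mp p"
  by (rule additive_subgroup.a_closed[OF mp_sub])

lemma homog_mult: "homog p u \<Longrightarrow> homog p' w \<Longrightarrow> homog (bplus p p') (u * w)"
  unfolding homog_def using mp_carrier
  by (auto simp: ZZ_mult act_mult bplus_assoc[symmetric] bplus_comm[of p])

lemma homog_add: "homog p u \<Longrightarrow> homog p w \<Longrightarrow> homog p (u + w)"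
  unfolding homog_def using mp_carrier by (auto simp: ZZ_add act_add intro: mp_add)
lemma homog_sc: "homog p u \<Longrightarrow> homog p (sc (v powi j) u)"
  unfolding homog_def using mp_carrier by (auto simp: ZZ_sc act_sc intro: fs_mp)
lemma homog_minus: "homog p u \<Longrightarrow> homog p (- u)"
  unfolding homog_def using mp_carrier by (auto simp: ZZ_minus act_minus intro: fs_mp)
lemma homog_diff: "homog p u \<Longrightarrow> homog p w \<Longrightarrow> homog p (u - w)"
  using homog_add[OF _ homog_minus, of p u w] by simp

lemma homog_qc: assumes "homog p u" "homog p' w" shows "homog (bplus p p') (qc (va a powi j) u w)"
  unfolding qc_def va_v 
  using homog_diff[OF homog_mult[OF assms] homog_sc[OF homog_mult[OF assms(2,1), unfolded bplus_comm[of p' p]]]] .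

lemma homog_even: "u \<in> ZZ \<Longrightarrow> (\<And>x s. x \<in> mp s \<Longrightarrow> act u x \<in> mp s) \<Longrightarrow> homog 0 u"
  by (simp add: homog_def bplus_0)

lemma homog_E: "i \<in> {1..<r} \<Longrightarrow> \<exists>p. homog p (E i)"
proof (cases "i = m")
  case True
  assume "i \<in> {1..<r}"
  hence "homog 1 (E i)" using Em_mp ZZ_E[of i] True unfolding homog_def bplus_def by blast
  thus ?thesis by blast
next
  case False
  assume i: "i \<in> {1..<r}"
  have "homog 0 (E i)" by (rule homog_even) (use i False ZZ_E eD_mp[of i _ _ "Suc 0", unfolded eD_1] in blast)+
  thus ?thesis by blast
qed

lemma homog_F: "i \<in> {1..<r} \<Longrightarrow> \<exists>p. homog p (F i)"
proof (cases "i = m")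
  case True
  assume "i \<in> {1..<r}"
  hence "homog 1 (F i)" using Fm_mp ZZ_F[of i] True unfolding homog_def bplus_def by blast
  thus ?thesis by blast
next
  case False
  assume i: "i \<in> {1..<r}"
  have "homog 0 (F i)" by (rule homog_even) (use i False ZZ_F fD_mp[of i _ _ "Suc 0", unfolded fD_1] in blast)+
  thus ?thesis by blast
qed

lemma homog_RE: "1 \<le> a \<Longrightarrow> a < b \<Longrightarrow> b \<le> r \<Longrightarrow> \<exists>p. homog p (RE a b)"
proof (induction b)
  case (Suc b)
  show ?case
  proof (cases "a = b")
    case True thus ?thesis using homog_E[of b] Suc.prems by auto
  next
    case False
    then obtain p p' where p: "homog p (RE a b)" "homog p' (E b)" using Suc homog_E[of b] by auto
    show ?thesis using homog_qc[OF p, of b "-1"] False by (auto simp: power_int_minus)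
  qed
qed simp

lemma homog_RF: "1 \<le> a \<Longrightarrow> a < b \<Longrightarrow> b \<le> r \<Longrightarrow> \<exists>p. homog p (RF a b)"
proof (induction b)
  case (Suc b)
  show ?case
  proof (cases "a = b")
    case True thus ?thesis using homog_F[of b] Suc.prems by auto
  next
    case False
    then obtain p p' where p: "homog p (RF a b)" "homog p' (F b)" using Suc homog_F[of b] by auto
    show ?thesis using homog_qc[OF p(2,1), of b 1] False by auto
  qed
qed simp

lemma homog_lowering: "lowering k g u \<Longrightarrow> \<exists>p. homog p u"
proof (induction rule: lowering.induct)
  case (lowering_f i M)
  have "homog 0 (fD i (Suc M))" by (rule homog_even) (use lowering_f fD_mp ZZ_fD in blast)+
  thus ?case by blast
qed (auto simp: oddpos_def intro!: homog_RE homog_RF)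

lemma homog_raising: "raising k g u \<Longrightarrow> \<exists>p. homog p u"
proof (induction rule: raising.induct)
  case (raising_e i M)
  have "homog 0 (eD i (Suc M))" by (rule homog_even) (use raising_e eD_mp ZZ_eD in blast)+
  thus ?case by blast
qed (auto simp: oddpos_def intro!: homog_RE homog_RF)

lemma homog_kB: assumes a: "a \<in> {1..r}" shows "homog 0 (kB a c t)"
proof -
  have "kB a c t \<in> {u. homog 0 u}"
    unfolding kB_def
  proof (rule kb_closed[OF va0 qn_va])
    show "L a \<in> {u. homog 0 u}" using a L_mp ZZ_L homog_even[of "L a"] by blast
    show "kb (va a) (K a) (L a) 0 s \<in> {u. homog 0 u}" for s
      using a kB0_mp ZZ_kB0 homog_even[of "kB a 0 s"] unfolding kB_def[symmetric] by blast
    show "sc (va a powi j) x \<in> {u. homog 0 u}" if "x \<in> {u. homog 0 u}" for x j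
      using that homog_sc unfolding va_v by simp
    show "x * y \<in> {u. homog 0 u}" if "x \<in> {u. homog 0 u}" "y \<in> {u. homog 0 u}" for x y
      using that homog_mult[of 0 x 0 y] by (simp add: bplus_0)
  qed (use a homog_add homog_diff in \<open>auto simp: KL LK\<close>)
  thus ?thesis by simp
qed

lemma direct:
  assumes "y \<in> mp p" "z \<in> mp p'" "p \<noteq> p'" "y \<oplus> z = \<zero>"
  shows "y = \<zero>" "z = \<zero>"
proof -
  have c: "y \<in> carrier V" "z \<in> carrier V" using assms mp_carrier by auto
  have "y = y \<oplus> (z \<oplus> fs (-1) z)" using c by (simp add: fs_m1')
  also have "\<dots> = (y \<oplus> z) \<oplus> fs (-1) z" using c by (simp add: a_assoc fs_closed)
  finally have y: "y = fs (-1) z" using assms(4) c by (simp add: fs_closed)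
  have "y \<in> mp p'" unfolding y by (rule fs_mp) (rule assms)
  moreover have "p = 0 \<and> p' = 1 \<or> p = 1 \<and> p' = 0" using assms(3) by (metis bit_not_zero_iff)
  ultimately have "y \<in> mp 0 \<inter> mp 1" using assms(1) by auto
  thus y0: "y = \<zero>" using mp_int by simp
  show "z = \<zero>" using assms(4) c unfolding y0 by simp
qed

text \<open>A homogeneous operator that kills a vector kills its even and its odd component. With
\<open>eigen_comp\<close> this shows that the components of a singular vector are singular, hence that the
span of singular vectors is a graded subspace.\<close>

lemma homog_kernel:
  assumes "homog p u" "y \<in> mp 0" "z \<in> mp 1" "act u (y \<oplus> z) = \<zero>"
  shows "act u y = \<zero>" "act u z = \<zero>"
proof -
  have u: "u \<in> ZZ" using assms(1) by (simp add: homog_def)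
  have e: "act u y \<oplus> act u z = \<zero>" using assms(4) act_vadd[OF u mp_carrier[OF assms(2)] mp_carrier[OF assms(3)]] by simp
  have "act u y \<in> mp (bplus 0 p)" "act u z \<in> mp (bplus 1 p)" using assms unfolding homog_def by blast+
  moreover have "bplus 0 p \<noteq> bplus 1 p" unfolding bplus_def by (metis add_right_cancel zero_neq_one)
  ultimately show "act u y = \<zero>" "act u z = \<zero>" using direct[OF _ _ _ e] by blast+
qed

lemma eigen_comp:
  assumes u: "homog 0 u" and y: "y \<in> mp 0" and z: "z \<in> mp 1" and e: "act u (y \<oplus> z) = fs c (y \<oplus> z)"
  shows "act u y = fs c y" "act u z = fs c z"
proof -
  have uZ: "u \<in> ZZ" using u by (simp add: homog_def)
  have c: "y \<in> carrier V" "z \<in> carrier V" using y z mp_carrier by auto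
  have d: "fs c x \<oplus> fs (- c) x = \<zero>" "fs (- c) x \<oplus> fs c x = \<zero>" if "x \<in> carrier V" for x
    using fs_add[OF that, of c "-c"] fs_add[OF that, of "-c" c] fs_0[OF that] by auto
  let ?T = "\<lambda>x. act u x \<oplus> fs (- c) x"
  have T: "?T y \<oplus> ?T z = \<zero>"
  proof -
    have "?T y \<oplus> ?T z = act u (y \<oplus> z) \<oplus> fs (- c) (y \<oplus> z)"
      using c uZ by (simp add: act_vadd fs_vadd act_closed fs_closed a_ac)
    thus ?thesis unfolding e using d(1)[of "y \<oplus> z"] c by simp
  qed
  have m: "?T x \<in> mp s" if "x \<in> mp s" for x s
    using that u by (intro mp_add fs_mp) (auto simp: homog_def bplus_0)
  have z0: "?T y = \<zero>" "?T z = \<zero>" using direct[OF m[OF y] m[OF z] _ T] by simp_all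
  have *: "act u x = fs c x" if "?T x = \<zero>" "x \<in> carrier V" for x
  proof (rule add.r_cancel[of _ "fs (- c) x"])
    show "act u x \<oplus> fs (- c) x = fs c x \<oplus> fs (- c) x" using that d by simp
  qed (use that uZ in \<open>auto simp: act_closed fs_closed\<close>)
  show "act u y = fs c y" "act u z = fs c z" using * z0 c by auto
qed

lemma wspace_comp:
  assumes "y \<in> mp 0" "z \<in> mp 1" "y \<oplus> z \<in> wspace n"
  shows "y \<in> wspace n" "z \<in> wspace n"
proof -
  have h: "homog 0 (K a)" if "a \<in> {1..r}" for a using that K_mp ZZ_K homog_even[of "K a"] by blast
  have c: "y \<in> carrier V" "z \<in> carrier V" using assms mp_carrier by auto
  have k: "act (K a) (y \<oplus> z) = fs (qa a powi n a) (y \<oplus> z)"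
    "act (kB a c t) (y \<oplus> z) = fs (B (n a + c) t) (y \<oplus> z)" if "a \<in> {1..r}" for a c t
    using assms(3) that by (auto simp: wspace_def)
  show "y \<in> wspace n" "z \<in> wspace n" unfolding wspace_def using c
    eigen_comp[OF h assms(1,2) k(1)] eigen_comp[OF homog_kB assms(1,2) k(2)] by auto
qed

lemma singular_comp:
  assumes "x \<in> singular k n"
  shows "\<exists>y z. y \<in> mp 0 \<and> z \<in> mp 1 \<and> y \<in> singular k n \<and> z \<in> singular k n \<and> x = y \<oplus> z"
proof -
  have x: "x \<in> carrier V" "x \<in> wspace n" using assms wspace_carrier by (auto simp: singular_def)
  obtain y z where yz: "y \<in> mp 0" "z \<in> mp 1" "x = y \<oplus> z" using mp_sum[OF x(1)] by blast
  have "act u y = \<zero> \<and> act u z = \<zero>" if p: "raising k g u" for g u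
  proof -
    have "act u (y \<oplus> z) = \<zero>" using assms p yz(3) by (auto simp: singular_def killed_def)
    thus ?thesis using homog_raising[OF p] homog_kernel[OF _ yz(1,2)] by blast
  qed
  thus ?thesis using yz wspace_comp[OF yz(1,2)] x(2) unfolding singular_def killed_def
    by (intro exI[of _ y] exI[of _ z]) auto
qed

lemma sing_span_comp: "sing_span k n0 n x \<Longrightarrow> \<exists>y z. y \<in> mp 0 \<and> z \<in> mp 1 \<and> sing_span k n0 n y \<and> sing_span k n0 n z \<and> x = y \<oplus> z"
proof (induction rule: sing_span.induct)
  case (sing_span_base x) thus ?case using singular_comp sing_span.sing_span_base by blast
next
  case (sing_span_0 n)
  show ?case by (intro exI[of _ \<zero>]) (auto simp: mp_0 intro: sing_span.sing_span_0)
next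
  case (sing_span_add n x x')
  then obtain y z y' z' where o: "y \<in> mp 0" "z \<in> mp 1" "sing_span k n0 n y" "sing_span k n0 n z" "x = y \<oplus> z"
    "y' \<in> mp 0" "z' \<in> mp 1" "sing_span k n0 n y'" "sing_span k n0 n z'" "x' = y' \<oplus> z'" by blast
  have "x \<oplus> x' = (y \<oplus> y') \<oplus> (z \<oplus> z')" using o sing_span_carrier[of k n0 n] by (simp add: a_ac)
  thus ?case using o by (intro exI[of _ "y \<oplus> y'"] exI[of _ "z \<oplus> z'"] conjI) (auto intro: sing_span.sing_span_add mp_add)
next
  case (sing_span_neg n x g u)
  then obtain y z where o: "y \<in> mp 0" "z \<in> mp 1" "sing_span k n0 n y" "sing_span k n0 n z" "x = y \<oplus> z" by blast
  obtain p where p: "homog p u" using homog_lowering[OF sing_span_neg.hyps(2)] by blast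
  have u: "u \<in> ZZ" using p by (simp add: homog_def)
  have e: "act u x = act u y \<oplus> act u z" "act u x = act u z \<oplus> act u y"
    using o sing_span_carrier[of k n0 n] by (simp_all add: act_vadd[OF u] act_closed[OF u] a_comm)
  have s: "sing_span k n0 (\<lambda>i. n i + g i) (act u y)" "sing_span k n0 (\<lambda>i. n i + g i) (act u z)"
    using o sing_span_neg.hyps(2) sing_span.sing_span_neg by blast+
  have h: "act u y \<in> mp (bplus 0 p)" "act u z \<in> mp (bplus 1 p)" using p o unfolding homog_def by blast+
  show ?case
  proof (cases "p = 0")
    case True thus ?thesis using e(1) s h unfolding True bplus_0 by blast
  next
    case False
    hence p1: "p = 1" by (metis bit_not_zero_iff)
    have "act u z \<in> mp 0" "act u y \<in> mp 1" using h unfolding p1 bplus_1 by simp_all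
    thus ?thesis using e(2) s by blast
  qed
next
  case (sing_span_eq n x n')
  have "sing_span k n0 n y \<Longrightarrow> sing_span k n0 n' y" for y by (rule sing_span.sing_span_eq[of k n0 n]) (use sing_span_eq.hyps(2) in auto)
  thus ?case using sing_span_eq.IH by blast
qed

section \<open>The submodule generated by singular vectors\<close>

text \<open>Sums over all weights of the spaces \<open>sing_span k n0 n\<close>.\<close>

inductive_set sing_module :: "nat \<Rightarrow> (nat \<Rightarrow> int) \<Rightarrow> 'w set" for k n0 where
  sing_module_span: "sing_span k n0 n x \<Longrightarrow> x \<in> sing_module k n0"
| sing_module_add: "x \<in> sing_module k n0 \<Longrightarrow> y \<in> sing_module k n0 \<Longrightarrow> x \<oplus> y \<in> sing_module k n0"

lemma sing_module_carrier: "x \<in> sing_module k n0 \<Longrightarrow> x \<in> carrier V"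
  by (induction rule: sing_module.induct) (auto simp: sing_span_carrier)

lemma sing_module_fs: "x \<in> sing_module k n0 \<Longrightarrow> fs c x \<in> sing_module k n0"
  by (induction rule: sing_module.induct) (auto simp: fs_vadd sing_module_carrier intro: sing_module.intros sing_span_fs)

lemma sing_module_preserves: "x \<in> sing_module k n0 \<Longrightarrow> (\<And>H. preserves k n0 H g u) \<Longrightarrow> act u x \<in> sing_module k n0"
proof (induction rule: sing_module.induct)
  case (sing_module_span n x)
  have "sing_span k n0 (\<lambda>i. n i + g i) (act u x)"
    using sing_module_span(2)[of "height k n0 - height k n + 1"] sing_module_span(1) unfolding preserves_def by auto
  thus ?case by (rule sing_module.sing_module_span)
next
  case (sing_module_add x y)
  thus ?case using act_vadd[OF preserves_ZZ[OF sing_module_add.prems]] sing_module_carrier by (auto intro: sing_module.sing_module_add)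
qed

lemma sing_module_scalar: 
  assumes u: "u \<in> ZZ" and s: "\<And>n x. x \<in> wspace n \<Longrightarrow> \<exists>c. act u x = fs c x" 
  shows "x \<in> sing_module k n0 \<Longrightarrow> act u x \<in> sing_module k n0"
proof (induction rule: sing_module.induct)
  case (sing_module_span n x)
  obtain c where "act u x = fs c x" using s[OF sing_span_wspace[OF sing_module_span]] by blast
  thus ?case using sing_span_fs[OF sing_module_span] by (auto intro: sing_module.sing_module_span)
next
  case (sing_module_add x y)
  thus ?case using act_vadd[OF u] sing_module_carrier by (auto intro: sing_module.sing_module_add)
qed

lemma preserves_all_RE: "oddpos a b \<Longrightarrow> preserves k n0 H (rt a b) (RE a b)"
  using raising_preserves[OF raising_X] preserves_lowering[OF lowering_X] by (cases "odd_rank a b \<le> k") auto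
lemma preserves_all_RF: "oddpos a b \<Longrightarrow> preserves k n0 H (rt b a) (RF a b)"
  using raising_preserves[OF raising_Y] preserves_lowering[OF lowering_Y] by (cases "odd_rank a b \<le> k") auto

lemma sing_module_eD: assumes "x \<in> sing_module k n0" "i \<in> {1..<r}" shows "act (eD i M) x \<in> sing_module k n0"
proof -
  consider "M = 0" | N where "i \<noteq> m" "M = Suc N" | "i = m" "M = 1" | "i = m" "1 < M" 
    by (metis One_nat_def Suc_lessI not0_implies_Suc not_gr_zero)
  thus ?thesis
  proof cases
    case 1 thus ?thesis using assms sing_module_carrier by (simp add: act_1)
  next
    case 2 thus ?thesis using sing_module_preserves[OF assms(1) raising_preserves[OF raising_e]] assms by simp
  next
    case 3
    have "oddpos m (Suc m)" using 3 assms by (auto simp: oddpos_def)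
    thus ?thesis using sing_module_preserves[OF assms(1) preserves_all_RE, of m "Suc m"] 3 by (simp add: eD_1)
  next
    case 4 thus ?thesis using eD_m[of M] assms sing_module_carrier by (auto simp: act_0 intro: sing_module_span[OF sing_span_0])
  qed
qed

lemma sing_module_fD: assumes "x \<in> sing_module k n0" "i \<in> {1..<r}" shows "act (fD i M) x \<in> sing_module k n0"
proof -
  consider "M = 0" | N where "i \<noteq> m" "M = Suc N" | "i = m" "M = 1" | "i = m" "1 < M" 
    by (metis One_nat_def Suc_lessI not0_implies_Suc not_gr_zero)
  thus ?thesis
  proof cases
    case 1 thus ?thesis using assms sing_module_carrier by (simp add: act_1)
  next
    case 2 thus ?thesis using sing_module_preserves[OF assms(1) preserves_lowering[OF lowering_f]] assms by simp
  next
    case 3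
    have "oddpos m (Suc m)" using 3 assms by (auto simp: oddpos_def)
    thus ?thesis using sing_module_preserves[OF assms(1) preserves_all_RF, of m "Suc m"] 3 by (simp add: fD_1)
  next
    case 4 thus ?thesis using fD_m[of M] assms sing_module_carrier by (auto simp: act_0 intro: sing_module_span[OF sing_span_0])
  qed
qed

lemma sing_module_comp: "x \<in> sing_module k n0 \<Longrightarrow> \<exists>y\<in>sing_module k n0 \<inter> mp 0. \<exists>z\<in>sing_module k n0 \<inter> mp 1. x = y \<oplus> z"
proof (induction rule: sing_module.induct)
  case (sing_module_span n x)
  obtain y z where "y \<in> mp 0" "z \<in> mp 1" "sing_span k n0 n y" "sing_span k n0 n z" "x = y \<oplus> z" using sing_span_comp[OF sing_module_span] by blast
  thus ?case by (intro bexI[of _ y] bexI[of _ z]) (auto intro: sing_module.sing_module_span)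
next
  case (sing_module_add x x')
  then obtain y z y' z' where o: "y \<in> sing_module k n0" "y \<in> mp 0" "z \<in> sing_module k n0" "z \<in> mp 1" "x = y \<oplus> z"
    "y' \<in> sing_module k n0" "y' \<in> mp 0" "z' \<in> sing_module k n0" "z' \<in> mp 1" "x' = y' \<oplus> z'" by blast
  have "x \<oplus> x' = (y \<oplus> y') \<oplus> (z \<oplus> z')" using o sing_module_carrier by (simp add: a_ac)
  thus ?case using o by (intro bexI[of _ "y \<oplus> y'"] bexI[of _ "z \<oplus> z'"]) (auto intro: sing_module.sing_module_add mp_add)
qed

text \<open>The sum is a graded submodule, since raising and lowering letters generate the algebra together with the
torus, which acts by scalars on each summand. Irreducibility does the rest.\<close>

lemma sing_module_all:
  assumes w: "w \<in> singular k n0" "w \<noteq> \<zero>"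
  shows "sing_module k n0 = carrier V"
proof -
  have "w \<in> sing_module k n0" using w by (auto intro: sing_module_span sing_span_base)
  moreover have "sing_module k n0 = {\<zero>} \<or> sing_module k n0 = carrier V"
  proof (rule irr)
    show "act (K a) x \<in> sing_module k n0" if "a \<in> {1..r}" "x \<in> sing_module k n0" for a x
      by (rule sing_module_scalar) (use that in \<open>auto simp: ZZ_K wspace_def\<close>)
    show "act (L a) x \<in> sing_module k n0" if "a \<in> {1..r}" "x \<in> sing_module k n0" for a x
      by (rule sing_module_scalar) (use that wspace_L in \<open>auto simp: ZZ_L\<close>)
    show "act (kB a 0 t) x \<in> sing_module k n0" if "a \<in> {1..r}" "x \<in> sing_module k n0" for a t x
      by (rule sing_module_scalar) (use that in \<open>auto simp: ZZ_kB wspace_def\<close>)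
  qed (auto simp: sing_module_carrier intro: sing_module_span[OF sing_span_0] sing_module_add sing_module_fs sing_module_comp sing_module_eD sing_module_fD)
  ultimately show ?thesis using w by auto
qed

lemma sep_comp: "sep n T \<Longrightarrow> sep n T' \<Longrightarrow> sep n (\<lambda>x. T (T' x))"
proof -
  assume T: "sep n T" "sep n T'"
  have "\<exists>c. T (T' x) = fs c x" if x: "x \<in> wspace n'" for n' x
  proof -
    obtain c where c: "T' x = fs c x" using T(2) x unfolding sep_def by blast
    obtain d where "T (fs c x) = fs d (fs c x)" using T(1) wspace_fs[OF x] unfolding sep_def by blast
    thus ?thesis unfolding c using fs_fs[OF wspace_carrier[OF x]] by auto
  qed
  thus ?thesis using T unfolding sep_def by auto
qed

text \<open>The component of weight \<open>n\<close> of a sum of weight vectors is cut out by a composition of the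
separating operators, one for each summand of another weight. Quantifying over a further operator
\<open>T'\<close> makes the induction on the number of summands work.\<close>

lemma sing_module_project: "y \<in> sing_module k n0 \<Longrightarrow> \<exists>T. sep n T \<and> (\<forall>T'. sep n T' \<longrightarrow> sing_span k n0 n (T (T' y)))"
proof (induction rule: sing_module.induct)
  case (sing_module_span n' s)
  have sc: "\<exists>c. T' s = fs c s" if "sep n T'" for T' using that sing_span_wspace[OF sing_module_span] unfolding sep_def by blast
  show ?case
  proof (cases "\<forall>a\<in>{1..r}. n a = n' a")
    case True
    have "sing_span k n0 n s" by (rule sing_span_eq[OF sing_module_span]) (use True in auto)
    hence "sing_span k n0 n (T' s)" if "sep n T'" for T' using sc[OF that] sing_span_fs by metis
    moreover have "\<exists>c. x = fs c x" if "x \<in> wspace n'" for x n'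
      using fs_1[OF wspace_carrier[OF that]] by metis
    hence "sep n (\<lambda>x. x)" by (auto simp: sep_def)
    ultimately show ?thesis by blast
  next
    case False
    then obtain a where a: "a \<in> {1..r}" "n a \<noteq> n' a" by blast
    obtain T where T: "sep n T" "\<forall>x\<in>wspace n'. T x = \<zero>" using separate[of a n n'] a by blast
    have "T (T' s) = \<zero>" if "sep n T'" for T' 
      using sc[OF that] T(2) wspace_fs[OF sing_span_wspace[OF sing_module_span]] by metis
    thus ?thesis using T(1) sing_span_0 by metis
  qed
next
  case (sing_module_add y s)
  then obtain T1 T2 where T: "sep n T1" "\<And>T'. sep n T' \<Longrightarrow> sing_span k n0 n (T1 (T' y))"
    "sep n T2" "\<And>T'. sep n T' \<Longrightarrow> sing_span k n0 n (T2 (T' s))" by blast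
  have "sing_span k n0 n (T1 (T2 (T' (y \<oplus> s))))" if T': "sep n T'" for T'
  proof -
    have c: "y \<in> carrier V" "s \<in> carrier V" using sing_module_add.hyps sing_module_carrier by auto
    have e: "T1 (T2 (T' (y \<oplus> s))) = T1 (T2 (T' y)) \<oplus> T1 (T2 (T' s))"
      using T(1,3) T' c unfolding sep_def by simp
    have 2: "sing_span k n0 n (T2 (T' s))" using T(4)[OF T'] .
    hence "T1 (T2 (T' s)) = T2 (T' s)" using T(1) sing_span_wspace unfolding sep_def by blast
    thus ?thesis unfolding e using T(2)[OF sep_comp[OF T(3) T']] 2 by (auto intro: sing_span_add)
  qed
  thus ?case using sep_comp[OF T(1,3)] by blast
qed

text \<open>An irreducible module with a nonzero singular vector of weight \<open>n0\<close> has all its weight vectors in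
the span of lowered singular vectors of weight \<open>n0\<close>: apply the projection to the vector itself.\<close>

theorem singular_generates:
  assumes w: "w \<in> singular k n0" "w \<noteq> \<zero>" and y: "y \<in> wspace n"
  shows "sing_span k n0 n y"
proof -
  have "y \<in> sing_module k n0" using sing_module_all[OF w] wspace_carrier[OF y] by simp
  then obtain T where T: "sep n T" "\<And>T'. sep n T' \<Longrightarrow> sing_span k n0 n (T (T' y))" using sing_module_project by blast
  have "T (T y) = y" using T(1) y unfolding sep_def by simp
  thus ?thesis using T(2)[OF T(1)] by simp
qed

text \<open>The space of weight \<open>n0\<close> is at the top height.\<close>

corollary singular_weight_space:
  assumes "w \<in> singular k n0" "w \<noteq> \<zero>" "y \<in> wspace n0"
  shows "y \<in> singular k n0"
  using sing_span_top[OF singular_generates[OF assms]] by (auto simp: singular_def wspace_0 killed_def act_zero raising_ZZ)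

corollary singular_max:
  assumes "w \<in> singular k n0" "w \<noteq> \<zero>" "y \<in> wspace n" "height k n > height k n0"
  shows "y = \<zero>"
  using sing_span_top[OF singular_generates[OF assms(1-3)]] assms(4) height_cong[of n n0 k] by auto

section \<open>Odd reflections\<close>

lemma odd_rank_inj: "oddpos a b \<Longrightarrow> oddpos c d \<Longrightarrow> odd_rank a b = odd_rank c d \<Longrightarrow> a = c \<and> b = d"
  using odd_rank_less[of a b c d] odd_rank_less[of c d a b] by auto

lemma act_RE_zero:
  assumes w: "w \<in> carrier V" and a: "1 \<le> a"
  shows "a < b \<Longrightarrow> b \<le> r \<Longrightarrow> (\<And>i. a \<le> i \<Longrightarrow> i < b \<Longrightarrow> act (E i) w = \<zero>) \<Longrightarrow> act (RE a b) w = \<zero>"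
proof (induction b)
  case (Suc b)
  have b: "b \<in> {1..<r}" and E: "act (E b) w = \<zero>" using Suc.prems a by auto
  show ?case
  proof (cases "a = b")
    case True thus ?thesis using E by simp
  next
    case False
    hence R: "RE a b \<in> ZZ" "act (RE a b) w = \<zero>" using Suc ZZ_RE a by auto
    have p: "act (RE a b * E b) w = \<zero>" "act (E b * RE a b) w = \<zero>"
      using R ZZ_E[OF b] E w by (simp_all add: act_mult act_zero)
    have "RE a (Suc b) = RE a b * E b - sc (va b powi -1) (E b * RE a b)"
      using False by (simp add: qc_def power_int_minus)
    thus ?thesis using R(1) ZZ_E[OF b] w p
      by (simp only: act_diff ZZ_mult ZZ_sc_va act_sc_va) (simp add: fs_zero)
  qed
qed simp

lemma killed_RE: "killed k x \<Longrightarrow> oddpos a b \<Longrightarrow> k < odd_rank a b \<Longrightarrow> act (RE a b) x = \<zero>"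
  using raising_X unfolding killed_def by blast
lemma killed_RF: "killed k x \<Longrightarrow> oddpos a b \<Longrightarrow> odd_rank a b \<le> k \<Longrightarrow> act (RF a b) x = \<zero>"
  using raising_Y unfolding killed_def by blast
lemma killed_eD: "killed k x \<Longrightarrow> i \<in> {1..<r} \<Longrightarrow> i \<noteq> m \<Longrightarrow> 0 < M \<Longrightarrow> act (eD i M) x = \<zero>"
  using raising_e[of i k "M - 1"] unfolding killed_def by auto

lemma killed_RE_even:
  assumes "killed k x" "x \<in> carrier V" "1 \<le> a" "a < b" "b \<le> r" "b \<le> m \<or> m < a"
  shows "act (RE a b) x = \<zero>"
  by (rule act_RE_zero[OF assms(2-5)]) (use assms killed_eD[of k x _ "Suc 0", unfolded eD_1] in auto)

lemma killedI:
  assumes "\<And>i M. i \<in> {1..<r} \<Longrightarrow> i \<noteq> m \<Longrightarrow> act (eD i (Suc M)) x = \<zero>"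
    "\<And>a b. oddpos a b \<Longrightarrow> k < odd_rank a b \<Longrightarrow> act (RE a b) x = \<zero>"
    "\<And>a b. oddpos a b \<Longrightarrow> odd_rank a b \<le> k \<Longrightarrow> act (RF a b) x = \<zero>"
  shows "killed k x"
  unfolding killed_def using assms by (auto elim!: raising.cases)

text \<open>Let \<open>(c, d)\<close> be the position of rank \<open>k + 1\<close>. Moving a raising letter of stage
\<open>k + 1\<close> past \<open>E\<^sub>-\<^sub>\<beta>\<close> produces error terms that end with an
operator killing \<open>x\<close>. For the even letters it is an even letter or a negative odd root vector,
whose rank is smaller because its chain is shorter.\<close>

lemma reflect_e:
  assumes s: "killed k x" "x \<in> carrier V" and c: "oddpos c d" "odd_rank c d = Suc k" and i: "i \<in> {1..<r}" "i \<noteq> m"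
  shows "act (eD i (Suc M)) (act (RF c d) x) = \<zero>"
proof -
  obtain e G where Z: "eD i (Suc M) * RF c d = RF c d * eD i (Suc M) + sc (v powi e) (G * eD i M)"
     "G = 0 \<or> (c < m \<and> i = c \<and> G = - ((L (Suc c) * K c) * RF (Suc c) d))
        \<or> (Suc m < d \<and> Suc i = d \<and> G = sc (v powi -1) ((K d * L (d - 1)) * RF c (d - 1)))"
    using eD_RF[OF i c(1)] by blast
  have o: "1 \<le> c" "c \<le> m" "m < d" "d \<le> r" using c by (auto simp: oddpos_def)
  have Yz: "act (RF a b) x = \<zero>" "RF a b \<in> ZZ" if "oddpos a b" "odd_rank a b < odd_rank c d" for a b
    using killed_RF[OF s(1)] that c(2) oddpos_RF[of a b] by auto
  have G: "G \<in> ZZ \<and> act G x = \<zero>"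
    using Z(2)
  proof (elim disjE conjE)
    assume a: "c < m" "i = c" "G = - ((L (Suc c) * K c) * RF (Suc c) d)"
    have o': "oddpos (Suc c) d" using a o by (simp add: oddpos_def)
    have z: "act (RF (Suc c) d) x = \<zero>" "RF (Suc c) d \<in> ZZ" using Yz[OF o'] odd_rank_less[OF o' c(1)] by auto
    have k: "L (Suc c) * K c \<in> ZZ" using a o by (intro ZZ_KL) auto
    show ?thesis unfolding a(3) using z k s(2)
      by (simp add: act_minus ZZ_mult ZZ_minus act_mult act_zero fs_zero)
  next
    assume a: "Suc m < d" "Suc i = d" "G = sc (v powi -1) ((K d * L (d - 1)) * RF c (d - 1))"
    have o': "oddpos c (d - 1)" using a o by (auto simp: oddpos_def)
    have z: "act (RF c (d - 1)) x = \<zero>" "RF c (d - 1) \<in> ZZ" using Yz[OF o'] odd_rank_less[OF o' c(1)] a by auto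
    have k: "K d * L (d - 1) \<in> ZZ" using a o by (intro ZZ_KL) auto
    have "act G x = \<zero>"
      unfolding a(3) act_sc[OF ZZ_mult[OF k z(2)] s(2)] act_mult[OF k z(2) s(2)] z(1) act_zero[OF k] fs_zero ..
    thus ?thesis unfolding a(3) using ZZ_sc[OF ZZ_mult[OF k z(2)]] by blast
  qed (simp add: ZZ_0 act_0 s(2))
  have e: "act (eD i (Suc M)) x = \<zero>" using killed_eD[OF s(1) i] by simp
  have e': "act (G * eD i M) x = \<zero>"
  proof (cases "M = 0")
    case True thus ?thesis using G by simp
  next
    case False thus ?thesis using killed_eD[OF s(1) i, of M] G s(2) i by (simp add: act_mult ZZ_eD act_zero)
  qed
  have R: "RF c d \<in> ZZ" using oddpos_RF[OF c(1)] by simp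
  have "act (eD i (Suc M)) (act (RF c d) x) = act (RF c d * eD i (Suc M) + sc (v powi e) (G * eD i M)) x"
    using Z(1) R i s(2) by (simp add: act_mult[symmetric] ZZ_eD)
  also have "\<dots> = \<zero>"
    using R i s(2) G e e' by (simp add: act_add ZZ_mult ZZ_sc ZZ_eD act_mult[OF R] act_sc act_zero fs_zero)
  finally show ?thesis .
qed

text \<open>Here the error term of the crossing case ends with a negative root vector in the column of
\<open>b < d\<close>, which has smaller rank; equal positions are settled by the vanishing of squares.\<close>

lemma reflect_Y:
  assumes s: "killed k x" "x \<in> carrier V" and c: "oddpos c d" "odd_rank c d = Suc k" and a: "oddpos a b" "odd_rank a b \<le> Suc k"
  shows "act (RF a b) (act (RF c d) x) = \<zero>"
proof -
  have o: "1 \<le> a" "a \<le> m" "m < b" "b \<le> r" "1 \<le> c" "c \<le> m" "m < d" "d \<le> r" using a c by (auto simp: oddpos_def)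
  have R: "RF a b \<in> ZZ" "RF c d \<in> ZZ" using oddpos_RF a c by auto
  have le: "b < d \<or> (b = d \<and> c \<le> a)" using odd_rank_le[OF a(1) c(1)] a c by simp
  have Yz: "act (RF a b) x = \<zero>" "RF a b \<in> ZZ" if "oddpos a b" "odd_rank a b < odd_rank c d" for a b
    using killed_RF[OF s(1)] that c(2) oddpos_RF[of a b] by auto
  have *: "act (RF a b) (act (RF c d) x) = act (RF a b * RF c d) x" using R s(2) by (simp add: act_mult)
  have com: "act (RF a b * RF c d) x = \<zero>" if "RF a b * RF c d = - sc (v powi j) (RF c d * RF a b)" "act (RF a b) x = \<zero>" for j
    unfolding that(1) using R s(2) that(2) by (simp add: act_minus ZZ_mult ZZ_sc act_sc act_mult act_zero fs_zero)
  have "act (RF a b * RF c d) x = \<zero>"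
  proof -
  consider "a = c" "b = d" | "d = b" "c < a" | "b < d" "a = c" | "b < d" "c < a" | "b < d" "a < c" using le by linarith
  thus ?thesis
  proof cases
    case 1 thus ?thesis using RF_sq[of a b] o s(2) by (simp add: act_0)
  next
    case 2
    have z: "act (RF a b) x = \<zero>" using Yz[OF a(1)] odd_rank_less[OF a(1) c(1)] 2 by simp
    show ?thesis by (rule com[of 1, OF _ z]) (use RF_RF_col[of c a b] o 2 in simp)
  next
    case 3
    have z: "act (RF a b) x = \<zero>" using Yz[OF a(1)] odd_rank_less[OF a(1) c(1)] 3 by simp
    have "RF a d * RF a b = - sc (inverse v) (RF a b * RF a d)" using RF_RF_row[of a b d] o 3 by simp
    hence "RF a b * RF c d = - sc (v powi 1) (RF c d * RF a b)"
      using 3 v0 by (simp add: sc_minus_right sc_sc)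
    thus ?thesis using com z by blast
  next
    case 4
    have z: "act (RF a b) x = \<zero>" using Yz[OF a(1)] odd_rank_less[OF a(1) c(1)] 4 by simp
    show ?thesis by (rule com[of 0, OF _ z]) (use RF_RF_nested[of c a b d] o 4 in simp)
  next
    case 5
    have oo: "oddpos a d" "oddpos c b" using o by (auto simp: oddpos_def)
    have z: "act (RF a b) x = \<zero>" "act (RF c b) x = \<zero>" "RF c b \<in> ZZ" "RF a d \<in> ZZ"
      using Yz[OF a(1)] Yz[OF oo(2)] odd_rank_less[OF a(1) c(1)] odd_rank_less[OF oo(2) c(1)] 5 oddpos_RF[OF oo(1)] by auto
    have "RF a b * RF c d = (sc (v powi -1) (RF a d * RF c b) - sc (v powi 1) (RF a d * RF c b)) - RF c d * RF a b"
      using RF_RF_cross[of a c b d] o 5 by (simp add: sc_diff_left power_int_minus algebra_simps)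
    thus ?thesis using z R s(2) by (simp only: act_diff act_sc act_mult ZZ_diff ZZ_sc ZZ_mult) (simp add: act_zero fs_zero)
  qed
  qed
  thus ?thesis unfolding * .
qed

text \<open>Here the error terms end with an even positive root vector.\<close>

lemma reflect_X:
  assumes s: "killed k x" "x \<in> carrier V" and c: "oddpos c d" "odd_rank c d = Suc k" and a: "oddpos a b" "Suc k < odd_rank a b"
  shows "act (RE a b) (act (RF c d) x) = \<zero>"
proof -
  have o: "1 \<le> a" "a \<le> m" "m < b" "b \<le> r" "1 \<le> c" "c \<le> m" "m < d" "d \<le> r" using a c by (auto simp: oddpos_def)
  have oi: "a \<in> {1..r}" "b \<in> {1..r}" "c \<in> {1..r}" "d \<in> {1..r}" using o by auto
  have R: "RE a b \<in> ZZ" "RF c d \<in> ZZ" using oddpos_RF oddpos_RE a c by auto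
  have le: "d < b \<or> (d = b \<and> a < c)" using odd_rank_less[OF c(1) a(1)] a c by simp
  have X: "act (RE a b) x = \<zero>" using killed_RE[OF s(1) a(1)] a(2) by simp
  note even = killed_RE_even[OF s]
  have main: ?thesis if G: "RE a b * RF c d = - (RF c d * RE a b) + P * Q" and P: "P \<in> ZZ" and Q: "Q \<in> ZZ" "act Q x = \<zero>" for P Q
  proof -
    have "act (RE a b) (act (RF c d) x) = act (- (RF c d * RE a b) + P * Q) x" using R s(2) G by (simp add: act_mult[symmetric])
    thus ?thesis using R s(2) X P Q by (simp add: act_diff act_mult ZZ_mult act_zero fs_zero)
  qed
  consider "a = c" "d < b" | "b = d" "a < c" | "a < c" "d < b" | "c < a" "d < b" using le by linarith
  thus ?thesis
  proof cases
    case 1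
    show ?thesis by (rule main[of "sc (v powi 1) (K d * L a)" "RE d b"])
      (use RF_RE_row[of a d b] o 1 ZZ_RE[of d b] even[of d b] ZZ_sc[OF ZZ_KL(1)[OF oi(4,1)], of 1] in \<open>simp_all add: mult_sc_left\<close>)
  next
    case 2
    show ?thesis by (rule main[of "L b * K c" "RE a c"])
      (use RF_RE_col[of a c b] o 2 ZZ_RE[of a c] even[of a c] ZZ_KL(2)[OF oi(2,3)] in simp_all)
  next
    case 3
    show ?thesis by (rule main[of 0 0]) (use RE_RF_nested[of a c d b] o 3 s(2) in \<open>simp_all add: ZZ_0 act_0\<close>)
  next
    case 4
    let ?P = "RF c a * (K d * L a)"
    have P: "?P \<in> ZZ" using o 4 oi ZZ_RF[of c a] by (intro ZZ_mult ZZ_K ZZ_L) auto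
    show ?thesis by (rule main[of "?P - sc (v powi 2) ?P" "RE d b"])
      (use RE_RF_cross[of c a d b] o 4 ZZ_RE[of d b] even[of d b] P ZZ_diff[OF P ZZ_sc[OF P, of 2]] in 
       \<open>simp_all add: mult_sc_left left_diff_distrib sc_diff_left power2_eq_square\<close>)
  qed
qed

text \<open>The vector \<open>?w\<close> is killed by all raising letters of the new stage, and applying the positive root
vector to it gives back \<open>u\<close> up to the factor of \<open>act_kap\<close>. If the factor vanishes,
\<open>?w\<close> is singular of the old stage with a smaller height than \<open>u\<close>, which is
impossible unless \<open>?w = 0\<close> by \<open>singular_max\<close>.\<close>

theorem odd_reflection:
  assumes u: "u \<in> singular k n" "u \<noteq> \<zero>" and c: "oddpos c d" "odd_rank c d = Suc k"
  shows "q powi (n c + n d) \<noteq> q powi (- (n c + n d)) \<Longrightarrow>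
      act (RF c d) u \<in> singular (Suc k) (\<lambda>i. n i + rt d c i) \<and> act (RF c d) u \<noteq> \<zero>"
    and "q powi (n c + n d) = q powi (- (n c + n d)) \<Longrightarrow> u \<in> singular (Suc k) n"
proof -
  have s: "killed k u" "u \<in> carrier V" "u \<in> wspace n" using u wspace_carrier by (auto simp: singular_def)
  have R: "RE c d \<in> ZZ" "RF c d \<in> ZZ" using oddpos_RE oddpos_RF c by auto
  let ?w = "act (RF c d) u" and ?n = "\<lambda>i. n i + rt d c i"
  have w: "killed (Suc k) ?w"
    by (rule killedI) (use reflect_e[OF s(1,2) c] reflect_X[OF s(1,2) c] reflect_Y[OF s(1,2) c] in auto)
  have wv: "?w \<in> wspace ?n" using wspace_act[of "RF c d" "rt d c" u n] oddpos_RF[OF c(1)] s(3) by simp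
  have X: "act (RE c d) u = \<zero>" using killed_RE[OF s(1) c(1)] c(2) by simp
  have o: "1 \<le> c" "c \<le> m" "m < d" "d \<le> r" using c by (auto simp: oddpos_def)
  have D: "act (RE c d) ?w = fs ((q powi (n c + n d) - q powi (- (n c + n d))) / (q - inverse q)) u"
  proof -
    have "act (RE c d) ?w = act (- (RF c d * RE c d) + sc dl (kap c d)) u"
      using RE_RF_eq[OF o] R s(2) by (simp add: act_mult[symmetric])
    also have "\<dots> = act (sc dl (kap c d)) u"
      using R s(2) X act_kap(1)[OF c(1) s(3)] by (simp add: act_diff act_mult ZZ_mult act_zero fs_zero act_closed)
    finally show ?thesis using act_kap(2)[OF c(1) s(3)] by simp
  qed
  {
    assume ne: "q powi (n c + n d) \<noteq> q powi (- (n c + n d))"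
    have "?w \<noteq> \<zero>"
    proof
      assume "?w = \<zero>"
      hence "fs ((q powi (n c + n d) - q powi (- (n c + n d))) / (q - inverse q)) u = \<zero>"
        using D act_zero[OF R(1)] by simp
      moreover have "(q powi (n c + n d) - q powi (- (n c + n d))) / (q - inverse q) \<noteq> 0"
        unfolding divide_eq_0_iff using ne q2 by (simp only: right_minus_eq) simp
      ultimately show False using fs_eq_0[OF s(2)] u(2) by blast
    qed
    thus "?w \<in> singular (Suc k) ?n \<and> ?w \<noteq> \<zero>" using w wv by (simp add: singular_def)
  next
    assume eq: "q powi (n c + n d) = q powi (- (n c + n d))"
    have X0: "act (RE c d) ?w = \<zero>" unfolding D eq using s(2) by (simp add: fs_0)
    have wk: "killed k ?w"
    proof (rule killedI)
      fix a b assume a: "oddpos a b" "k < odd_rank a b"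
      show "act (RE a b) ?w = \<zero>"
      proof (cases "odd_rank a b = Suc k")
        case True thus ?thesis using odd_rank_inj[OF a(1) c(1)] c(2) X0 by simp
      next
        case False thus ?thesis using killed_RE[OF w a(1)] a(2) by simp
      qed
    next
      fix a b assume a: "oddpos a b" "odd_rank a b \<le> k"
      show "act (RF a b) ?w = \<zero>" using killed_RF[OF w a(1)] a(2) by simp
    qed (use killed_eD[OF w] in auto)
    have "?w = \<zero>"
    proof (rule ccontr)
      assume ne: "?w \<noteq> \<zero>"
      \<comment> \<open>the root of rank \<open>k + 1\<close> has height 1 at stage \<open>k\<close>\<close>
      have "height k n > height k ?n" unfolding height_add using height_odd'[OF c(1), of k] c(2) by simp
      moreover have "?w \<in> singular k ?n" using wk wv by (simp add: singular_def)
      ultimately have "u = \<zero>" using singular_max[OF _ ne s(3)] by blast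
      thus False using u(2) by simp
    qed
    have "killed (Suc k) u"
    proof (rule killedI)
      fix a b assume a: "oddpos a b" "odd_rank a b \<le> Suc k"
      show "act (RF a b) u = \<zero>"
      proof (cases "odd_rank a b = Suc k")
        case True thus ?thesis using odd_rank_inj[OF a(1) c(1)] c(2) \<open>?w = \<zero>\<close> by simp
      next
        case False thus ?thesis using killed_RF[OF s(1) a(1)] a(2) by simp
      qed
    qed (use killed_eD[OF s(1)] killed_RE[OF s(1)] in auto)
    thus "u \<in> singular (Suc k) n" using s(3) by (simp add: singular_def)
  }
qed

end

section \<open>Tensor products\<close>

lemma frag_diff_keys: "Poly_Mapping.keys a \<subseteq> S \<Longrightarrow> Poly_Mapping.keys b \<subseteq> S \<Longrightarrow> Poly_Mapping.keys (a - b) \<subseteq> S"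
  for a b :: "'a \<Rightarrow>\<^sub>0 int" using keys_diff[of a b] by blast
lemma frag_add_keys: "Poly_Mapping.keys a \<subseteq> S \<Longrightarrow> Poly_Mapping.keys b \<subseteq> S \<Longrightarrow> Poly_Mapping.keys (a + b) \<subseteq> S"
  for a b :: "'a \<Rightarrow>\<^sub>0 int" using keys_add[of a b] by blast

lemma frag_extend_add': "frag_extend (\<lambda>a. F a + G a) x = frag_extend F x + frag_extend G x"
  by (induction x rule: frag_induction[OF subset_UNIV]) (simp_all add: frag_extend_diff)

lemma frag_extend_minus': "frag_extend (\<lambda>a. - F a) x = - frag_extend F x"
  by (induction x rule: frag_induction[OF subset_UNIV]) (simp_all add: frag_extend_diff)

text \<open>Induction with sums and negatives instead of differences, which suits biadditive maps.\<close>

lemma free_add_induct [consumes 1, case_names zero add minus gen]: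
  assumes "Poly_Mapping.keys x \<subseteq> S" "P 0"
    and "\<And>x y. Poly_Mapping.keys x \<subseteq> S \<Longrightarrow> Poly_Mapping.keys y \<subseteq> S \<Longrightarrow> P x \<Longrightarrow> P y \<Longrightarrow> P (x + y)"
    and "\<And>x. Poly_Mapping.keys x \<subseteq> S \<Longrightarrow> P x \<Longrightarrow> P (- x)" and "\<And>a. a \<in> S \<Longrightarrow> P (frag_of a)"
  shows "P x"
  using assms(1)
proof (rule free_Abelian_group_induct)
  fix x y assume a: "Poly_Mapping.keys x \<subseteq> S" "Poly_Mapping.keys y \<subseteq> S" "P x" "P y"
  have "P (x + - y)" using a by (intro assms(3,4)) auto
  thus "P (x - y)" by simp
qed (use assms in auto)

text \<open>The closure conditions that make the set of relations a subset of the free abelian group.\<close>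

locale tensor =
  fixes M :: "('a, 'c) ring_scheme" and N :: "('b, 'd) ring_scheme" and R :: "'r set"
    and ra :: "'a \<Rightarrow> 'r \<Rightarrow> 'a" and la :: "'r \<Rightarrow> 'b \<Rightarrow> 'b"
  assumes Madd: "\<And>x y. x \<in> carrier M \<Longrightarrow> y \<in> carrier M \<Longrightarrow> x \<oplus>\<^bsub>M\<^esub> y \<in> carrier M"
    and Nadd: "\<And>x y. x \<in> carrier N \<Longrightarrow> y \<in> carrier N \<Longrightarrow> x \<oplus>\<^bsub>N\<^esub> y \<in> carrier N"
    and ra: "\<And>x r. x \<in> carrier M \<Longrightarrow> r \<in> R \<Longrightarrow> ra x r \<in> carrier M"
    and la: "\<And>y r. y \<in> carrier N \<Longrightarrow> r \<in> R \<Longrightarrow> la r y \<in> carrier N"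
begin

abbreviation "S \<equiv> carrier M \<times> carrier N"
abbreviation "FG \<equiv> free_Abelian_group S"
abbreviation "FK \<equiv> tensor_ker M N R ra la"
abbreviation "cl \<equiv> tensor_class M N R ra la"
abbreviation "TG \<equiv> tensor_group M N R ra la"
abbreviation frel where "frel \<equiv> tensor_rels M N R ra la"

lemma frel_keys: "c \<in> frel \<Longrightarrow> Poly_Mapping.keys c \<subseteq> S"
  unfolding tensor_rels_def
  by (elim UnE CollectE exE conjE; simp; intro frag_diff_keys) (auto simp: Madd Nadd ra la)

lemma frel_sub: "frel \<subseteq> carrier FG" using frel_keys by auto

lemma ker_subgroup: "subgroup FK FG"
  unfolding tensor_ker_def by (rule group.generate_is_subgroup[OF group_free_Abelian_group frel_sub])

lemma ker_keys: "c \<in> FK \<Longrightarrow> Poly_Mapping.keys c \<subseteq> S"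
  using subsetD[OF subgroup.subset[OF ker_subgroup], of c] unfolding carrier_free_Abelian_group_iff .
lemma ker_0: "0 \<in> FK" using subgroup.one_closed[OF ker_subgroup] by simp
lemma ker_add: "c \<in> FK \<Longrightarrow> d \<in> FK \<Longrightarrow> c + d \<in> FK" using subgroup.m_closed[OF ker_subgroup] by simp
lemma ker_minus: "c \<in> FK \<Longrightarrow> - c \<in> FK" using subgroup.m_inv_closed[OF ker_subgroup, of c] ker_keys[of c] by simp
lemma ker_rel: "c \<in> frel \<Longrightarrow> c \<in> FK" unfolding tensor_ker_def by (rule generate.incl)

lemma ker_induct [consumes 1, case_names zero add minus rel]:
  assumes "c \<in> FK" "P 0" "\<And>x y. x \<in> FK \<Longrightarrow> y \<in> FK \<Longrightarrow> P x \<Longrightarrow> P y \<Longrightarrow> P (x + y)" "\<And>x. x \<in> FK \<Longrightarrow> P x \<Longrightarrow> P (- x)" "\<And>x. x \<in> frel \<Longrightarrow> P x"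
  shows "P c"
  using assms(1) unfolding tensor_ker_def
proof (induction rule: generate.induct)
  case (inv h) thus ?case using assms(4,5) frel_keys ker_rel by simp
next
  case (eng x y) thus ?case using assms(3) unfolding tensor_ker_def by simp
qed (use assms in simp_all)

lemma cl_image: "cl c = (\<lambda>h. h + c) ` FK"
  unfolding tensor_class_def r_coset_def by auto

lemma cl_self: "c \<in> cl c" unfolding cl_image using ker_0 by force

lemma cl_subI: assumes "c - d \<in> FK" shows "cl c \<subseteq> cl d"
  unfolding cl_image
proof (rule image_subsetI)
  fix h assume "h \<in> FK"
  with assms have "h + (c - d) \<in> FK" by (simp add: ker_add)
  thus "h + c \<in> (\<lambda>h. h + d) ` FK" by (intro image_eqI[of _ _ "h + (c - d)"]) simp_all
qed

lemma cl_eqI: "c - d \<in> FK \<Longrightarrow> cl c = cl d"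
  using cl_subI[of c d] cl_subI[of d c] ker_minus[of "c - d"] by auto

lemma cl_mem: "d \<in> cl c \<Longrightarrow> d - c \<in> FK" unfolding cl_image by auto

lemma ker_normal: "FK \<lhd> FG"
  using comm_group.normal_iff_subgroup[OF abelian_free_Abelian_group] ker_subgroup by blast

lemma TG_carrier: "carrier TG = cl ` {c. Poly_Mapping.keys c \<subseteq> S}"
  unfolding tensor_group_def carrier_FactGroup tensor_class_def[abs_def] by auto

lemma cl_carrier: "Poly_Mapping.keys c \<subseteq> S \<Longrightarrow> cl c \<in> carrier TG" unfolding TG_carrier by blast

lemma cl_add: "Poly_Mapping.keys c \<subseteq> S \<Longrightarrow> Poly_Mapping.keys d \<subseteq> S \<Longrightarrow> cl c \<otimes>\<^bsub>TG\<^esub> cl d = cl (c + d)"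
  unfolding tensor_group_def tensor_class_def mult_FactGroup using normal.rcos_sum[OF ker_normal, of c d] by simp

lemma TG_one: "\<one>\<^bsub>TG\<^esub> = cl 0"
  unfolding cl_image unfolding tensor_group_def by simp

lemma rel_addM: "x \<in> carrier M \<Longrightarrow> x' \<in> carrier M \<Longrightarrow> y \<in> carrier N \<Longrightarrow>
    cl (frag_of (x \<oplus>\<^bsub>M\<^esub> x', y)) = cl (frag_of (x, y)) \<otimes>\<^bsub>TG\<^esub> cl (frag_of (x', y))"
proof -
  assume a: "x \<in> carrier M" "x' \<in> carrier M" "y \<in> carrier N"
  have "frag_of (x \<oplus>\<^bsub>M\<^esub> x', y) - frag_of (x, y) - frag_of (x', y) \<in> frel" unfolding tensor_rels_def using a by blast
  thus ?thesis using a by (subst cl_add) (auto simp: diff_diff_eq intro!: cl_eqI ker_rel)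
qed

lemma rel_addN: "x \<in> carrier M \<Longrightarrow> y \<in> carrier N \<Longrightarrow> y' \<in> carrier N \<Longrightarrow>
    cl (frag_of (x, y \<oplus>\<^bsub>N\<^esub> y')) = cl (frag_of (x, y)) \<otimes>\<^bsub>TG\<^esub> cl (frag_of (x, y'))"
proof -
  assume a: "x \<in> carrier M" "y \<in> carrier N" "y' \<in> carrier N"
  have "frag_of (x, y \<oplus>\<^bsub>N\<^esub> y') - frag_of (x, y) - frag_of (x, y') \<in> frel" unfolding tensor_rels_def using a by blast
  thus ?thesis using a by (subst cl_add) (auto simp: diff_diff_eq intro!: cl_eqI ker_rel)
qed

lemma rel_bal: "x \<in> carrier M \<Longrightarrow> y \<in> carrier N \<Longrightarrow> r \<in> R \<Longrightarrow> cl (frag_of (ra x r, y)) = cl (frag_of (x, la r y))"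
  by (rule cl_eqI[OF ker_rel]) (unfold tensor_rels_def, blast)

end

section \<open>The generic quantum supergroup as a ring\<close>

lemma ring_transfer:
  assumes R: "ring R" and e: "carrier R' = carrier R" "monoid.mult R' = monoid.mult R" "monoid.one R' = monoid.one R" "ring.zero R' = ring.zero R" "ring.add R' = ring.add R"
  shows "ring R'"
proof -
  interpret R: ring R by (rule R)
  show ?thesis
  proof (rule ringI)
    show "abelian_group R'"
    proof (rule abelian_groupI)
      fix x assume "x \<in> carrier R'"
      thus "\<exists>y\<in>carrier R'. y \<oplus>\<^bsub>R'\<^esub> x = \<zero>\<^bsub>R'\<^esub>"
        unfolding e by (intro bexI[of _ "\<ominus>\<^bsub>R\<^esub> x"]) (simp_all add: R.l_neg)
    qed (simp_all add: e R.add.m_ac)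
    show "monoid R'" by (rule monoidI) (simp_all add: e R.m_assoc)
  qed (simp_all add: e R.l_distr R.r_distr)
qed

lemma free_carrier: "x \<in> carrier (free_alg m n) \<longleftrightarrow> (\<forall>w\<in>Poly_Mapping.keys x. set (letters w) \<subseteq> gens m n)"
  by (simp add: free_alg_def)

lemma free_ops [simp]: "monoid.mult (free_alg m n) = (*)" "ring.add (free_alg m n) = (+)"
  "ring.zero (free_alg m n) = 0" "monoid.one (free_alg m n) = 1"
  by (simp_all add: free_alg_def ring_of_type_algebra_def)

lemma free_1: "1 \<in> carrier (free_alg m n)"
  by (auto simp: free_carrier zero_gword_def)

lemma free_0: "0 \<in> carrier (free_alg m n)" by (simp add: free_carrier)

lemma free_add: "x \<in> carrier (free_alg m n) \<Longrightarrow> y \<in> carrier (free_alg m n) \<Longrightarrow> x + y \<in> carrier (free_alg m n)"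
  using keys_add[of x y] unfolding free_carrier by blast

lemma free_diff: "x \<in> carrier (free_alg m n) \<Longrightarrow> y \<in> carrier (free_alg m n) \<Longrightarrow> x - y \<in> carrier (free_alg m n)"
  using keys_diff[of x y] unfolding free_carrier by blast

lemma free_minus: "x \<in> carrier (free_alg m n) \<Longrightarrow> - x \<in> carrier (free_alg m n)"
  unfolding free_carrier by simp

lemma free_mult: "x \<in> carrier (free_alg m n) \<Longrightarrow> y \<in> carrier (free_alg m n) \<Longrightarrow> x * y \<in> carrier (free_alg m n)"
  using keys_mult[of x y] unfolding free_carrier plus_gword_def by fastforce

lemma free_scal: "scal c \<in> carrier (free_alg m n)"
  by (auto simp: free_carrier scal_def zero_gword_def split: if_splits)

lemma free_letter: "g \<in> gens m n \<Longrightarrow> letter g \<in> carrier (free_alg m n)"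
  by (auto simp: free_carrier letter_def)

lemma free_E: "i \<in> {1..<m+n} \<Longrightarrow> xE i \<in> carrier (free_alg m n)"
  and free_F: "i \<in> {1..<m+n} \<Longrightarrow> xF i \<in> carrier (free_alg m n)"
  and free_K: "j \<in> {1..m+n} \<Longrightarrow> xK j \<in> carrier (free_alg m n)"
  and free_L: "j \<in> {1..m+n} \<Longrightarrow> xL j \<in> carrier (free_alg m n)"
  by (auto intro!: free_letter simp: gens_def)

lemma free_pow: "x \<in> carrier (free_alg m n) \<Longrightarrow> x ^ k \<in> carrier (free_alg m n)"
  by (induction k) (auto intro: free_1 free_mult)

lemmas free_intros = free_1 free_0 free_add free_diff free_minus free_mult free_scal free_E free_F free_K free_L free_pow

lemma ring_free: "ring (free_alg m n)"
proof (rule ringI)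
  show "abelian_group (free_alg m n)"
  proof (rule abelian_groupI)
    fix x assume "x \<in> carrier (free_alg m n)"
    thus "\<exists>y\<in>carrier (free_alg m n). y \<oplus>\<^bsub>free_alg m n\<^esub> x = \<zero>\<^bsub>free_alg m n\<^esub>"
      by (intro bexI[of _ "- x"]) (auto intro: free_minus)
  qed (auto intro: free_intros simp: algebra_simps)
  show "monoid (free_alg m n)" by (rule monoidI) (auto intro: free_intros simp: algebra_simps)
qed (auto simp: algebra_simps)

lemma scal_0: "scal 0 = 0" and scal_1: "scal 1 = 1" and scal_add: "scal (c + d) = scal c + scal d"
  and scal_mult: "scal c * scal d = scal (c * d)"
  by (simp_all add: scal_def single_add mult_single)

lemma scal_central: "scal c * x = x * scal c"
proof (induction x rule: update_induct)
  case (update f a b)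
  have "Poly_Mapping.update a b f = f + Poly_Mapping.single a b"
    using update(1) by (intro poly_mapping_eqI) (auto simp: lookup_update lookup_add lookup_single in_keys_iff when_def)
  thus ?case using update(3) by (simp add: distrib_left distrib_right scal_def mult_single mult.commute)
qed simp

lemma rels_free: "rels m n \<subseteq> carrier (free_alg m n)"
proof -
  have oe: "oddE m \<in> carrier (free_alg m n)" "oddF m \<in> carrier (free_alg m n)" if "2 \<le> m" "2 \<le> n"
    unfolding oddE_def oddF_def using that by (intro free_intros; auto)+
  have ite: "x \<in> C \<Longrightarrow> y \<in> C \<Longrightarrow> (if b then x else y) \<in> C" for x y :: falg and C b by simp
  have sgn: "(if b then 1 else - 1) \<in> carrier (free_alg m n)" for b by (intro ite free_minus free_1)
  have odd: "scomm 1 1 x y \<in> carrier (free_alg m n)"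
    if "x \<in> carrier (free_alg m n)" "y \<in> carrier (free_alg m n)" for x y
    unfolding scomm_def by (intro free_diff free_mult sgn that)
  show ?thesis unfolding rels_def scomm_def[of "gen_par m _"]
  proof (intro Un_least)
    show "(if 1 \<le> m \<and> 1 \<le> n then {xE m ^ 2, xF m ^ 2} else {}) \<subseteq> carrier (free_alg m n)"
      using free_pow[OF free_E[of m m n], of 2] free_pow[OF free_F[of m m n], of 2] by auto
    show "(if 2 \<le> m \<and> 2 \<le> n then {scomm 1 1 (xE m) (oddE m), scomm 1 1 (xF m) (oddF m)} else {}) \<subseteq> carrier (free_alg m n)"
      using odd[OF free_E[of m m n] oe(1)] odd[OF free_F[of m m n] oe(2)] by auto
  qed (rule subsetI, elim CollectE exE conjE, hypsubst, intro free_add free_diff free_mult free_scal free_pow sgn ite free_0 free_1 free_E free_F free_K free_L; simp; fail)+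
qed

lemma ideal_rel: "ideal (rel_ideal m n) (free_alg m n)"
  unfolding rel_ideal_def by (rule ring.genideal_ideal[OF ring_free rels_free])

lemma rel_in: "x \<in> rels m n \<Longrightarrow> x \<in> rel_ideal m n"
  unfolding rel_ideal_def using ring.genideal_self[OF ring_free rels_free] by blast

lemma Uups_ops: "carrier (Uups m n) = carrier (free_alg m n Quot rel_ideal m n)"
  "monoid.mult (Uups m n) = monoid.mult (free_alg m n Quot rel_ideal m n)"
  "monoid.one (Uups m n) = monoid.one (free_alg m n Quot rel_ideal m n)"
  "ring.zero (Uups m n) = ring.zero (free_alg m n Quot rel_ideal m n)"
  "ring.add (Uups m n) = ring.add (free_alg m n Quot rel_ideal m n)"
  by (simp_all add: Uups_def ring.extend_def)

lemma ring_Uups: "ring (Uups m n)"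
  by (rule ring_transfer[OF ideal.quotient_is_ring[OF ideal_rel[of m n]]]) (simp_all add: Uups_ops)

interpretation U: ring "Uups m n" for m n by (rule ring_Uups)

lemma cls_hom: "cls m n \<in> ring_hom (free_alg m n) (Uups m n)"
  using ideal.rcos_ring_hom[OF ideal_rel[of m n]] unfolding ring_hom_def cls_def[abs_def] by (simp add: Uups_ops)

lemma cls_carrier: "x \<in> carrier (free_alg m n) \<Longrightarrow> cls m n x \<in> carrier (Uups m n)"
  and cls_mult: "x \<in> carrier (free_alg m n) \<Longrightarrow> y \<in> carrier (free_alg m n) \<Longrightarrow> cls m n (x * y) = cls m n x \<otimes>\<^bsub>Uups m n\<^esub> cls m n y"
  and cls_add: "x \<in> carrier (free_alg m n) \<Longrightarrow> y \<in> carrier (free_alg m n) \<Longrightarrow> cls m n (x + y) = cls m n x \<oplus>\<^bsub>Uups m n\<^esub> cls m n y"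
  and cls_1: "cls m n 1 = \<one>\<^bsub>Uups m n\<^esub>"
  using ring_hom_closed[OF cls_hom] ring_hom_mult[OF cls_hom] ring_hom_add[OF cls_hom] ring_hom_one[OF cls_hom]
  by simp_all

lemma cls_0: "cls m n 0 = \<zero>\<^bsub>Uups m n\<^esub>"
  using cls_add[OF free_0 free_0, of m n] cls_carrier[OF free_0, of m n] U.r_neg1 by (metis U.add.r_cancel_one' add.right_neutral)

lemma cls_minus: "x \<in> carrier (free_alg m n) \<Longrightarrow> cls m n (- x) = \<ominus>\<^bsub>Uups m n\<^esub> cls m n x"
  using cls_add[of x m n "-x"] cls_carrier[of x m n] cls_carrier[OF free_minus, of x m n] cls_0[of m n]
  by (metis U.minus_equality U.a_comm free_minus right_minus)

lemma cls_diff: "x \<in> carrier (free_alg m n) \<Longrightarrow> y \<in> carrier (free_alg m n) \<Longrightarrow> cls m n (x - y) = cls m n x \<ominus>\<^bsub>Uups m n\<^esub> cls m n y"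
  using cls_add[of x m n "-y"] cls_minus[of y m n] free_minus[of y m n] unfolding a_minus_def by simp

lemma cls_surj: "u \<in> carrier (Uups m n) \<Longrightarrow> \<exists>x\<in>carrier (free_alg m n). u = cls m n x"
  by (auto simp: Uups_ops FactRing_def A_RCOSETS_def RCOSETS_def cls_def a_r_coset_def)

lemma cls_rel: "x - y \<in> rels m n \<Longrightarrow> x \<in> carrier (free_alg m n) \<Longrightarrow> y \<in> carrier (free_alg m n) \<Longrightarrow> cls m n x = cls m n y"
proof -
  assume a: "x - y \<in> rels m n" and xy: "x \<in> carrier (free_alg m n)" "y \<in> carrier (free_alg m n)"
  have z: "cls m n (x - y) = \<zero>\<^bsub>Uups m n\<^esub>"
    unfolding cls_def using ring.a_rcos_zero[OF ring_free ideal_rel rel_in[OF a]]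
    by (simp add: Uups_ops FactRing_def)
  have "cls m n x = cls m n ((x - y) + y)" by simp
  also have "\<dots> = cls m n y" unfolding cls_add[OF free_diff[OF xy] xy(2)] z using cls_carrier[OF xy(2)] by simp
  finally show ?thesis .
qed

text \<open>The generic quantum supergroup is a ring on a carrier set that depends on \<open>m\<close> and
\<open>n\<close>. The product of all these rings is a type of class \<open>ring\<close>, on which the previous
sections can be used; an element is described by its component at the given \<open>(m, n)\<close>, and the
other components are chosen such that all relations hold there trivially.\<close>

typedef uall = "{f. \<forall>m n. f m n \<in> carrier (Uups m n)}" morphisms proj Uall
  by (rule exI[of _ "\<lambda>m n. \<zero>\<^bsub>Uups m n\<^esub>"]) simp

lemma proj_carrier [simp]: "proj u m n \<in> carrier (Uups m n)"
  using proj by blast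

lemma proj_Uall: "(\<And>m n. f m n \<in> carrier (Uups m n)) \<Longrightarrow> proj (Uall f) m n = f m n"
  by (simp add: Uall_inverse)

lemma uall_eqI: "(\<And>m n. proj u m n = proj w m n) \<Longrightarrow> u = w"
  by (simp add: proj_inject[symmetric] ext)

instantiation uall :: "{ring,monoid_mult}"
begin
definition "0 = Uall (\<lambda>m n. \<zero>\<^bsub>Uups m n\<^esub>)"
definition "1 = Uall (\<lambda>m n. \<one>\<^bsub>Uups m n\<^esub>)"
definition "u + w = Uall (\<lambda>m n. proj u m n \<oplus>\<^bsub>Uups m n\<^esub> proj w m n)"
definition "u - w = Uall (\<lambda>m n. proj u m n \<ominus>\<^bsub>Uups m n\<^esub> proj w m n)"
definition "- u = Uall (\<lambda>m n. \<ominus>\<^bsub>Uups m n\<^esub> proj u m n)"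
definition "u * w = Uall (\<lambda>m n. proj u m n \<otimes>\<^bsub>Uups m n\<^esub> proj w m n)"

lemma proj_0: "proj 0 m n = \<zero>\<^bsub>Uups m n\<^esub>" unfolding zero_uall_def by (rule proj_Uall) simp
lemma proj_1: "proj 1 m n = \<one>\<^bsub>Uups m n\<^esub>" unfolding one_uall_def by (rule proj_Uall) simp
lemma proj_add: "proj (u + w) m n = proj u m n \<oplus>\<^bsub>Uups m n\<^esub> proj w m n" unfolding plus_uall_def by (rule proj_Uall) simp
lemma proj_diff: "proj (u - w) m n = proj u m n \<ominus>\<^bsub>Uups m n\<^esub> proj w m n" unfolding minus_uall_def by (rule proj_Uall) simp
lemma proj_minus: "proj (- u) m n = \<ominus>\<^bsub>Uups m n\<^esub> proj u m n" unfolding uminus_uall_def by (rule proj_Uall) simp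
lemma proj_mult: "proj (u * w) m n = proj u m n \<otimes>\<^bsub>Uups m n\<^esub> proj w m n" unfolding times_uall_def by (rule proj_Uall) simp

instance
  by standard (auto intro!: uall_eqI simp: proj_0 proj_1 proj_add proj_diff proj_minus proj_mult
      U.add.m_ac U.m_assoc U.l_distr U.r_distr U.r_neg a_minus_def)

end

lemmas proj_simps = proj_0 proj_1 proj_add proj_diff proj_minus proj_mult

definition usc :: "qv \<Rightarrow> uall \<Rightarrow> uall" where
  "usc c u = Uall (\<lambda>m n. cls m n (scal c) \<otimes>\<^bsub>Uups m n\<^esub> proj u m n)"

lemma proj_usc: "proj (usc c u) m n = cls m n (scal c) \<otimes>\<^bsub>Uups m n\<^esub> proj u m n"
  unfolding usc_def by (rule proj_Uall) (simp add: cls_carrier free_scal)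

lemma cls_scal_central: "u \<in> carrier (Uups m n) \<Longrightarrow> u \<otimes>\<^bsub>Uups m n\<^esub> cls m n (scal c) = cls m n (scal c) \<otimes>\<^bsub>Uups m n\<^esub> u"
  using cls_surj[of u m n] cls_mult[OF free_scal, of _ m n c] cls_mult[OF _ free_scal, of _ m n c] scal_central[of c]
  by auto

lemma sc_algebra_usc: "sc_algebra usc"
proof
  fix c d :: qv and x y :: uall
  have s: "cls m n (scal c) \<in> carrier (Uups m n)" for c m n by (simp add: cls_carrier free_scal)
  show "usc c (x + y) = usc c x + usc c y"
    by (rule uall_eqI) (simp add: proj_usc proj_add U.r_distr s)
  show "usc (c + d) x = usc c x + usc d x"
    by (rule uall_eqI) (simp add: proj_usc proj_add scal_add cls_add free_scal U.l_distr s)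
  show "usc c (usc d x) = usc (c * d) x"
    by (rule uall_eqI) (simp add: proj_usc scal_mult[symmetric] cls_mult free_scal U.m_assoc s)
  show "usc 1 x = x" by (rule uall_eqI) (simp add: proj_usc scal_1 cls_1)
  show "usc c x * y = usc c (x * y)" by (rule uall_eqI) (simp add: proj_usc proj_mult U.m_assoc s)
  show "x * usc c y = usc c (x * y)"
    by (rule uall_eqI) (simp add: proj_usc proj_mult U.m_assoc[symmetric] s cls_scal_central)
qed

interpretation usc: sc_algebra usc by (rule sc_algebra_usc)

definition represents :: "nat \<Rightarrow> nat \<Rightarrow> uall \<Rightarrow> falg \<Rightarrow> bool" where
  "represents m n u x \<longleftrightarrow> x \<in> carrier (free_alg m n) \<and> proj u m n = cls m n x"

lemma rep_0: "represents m n 0 0" and rep_1: "represents m n 1 1"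
  by (simp_all add: represents_def proj_simps cls_0 cls_1 free_0 free_1)
lemma rep_add: "represents m n u x \<Longrightarrow> represents m n w y \<Longrightarrow> represents m n (u + w) (x + y)"
  and rep_diff: "represents m n u x \<Longrightarrow> represents m n w y \<Longrightarrow> represents m n (u - w) (x - y)"
  and rep_mult: "represents m n u x \<Longrightarrow> represents m n w y \<Longrightarrow> represents m n (u * w) (x * y)"
  and rep_minus: "represents m n u x \<Longrightarrow> represents m n (- u) (- x)"
  and rep_sc: "represents m n u x \<Longrightarrow> represents m n (usc c u) (scal c * x)"
  by (simp_all add: represents_def proj_simps proj_usc cls_add cls_diff cls_mult cls_minus free_intros)
lemma rep_pow: "represents m n u x \<Longrightarrow> represents m n (u ^ k) (x ^ k)"
  by (induction k) (simp_all add: rep_1 rep_mult)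
lemma rep_qc: "represents m n u x \<Longrightarrow> represents m n w y \<Longrightarrow> represents m n (usc.qc c u w) (x * y - scal c * y * x)"
  unfolding usc.qc_def mult.assoc by (intro rep_diff rep_mult rep_sc)

lemma rep_eq: "represents m n u x \<Longrightarrow> represents m n w y \<Longrightarrow> x - y \<in> rels m n \<Longrightarrow> proj u m n = proj w m n"
  by (simp add: represents_def cls_rel)

text \<open>Used with a default \<open>d\<close> for which all relations hold in the other components. The default also
takes effect when \<open>x\<close> is not in the free algebra, that is, for an index out of range.\<close>

definition ugen :: "nat \<Rightarrow> nat \<Rightarrow> falg \<Rightarrow> uall \<Rightarrow> uall" where
  "ugen m n x d = Uall (\<lambda>m' n'. if m' = m \<and> n' = n \<and> x \<in> carrier (free_alg m n) then cls m n x else proj d m' n')"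

lemma proj_ugen: "proj (ugen m n x d) m' n' = (if m' = m \<and> n' = n \<and> x \<in> carrier (free_alg m n) then cls m n x else proj d m' n')"
  unfolding ugen_def by (rule proj_Uall) (auto simp: cls_carrier)

lemma rep_ugen: "x \<in> carrier (free_alg m n) \<Longrightarrow> represents m n (ugen m n x d) x"
  by (simp add: represents_def proj_ugen)

text \<open>In the other components, \<open>E\<close> and \<open>F\<close> are 0 and the \<open>K\<close> and
\<open>L\<close> are 1, which satisfies all relations.\<close>

definition uE where "uE m n i = ugen m n (xE i) 0"
definition uF where "uF m n i = ugen m n (xF i) 0"
definition uK where "uK m n i = ugen m n (xK i) 1"
definition uL where "uL m n i = ugen m n (xL i) 1"

lemma rep_E: "i \<in> {1..<m+n} \<Longrightarrow> represents m n (uE m n i) (xE i)"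
  and rep_F: "i \<in> {1..<m+n} \<Longrightarrow> represents m n (uF m n i) (xF i)"
  and rep_K: "j \<in> {1..m+n} \<Longrightarrow> represents m n (uK m n j) (xK j)"
  and rep_L: "j \<in> {1..m+n} \<Longrightarrow> represents m n (uL m n j) (xL j)"
  by (auto simp: uE_def uF_def uK_def uL_def intro!: rep_ugen free_E free_F free_K free_L)

lemma other_proj: "(m', n') \<noteq> (m, n) \<Longrightarrow> proj (uE m n i) m' n' = \<zero>\<^bsub>Uups m' n'\<^esub>"
  "(m', n') \<noteq> (m, n) \<Longrightarrow> proj (uF m n i) m' n' = \<zero>\<^bsub>Uups m' n'\<^esub>"
  "(m', n') \<noteq> (m, n) \<Longrightarrow> proj (uK m n i) m' n' = \<one>\<^bsub>Uups m' n'\<^esub>"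
  "(m', n') \<noteq> (m, n) \<Longrightarrow> proj (uL m n i) m' n' = \<one>\<^bsub>Uups m' n'\<^esub>"
  by (auto simp: uE_def uF_def uK_def uL_def proj_ugen proj_simps)

section \<open>The defining relations hold\<close>

lemma ups_eq: "ups ^ j = Fraction_Field.Fract (monom 1 j) 1"
proof (induction j)
  case 0 thus ?case by (simp add: Fraction_Field.One_fract_def)
next
  case (Suc j)
  have "[:0, 1:] = monom (1::rat) 1" by (simp add: monom_altdef)
  thus ?case unfolding power_Suc Suc unfolding ups_def by (simp add: mult_monom)
qed

lemma ups_0: "ups \<noteq> 0"
  by (simp add: ups_def Fraction_Field.Zero_fract_def Fraction_Field.eq_fract)

lemma ups_root: "j > 0 \<Longrightarrow> ups ^ j \<noteq> 1"
proof
  assume j: "j > 0" "ups ^ j = 1"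
  hence "monom (1::rat) j = 1" unfolding ups_eq by (simp add: Fraction_Field.One_fract_def Fraction_Field.eq_fract)
  hence "degree (monom (1::rat) j) = 0" by simp
  thus False using j(1) by (simp add: degree_monom_eq)
qed

text \<open>An equation between elements of the product is a defining relation in the component \<open>(m, n)\<close> and
has to be checked separately in the others.\<close>

lemma rel_eqI:
  assumes "represents m n u x" "represents m n w y" "x - y \<in> rels m n"
    and "\<And>m' n'. (m', n') \<noteq> (m, n) \<Longrightarrow> proj u m' n' = proj w m' n'"
  shows "u = w"
proof (rule uall_eqI)
  fix m' n'
  show "proj u m' n' = proj w m' n'"
    by (cases "(m', n') = (m, n)") (use assms(4) rep_eq[OF assms(1-3)] in auto)
qed

lemma scal_m1: "scal (-1) = -1"
proof -
  have "scal (-1) + 1 = scal (-1 + 1)" unfolding scal_add scal_1 ..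
  hence "scal (-1) + 1 = 0" by (simp add: scal_0)
  thus ?thesis by (simp only: eq_neg_iff_add_eq_0)
qed

lemma cls_s [simp]: "cls m n (scal c) \<in> carrier (Uups m n)" by (simp add: cls_carrier free_scal)

lemma other_simps: assumes "(m', n') \<noteq> (m, n)"
  shows "proj (uE m n i * x) m' n' = \<zero>\<^bsub>Uups m' n'\<^esub>" "proj (x * uE m n i) m' n' = \<zero>\<^bsub>Uups m' n'\<^esub>"
    "proj (uF m n i * x) m' n' = \<zero>\<^bsub>Uups m' n'\<^esub>" "proj (x * uF m n i) m' n' = \<zero>\<^bsub>Uups m' n'\<^esub>"
    "proj (uK m n i * x) m' n' = proj x m' n'" "proj (x * uK m n i) m' n' = proj x m' n'"
    "proj (uL m n i * x) m' n' = proj x m' n'" "proj (x * uL m n i) m' n' = proj x m' n'"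
  using other_proj[OF assms] by (simp_all add: proj_mult)

lemma uEE: 
  assumes "a \<in> {1..<m+n}" "b \<in> {1..<m+n}" "Suc a < b"
  shows "uE m n a * uE m n b = uE m n b * uE m n a" "uF m n a * uF m n b = uF m n b * uF m n a"
proof -
  have i: "\<bar>int a - int b\<bar> > 1" using assms(3) by simp
  have "xE a * xE b - xE b * xE a \<in> rels m n" unfolding rels_def using assms(1,2) i by blast
  thus "uE m n a * uE m n b = uE m n b * uE m n a"
    by (rule rel_eqI[OF rep_mult[OF rep_E rep_E] rep_mult[OF rep_E rep_E], rotated 4]) (use assms in \<open>auto simp: other_simps other_proj\<close>)
  have "xF a * xF b - xF b * xF a \<in> rels m n" unfolding rels_def using assms(1,2) i by blast
  thus "uF m n a * uF m n b = uF m n b * uF m n a"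
    by (rule rel_eqI[OF rep_mult[OF rep_F rep_F] rep_mult[OF rep_F rep_F], rotated 4]) (use assms in \<open>auto simp: other_simps other_proj\<close>)
qed

lemma sform_eps_alpha: "a \<in> {1..m+n} \<Longrightarrow> b \<in> {1..<m+n} \<Longrightarrow>
   sform m n (eps m n a) (alpha m n b (b+1)) = isgn m a * rt b (b+1) a"
proof -
  assume a: "a \<in> {1..m+n}" and b: "b \<in> {1..<m+n}"
  have "sform m n (eps m n a) (alpha m n b (b+1)) = (\<Sum>i=1..m+n. if i = a then isgn m a * rt b (b+1) a else 0)"
    unfolding sform_def by (rule sum.cong) (use b in \<open>auto simp: eps_def alpha_def rt_def\<close>)
  thus ?thesis using a by simp
qed

theorem qgl_rel_ups: "qgl_rel usc m (m+n) ups (uE m n) (uF m n) (uK m n) (uL m n)"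
proof -
  interpret g: qgl usc m "m+n" ups "uE m n" "uF m n" "uK m n" "uL m n" ..
  have va: "g.va i = upsa m i" for i by (simp add: g.va_def upsa_def isgn_def ipar_def power_int_minus)
  have vap: "g.va a powi j = ups powi (isgn m a * j)" for a j
    by (simp add: g.va_def isgn_def ipar_def power_int_inverse power_int_minus)
  show ?thesis
  proof (unfold_locales, goal_cases)
    case 1 show ?case by (rule ups_0)
  next
    case (2 j) thus ?case by (rule ups_root)
  next
    case (3 a b)
    have "xK a * xK b - xK b * xK a \<in> rels m n" unfolding rels_def using 3 by blast
    thus ?case
      by (rule rel_eqI[OF rep_mult[OF rep_K rep_K] rep_mult[OF rep_K rep_K], rotated 4]) (use 3 in \<open>auto simp: other_simps other_proj\<close>)
  next
    case (4 a)
    have "xK a * xL a - 1 \<in> rels m n" unfolding rels_def using 4 by blast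
    thus ?case
      by (rule rel_eqI[OF rep_mult[OF rep_K rep_L] rep_1, rotated 2]) (use 4 in \<open>auto simp: other_simps other_proj proj_1\<close>)
  next
    case (5 a)
    have "xL a * xK a - 1 \<in> rels m n" unfolding rels_def using 5 by blast
    thus ?case
      by (rule rel_eqI[OF rep_mult[OF rep_L rep_K] rep_1, rotated 2]) (use 5 in \<open>auto simp: other_simps other_proj proj_1\<close>)
  next
    case (6 a b)
    let ?c = "ups powi sform m n (eps m n a) (alpha m n b (b+1))"
    have "xK a * xE b - scal ?c * xE b * xK a \<in> rels m n" unfolding rels_def using 6 by blast
    hence "xK a * xE b - scal ?c * (xE b * xK a) \<in> rels m n" by (simp only: mult.assoc)
    hence "uK m n a * uE m n b = usc ?c (uE m n b * uK m n a)"
      by (rule rel_eqI[OF rep_mult[OF rep_K rep_E] rep_sc[OF rep_mult[OF rep_E rep_K]], rotated 4]) (use 6 in \<open>simp_all add: other_simps other_proj proj_usc proj_add\<close>)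
    thus ?case unfolding vap sform_eps_alpha[OF 6] .
  next
    case (7 a b)
    let ?c = "ups powi (- sform m n (eps m n a) (alpha m n b (b+1)))"
    have "xK a * xF b - scal ?c * xF b * xK a \<in> rels m n" unfolding rels_def using 7 by blast
    hence "xK a * xF b - scal ?c * (xF b * xK a) \<in> rels m n" by (simp only: mult.assoc)
    hence "uK m n a * uF m n b = usc ?c (uF m n b * uK m n a)"
      by (rule rel_eqI[OF rep_mult[OF rep_K rep_F] rep_sc[OF rep_mult[OF rep_F rep_K]], rotated 4]) (use 7 in \<open>simp_all add: other_simps other_proj proj_usc proj_add\<close>)
    moreover have "- (isgn m a * rt b (b+1) a) = isgn m a * rt (b+1) b a" by (simp add: rt_def)
    ultimately show ?case unfolding vap sform_eps_alpha[OF 7] by simp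
  next
    case (8 a)
    have r: "a \<in> {1..m+n}" "a + 1 \<in> {1..m+n}" using 8 by auto
    let ?d = "1 / (upsa m a - inverse (upsa m a))"
    let ?k = "xK a * xL (a+1) - xL a * xK (a+1)"
    have "scomm (gen_par m (gE a)) (gen_par m (gF a)) (xE a) (xF a) - (if a = a then scal ?d * ?k else 0) \<in> rels m n"
      unfolding rels_def using 8 by blast
    moreover have "scomm (gen_par m (gE a)) (gen_par m (gF a)) (xE a) (xF a) = xE a * xF a - scal (g.et a) * (xF a * xE a)"
      by (simp add: scomm_def gen_par_def g.et_def scal_m1 scal_1)
    ultimately have "xE a * xF a - (scal (g.et a) * (xF a * xE a) + scal ?d * ?k) \<in> rels m n"
      by (simp add: diff_diff_eq)
    thus ?case unfolding g.kap_def va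
      by (rule rel_eqI[OF rep_mult[OF rep_E rep_F] rep_add[OF rep_sc[OF rep_mult[OF rep_F rep_E]] rep_sc[OF rep_diff[OF rep_mult[OF rep_K rep_L] rep_mult[OF rep_L rep_K]]]], rotated 8])
        (use 8 r in \<open>auto simp: other_simps other_proj proj_usc proj_add proj_diff a_minus_def U.r_neg\<close>)
  next
    case (9 a b)
    have "scomm (gen_par m (gE a)) (gen_par m (gF b)) (xE a) (xF b) - 
        (if a = b then scal (1 / (upsa m a - inverse (upsa m a))) * (xK a * xL (a+1) - xL a * xK (a+1)) else 0) \<in> rels m n"
      unfolding rels_def using 9 by blast
    hence "xE a * xF b - xF b * xE a \<in> rels m n" using 9(3) by (auto simp: scomm_def gen_par_def split: if_splits)
    thus ?case
      by (rule rel_eqI[OF rep_mult[OF rep_E rep_F] rep_mult[OF rep_F rep_E], rotated 4]) (use 9 in \<open>auto simp: other_simps other_proj\<close>)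
  next
    case (10 a b) thus ?case by (rule uEE(1))
  next
    case (11 a b) thus ?case by (rule uEE(2))
  next
    case (12 a b)
    have "\<bar>int a - int b\<bar> = 1" using 12(4) by auto
    hence "xE a ^ 2 * xE b - scal (upsa m a + inverse (upsa m a)) * xE a * xE b * xE a + xE b * xE a ^ 2 \<in> rels m n"
      unfolding rels_def using 12(1-3) by blast
    hence "xE a * (xE a * xE b) + xE b * (xE a * xE a) - scal (upsa m a + inverse (upsa m a)) * (xE a * (xE b * xE a)) \<in> rels m n"
      by (simp add: power2_eq_square mult.assoc add_diff_eq diff_add_eq)
    thus ?case unfolding va
      by (rule rel_eqI[OF rep_add[OF rep_mult[OF rep_E rep_mult[OF rep_E rep_E]] rep_mult[OF rep_E rep_mult[OF rep_E rep_E]]] rep_sc[OF rep_mult[OF rep_E rep_mult[OF rep_E rep_E]]], rotated 9])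
        (use 12 in \<open>simp_all add: other_simps other_proj proj_usc proj_add\<close>)
  next
    case (13 a b)
    have "\<bar>int a - int b\<bar> = 1" using 13(4) by auto
    hence "xF a ^ 2 * xF b - scal (upsa m a + inverse (upsa m a)) * xF a * xF b * xF a + xF b * xF a ^ 2 \<in> rels m n"
      unfolding rels_def using 13(1-3) by blast
    hence "xF a * (xF a * xF b) + xF b * (xF a * xF a) - scal (upsa m a + inverse (upsa m a)) * (xF a * (xF b * xF a)) \<in> rels m n"
      by (simp add: power2_eq_square mult.assoc add_diff_eq diff_add_eq)
    thus ?case unfolding va
      by (rule rel_eqI[OF rep_add[OF rep_mult[OF rep_F rep_mult[OF rep_F rep_F]] rep_mult[OF rep_F rep_mult[OF rep_F rep_F]]] rep_sc[OF rep_mult[OF rep_F rep_mult[OF rep_F rep_F]]], rotated 9])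
        (use 13 in \<open>simp_all add: other_simps other_proj proj_usc proj_add\<close>)
  next
    case 14
    have "xE m * xE m - 0 \<in> rels m n" unfolding rels_def using 14 by (simp add: power2_eq_square)
    thus ?case
      by (rule rel_eqI[OF rep_mult[OF rep_E rep_E] rep_0, rotated 2]) (use 14 in \<open>auto simp: other_simps proj_0\<close>)
  next
    case 15
    have "xF m * xF m - 0 \<in> rels m n" unfolding rels_def using 15 by (simp add: power2_eq_square)
    thus ?case
      by (rule rel_eqI[OF rep_mult[OF rep_F rep_F] rep_0, rotated 2]) (use 15 in \<open>auto simp: other_simps proj_0\<close>)
  next
    case 16
    let ?A = "uE m n (m-1)" and ?B = "uE m n m" and ?C = "uE m n (m+1)"
    let ?O = "?A * ?B * ?C - usc ups (?A * ?C * ?B) - usc (inverse ups) (?B * ?C * ?A) + ?C * ?B * ?A"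
    have r: "m - 1 \<in> {1..<m+n}" "m \<in> {1..<m+n}" "m + 1 \<in> {1..<m+n}" using 16 by auto
    have AC: "?A * ?C = ?C * ?A" using uEE(1)[OF r(1,3)] 16 by simp
    have s: "Suc (m - 1) = m" "m - 1 \<noteq> m" "m - 1 \<noteq> Suc m" using r by auto
    have R1: "g.RE (m-1) m = ?A" using g.RE.simps(2)[of "m-1" "m-1"] unfolding s(1) by simp
    have R2: "g.RE (m-1) (Suc m) = usc.qc (inverse (g.va m)) ?A ?B" unfolding g.RE.simps(2) R1 using s by simp
    have R3: "g.RE (m-1) (Suc (Suc m)) = usc.qc (inverse (g.va (Suc m))) (usc.qc (inverse (g.va m)) ?A ?B) ?C" unfolding g.RE.simps(2)[of _ "Suc m"] R2 using s by simp
    have v: "g.va m = ups" "g.va (Suc m) = inverse ups" by (simp_all add: g.va_def)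
    have AC': "?A * (?C * x) = ?C * (?A * x)" for x unfolding mult.assoc[symmetric] AC ..
    have R: "g.RE (m-1) (m+2) = ?O"
      using R3 AC ups_0 unfolding v usc.qc_def by (simp add: usc.sc_simps AC'; simp add: algebra_simps)
    have O: "represents m n ?O (oddE m)"
      using rep_add[OF rep_diff[OF rep_diff[OF rep_mult[OF rep_mult[OF rep_E rep_E] rep_E] rep_sc[OF rep_mult[OF rep_mult[OF rep_E rep_E] rep_E]]] rep_sc[OF rep_mult[OF rep_mult[OF rep_E rep_E] rep_E]]] rep_mult[OF rep_mult[OF rep_E rep_E] rep_E],
         OF r(1) r(2) r(3) r(1) r(3) r(2) r(2) r(3) r(1) r(3) r(2) r(1), of ups "inverse ups"]
      unfolding oddE_def by (simp add: mult.assoc)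
    have "scomm 1 1 (xE m) (oddE m) \<in> rels m n" unfolding rels_def using 16 by simp
    hence "xE m * oddE m - (- (oddE m * xE m)) \<in> rels m n" by (simp add: scomm_def)
    thus ?case unfolding R
      by (rule rel_eqI[OF rep_mult[OF rep_E O] rep_minus[OF rep_mult[OF O rep_E]], rotated 2]) (use r in \<open>auto simp: other_simps proj_minus\<close>)
  next
    case 17
    let ?A = "uF m n (m-1)" and ?B = "uF m n m" and ?C = "uF m n (m+1)"
    let ?O = "?C * ?B * ?A - usc (inverse ups) (?B * ?C * ?A) - usc ups (?A * ?C * ?B) + ?A * ?B * ?C"
    have r: "m - 1 \<in> {1..<m+n}" "m \<in> {1..<m+n}" "m + 1 \<in> {1..<m+n}" using 17 by auto
    have AC: "?A * ?C = ?C * ?A" using uEE(2)[OF r(1,3)] 17 by simp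
    have s: "Suc (m - 1) = m" "m - 1 \<noteq> m" "m - 1 \<noteq> Suc m" using r by auto
    have R1: "g.RF (m-1) m = ?A" using g.RF.simps(2)[of "m-1" "m-1"] unfolding s(1) by simp
    have R2: "g.RF (m-1) (Suc m) = usc.qc (g.va m) ?B ?A" unfolding g.RF.simps(2) R1 using s by simp
    have R3: "g.RF (m-1) (Suc (Suc m)) = usc.qc (g.va (Suc m)) ?C (usc.qc (g.va m) ?B ?A)" unfolding g.RF.simps(2)[of _ "Suc m"] R2 using s by simp
    have v: "g.va m = ups" "g.va (Suc m) = inverse ups" by (simp_all add: g.va_def)
    have AC': "?A * (?C * x) = ?C * (?A * x)" for x unfolding mult.assoc[symmetric] AC ..
    have R: "g.RF (m-1) (m+2) = ?O"
      using R3 AC ups_0 unfolding v usc.qc_def by (simp add: usc.sc_simps AC'; simp add: algebra_simps)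
    have O: "represents m n ?O (oddF m)"
      using rep_add[OF rep_diff[OF rep_diff[OF rep_mult[OF rep_mult[OF rep_F rep_F] rep_F] rep_sc[OF rep_mult[OF rep_mult[OF rep_F rep_F] rep_F]]] rep_sc[OF rep_mult[OF rep_mult[OF rep_F rep_F] rep_F]]] rep_mult[OF rep_mult[OF rep_F rep_F] rep_F],
         OF r(3) r(2) r(1) r(2) r(3) r(1) r(1) r(3) r(2) r(1) r(2) r(3), of "inverse ups" ups]
      unfolding oddF_def by (simp add: mult.assoc)
    have "scomm 1 1 (xF m) (oddF m) \<in> rels m n" unfolding rels_def using 17 by simp
    hence "xF m * oddF m - (- (oddF m * xF m)) \<in> rels m n" by (simp add: scomm_def)
    thus ?case unfolding R
      by (rule rel_eqI[OF rep_mult[OF rep_F O] rep_minus[OF rep_mult[OF O rep_F]], rotated 2]) (use r in \<open>auto simp: other_simps proj_minus\<close>)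
  qed
qed

section \<open>Laurent polynomials, specialization, and representatives\<close>

lemma laurent_eval_super: "finite A \<Longrightarrow> Poly_Mapping.keys z \<subseteq> A \<Longrightarrow> laurent_eval x z = (\<Sum>k\<in>A. of_int (Poly_Mapping.lookup z k) * x powi k)"
  unfolding laurent_eval_def by (rule sum.mono_neutral_left) (auto simp: in_keys_iff)

lemma laurent_eval_diff: "laurent_eval x (z - w) = laurent_eval x z - laurent_eval x w"
proof -
  let ?A = "Poly_Mapping.keys z \<union> Poly_Mapping.keys w"
  have f: "finite ?A" and k: "Poly_Mapping.keys (z - w) \<subseteq> ?A" using keys_diff[of z w] by auto
  show ?thesis
    unfolding laurent_eval_super[OF f k] laurent_eval_super[OF f Un_upper1] laurent_eval_super[OF f Un_upper2]
    by (simp add: lookup_minus left_diff_distrib sum_subtractf)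
qed

lemma laurent_eval_single: "laurent_eval x (Poly_Mapping.single j 1) = x powi j"
  by (simp add: laurent_eval_def)

lemma laurent_eval_zero: "laurent_eval x 0 = 0" by (simp add: laurent_eval_def)

text \<open>\<open>\<upsilon>\<close> is transcendental: after multiplication by a power of \<open>\<upsilon>\<close> the
Laurent polynomial becomes an ordinary one, whose coefficients are read off. This makes
\<open>specialize\<close> well defined.\<close>

lemma laurent_eval_ups_eq_0:
  assumes "laurent_eval ups z = 0" shows "z = 0"
proof (rule poly_mapping_eqI)
  fix k0
  let ?S = "Poly_Mapping.keys z"
  \<comment> \<open>a bound for the negative exponents\<close>
  obtain N :: nat where N: "\<And>k. k \<in> ?S \<Longrightarrow> - k \<le> int N"
  proof
    fix k assume "k \<in> ?S"
    hence "nat (- k) \<le> (\<Sum>k\<in>?S. nat (- k))" by (intro member_le_sum) auto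
    thus "- k \<le> int (\<Sum>k\<in>?S. nat (- k))" by linarith
  qed
  define p :: "rat poly" where "p = (\<Sum>k\<in>?S. monom (of_int (Poly_Mapping.lookup z k)) (nat (k + int N)))"
  have m: "to_fract (monom (of_int c) j) = of_int c * ups ^ j" for c j
  proof -
    have "monom (of_int c) j = of_int c * monom (1::rat) j" by (simp add: monom_altdef of_int_poly)
    hence "to_fract (monom (of_int c) j) = to_fract (of_int c) * to_fract (monom (1::rat) j)" by simp
    moreover
    have n: "to_fract (of_nat j :: rat poly) = of_nat j" for j by (induction j) simp_all
    have "to_fract (of_int c :: rat poly) = of_int c" by (cases c rule: int_cases2) (simp_all add: n)
    with calculation show ?thesis unfolding ups_eq to_fract_def by simp
  qed
  have "to_fract p = (\<Sum>k\<in>?S. of_int (Poly_Mapping.lookup z k) * ups ^ nat (k + int N))"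
    unfolding p_def to_fract_sum m ..
  also have "\<dots> = (\<Sum>k\<in>?S. (of_int (Poly_Mapping.lookup z k) * ups powi k) * ups ^ N)"
  proof (rule sum.cong)
    fix k assume "k \<in> ?S"
    hence "ups ^ nat (k + int N) = ups powi (k + int N)" using N[of k] by (simp add: power_int_def)
    also have "\<dots> = ups powi k * ups ^ N" using ups_0 by (simp add: power_int_add)
    finally show "of_int (Poly_Mapping.lookup z k) * ups ^ nat (k + int N) = (of_int (Poly_Mapping.lookup z k) * ups powi k) * ups ^ N"
      by (simp add: mult.assoc)
  qed simp
  also have "\<dots> = laurent_eval ups z * ups ^ N" by (simp add: laurent_eval_def sum_distrib_right)
  finally have "p = 0" unfolding assms by simp
  hence c: "coeff p (nat (k0 + int N)) = 0" by simp
  show "Poly_Mapping.lookup z k0 = Poly_Mapping.lookup 0 k0"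
  proof (cases "k0 \<in> ?S")
    case True
    have "coeff p (nat (k0 + int N)) = (\<Sum>k\<in>?S. if k = k0 then of_int (Poly_Mapping.lookup z k) else 0)"
      unfolding p_def coeff_sum
    proof (rule sum.cong)
      fix k assume "k \<in> ?S"
      hence "nat (k + int N) = nat (k0 + int N) \<longleftrightarrow> k = k0" using N[of k] N[OF True] by auto
      thus "coeff (monom (of_int (Poly_Mapping.lookup z k)) (nat (k + int N))) (nat (k0 + int N)) =
         (if k = k0 then of_int (Poly_Mapping.lookup z k) else (0::rat))" by simp
    qed simp
    thus ?thesis using True c by simp
  qed (simp add: in_keys_iff)
qed

lemma specialize_laurent: "specialize q (laurent_eval ups z) = laurent_eval q z"
proof -
  have "(THE w. laurent_eval ups w = laurent_eval ups z) = z"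
    using laurent_eval_ups_eq_0[of "_ - z"] by (intro the_equality) (auto simp: laurent_eval_diff)
  thus ?thesis by (simp add: specialize_def)
qed

lemma specialize_0: "specialize q 0 = 0" and specialize_1: "specialize q 1 = 1"
  using specialize_laurent[of q 0] specialize_laurent[of q "Poly_Mapping.single 0 1"]
  unfolding laurent_eval_zero laurent_eval_single by simp_all

lemma qbinom_0: "t > 0 \<Longrightarrow> qbinom 0 t = 0"
  unfolding qbinom_def by (rule prod_zero) (auto intro!: bexI[of _ 1])

lemma qn_ups: "s > 0 \<Longrightarrow> qn ups s \<noteq> 0"
  using qgl_rel.qn_v[OF qgl_rel_ups] .

text \<open>The numerator is the product of the denominators in reverse order.\<close>

lemma qbinom_diag: "qbinom (int t) t = 1"
proof -
  have "qbinom (int t) t = (\<Prod>i=1..t. qn ups (t + 1 - i) / qn ups i)"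
    unfolding qbinom_def
  proof (rule prod.cong)
    fix i assume "i \<in> {1..t}"
    hence e: "int t - int i + 1 = int (t + 1 - i)" "- int t + int i - 1 = - int (t + 1 - i)" by auto
    show "(ups powi (int t - int i + 1) - ups powi (- int t + int i - 1)) / (ups powi int i - ups powi - int i) =
      qn ups (t + 1 - i) / qn ups i" unfolding e qn_powi ..
  qed simp
  also have "\<dots> = (\<Prod>i=1..t. qn ups (t + 1 - i)) / (\<Prod>i=1..t. qn ups i)" by (rule prod_dividef)
  also have "(\<Prod>i=1..t. qn ups (t + 1 - i)) = (\<Prod>i=1..t. qn ups i)"
    by (rule prod.reindex_bij_witness[of _ "\<lambda>i. t + 1 - i" "\<lambda>i. t + 1 - i"]) auto
  also have "(\<Prod>i=1..t. qn ups i) / (\<Prod>i=1..t. qn ups i) = 1"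
    using qn_ups by simp
  finally show ?thesis .
qed

lemma rep_prod_list: "(\<And>s. s \<in> set xs \<Longrightarrow> represents m n (f s) (h s)) \<Longrightarrow>
   represents m n (prod_list (map f xs)) (prod_list (map h xs))"
  by (induction xs) (simp_all add: rep_1 rep_mult)

lemma qf_ups: "qf ups M = qfact M"
  by (simp only: qf_def qi_def qfact_def qint_def qn_powi)

context fixes m n :: nat begin

interpretation g: qgl_rel usc m "m+n" ups "uE m n" "uF m n" "uK m n" "uL m n" by (rule qgl_rel_ups)

lemma va_upsa: "g.va i = upsa m i" by (simp add: g.va_def upsa_def isgn_def ipar_def power_int_minus)

lemma rep_eD: "i \<in> {1..<m+n} \<Longrightarrow> represents m n (g.eD i M) (divpow (xE i) M)"
  and rep_fD: "i \<in> {1..<m+n} \<Longrightarrow> represents m n (g.fD i M) (divpow (xF i) M)"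
  unfolding g.eD_def g.fD_def usc.dp_def divpow_def qf_ups by (intro rep_sc rep_pow rep_E rep_F; assumption)+

lemma rep_kB: "a \<in> {1..m+n} \<Longrightarrow> represents m n (g.kB a c t) (Kbinom m a c t)"
  unfolding g.kB_def usc.kb_def Kbinom_def va_upsa
  by (intro rep_prod_list rep_sc rep_diff rep_K rep_L; assumption)

lemma rep_RE: "1 \<le> a \<Longrightarrow> a < b \<Longrightarrow> b \<le> m + n \<Longrightarrow> represents m n (g.RE a b) (rootvec m a b)"
proof (induction b)
  case (Suc b)
  have s: "rootvec m b (Suc b) = xE b" by (subst rootvec.simps) simp
  show ?case
  proof (cases "a = b")
    case True thus ?thesis using rep_E[of b m n] Suc.prems s by simp
  next
    case False
    have "rootvec m a (Suc b) = rootvec m a b * xE b - scal (inverse (upsa m b)) * xE b * rootvec m a b"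
      using False Suc.prems by (subst rootvec.simps) (simp add: Let_def s)
    thus ?thesis using rep_qc[OF Suc.IH rep_E, of b "inverse (upsa m b)"] False Suc.prems by (simp add: va_upsa)
  qed
qed simp

lemma rep_RF: "1 \<le> a \<Longrightarrow> a < b \<Longrightarrow> b \<le> m + n \<Longrightarrow> represents m n (g.RF a b) (rootvec m b a)"
proof (induction b)
  case (Suc b)
  have s: "rootvec m (Suc b) b = xF b" by (subst rootvec.simps) simp
  show ?case
  proof (cases "a = b")
    case True thus ?thesis using rep_F[of b m n] Suc.prems s by simp
  next
    case False
    have "rootvec m (Suc b) a = xF b * rootvec m b a - scal (upsa m b) * rootvec m b a * xF b"
      using False Suc.prems by (subst rootvec.simps) (simp add: Let_def s)
    thus ?thesis using rep_qc[OF rep_F Suc.IH, of b "upsa m b"] False Suc.prems by (simp add: va_upsa)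
  qed
qed simp

end

section \<open>The integral form and its base change\<close>

definition UZgens :: "nat \<Rightarrow> nat \<Rightarrow> uelt set" where
  "UZgens m n = (\<lambda>z. cls m n (scal (laurent_eval ups z))) ` UNIV \<union>
        cls m n ` ({divpow (xE i) M | i M. i \<in> {1..<m+n}} \<union>
                   {divpow (xF i) M | i M. i \<in> {1..<m+n}} \<union>
                   {xK j | j. j \<in> {1..m+n}} \<union> {xL j | j. j \<in> {1..m+n}} \<union>
                   {Kbinom m j 0 t | j t. j \<in> {1..m+n}})"

lemma UZ_ops [simp]: "carrier (UZ m n) = generate_ring (Uups m n) (UZgens m n)"
  "monoid.mult (UZ m n) = monoid.mult (Uups m n)" "monoid.one (UZ m n) = monoid.one (Uups m n)"
  "ring.add (UZ m n) = ring.add (Uups m n)" "part (UZ m n) p = part (Uups m n) p \<inter> carrier (UZ m n)"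
  by (simp_all add: UZ_def UZgens_def Let_def)

lemma rep_free: "represents m n u x \<Longrightarrow> x \<in> carrier (free_alg m n)" by (simp add: represents_def)
lemma rep_proj: "represents m n u x \<Longrightarrow> proj u m n = cls m n x" by (simp add: represents_def)

lemmas free_divE = rep_free[OF rep_eD] and free_divF = rep_free[OF rep_fD] and free_Kb = rep_free[OF rep_kB]

lemma UZgens_sub: "UZgens m n \<subseteq> carrier (Uups m n)"
  unfolding UZgens_def by (auto intro!: cls_carrier free_divE free_divF free_Kb free_K free_L free_scal)

abbreviation UZc where "UZc m n \<equiv> generate_ring (Uups m n) (UZgens m n)"

lemma UZ_sub: "u \<in> UZc m n \<Longrightarrow> u \<in> carrier (Uups m n)"
  using U.generate_ring_incl[OF UZgens_sub] U.generate_ring_in_carrier[OF UZgens_sub] by blast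

lemma UZ_scal: "cls m n (scal (laurent_eval ups z)) \<in> UZc m n"
  by (rule generate_ring.incl) (simp add: UZgens_def)

lemma UZ_actc: "u \<in> UZc m n \<Longrightarrow> UZ_act m n u z \<in> UZc m n"
  unfolding UZ_act_def by (rule generate_ring.eng_mult[OF UZ_scal])

lemma UZ_act_mult: "u \<in> carrier (Uups m n) \<Longrightarrow> w \<in> carrier (Uups m n) \<Longrightarrow> UZ_act m n u z \<otimes>\<^bsub>Uups m n\<^esub> w = UZ_act m n (u \<otimes>\<^bsub>Uups m n\<^esub> w) z"
  unfolding UZ_act_def by (simp add: U.m_assoc)

text \<open>Scalars are central, so multiplication on the left and on the right is compatible with the balancing relation.\<close>

lemma UZ_mult_act: assumes "u \<in> carrier (Uups m n)" "w \<in> carrier (Uups m n)"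
  shows "w \<otimes>\<^bsub>Uups m n\<^esub> UZ_act m n u z = UZ_act m n (w \<otimes>\<^bsub>Uups m n\<^esub> u) z"
proof -
  let ?c = "cls m n (scal (laurent_eval ups z))"
  have "w \<otimes>\<^bsub>Uups m n\<^esub> (?c \<otimes>\<^bsub>Uups m n\<^esub> u) = (w \<otimes>\<^bsub>Uups m n\<^esub> ?c) \<otimes>\<^bsub>Uups m n\<^esub> u"
    using assms by (simp add: U.m_assoc)
  also have "\<dots> = ?c \<otimes>\<^bsub>Uups m n\<^esub> (w \<otimes>\<^bsub>Uups m n\<^esub> u)"
    unfolding cls_scal_central[OF assms(2)] using assms by (simp add: U.m_assoc)
  finally show ?thesis unfolding UZ_act_def .
qed

context
  fixes m n :: nat and q :: "'f::field"
begin

abbreviation "Fr \<equiv> (ring_of_type_algebra :: 'f ring)"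
abbreviation "fla \<equiv> (\<lambda>z f. laurent_eval q z * f)"

lemma Fr_simps [simp]: "carrier Fr = UNIV" "x \<oplus>\<^bsub>Fr\<^esub> y = x + y"
  by (simp_all add: ring_of_type_algebra_def)

interpretation T: tensor "UZ m n" Fr UNIV "UZ_act m n" fla
  by unfold_locales (simp_all add: generate_ring.eng_add UZ_actc)

text \<open>The biadditive extension of the product of simple tensors to the free abelian group.\<close>

definition BB :: "(uelt \<times> 'f \<Rightarrow>\<^sub>0 int) \<Rightarrow> (uelt \<times> 'f \<Rightarrow>\<^sub>0 int) \<Rightarrow> (uelt \<times> 'f \<Rightarrow>\<^sub>0 int)" where
  "BB x y = frag_extend (\<lambda>(a, f). frag_extend (\<lambda>(b, g). frag_of (a \<otimes>\<^bsub>Uups m n\<^esub> b, f * g)) y) x"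

lemma BB_of: "BB (frag_of (a, f)) (frag_of (b, g)) = frag_of (a \<otimes>\<^bsub>Uups m n\<^esub> b, f * g)"
  by (simp add: BB_def)

lemma BB_left: "BB (x + x') y = BB x y + BB x' y" "BB (- x) y = - BB x y" "BB (x - x') y = BB x y - BB x' y" "BB 0 y = 0"
  by (simp_all add: BB_def frag_extend_add frag_extend_minus frag_extend_diff)

lemma BB_right: "BB x (y + y') = BB x y + BB x y'" "BB x (- y) = - BB x y" "BB x 0 = 0" "BB x (y - y') = BB x y - BB x y'"
proof -
  show a: "BB x (y + y') = BB x y + BB x y'" for y y'
    unfolding BB_def case_prod_unfold frag_extend_add by (rule frag_extend_add')
  show b: "BB x (- y) = - BB x y" for y
    unfolding BB_def case_prod_unfold frag_extend_minus by (rule frag_extend_minus')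
  show "BB x 0 = 0" using a[of 0 0] by simp
  show "BB x (y - y') = BB x y - BB x y'" using a[of y "- y'"] b[of y'] by simp
qed

abbreviation "UF \<equiv> UZc m n \<times> (UNIV :: 'f set)"

lemma BB_keys:
  assumes "Poly_Mapping.keys x \<subseteq> UF" "Poly_Mapping.keys y \<subseteq> UF" shows "Poly_Mapping.keys (BB x y) \<subseteq> UF"
  using assms
proof (induction x rule: free_add_induct)
  case (gen a)
  from gen(2,1) show ?case
  proof (induction y rule: free_add_induct)
    case (gen b) thus ?case by (cases a; cases b) (auto simp: BB_of generate_ring.eng_mult)
  qed (auto simp: BB_right frag_add_keys)
qed (auto simp: BB_left frag_add_keys)

text \<open>It suffices to treat a relation times a free generator, which is again a relation of the same kind.\<close>

lemma BB_ker_left: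
  assumes "Poly_Mapping.keys y \<subseteq> UF" "x \<in> T.FK" shows "BB x y \<in> T.FK"
  using assms
proof (induction y rule: free_add_induct)
  case (gen w)
  obtain b g where w: "w = (b, g)" by force
  have b: "b \<in> UZc m n" "b \<in> carrier (Uups m n)" using gen w UZ_sub by auto
  from gen(2) show ?case
  proof (induction x rule: T.ker_induct)
    case (rel x)
    from rel[unfolded tensor_rels_def] have "BB x (frag_of w) \<in> T.frel"
    proof (elim UnE CollectE exE conjE)
      fix a a' f assume h: "x = frag_of (a \<oplus>\<^bsub>UZ m n\<^esub> a', f) - frag_of (a, f) - frag_of (a', f)" "a \<in> carrier (UZ m n)" "a' \<in> carrier (UZ m n)"
      have e: "BB x (frag_of w) = frag_of ((a \<otimes>\<^bsub>Uups m n\<^esub> b) \<oplus>\<^bsub>UZ m n\<^esub> (a' \<otimes>\<^bsub>Uups m n\<^esub> b), f * g) - frag_of (a \<otimes>\<^bsub>Uups m n\<^esub> b, f * g) - frag_of (a' \<otimes>\<^bsub>Uups m n\<^esub> b, f * g)"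
        using h b by (simp add: w BB_left BB_of U.l_distr UZ_sub)
      have "a \<otimes>\<^bsub>Uups m n\<^esub> b \<in> carrier (UZ m n)" "a' \<otimes>\<^bsub>Uups m n\<^esub> b \<in> carrier (UZ m n)"
        using h b by (simp_all add: generate_ring.eng_mult)
      thus "BB x (frag_of w) \<in> T.frel" unfolding e tensor_rels_def Fr_simps(1) by blast
    next
      fix a f f' assume h: "x = frag_of (a, f \<oplus>\<^bsub>Fr\<^esub> f') - frag_of (a, f) - frag_of (a, f')" "a \<in> carrier (UZ m n)"
      have e: "BB x (frag_of w) = frag_of (a \<otimes>\<^bsub>Uups m n\<^esub> b, f * g \<oplus>\<^bsub>Fr\<^esub> f' * g) - frag_of (a \<otimes>\<^bsub>Uups m n\<^esub> b, f * g) - frag_of (a \<otimes>\<^bsub>Uups m n\<^esub> b, f' * g)"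
        using h b by (simp add: w BB_left BB_of distrib_right)
      have "a \<otimes>\<^bsub>Uups m n\<^esub> b \<in> carrier (UZ m n)" using h b by (simp add: generate_ring.eng_mult)
      thus "BB x (frag_of w) \<in> T.frel" unfolding e tensor_rels_def Fr_simps(1) by blast
    next
      fix a f z assume h: "x = frag_of (UZ_act m n a z, f) - frag_of (a, laurent_eval q z * f)" "a \<in> carrier (UZ m n)"
      have e: "BB x (frag_of w) = frag_of (UZ_act m n (a \<otimes>\<^bsub>Uups m n\<^esub> b) z, f * g) - frag_of (a \<otimes>\<^bsub>Uups m n\<^esub> b, laurent_eval q z * (f * g))"
        using h b by (simp add: w BB_left BB_of UZ_act_mult UZ_sub mult.assoc)
      have "a \<otimes>\<^bsub>Uups m n\<^esub> b \<in> carrier (UZ m n)" using h b by (simp add: generate_ring.eng_mult)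
      thus "BB x (frag_of w) \<in> T.frel" unfolding e tensor_rels_def Fr_simps(1) by blast
    qed
    thus ?case by (rule T.ker_rel)
  qed (simp_all add: BB_left T.ker_0 T.ker_add T.ker_minus)
qed (simp_all add: BB_right T.ker_0 T.ker_add T.ker_minus)

lemma BB_ker_right:
  assumes "Poly_Mapping.keys y \<subseteq> UF" "x \<in> T.FK" shows "BB y x \<in> T.FK"
  using assms
proof (induction y rule: free_add_induct)
  case (gen w)
  obtain b g where w: "w = (b, g)" by force
  have b: "b \<in> UZc m n" "b \<in> carrier (Uups m n)" using gen w UZ_sub by auto
  from gen(2) show ?case
  proof (induction x rule: T.ker_induct)
    case (rel x)
    from rel[unfolded tensor_rels_def] have "BB (frag_of w) x \<in> T.frel"
    proof (elim UnE CollectE exE conjE)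
      fix a a' f assume h: "x = frag_of (a \<oplus>\<^bsub>UZ m n\<^esub> a', f) - frag_of (a, f) - frag_of (a', f)" "a \<in> carrier (UZ m n)" "a' \<in> carrier (UZ m n)"
      have e: "BB (frag_of w) x = frag_of ((b \<otimes>\<^bsub>Uups m n\<^esub> a) \<oplus>\<^bsub>UZ m n\<^esub> (b \<otimes>\<^bsub>Uups m n\<^esub> a'), g * f) - frag_of (b \<otimes>\<^bsub>Uups m n\<^esub> a, g * f) - frag_of (b \<otimes>\<^bsub>Uups m n\<^esub> a', g * f)"
        using h b by (simp add: w BB_right BB_of U.r_distr UZ_sub)
      have "b \<otimes>\<^bsub>Uups m n\<^esub> a \<in> carrier (UZ m n)" "b \<otimes>\<^bsub>Uups m n\<^esub> a' \<in> carrier (UZ m n)"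
        using h b by (simp_all add: generate_ring.eng_mult)
      thus "BB (frag_of w) x \<in> T.frel" unfolding e tensor_rels_def Fr_simps(1) by blast
    next
      fix a f f' assume h: "x = frag_of (a, f \<oplus>\<^bsub>Fr\<^esub> f') - frag_of (a, f) - frag_of (a, f')" "a \<in> carrier (UZ m n)"
      have e: "BB (frag_of w) x = frag_of (b \<otimes>\<^bsub>Uups m n\<^esub> a, g * f \<oplus>\<^bsub>Fr\<^esub> g * f') - frag_of (b \<otimes>\<^bsub>Uups m n\<^esub> a, g * f) - frag_of (b \<otimes>\<^bsub>Uups m n\<^esub> a, g * f')"
        using h b by (simp add: w BB_right BB_of distrib_left)
      have "b \<otimes>\<^bsub>Uups m n\<^esub> a \<in> carrier (UZ m n)" using h b by (simp add: generate_ring.eng_mult)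
      thus "BB (frag_of w) x \<in> T.frel" unfolding e tensor_rels_def Fr_simps(1) by blast
    next
      fix a f z assume h: "x = frag_of (UZ_act m n a z, f) - frag_of (a, laurent_eval q z * f)" "a \<in> carrier (UZ m n)"
      have e: "BB (frag_of w) x = frag_of (UZ_act m n (b \<otimes>\<^bsub>Uups m n\<^esub> a) z, g * f) - frag_of (b \<otimes>\<^bsub>Uups m n\<^esub> a, laurent_eval q z * (g * f))"
        using h b by (simp add: w BB_right BB_of UZ_mult_act UZ_sub mult.left_commute)
      have "b \<otimes>\<^bsub>Uups m n\<^esub> a \<in> carrier (UZ m n)" using h b by (simp add: generate_ring.eng_mult)
      thus "BB (frag_of w) x \<in> T.frel" unfolding e tensor_rels_def Fr_simps(1) by blast
    qed
    thus ?case by (rule T.ker_rel)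
  qed (simp_all add: BB_right T.ker_0 T.ker_add T.ker_minus)
qed (simp_all add: BB_left T.ker_0 T.ker_add T.ker_minus)

abbreviation "UQ \<equiv> Uq m n q"

lemma bc_simps: "bc_class m n q = T.cl" "bc_group m n q = T.TG"
  by (simp_all add: bc_class_def bc_group_def fun_eq_iff)

lemma Uq_ops: "carrier UQ = T.cl ` {c. Poly_Mapping.keys c \<subseteq> UF}"
  "P \<oplus>\<^bsub>UQ\<^esub> Q = P \<otimes>\<^bsub>T.TG\<^esub> Q" "\<zero>\<^bsub>UQ\<^esub> = T.cl 0"
  "P \<otimes>\<^bsub>UQ\<^esub> Q = (\<Union>x\<in>P. \<Union>y\<in>Q. T.cl (BB x y))" "\<one>\<^bsub>UQ\<^esub> = T.cl (frag_of (\<one>\<^bsub>Uups m n\<^esub>, 1))"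
  by (simp_all add: Uq_def bc_simps T.TG_carrier T.TG_one BB_def)

lemma Uq_carrier: "Poly_Mapping.keys c \<subseteq> UF \<Longrightarrow> T.cl c \<in> carrier UQ"
  unfolding Uq_ops by blast

lemma Uq_add: "Poly_Mapping.keys c \<subseteq> UF \<Longrightarrow> Poly_Mapping.keys d \<subseteq> UF \<Longrightarrow> T.cl c \<oplus>\<^bsub>UQ\<^esub> T.cl d = T.cl (c + d)"
  unfolding Uq_ops by (rule T.cl_add) simp_all

text \<open>The union over all representatives in the definition of the product is a union of equal classes.\<close>

lemma Uq_mult: 
  assumes "Poly_Mapping.keys c \<subseteq> UF" "Poly_Mapping.keys d \<subseteq> UF"
  shows "T.cl c \<otimes>\<^bsub>UQ\<^esub> T.cl d = T.cl (BB c d)"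
proof -
  have e: "T.cl (BB x y) = T.cl (BB c d)" if "x \<in> T.cl c" "y \<in> T.cl d" for x y
  proof (rule T.cl_eqI)
    have k: "x - c \<in> T.FK" "y - d \<in> T.FK" using that T.cl_mem by auto
    have "Poly_Mapping.keys y \<subseteq> UF" using frag_add_keys[OF T.ker_keys[OF k(2)], of d] assms(2) by simp
    hence "BB (x - c) y \<in> T.FK" "BB c (y - d) \<in> T.FK" using BB_ker_left[OF _ k(1), of y] BB_ker_right[OF _ k(2)] assms by simp_all
    hence "BB (x - c) y + BB c (y - d) \<in> T.FK" by (rule T.ker_add)
    thus "BB x y - BB c d \<in> T.FK" by (simp add: BB_left BB_right)
  qed
  have "(\<Union>x\<in>T.cl c. \<Union>y\<in>T.cl d. T.cl (BB x y)) = (\<Union>x\<in>T.cl c. \<Union>y\<in>T.cl d. T.cl (BB c d))"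
    using e by simp
  also have "\<dots> = T.cl (BB c d)" using T.cl_self[of c] T.cl_self[of d] by auto
  finally show ?thesis unfolding Uq_ops(4) .
qed

lemma BB_assoc:
  assumes "Poly_Mapping.keys x \<subseteq> UF" "Poly_Mapping.keys y \<subseteq> UF" "Poly_Mapping.keys z \<subseteq> UF"
  shows "BB (BB x y) z = BB x (BB y z)"
  using assms(1)
proof (induction x rule: free_add_induct)
  case (gen a)
  from assms(2) show ?case
  proof (induction y rule: free_add_induct)
    case (gen b)
    from assms(3) show ?case
    proof (induction z rule: free_add_induct)
      case (gen c)
      thus ?case using \<open>a \<in> UF\<close> \<open>b \<in> UF\<close> UZ_sub
        by (cases a; cases b; cases c) (auto simp: BB_of U.m_assoc mult.assoc)
    qed (simp_all add: BB_right)
  qed (simp_all add: BB_right BB_left)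
qed (simp_all add: BB_left)

lemma BB_one: "Poly_Mapping.keys x \<subseteq> UF \<Longrightarrow> BB (frag_of (\<one>\<^bsub>Uups m n\<^esub>, 1)) x = x \<and> BB x (frag_of (\<one>\<^bsub>Uups m n\<^esub>, 1)) = x"
proof (induction x rule: free_add_induct)
  case (gen a) thus ?case using UZ_sub by (cases a) (auto simp: BB_of)
qed (simp_all add: BB_left BB_right)

lemma one_keys: "Poly_Mapping.keys (frag_of (\<one>\<^bsub>Uups m n\<^esub>, 1::'f)) \<subseteq> UF" by (auto simp: generate_ring.one)

lemma Uq_E: assumes "P \<in> carrier UQ" obtains c where "P = T.cl c" "Poly_Mapping.keys c \<subseteq> UF"
  using assms unfolding Uq_ops(1) by blast

lemma ring_Uq: "ring UQ"
proof (rule ringI)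
  show "abelian_group UQ"
  proof (rule abelian_groupI)
    fix x assume "x \<in> carrier UQ"
    then obtain c where c: "x = T.cl c" "Poly_Mapping.keys c \<subseteq> UF" by (rule Uq_E)
    thus "\<exists>y\<in>carrier UQ. y \<oplus>\<^bsub>UQ\<^esub> x = \<zero>\<^bsub>UQ\<^esub>"
      using Uq_add[of "-c" c] Uq_carrier[of "-c"] by (intro bexI[of _ "T.cl (-c)"]) (simp_all add: Uq_ops(3))
  qed ((unfold Uq_ops(3))?; (elim Uq_E; hypsubst)?; simp add: Uq_add Uq_carrier frag_add_keys add.assoc; simp add: add.commute; fail)+
  show "monoid UQ"
    by (rule monoidI; (unfold Uq_ops(5))?; (elim Uq_E; hypsubst)?; simp only: Uq_mult Uq_carrier BB_keys BB_assoc BB_one one_keys)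
qed ((elim Uq_E; hypsubst)?; simp only: Uq_mult Uq_add frag_add_keys BB_keys BB_left BB_right)+

end

section \<open>Simple tensors and parity\<close>

definition simple_tensor :: "nat \<Rightarrow> nat \<Rightarrow> 'f::field \<Rightarrow> uelt \<Rightarrow> 'f \<Rightarrow> 'f uqelt" where
  "simple_tensor m n q a f = bc_class m n q (frag_of (a, f))"

context
  fixes m n :: nat and q :: "'f::field"
begin

interpretation T: tensor "UZ m n" "Fr :: 'f ring" UNIV "UZ_act m n" "\<lambda>z f. laurent_eval q z * f"
  by unfold_locales (simp_all add: generate_ring.eng_add UZ_actc)

interpretation Uq: ring "Uq m n q" by (rule ring_Uq)

lemma simple_tensor_cl: "simple_tensor m n q a f = T.cl (frag_of (a, f))" by (simp add: simple_tensor_def bc_simps)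

lemma simple_tensor_keys: "a \<in> UZc m n \<Longrightarrow> Poly_Mapping.keys (frag_of (a, f::'f)) \<subseteq> UZc m n \<times> UNIV" by simp

lemma simple_tensor_carrier: "a \<in> UZc m n \<Longrightarrow> simple_tensor m n q a f \<in> carrier (Uq m n q)"
  unfolding simple_tensor_cl by (rule Uq_carrier[OF simple_tensor_keys])

lemma simple_tensor_mult: "a \<in> UZc m n \<Longrightarrow> b \<in> UZc m n \<Longrightarrow>
    simple_tensor m n q a f \<otimes>\<^bsub>Uq m n q\<^esub> simple_tensor m n q b g = simple_tensor m n q (a \<otimes>\<^bsub>Uups m n\<^esub> b) (f * g)"
  unfolding simple_tensor_cl by (simp only: Uq_mult[OF simple_tensor_keys simple_tensor_keys] BB_of)

lemma simple_tensor_one: "\<one>\<^bsub>Uq m n q\<^esub> = simple_tensor m n q \<one>\<^bsub>Uups m n\<^esub> 1"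
  unfolding simple_tensor_cl by (rule Uq_ops)

lemma simple_tensor_add_left: "a \<in> UZc m n \<Longrightarrow> b \<in> UZc m n \<Longrightarrow>
    simple_tensor m n q (a \<oplus>\<^bsub>Uups m n\<^esub> b) f = simple_tensor m n q a f \<oplus>\<^bsub>Uq m n q\<^esub> simple_tensor m n q b f"
  unfolding simple_tensor_cl Uq_ops(2) using T.rel_addM[of a b f] by simp

lemma simple_tensor_add_right: "a \<in> UZc m n \<Longrightarrow> simple_tensor m n q a (f + g) = simple_tensor m n q a f \<oplus>\<^bsub>Uq m n q\<^esub> simple_tensor m n q a g"
  unfolding simple_tensor_cl Uq_ops(2) using T.rel_addN[of a f g] by simp

lemma simple_tensor_act: "a \<in> UZc m n \<Longrightarrow> simple_tensor m n q (UZ_act m n a z) f = simple_tensor m n q a (laurent_eval q z * f)"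
  unfolding simple_tensor_cl using T.rel_bal[of a f z] by simp

lemma simple_tensor_zero: "a \<in> UZc m n \<Longrightarrow> simple_tensor m n q a 0 = \<zero>\<^bsub>Uq m n q\<^esub>"
  using simple_tensor_add_right[of a 0 0] simple_tensor_carrier[of a 0] by (metis Uq.add.r_cancel_one' add.right_neutral)

lemma simple_tensor_minus: "a \<in> UZc m n \<Longrightarrow> T.cl (- frag_of (a, f)) = simple_tensor m n q a (- f)"
proof -
  assume a: "a \<in> UZc m n"
  have "T.cl (frag_of (a, f) + frag_of (a, - f)) = T.cl 0"
    using simple_tensor_add_right[OF a, of f "-f"] simple_tensor_zero[OF a] a unfolding simple_tensor_cl Uq_ops(2,3) by (simp add: T.cl_add)
  moreover have "0 \<in> T.cl 0" by (rule T.cl_self)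
  ultimately have "0 - (frag_of (a, f) + frag_of (a, - f)) \<in> T.FK" using T.cl_mem by metis
  thus ?thesis unfolding simple_tensor_cl by (intro T.cl_eqI) (simp add: algebra_simps)
qed

text \<open>The base change is spanned additively by simple tensors; negatives are absorbed by the second factor.\<close>

lemma Uq_induct [consumes 1, case_names zero add tensor]:
  assumes u: "u \<in> carrier (Uq m n q)" and 0: "P \<zero>\<^bsub>Uq m n q\<^esub>"
    and add: "\<And>x y. x \<in> carrier (Uq m n q) \<Longrightarrow> y \<in> carrier (Uq m n q) \<Longrightarrow> P x \<Longrightarrow> P y \<Longrightarrow> P (x \<oplus>\<^bsub>Uq m n q\<^esub> y)"
    and t: "\<And>a f. a \<in> UZc m n \<Longrightarrow> P (simple_tensor m n q a f)"
  shows "P u"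
proof -
  obtain c where c: "u = T.cl c" "Poly_Mapping.keys c \<subseteq> UZc m n \<times> UNIV" using Uq_E[OF u] .
  from c(2) have "P (T.cl c) \<and> P (T.cl (- c))"
  proof (induction c rule: free_add_induct)
    case zero thus ?case using 0 by (simp add: Uq_ops(3))
  next
    case (add x y)
    have k: "Poly_Mapping.keys (- x) \<subseteq> UZc m n \<times> UNIV" "Poly_Mapping.keys (- y) \<subseteq> UZc m n \<times> UNIV" using add by auto
    have "T.cl (x + y) = T.cl x \<oplus>\<^bsub>Uq m n q\<^esub> T.cl y" "T.cl (- (x + y)) = T.cl (- x) \<oplus>\<^bsub>Uq m n q\<^esub> T.cl (- y)"
      using Uq_add[OF add.hyps, of q] Uq_add[OF k, of q] by simp_all
    thus ?case using add.IH assms(3) Uq_carrier[OF add.hyps(1)] Uq_carrier[OF add.hyps(2)] Uq_carrier[OF k(1)] Uq_carrier[OF k(2)] by metis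
  next
    case (gen p)
    obtain a f where p: "p = (a, f)" by force
    thus ?case using gen t[of a f] t[of a "-f"] simple_tensor_minus[of a f] unfolding simple_tensor_cl[of a f] by auto
  qed simp
  thus ?thesis using c by simp
qed

end

definition homogeneous :: "nat \<Rightarrow> bit \<Rightarrow> falg set" where
  "homogeneous m p = {x. \<forall>w\<in>Poly_Mapping.keys x. word_par m w = p}"

lemma word_par_add: "word_par m (u + w) = word_par m u + word_par m w"
  by (simp add: word_par_def plus_gword_def)

lemma homogeneous_mult: "x \<in> homogeneous m p \<Longrightarrow> y \<in> homogeneous m r \<Longrightarrow> x * y \<in> homogeneous m (p + r)"
  unfolding homogeneous_def using keys_mult[of x y] by (fastforce simp: word_par_add)
lemma homogeneous_diff: "x \<in> homogeneous m p \<Longrightarrow> y \<in> homogeneous m p \<Longrightarrow> x - y \<in> homogeneous m p"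
  unfolding homogeneous_def using keys_diff[of x y] by blast
lemma homogeneous_scal: "scal c \<in> homogeneous m 0"
  by (auto simp: homogeneous_def scal_def word_par_def zero_gword_def split: if_splits)
lemma homogeneous_1: "1 \<in> homogeneous m 0" using homogeneous_scal[of 1 m] by (simp add: scal_1)
lemma homogeneous_letter: "letter g \<in> homogeneous m (gen_par m g)"
  by (auto simp: homogeneous_def letter_def word_par_def)
lemma homogeneous_scal_mult: "x \<in> homogeneous m p \<Longrightarrow> scal c * x \<in> homogeneous m p"
  using homogeneous_mult[OF homogeneous_scal, of x m p c] unfolding add.left_neutral .
lemma homogeneous_mult0: "x \<in> homogeneous m 0 \<Longrightarrow> y \<in> homogeneous m 0 \<Longrightarrow> x * y \<in> homogeneous m 0"
  using homogeneous_mult[of x m 0 y 0] unfolding add.left_neutral .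
lemma homogeneous_pow: "x \<in> homogeneous m 0 \<Longrightarrow> x ^ M \<in> homogeneous m 0"
  by (induction M) (simp_all add: homogeneous_1 homogeneous_mult0)

lemma homogeneous_div: "letter g \<in> homogeneous m 0 \<Longrightarrow> divpow (letter g) M \<in> homogeneous m 0"
  unfolding divpow_def by (intro homogeneous_scal_mult homogeneous_pow)

lemma homogeneous_K: "xK j \<in> homogeneous m 0" and homogeneous_L: "xL j \<in> homogeneous m 0"
  using homogeneous_letter[of "gK j" m] homogeneous_letter[of "gL j" m] by (simp_all add: gen_par_def)

lemma homogeneous_Kbinom: "Kbinom m a c t \<in> homogeneous m 0"
proof -
  have "(\<Prod>s\<leftarrow>xs. scal (1 / (upsa m a powi int s - upsa m a powi (- int s)))
       * (scal (upsa m a powi (c - int s + 1)) * xK a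
          - scal (upsa m a powi (- c + int s - 1)) * xL a)) \<in> homogeneous m 0" for xs
    by (induction xs) (auto intro!: homogeneous_1 homogeneous_mult0 homogeneous_scal homogeneous_diff homogeneous_K homogeneous_L)
  thus ?thesis unfolding Kbinom_def .
qed

lemma part_Uups: "part (Uups m n) p = cls m n ` (carrier (free_alg m n) \<inter> homogeneous m p)"
  by (auto simp: Uups_def ring.extend_def sring.fields_def homogeneous_def)

lemma simple_tensor_part: "x \<in> carrier (free_alg m n) \<Longrightarrow> x \<in> homogeneous m p \<Longrightarrow> cls m n x \<in> UZc m n \<Longrightarrow>
    simple_tensor m n q (cls m n x) f \<in> part (Uq m n q) p"
  unfolding Uq_def simple_tensor_def by (auto intro!: generate.incl exI[of _ "cls m n x"] exI[of _ f] simp: part_Uups)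

definition elU :: "nat \<Rightarrow> nat \<Rightarrow> 'f::field \<Rightarrow> uall \<Rightarrow> 'f uqelt" where
  "elU m n q u = simple_tensor m n q (proj u m n) 1"

definition ZZ :: "nat \<Rightarrow> nat \<Rightarrow> uall set" where "ZZ m n = {u. proj u m n \<in> UZc m n}"

lemma scq_tq: "scq m n q c = simple_tensor m n q \<one>\<^bsub>Uups m n\<^esub> c" by (simp add: scq_def simple_tensor_def)

lemma elq_rep: "represents m n u x \<Longrightarrow> elq m n q x = elU m n q u"
  by (simp add: elq_def elU_def simple_tensor_def represents_def)

lemma UZ_1: "\<one>\<^bsub>Uups m n\<^esub> \<in> UZc m n" by (rule generate_ring.one)

lemma cls_gens:
  "i \<in> {1..<m+n} \<Longrightarrow> cls m n (divpow (xE i) M) \<in> UZc m n" "i \<in> {1..<m+n} \<Longrightarrow> cls m n (divpow (xF i) M) \<in> UZc m n"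
  "j \<in> {1..m+n} \<Longrightarrow> cls m n (xK j) \<in> UZc m n" "j \<in> {1..m+n} \<Longrightarrow> cls m n (xL j) \<in> UZc m n"
  "j \<in> {1..m+n} \<Longrightarrow> cls m n (Kbinom m j 0 t) \<in> UZc m n"
  by (rule generate_ring.incl; unfold UZgens_def; blast)+

lemma usc_act: "proj (usc (laurent_eval ups z) u) m n = UZ_act m n (proj u m n) z"
  by (simp add: proj_usc UZ_act_def)

lemma ZZ_closed: "1 \<in> ZZ m n" "x \<in> ZZ m n \<Longrightarrow> y \<in> ZZ m n \<Longrightarrow> x + y \<in> ZZ m n" "x \<in> ZZ m n \<Longrightarrow> y \<in> ZZ m n \<Longrightarrow> x - y \<in> ZZ m n"
  "x \<in> ZZ m n \<Longrightarrow> y \<in> ZZ m n \<Longrightarrow> x * y \<in> ZZ m n" "x \<in> ZZ m n \<Longrightarrow> usc (ups powi j) x \<in> ZZ m n"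
  using UZ_actc[of "proj x m n" m n "Poly_Mapping.single j 1"] usc_act[of "Poly_Mapping.single j 1" x m n]
  by (simp_all add: ZZ_def proj_simps generate_ring.intros a_minus_def laurent_eval_single)

lemma ZZ_rep: "represents m n u x \<Longrightarrow> cls m n x \<in> UZc m n \<Longrightarrow> u \<in> ZZ m n"
  by (simp add: ZZ_def represents_def)

lemma elU_carrier: "u \<in> ZZ m n \<Longrightarrow> elU m n q u \<in> carrier (Uq m n q)"
  unfolding elU_def ZZ_def by (simp add: simple_tensor_carrier)
lemma scq_carrier: "scq m n q c \<in> carrier (Uq m n q)"
  unfolding scq_tq by (rule simple_tensor_carrier[OF UZ_1])
lemma elU_add: "u \<in> ZZ m n \<Longrightarrow> w \<in> ZZ m n \<Longrightarrow> elU m n q (u + w) = elU m n q u \<oplus>\<^bsub>Uq m n q\<^esub> elU m n q w"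
  by (simp add: elU_def ZZ_def proj_add simple_tensor_add_left)
lemma elU_mult: "u \<in> ZZ m n \<Longrightarrow> w \<in> ZZ m n \<Longrightarrow> elU m n q (u * w) = elU m n q u \<otimes>\<^bsub>Uq m n q\<^esub> elU m n q w"
  by (simp add: elU_def ZZ_def proj_mult simple_tensor_mult)
lemma elU_1: "elU m n q 1 = \<one>\<^bsub>Uq m n q\<^esub>" by (simp add: elU_def proj_1 simple_tensor_one)
lemma scq_1: "scq m n q 1 = \<one>\<^bsub>Uq m n q\<^esub>" by (simp add: scq_tq simple_tensor_one)
lemma scq_add: "scq m n q (c + d) = scq m n q c \<oplus>\<^bsub>Uq m n q\<^esub> scq m n q d"
  unfolding scq_tq by (rule simple_tensor_add_right[OF UZ_1])
lemma scq_mult: "scq m n q c \<otimes>\<^bsub>Uq m n q\<^esub> scq m n q d = scq m n q (c * d)"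
  unfolding scq_tq by (simp add: simple_tensor_mult UZ_1)
lemma scq_tensor: "a \<in> UZc m n \<Longrightarrow> scq m n q c \<otimes>\<^bsub>Uq m n q\<^esub> simple_tensor m n q a f = simple_tensor m n q a (c * f)"
  "a \<in> UZc m n \<Longrightarrow> simple_tensor m n q a f \<otimes>\<^bsub>Uq m n q\<^esub> scq m n q c = simple_tensor m n q a (c * f)"
  unfolding scq_tq by (simp_all add: simple_tensor_mult UZ_1 UZ_sub mult.commute)
lemma elU_sc: "u \<in> ZZ m n \<Longrightarrow> elU m n q (usc (ups powi j) u) = scq m n q (q powi j) \<otimes>\<^bsub>Uq m n q\<^esub> elU m n q u"
  using usc_act[of "Poly_Mapping.single j 1" u m n]
  by (simp add: elU_def ZZ_def scq_tensor laurent_eval_single simple_tensor_act)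
lemma scq_elU: "u \<in> ZZ m n \<Longrightarrow> elU m n q u \<otimes>\<^bsub>Uq m n q\<^esub> scq m n q c = scq m n q c \<otimes>\<^bsub>Uq m n q\<^esub> elU m n q u"
  by (simp add: elU_def ZZ_def scq_tensor)

context
  fixes m n :: nat
begin

interpretation g: qgl_rel usc m "m+n" ups "uE m n" "uF m n" "uK m n" "uL m n" by (rule qgl_rel_ups)

lemma gens_ZZ:
  "i \<in> {1..<m+n} \<Longrightarrow> g.eD i M \<in> ZZ m n" "i \<in> {1..<m+n} \<Longrightarrow> g.fD i M \<in> ZZ m n"
  "j \<in> {1..m+n} \<Longrightarrow> uK m n j \<in> ZZ m n" "j \<in> {1..m+n} \<Longrightarrow> uL m n j \<in> ZZ m n"
  "j \<in> {1..m+n} \<Longrightarrow> g.kB j 0 t \<in> ZZ m n"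
  by (rule ZZ_rep[OF rep_eD cls_gens(1)] ZZ_rep[OF rep_fD cls_gens(2)] ZZ_rep[OF rep_K cls_gens(3)]
     ZZ_rep[OF rep_L cls_gens(4)] ZZ_rep[OF rep_kB cls_gens(5)]; assumption)+

end

section \<open>Irreducible supermodules over the base change\<close>

lemma supermoduleD:
  assumes "supermodule A V"
  shows "abelian_group V" "a \<in> carrier A \<Longrightarrow> x \<in> carrier V \<Longrightarrow> a \<odot>\<^bsub>V\<^esub> x \<in> carrier V"
    "a \<in> carrier A \<Longrightarrow> b \<in> carrier A \<Longrightarrow> x \<in> carrier V \<Longrightarrow> (a \<oplus>\<^bsub>A\<^esub> b) \<odot>\<^bsub>V\<^esub> x = (a \<odot>\<^bsub>V\<^esub> x) \<oplus>\<^bsub>V\<^esub> (b \<odot>\<^bsub>V\<^esub> x)"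
    "a \<in> carrier A \<Longrightarrow> x \<in> carrier V \<Longrightarrow> y \<in> carrier V \<Longrightarrow> a \<odot>\<^bsub>V\<^esub> (x \<oplus>\<^bsub>V\<^esub> y) = (a \<odot>\<^bsub>V\<^esub> x) \<oplus>\<^bsub>V\<^esub> (a \<odot>\<^bsub>V\<^esub> y)"
    "a \<in> carrier A \<Longrightarrow> b \<in> carrier A \<Longrightarrow> x \<in> carrier V \<Longrightarrow> (a \<otimes>\<^bsub>A\<^esub> b) \<odot>\<^bsub>V\<^esub> x = a \<odot>\<^bsub>V\<^esub> (b \<odot>\<^bsub>V\<^esub> x)"
    "x \<in> carrier V \<Longrightarrow> \<one>\<^bsub>A\<^esub> \<odot>\<^bsub>V\<^esub> x = x"
    "additive_subgroup (mpart V p) V" "mpart V 0 \<inter> mpart V 1 = {\<zero>\<^bsub>V\<^esub>}"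
    "mpart V 0 <+>\<^bsub>V\<^esub> mpart V 1 = carrier V"
    "a \<in> part A p \<Longrightarrow> x \<in> mpart V r \<Longrightarrow> a \<odot>\<^bsub>V\<^esub> x \<in> mpart V (p + r)"
  using assms unfolding supermodule_def by blast+

lemma set_add_iff: "x \<in> A <+>\<^bsub>V\<^esub> B \<longleftrightarrow> (\<exists>y\<in>A. \<exists>z\<in>B. x = y \<oplus>\<^bsub>V\<^esub> z)"
  by (auto simp: set_add_def set_mult_def)

context
  fixes m n :: nat and q :: "'f::field" and V :: "('f uqelt, 'v) smod"
  assumes sm: "supermodule (Uq m n q) V"
begin

interpretation g: qgl_rel usc m "m+n" ups "uE m n" "uF m n" "uK m n" "uL m n" by (rule qgl_rel_ups)
interpretation Uq: ring "Uq m n q" by (rule ring_Uq)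
interpretation V: abelian_group V by (rule supermoduleD[OF sm])

definition actV :: "uall \<Rightarrow> 'v \<Rightarrow> 'v" where "actV u x = elU m n q u \<odot>\<^bsub>V\<^esub> x"
definition fsV :: "'f \<Rightarrow> 'v \<Rightarrow> 'v" where "fsV c x = scq m n q c \<odot>\<^bsub>V\<^esub> x"

text \<open>A subspace stable under the generators is stable under the integral form, by induction on how an element is
generated, and then under the base change, since a simple tensor is a scalar times an element of the integral
form.\<close>

lemma generated_closed:
  assumes W: "W \<subseteq> carrier V" "\<zero>\<^bsub>V\<^esub> \<in> W" "\<And>x y. x \<in> W \<Longrightarrow> y \<in> W \<Longrightarrow> x \<oplus>\<^bsub>V\<^esub> y \<in> W"
    and fs: "\<And>c x. x \<in> W \<Longrightarrow> fsV c x \<in> W"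
    and gE: "\<And>i M x. i \<in> {1..<m+n} \<Longrightarrow> x \<in> W \<Longrightarrow> actV (g.eD i M) x \<in> W"
    and gF: "\<And>i M x. i \<in> {1..<m+n} \<Longrightarrow> x \<in> W \<Longrightarrow> actV (g.fD i M) x \<in> W"
    and gK: "\<And>a x. a \<in> {1..m+n} \<Longrightarrow> x \<in> W \<Longrightarrow> actV (uK m n a) x \<in> W"
    and gL: "\<And>a x. a \<in> {1..m+n} \<Longrightarrow> x \<in> W \<Longrightarrow> actV (uL m n a) x \<in> W"
    and gB: "\<And>a t x. a \<in> {1..m+n} \<Longrightarrow> x \<in> W \<Longrightarrow> actV (g.kB a 0 t) x \<in> W"
    and u: "u \<in> carrier (Uq m n q)" and x: "x \<in> W"
  shows "u \<odot>\<^bsub>V\<^esub> x \<in> W"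
proof -
  note d = supermoduleD[OF sm]
  have cW: "x \<in> carrier V" if "x \<in> W" for x using that W(1) by blast
  have tens: "simple_tensor m n q a (c * f) \<odot>\<^bsub>V\<^esub> x = fsV c (simple_tensor m n q a f \<odot>\<^bsub>V\<^esub> x)" if "a \<in> UZc m n" "x \<in> W" for a c f x
    using that cW[of x] by (simp add: scq_tensor(1)[symmetric] d(5) scq_carrier simple_tensor_carrier fsV_def)
  have el: "simple_tensor m n q (cls m n y) 1 \<odot>\<^bsub>V\<^esub> x = actV u x" if "represents m n u y" for u x y
    using that by (simp add: actV_def elU_def represents_def)
  have int: "simple_tensor m n q a 1 \<odot>\<^bsub>V\<^esub> x \<in> W" if "a \<in> UZc m n" "x \<in> W" for a x
    using that
  proof (induction a arbitrary: x rule: generate_ring.induct)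
    case one thus ?case using d(6) cW by (simp add: simple_tensor_one[symmetric])
  next
    case (incl h)
    then consider z where "h = cls m n (scal (laurent_eval ups z))"
      | i M where "h = cls m n (divpow (xE i) M)" "i \<in> {1..<m+n}"
      | i M where "h = cls m n (divpow (xF i) M)" "i \<in> {1..<m+n}"
      | j where "h = cls m n (xK j)" "j \<in> {1..m+n}" | j where "h = cls m n (xL j)" "j \<in> {1..m+n}"
      | j t where "h = cls m n (Kbinom m j 0 t)" "j \<in> {1..m+n}"
      unfolding UZgens_def by blast
    thus ?case
    proof cases
      case 1
      have "h = UZ_act m n \<one>\<^bsub>Uups m n\<^esub> z" unfolding 1 UZ_act_def by simp
      hence "simple_tensor m n q h 1 = scq m n q (laurent_eval q z)" by (simp add: simple_tensor_act UZ_1 scq_tq)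
      thus ?thesis using fs[OF incl(2), of "laurent_eval q z"] by (simp add: fsV_def)
    next
      case 2 thus ?thesis using el[OF rep_eD] gE incl(2) by simp
    next
      case 3 thus ?thesis using el[OF rep_fD] gF incl(2) by simp
    next
      case 4 thus ?thesis using el[OF rep_K] gK incl(2) by simp
    next
      case 5 thus ?thesis using el[OF rep_L] gL incl(2) by simp
    next
      case 6 thus ?thesis using el[OF rep_kB] gB incl(2) by simp
    qed
  next
    case (a_inv h)
    have h: "h \<in> carrier (Uups m n)" using a_inv UZ_sub by blast
    \<comment> \<open>the negative is the product with the Laurent polynomial \<open>-1\<close>\<close>
    let ?z = "Poly_Mapping.single 0 (-1) :: laurent"
    have z: "laurent_eval y ?z = - 1" for y :: "'k::field" by (simp add: laurent_eval_def)
    have "UZ_act m n h ?z = \<ominus>\<^bsub>Uups m n\<^esub> h"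
      unfolding UZ_act_def z scal_m1 using h by (simp add: cls_minus free_1 cls_1 U.l_minus)
    hence "simple_tensor m n q (\<ominus>\<^bsub>Uups m n\<^esub> h) 1 = simple_tensor m n q h (- 1 * 1)"
      using simple_tensor_act[OF a_inv(1), of q ?z 1] by (simp add: z)
    thus ?case using tens[OF a_inv(1,3), of "- 1" 1] a_inv(2)[OF a_inv(3)] fs by simp
  next
    case (eng_add a b)
    thus ?case by (simp add: simple_tensor_add_left d(3) simple_tensor_carrier cW W(3))
  next
    case (eng_mult a b)
    have "simple_tensor m n q (a \<otimes>\<^bsub>Uups m n\<^esub> b) 1 = simple_tensor m n q a 1 \<otimes>\<^bsub>Uq m n q\<^esub> simple_tensor m n q b 1"
      using eng_mult(1,2) by (simp add: simple_tensor_mult)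
    thus ?case using eng_mult by (simp add: d(5) simple_tensor_carrier cW)
  qed
  from u x show ?thesis
  proof (induction u rule: Uq_induct)
    case zero
    have "scq m n q 0 = \<zero>\<^bsub>Uq m n q\<^esub>" unfolding scq_tq by (rule simple_tensor_zero[OF UZ_1])
    thus ?case using fs[of x 0] zero unfolding fsV_def by simp
  next
    case (add a b) thus ?case by (simp add: d(3) cW W(3))
  next
    case (tensor a f)
    thus ?case using tens[of a x f 1] int fs by simp
  qed
qed

lemma closed_subsupermodule:
  assumes W: "W \<subseteq> carrier V" "\<zero>\<^bsub>V\<^esub> \<in> W" "\<And>x y. x \<in> W \<Longrightarrow> y \<in> W \<Longrightarrow> x \<oplus>\<^bsub>V\<^esub> y \<in> W"
    and fs: "\<And>c x. x \<in> W \<Longrightarrow> fsV c x \<in> W"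
    and gr: "\<And>x. x \<in> W \<Longrightarrow> \<exists>y\<in>W \<inter> mpart V 0. \<exists>z\<in>W \<inter> mpart V 1. x = y \<oplus>\<^bsub>V\<^esub> z"
    and gE: "\<And>i M x. i \<in> {1..<m+n} \<Longrightarrow> x \<in> W \<Longrightarrow> actV (g.eD i M) x \<in> W"
    and gF: "\<And>i M x. i \<in> {1..<m+n} \<Longrightarrow> x \<in> W \<Longrightarrow> actV (g.fD i M) x \<in> W"
    and gK: "\<And>a x. a \<in> {1..m+n} \<Longrightarrow> x \<in> W \<Longrightarrow> actV (uK m n a) x \<in> W"
    and gL: "\<And>a x. a \<in> {1..m+n} \<Longrightarrow> x \<in> W \<Longrightarrow> actV (uL m n a) x \<in> W"
    and gB: "\<And>a t x. a \<in> {1..m+n} \<Longrightarrow> x \<in> W \<Longrightarrow> actV (g.kB a 0 t) x \<in> W"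
  shows "subsupermodule (Uq m n q) V W"
  unfolding subsupermodule_def
proof (intro conjI ballI)
  note d = supermoduleD[OF sm]
  have inv: "\<ominus>\<^bsub>V\<^esub> x \<in> W" if x: "x \<in> W" for x
  proof -
    have xc: "x \<in> carrier V" using x W(1) by blast
    have c: "fsV (-1) x \<in> carrier V" "fsV 0 x \<in> carrier V" using fs[OF x] W(1) by blast+
    have z: "fsV 0 x = \<zero>\<^bsub>V\<^esub>"
      using d(3)[OF scq_carrier scq_carrier xc, of 0 0] c(2) V.add.r_cancel_one'[of "fsV 0 x" "fsV 0 x"]
      unfolding fsV_def by (simp add: scq_add[symmetric])
    have "fsV 1 x = x" using xc by (simp add: fsV_def scq_1 d(6))
    hence "fsV (-1) x \<oplus>\<^bsub>V\<^esub> x = fsV (-1 + 1) x"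
      using d(3)[OF scq_carrier scq_carrier xc, of "-1" 1] by (simp only: fsV_def scq_add)
    hence "fsV (-1) x \<oplus>\<^bsub>V\<^esub> x = fsV 0 x" by simp
    hence "fsV (-1) x = \<ominus>\<^bsub>V\<^esub> x" using z c xc by (intro V.minus_equality[symmetric]) simp_all
    thus ?thesis using fs[OF x, of "-1"] by simp
  qed
  show "additive_subgroup W V"
    unfolding additive_subgroup_def
    by (rule group.subgroupI) (use W inv V.a_group in \<open>auto simp: a_inv_def\<close>)
  show "W \<inter> mpart V 0 <+>\<^bsub>V\<^esub> W \<inter> mpart V 1 = W"
    using W(3) gr by (auto simp: set_add_iff)
  show "a \<odot>\<^bsub>V\<^esub> x \<in> W" if "a \<in> carrier (Uq m n q)" "x \<in> W" for a x
    by (rule generated_closed[OF W fs gE gF gK gL gB that])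
qed

lemma act_part: "represents m n u x \<Longrightarrow> x \<in> homogeneous m p \<Longrightarrow> u \<in> ZZ m n \<Longrightarrow> w \<in> mpart V r \<Longrightarrow> actV u w \<in> mpart V (p + r)"
  unfolding actV_def elU_def using simple_tensor_part[of x m n p q 1] rep_free[of m n u x] rep_proj[of m n u x]
  by (intro supermoduleD(10)[OF sm]) (simp add: ZZ_def)

lemma act_part0: "represents m n u x \<Longrightarrow> x \<in> homogeneous m 0 \<Longrightarrow> u \<in> ZZ m n \<Longrightarrow> w \<in> mpart V r \<Longrightarrow> actV u w \<in> mpart V r"
  using act_part[of u x 0 w r] unfolding add.left_neutral .

lemma fs_part: "w \<in> mpart V r \<Longrightarrow> fsV c w \<in> mpart V r"
proof -
  assume w: "w \<in> mpart V r"
  have "scq m n q c \<in> part (Uq m n q) 0"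
    using simple_tensor_part[OF free_1 homogeneous_1, of m n q c] UZ_1 by (simp add: scq_tq cls_1)
  thus ?thesis using supermoduleD(10)[OF sm _ w, of "scq m n q c" 0] unfolding fsV_def add.left_neutral by blast
qed

lemma EF_part:
  "m \<in> {1..<m+n} \<Longrightarrow> w \<in> mpart V r \<Longrightarrow> actV (uE m n m) w \<in> mpart V (r + 1)"
  "m \<in> {1..<m+n} \<Longrightarrow> w \<in> mpart V r \<Longrightarrow> actV (uF m n m) w \<in> mpart V (r + 1)"
proof -
  assume a: "m \<in> {1..<m+n}" "w \<in> mpart V r"
  have h: "xE m \<in> homogeneous m 1" "xF m \<in> homogeneous m 1"
    using homogeneous_letter[of "gE m" m] homogeneous_letter[of "gF m" m] by (simp_all add: gen_par_def)
  have z: "uE m n m \<in> ZZ m n" "uF m n m \<in> ZZ m n"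
    using gens_ZZ(1)[OF a(1), of "Suc 0"] gens_ZZ(2)[OF a(1), of "Suc 0"] unfolding g.eD_1 g.fD_1 .
  show "actV (uE m n m) w \<in> mpart V (r + 1)" "actV (uF m n m) w \<in> mpart V (r + 1)"
    using act_part[OF rep_E[OF a(1)] h(1) z(1) a(2)] act_part[OF rep_F[OF a(1)] h(2) z(2) a(2)]
    unfolding add.commute[of 1 r] .
qed

theorem qgl_module_supermodule:
  assumes q: "q \<noteq> 0" "q \<noteq> inverse q" 
    and irr: "\<And>W. subsupermodule (Uq m n q) V W \<Longrightarrow> W = {\<zero>\<^bsub>V\<^esub>} \<or> W = carrier V"
  shows "qgl_module usc m (m+n) ups (uE m n) (uF m n) (uK m n) (uL m n) V (ZZ m n) actV fsV q
    (\<lambda>s t. specialize q (qbinom s t)) (mpart V)"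
proof -
  note d = supermoduleD[OF sm]
  have hE: "xE i \<in> homogeneous m 0" "xF i \<in> homogeneous m 0" if "i \<noteq> m" for i
    using that homogeneous_letter[of "gE i" m] homogeneous_letter[of "gF i" m] by (simp_all add: gen_par_def)
  have Z: "u \<in> ZZ m n \<Longrightarrow> elU m n q u \<in> carrier (Uq m n q)" for u by (rule elU_carrier)
  show ?thesis
  proof (rule qgl_module.intro[OF qgl_rel_ups V.abelian_group_axioms qgl_module_axioms.intro], goal_cases)
    case 1 show ?case by (rule ZZ_closed)
  next case (2 x y) thus ?case by (rule ZZ_closed)
  next case (3 x y) thus ?case by (rule ZZ_closed)
  next case (4 x y) thus ?case by (rule ZZ_closed)
  next case (5 x j) thus ?case by (rule ZZ_closed)
  next case (6 i M) thus ?case by (rule gens_ZZ)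
  next case (7 i M) thus ?case by (rule gens_ZZ)
  next case (8 a) thus ?case by (rule gens_ZZ)
  next case (9 a) thus ?case by (rule gens_ZZ)
  next case (10 a t) thus ?case by (rule gens_ZZ)
  next case (11 u x) thus ?case by (simp add: actV_def d(2) Z)
  next case (12 u x y) thus ?case by (simp add: actV_def d(4) Z)
  next case (13 u w x) thus ?case by (simp add: actV_def elU_add d(3) Z)
  next case (14 u w x) thus ?case by (simp add: actV_def elU_mult d(5) Z)
  next case (15 x) thus ?case by (simp add: actV_def elU_1 d(6))
  next case (16 u x j) thus ?case by (simp add: actV_def fsV_def elU_sc d(5) Z scq_carrier)
  next case (17 x c) thus ?case by (simp add: fsV_def d(2) scq_carrier)
  next case (18 x y c) thus ?case by (simp add: fsV_def d(4) scq_carrier)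
  next case (19 x c d) thus ?case by (simp add: fsV_def scq_add d(3) scq_carrier)
  next case (20 x c d) thus ?case by (simp add: fsV_def d(5)[symmetric] scq_carrier scq_mult)
  next case (21 x) thus ?case by (simp add: fsV_def scq_1 d(6))
  next case (22 u x c) thus ?case by (simp add: actV_def fsV_def d(5)[symmetric] scq_carrier Z scq_elU)
  next case 23 show ?case by (rule q)
  next case 24 show ?case by (rule q)
  next case (25 t) thus ?case by (simp add: qbinom_0 specialize_0)
  next case (26 t) show ?case by (simp add: qbinom_diag specialize_1)
  next case (27 p) show ?case by (rule d)
  next case 28 show ?case by (rule d)
  next case (29 x) thus ?case using d(9) by (simp add: set_add_iff[symmetric])
  next case (30 x c p) thus ?case by (intro fs_part)
  next case (31 x i M p) thus ?case by (intro act_part0[OF rep_eD homogeneous_div[OF hE(1)] gens_ZZ(1)])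
  next case (32 x i M p) thus ?case by (intro act_part0[OF rep_fD homogeneous_div[OF hE(2)] gens_ZZ(2)])
  next case (33 x p) thus ?case by (intro EF_part)
  next case (34 x p) thus ?case by (intro EF_part)
  next case (35 x a p) thus ?case by (intro act_part0[OF rep_K homogeneous_K gens_ZZ(3)])
  next case (36 x a p) thus ?case by (intro act_part0[OF rep_L homogeneous_L gens_ZZ(4)])
  next case (37 x a t p) thus ?case by (intro act_part0[OF rep_kB homogeneous_Kbinom gens_ZZ(5)])
  next case (38 W) show ?case by (rule irr, rule closed_subsupermodule; fact 38)
  qed
qed

end

section \<open>The highest weight vector\<close>

lemma Uq_ge0_ops: "carrier (Uq_ge0 m n q) = generate_ring (Uq m n q)
       (scq m n q ` UNIV \<union>
        elq m n q ` ({divpow (xE i) M | i M. i \<in> {1..<m+n}} \<union>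
                     {xK j | j. j \<in> {1..m+n}} \<union> {xL j | j. j \<in> {1..m+n}} \<union>
                     {Kbinom m j 0 t | j t. j \<in> {1..m+n}}))"
  "monoid.mult (Uq_ge0 m n q) = monoid.mult (Uq m n q)" "monoid.one (Uq_ge0 m n q) = monoid.one (Uq m n q)"
  "ring.add (Uq_ge0 m n q) = ring.add (Uq m n q)"
  by (simp_all add: Uq_ge0_def Let_def)

lemma ge0_gens:
  "scq m n q c \<in> carrier (Uq_ge0 m n q)"
  "i \<in> {1..<m+n} \<Longrightarrow> elq m n q (divpow (xE i) M) \<in> carrier (Uq_ge0 m n q)"
  "j \<in> {1..m+n} \<Longrightarrow> elq m n q (xK j) \<in> carrier (Uq_ge0 m n q)"
  "j \<in> {1..m+n} \<Longrightarrow> elq m n q (xL j) \<in> carrier (Uq_ge0 m n q)"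
  "j \<in> {1..m+n} \<Longrightarrow> elq m n q (Kbinom m j 0 t) \<in> carrier (Uq_ge0 m n q)"
  unfolding Uq_ge0_ops by (rule generate_ring.incl; blast)+

context
  fixes m n :: nat and q :: "'f::field"
begin

interpretation g: qgl_rel usc m "m+n" ups "uE m n" "uF m n" "uK m n" "uL m n" by (rule qgl_rel_ups)
interpretation Uq: ring "Uq m n q" by (rule ring_Uq)

lemma ge0_sub: "u \<in> carrier (Uq_ge0 m n q) \<Longrightarrow> u \<in> carrier (Uq m n q)"
proof -
  have "scq m n q ` UNIV \<union>
        elq m n q ` ({divpow (xE i) M | i M. i \<in> {1..<m+n}} \<union>
                     {xK j | j. j \<in> {1..m+n}} \<union> {xL j | j. j \<in> {1..m+n}} \<union>
                     {Kbinom m j 0 t | j t. j \<in> {1..m+n}}) \<subseteq> carrier (Uq m n q)"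
    using elq_rep[OF rep_eD, of _ m n q] elq_rep[OF rep_K, of _ m n q] elq_rep[OF rep_L, of _ m n q] elq_rep[OF rep_kB, of _ m n q]
    by (auto simp: scq_carrier intro!: elU_carrier gens_ZZ)
  from Uq.generate_ring_in_carrier[OF this] show "u \<in> carrier (Uq_ge0 m n q) \<Longrightarrow> u \<in> carrier (Uq m n q)"
    unfolding Uq_ge0_ops by blast
qed

lemma elU_diff: assumes "x \<in> ZZ m n" "y \<in> ZZ m n"
  shows "elU m n q (x - y) = elU m n q x \<ominus>\<^bsub>Uq m n q\<^esub> elU m n q y"
proof -
  have "elU m n q (x - y) \<oplus>\<^bsub>Uq m n q\<^esub> elU m n q y = elU m n q x"
    using elU_add[OF ZZ_closed(3)[OF assms] assms(2), of q] by simp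
  thus ?thesis using elU_carrier[OF ZZ_closed(3)[OF assms], of q] elU_carrier[OF assms(1), of q] elU_carrier[OF assms(2), of q]
    by (metis Uq.add.inv_solve_right Uq.minus_eq)
qed

text \<open>The defining generators contain only the binomials with \<open>c = 0\<close>; the others are obtained by
\<open>kb_closed\<close>.\<close>

lemma ge0_Kbinom: assumes a: "a \<in> {1..m+n}" shows "elq m n q (Kbinom m a c t) \<in> carrier (Uq_ge0 m n q)"
proof -
  let ?B = "{u \<in> ZZ m n. elU m n q u \<in> carrier (Uq_ge0 m n q)}"
  have "g.kB a c t \<in> ?B"
    unfolding g.kB_def
  proof (rule usc.kb_closed[OF g.va0 g.qn_va])
    show "uK m n a * uL m n a = uL m n a * uK m n a" using g.KL[OF a] g.LK[OF a] by simp
    show "x + y \<in> ?B" if "x \<in> ?B" "y \<in> ?B" for x y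
      using that by (auto simp: ZZ_closed elU_add Uq_ge0_ops generate_ring.eng_add)
    show "x - y \<in> ?B" if "x \<in> ?B" "y \<in> ?B" for x y
      using that by (auto simp: ZZ_closed elU_diff Uq_ge0_ops a_minus_def intro!: generate_ring.eng_add generate_ring.a_inv)
    show "x * y \<in> ?B" if "x \<in> ?B" "y \<in> ?B" for x y
      using that by (auto simp: ZZ_closed elU_mult Uq_ge0_ops generate_ring.eng_mult)
    show "usc (g.va a powi j) x \<in> ?B" if "x \<in> ?B" for x j
    proof -
      have "g.va a powi j = ups powi (if a \<le> m then j else - j)"
        by (simp add: g.va_def power_int_inverse power_int_minus)
      thus ?thesis using that ge0_gens(1)[of m n q] 
        by (auto simp: ZZ_closed elU_sc Uq_ge0_ops generate_ring.eng_mult)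
    qed
    show "uL m n a \<in> ?B" using gens_ZZ(4)[OF a] ge0_gens(4)[OF a, of q] unfolding elq_rep[OF rep_L[OF a]] by simp
    show "usc.kb (g.va a) (uK m n a) (uL m n a) 0 s \<in> ?B" for s
      using gens_ZZ(5)[OF a] ge0_gens(5)[OF a, of q] unfolding elq_rep[OF rep_kB[OF a]] g.kB_def by simp
  qed
  thus ?thesis unfolding elq_rep[OF rep_kB[OF a]] by simp
qed

context
  fixes N :: "('f uqelt, 'f) smod" and lam :: "nat \<Rightarrow> int"
  assumes N: "is_F_lambda m n q lam N"
begin

abbreviation "Bc \<equiv> carrier (Uq_ge0 m n q)"

lemma Nc [simp]: "carrier N = UNIV" "\<zero>\<^bsub>N\<^esub> = 0" "x \<oplus>\<^bsub>N\<^esub> y = x + y"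
  using N by (simp_all add: is_F_lambda_def)

interpretation I: tensor "Uq m n q" N Bc "monoid.mult (Uq m n q)" "module.smult N"
  by unfold_locales (simp_all add: ge0_sub)

abbreviation "IM \<equiv> induced_module (Uq m n q) (Uq_ge0 m n q) N"

lemma IM_ops: "carrier IM = carrier I.TG" "P \<oplus>\<^bsub>IM\<^esub> Q = P \<otimes>\<^bsub>I.TG\<^esub> Q"
  "u \<odot>\<^bsub>IM\<^esub> P = (\<Union>x\<in>P. I.cl (frag_extend (\<lambda>(a, w). frag_of (u \<otimes>\<^bsub>Uq m n q\<^esub> a, w)) x))"
  by (simp_all add: induced_module_def Let_def)

abbreviation "IF \<equiv> carrier (Uq m n q) \<times> (UNIV :: 'f set)"

text \<open>Left multiplication preserves the relations of the tensor product, so the action on classes is computed on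
representatives.\<close>

lemma IM_smult:
  assumes u: "u \<in> carrier (Uq m n q)" and c: "Poly_Mapping.keys c \<subseteq> IF"
  shows "u \<odot>\<^bsub>IM\<^esub> I.cl c = I.cl (frag_extend (\<lambda>(a, w). frag_of (u \<otimes>\<^bsub>Uq m n q\<^esub> a, w)) c)"
proof -
  let ?f = "frag_extend (\<lambda>(a, w). frag_of (u \<otimes>\<^bsub>Uq m n q\<^esub> a, w :: 'f))"
  have k: "?f x \<in> I.FK" if "x \<in> I.FK" for x
    using that
  proof (induction x rule: I.ker_induct)
    case (rel x)
    from rel[unfolded tensor_rels_def] have "?f x \<in> I.frel"
    proof (elim UnE CollectE exE conjE)
      fix a a' w assume h: "x = frag_of (a \<oplus>\<^bsub>Uq m n q\<^esub> a', w) - frag_of (a, w) - frag_of (a', w)" "a \<in> carrier (Uq m n q)" "a' \<in> carrier (Uq m n q)"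
      have "?f x = frag_of (u \<otimes>\<^bsub>Uq m n q\<^esub> a \<oplus>\<^bsub>Uq m n q\<^esub> u \<otimes>\<^bsub>Uq m n q\<^esub> a', w) - frag_of (u \<otimes>\<^bsub>Uq m n q\<^esub> a, w) - frag_of (u \<otimes>\<^bsub>Uq m n q\<^esub> a', w)"
        using h u by (simp add: frag_extend_diff Uq.r_distr)
      moreover have "u \<otimes>\<^bsub>Uq m n q\<^esub> a \<in> carrier (Uq m n q)" "u \<otimes>\<^bsub>Uq m n q\<^esub> a' \<in> carrier (Uq m n q)" using h u by simp_all
      ultimately show "?f x \<in> I.frel" unfolding tensor_rels_def Nc(1) by blast
    next
      fix a w w' assume h: "x = frag_of (a, w \<oplus>\<^bsub>N\<^esub> w') - frag_of (a, w) - frag_of (a, w')" "a \<in> carrier (Uq m n q)"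
      have "?f x = frag_of (u \<otimes>\<^bsub>Uq m n q\<^esub> a, w \<oplus>\<^bsub>N\<^esub> w') - frag_of (u \<otimes>\<^bsub>Uq m n q\<^esub> a, w) - frag_of (u \<otimes>\<^bsub>Uq m n q\<^esub> a, w')"
        using h u by (simp add: frag_extend_diff)
      moreover have "u \<otimes>\<^bsub>Uq m n q\<^esub> a \<in> carrier (Uq m n q)" using h u by simp
      ultimately show "?f x \<in> I.frel" unfolding tensor_rels_def Nc(1) by blast
    next
      fix a w b assume h: "x = frag_of (a \<otimes>\<^bsub>Uq m n q\<^esub> b, w) - frag_of (a, b \<odot>\<^bsub>N\<^esub> w)" "a \<in> carrier (Uq m n q)" "b \<in> Bc"
      have "?f x = frag_of ((u \<otimes>\<^bsub>Uq m n q\<^esub> a) \<otimes>\<^bsub>Uq m n q\<^esub> b, w) - frag_of (u \<otimes>\<^bsub>Uq m n q\<^esub> a, b \<odot>\<^bsub>N\<^esub> w)"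
        using h u ge0_sub by (simp add: frag_extend_diff Uq.m_assoc)
      moreover have "u \<otimes>\<^bsub>Uq m n q\<^esub> a \<in> carrier (Uq m n q)" using h u by simp
      ultimately show "?f x \<in> I.frel" using h(3) unfolding tensor_rels_def Nc(1) by blast
    qed
    thus ?case by (rule I.ker_rel)
  qed (simp_all add: frag_extend_add frag_extend_minus I.ker_0 I.ker_add I.ker_minus)
  have e: "I.cl (?f x) = I.cl (?f c)" if "x \<in> I.cl c" for x
    using k[OF I.cl_mem[OF that]] by (intro I.cl_eqI) (simp add: frag_extend_diff)
  have "(\<Union>x\<in>I.cl c. I.cl (?f x)) = (\<Union>x\<in>I.cl c. I.cl (?f c))" using e by simp
  also have "\<dots> = I.cl (?f c)" using I.cl_self[of c] by auto
  finally show ?thesis unfolding IM_ops(3) .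
qed

text \<open>The images \<open>w x\<close> of the simple tensors \<open>1 \<otimes> x\<close> span the quotient as a
module, so one of them is nonzero. Elements of the subalgebra act on \<open>w x\<close> as they act on
\<open>x\<close>, by balancing.\<close>

lemma highest_weight_vector:
  fixes V :: "('f uqelt, 'v) smod"
  assumes V: "supermodule (Uq m n q) V" "carrier V \<noteq> {\<zero>\<^bsub>V\<^esub>}"
    and phi: "\<phi> \<in> smod_hom (Uq m n q) IM V" "\<phi> ` carrier IM = carrier V"
  shows "\<exists>w\<in>weight_space m n q V lam. w \<noteq> \<zero>\<^bsub>V\<^esub> \<and>
    (\<forall>i\<in>{1..<m+n}. \<forall>M>0. elq m n q (divpow (xE i) M) \<odot>\<^bsub>V\<^esub> w = \<zero>\<^bsub>V\<^esub>)"
proof -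
  interpret V: abelian_group V by (rule supermoduleD[OF V(1)])
  note d = supermoduleD[OF V(1)]
  have c: "P \<in> carrier IM \<Longrightarrow> \<phi> P \<in> carrier V" 
    and hadd: "P \<in> carrier IM \<Longrightarrow> Q \<in> carrier IM \<Longrightarrow> \<phi> (P \<oplus>\<^bsub>IM\<^esub> Q) = \<phi> P \<oplus>\<^bsub>V\<^esub> \<phi> Q"
    and sm: "u \<in> carrier (Uq m n q) \<Longrightarrow> P \<in> carrier IM \<Longrightarrow> \<phi> (u \<odot>\<^bsub>IM\<^esub> P) = u \<odot>\<^bsub>V\<^esub> \<phi> P" for P Q u
    using phi(1) unfolding smod_hom_def by blast+
  have car: "I.cl c \<in> carrier IM" if "Poly_Mapping.keys c \<subseteq> IF" for c
    using that by (simp add: IM_ops I.cl_carrier)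
  define w where "w x = \<phi> (I.cl (frag_of (\<one>\<^bsub>Uq m n q\<^esub>, x)))" for x
  have wc: "w x \<in> carrier V" for x unfolding w_def by (intro c car) simp
  have uw: "u \<odot>\<^bsub>V\<^esub> w x = \<phi> (I.cl (frag_of (u, x)))" if "u \<in> carrier (Uq m n q)" for u x
    unfolding w_def using that by (subst sm[symmetric]) (simp_all add: car IM_smult)
  have bw: "b \<odot>\<^bsub>V\<^esub> w x = w (b \<odot>\<^bsub>N\<^esub> x)" if b: "b \<in> Bc" for b x
    unfolding uw[OF ge0_sub[OF b]] using I.rel_bal[of "\<one>\<^bsub>Uq m n q\<^esub>" x b] b ge0_sub[OF b] unfolding w_def by simp
  have wadd: "w (x + y) = w x \<oplus>\<^bsub>V\<^esub> w y" for x y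
  proof -
    have "I.cl (frag_of (\<one>\<^bsub>Uq m n q\<^esub>, x + y)) = I.cl (frag_of (\<one>\<^bsub>Uq m n q\<^esub>, x)) \<oplus>\<^bsub>IM\<^esub> I.cl (frag_of (\<one>\<^bsub>Uq m n q\<^esub>, y))"
      using I.rel_addN[of "\<one>\<^bsub>Uq m n q\<^esub>" x y] by (simp add: IM_ops)
    thus ?thesis unfolding w_def by (simp add: hadd car)
  qed
  have w0: "w 0 = \<zero>\<^bsub>V\<^esub>" using wadd[of 0 0] wc[of 0] V.add.r_cancel_one'[of "w 0" "w 0"] by simp
  have "\<exists>x. w x \<noteq> \<zero>\<^bsub>V\<^esub>"
  proof (rule ccontr)
    assume "\<not> ?thesis"
    hence w: "w x = \<zero>\<^bsub>V\<^esub>" for x by blast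
    have u0: "u \<odot>\<^bsub>V\<^esub> \<zero>\<^bsub>V\<^esub> = \<zero>\<^bsub>V\<^esub>" if "u \<in> carrier (Uq m n q)" for u
      using d(4)[OF that, of "\<zero>\<^bsub>V\<^esub>" "\<zero>\<^bsub>V\<^esub>"] d(2)[OF that, of "\<zero>\<^bsub>V\<^esub>"] V.add.r_cancel_one'[of "u \<odot>\<^bsub>V\<^esub> \<zero>\<^bsub>V\<^esub>" "u \<odot>\<^bsub>V\<^esub> \<zero>\<^bsub>V\<^esub>"] by simp
    have one0: "\<phi> (I.cl 0) = \<zero>\<^bsub>V\<^esub>"
    proof -
      have "I.cl 0 \<oplus>\<^bsub>IM\<^esub> I.cl 0 = I.cl 0" unfolding IM_ops by (subst I.cl_add) simp_all
      thus ?thesis using hadd[OF car car, of 0 0] c[OF car, of 0] V.add.r_cancel_one'[of "\<phi> (I.cl 0)" "\<phi> (I.cl 0)"] by simp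
    qed
    have z: "\<phi> (I.cl c) = \<zero>\<^bsub>V\<^esub>" if "Poly_Mapping.keys c \<subseteq> IF" for c
      using that
    proof (induction c rule: free_add_induct)
      case zero show ?case by (rule one0)
    next
      case (add x y)
      have "I.cl x \<oplus>\<^bsub>IM\<^esub> I.cl y = I.cl (x + y)" unfolding IM_ops by (rule I.cl_add) (use add in simp_all)
      thus ?case using hadd[OF car car, of x y] add by simp
    next
      case (minus x)
      have "I.cl x \<oplus>\<^bsub>IM\<^esub> I.cl (- x) = I.cl (x + - x)" unfolding IM_ops by (rule I.cl_add) (use minus in simp_all)
      thus ?case using hadd[OF car car, of x "- x"] c[OF car, of "- x"] minus one0 by simp
    next
      case (gen p)
      obtain u x where p: "p = (u, x)" by force
      thus ?case using uw[of u x] u0[of u] gen w[of x] by simp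
    qed
    have "carrier V \<subseteq> {\<zero>\<^bsub>V\<^esub>}"
    proof
      fix y assume "y \<in> carrier V"
      then obtain P where "P \<in> carrier I.TG" "y = \<phi> P" using phi(2) unfolding IM_ops by blast
      thus "y \<in> {\<zero>\<^bsub>V\<^esub>}" using z unfolding I.TG_carrier by auto
    qed
    hence "carrier V = {\<zero>\<^bsub>V\<^esub>}" by auto
    thus False using V(2) by simp
  qed
  then obtain x where x: "w x \<noteq> \<zero>\<^bsub>V\<^esub>" by blast
  have Nw: "x \<in> weight_space m n q N lam" using N by (simp add: is_F_lambda_def)
  have "w x \<in> weight_space m n q V lam"
    using Nw wc by (simp add: weight_space_def bw ge0_gens ge0_Kbinom)
  moreover have "elq m n q (divpow (xE i) M) \<odot>\<^bsub>V\<^esub> w x = \<zero>\<^bsub>V\<^esub>" if "i \<in> {1..<m+n}" "M > 0" for i M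
    using bw[OF ge0_gens(2)[OF that(1)], of M x] N that w0 by (simp add: is_F_lambda_def)
  ultimately show ?thesis using x by blast
qed

end
end

section \<open>The quantum characteristic and the theorem\<close>

lemma primitive_root_powi:
  assumes "primitive_root q l'"
  shows "q powi j = 1 \<longleftrightarrow> int l' dvd j"
proof -
  have l: "l' > 0" "q ^ l' = 1" using assms by (auto simp: primitive_root_def)
  have q: "q \<noteq> 0" using l by (metis power_0_left zero_neq_one neq0_conv)
  have "q powi j = q powi (int l' * (j div int l')) * q powi (j mod int l')"
    using q by (simp add: power_int_add[symmetric])
  also have "q powi (int l' * (j div int l')) = 1"
    using l by (simp add: power_int_mult)
  also have "q powi (j mod int l') = q ^ nat (j mod int l')" using l by (simp add: power_int_def)
  finally have e: "q powi j = q ^ nat (j mod int l')" by simp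
  have "q ^ nat (j mod int l') = 1 \<longleftrightarrow> nat (j mod int l') = 0"
  proof
    assume a: "q ^ nat (j mod int l') = 1"
    have "nat (j mod int l') < l'" using l by (simp add: nat_less_iff)
    moreover have "\<forall>k. 0 < k \<and> k < l' \<longrightarrow> q ^ k \<noteq> 1" using assms by (simp add: primitive_root_def)
    ultimately show "nat (j mod int l') = 0" using a spec[of _ "nat (j mod int l')"] by (metis neq0_conv)
  qed simp
  also have "\<dots> \<longleftrightarrow> int l' dvd j" using l pos_mod_sign[of "int l'" j] by (simp add: dvd_eq_mod_eq_0 del: pos_mod_sign)
  finally show ?thesis unfolding e .
qed

text \<open>\<open>q\<^sup>z = q\<^sup>-\<^sup>z\<close> means \<open>q\<^sup>2\<^sup>z = 1\<close>, and
\<open>l\<close> is the order of \<open>q\<^sup>2\<close>, or 0 if this order is infinite.\<close>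

lemma quantum_char_dvd:
  assumes l: "quantum_char q l" and q: "q \<noteq> 0"
  shows "int l dvd z \<longleftrightarrow> q powi z = q powi (- z)"
proof -
  have "q powi z = q powi (- z) \<longleftrightarrow> q powi (2 * z) = 1"
    using q by (simp add: power_int_minus field_simps power_int_add[symmetric])
  also have "\<dots> \<longleftrightarrow> int l dvd z"
    using l unfolding quantum_char_def
  proof
    assume "\<exists>l'\<ge>3. primitive_root q l' \<and> l = (if odd l' then l' else l' div 2)"
    then obtain l' where l': "primitive_root q l'" "l = (if odd l' then l' else l' div 2)" by blast
    show ?thesis
    proof (cases "odd l'")
      case True
      hence "coprime (int l') 2" by simp
      thus ?thesis using True l' by (simp add: primitive_root_powi[OF l'(1)] coprime_dvd_mult_right_iff)
    next
      case False
      hence "int l' = 2 * int l" using l' by auto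
      thus ?thesis by (simp add: primitive_root_powi[OF l'(1)])
    qed
  next
    assume a: "(\<forall>k>0. q ^ k \<noteq> 1) \<and> l = 0"
    have "q powi (2 * z) \<noteq> 1" if "z \<noteq> 0"
    proof
      assume e: "q powi (2 * z) = 1"
      hence "q powi (- (2 * z)) = 1" by (simp add: power_int_minus)
      hence "q powi (\<bar>2 * z\<bar>) = 1" using e by (cases "z \<ge> 0") simp_all
      moreover have "q powi (\<bar>2 * z\<bar>) = q ^ nat \<bar>2 * z\<bar>" by (simp add: power_int_def)
      ultimately show False using a that by simp
    qed
    thus ?thesis using a by auto
  qed
  finally show ?thesis ..
qed

lemma quantum_char_q2: "quantum_char q l \<Longrightarrow> q \<noteq> 0 \<Longrightarrow> q \<noteq> inverse q"
  using quantum_char_dvd[of q l 1] unfolding quantum_char_def by (auto simp: power_int_minus split: if_splits)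

lemma sform_alpha: 
  assumes "1 \<le> c" "c \<le> m" "m < d" "d \<le> m + n"
  shows "sform m n \<mu> (alpha m n c d) = \<mu> c + \<mu> d"
proof -
  have "sform m n \<mu> (alpha m n c d) = (\<Sum>i=1..m+n. (if i = c then \<mu> c else 0) + (if i = d then \<mu> d else 0))"
    unfolding sform_def by (rule sum.cong) (use assms in \<open>auto simp: alpha_def eps_def isgn_def ipar_def\<close>)
  thus ?thesis using assms by (simp add: sum.distrib)
qed

text \<open>The vector of stage \<open>k\<close> is shown to be singular of stage \<open>k\<close> by induction. The
weight picked by the choice operator and the one carried through the induction give the same eigenvalues of
the \<open>K\<^sub>a\<close>, and divisibility by \<open>l\<close> depends only on these.\<close>

theorem proposition8p2:
  fixes m n l :: nat and q :: "'f::field" and lam :: "nat \<Rightarrow> int"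
    and V :: "('f uqelt, 'v) smod" and v :: 'v
  assumes "m + n > 0"
    and "CHAR('f) \<noteq> 2" and "q \<noteq> 0" and "quantum_char q l"
    and "lam \<in> dominant m n"
    and "is_L m n q lam V"
    and "v \<in> weight_space m n q V lam" and "v \<noteq> \<zero>\<^bsub>V\<^esub>"
  shows "\<forall>k\<le>m*n.
     odd_vec m n q l V v k \<noteq> \<zero>\<^bsub>V\<^esub> \<and>
     (\<forall>M>0. \<forall>i. 1 \<le> i \<and> i \<le> m + n - 1 \<and> i \<noteq> m \<longrightarrow>
        elq m n q (divpow (rootvec m i (i+1)) M) \<odot>\<^bsub>V\<^esub> odd_vec m n q l V v k = \<zero>\<^bsub>V\<^esub>) \<and>
     (\<forall>i. 1 \<le> i \<and> i \<le> k \<longrightarrow>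
        E_minus_beta m n q i \<odot>\<^bsub>V\<^esub> odd_vec m n q l V v k = \<zero>\<^bsub>V\<^esub>) \<and>
     (\<forall>j. k < j \<and> j \<le> m*n \<longrightarrow>
        E_beta m n q j \<odot>\<^bsub>V\<^esub> odd_vec m n q l V v k = \<zero>\<^bsub>V\<^esub>)"
proof -
  note q0 = \<open>q \<noteq> 0\<close> and qc = \<open>quantum_char q l\<close>
  have irr: "supermodule (Uq m n q) V" "carrier V \<noteq> {\<zero>\<^bsub>V\<^esub>}"
    "\<And>W. subsupermodule (Uq m n q) V W \<Longrightarrow> W = {\<zero>\<^bsub>V\<^esub>} \<or> W = carrier V"
    using assms(6) unfolding is_L_def irreducible_supermodule_def by blast+
  interpret Q: qgl_module usc m "m+n" ups "uE m n" "uF m n" "uK m n" "uL m n" V "ZZ m n"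
      "actV m n q V" "fsV m n q V" q "\<lambda>s t. specialize q (qbinom s t)" "mpart V"
    by (rule qgl_module_supermodule[OF irr(1) q0 quantum_char_q2[OF qc q0] irr(3)])
  have act: "elq m n q x \<odot>\<^bsub>V\<^esub> w = actV m n q V u w" if "represents m n u x" for u x w
    using elq_rep[OF that, of q] by (simp add: actV_def[OF irr(1)])
  have qa: "qa m q a powi j = Q.qa a powi j" for a j
    by (simp add: qa_def Q.qa_def isgn_def ipar_def power_int_minus)
  have ws: "weight_space m n q V \<mu> = Q.wspace \<mu>" for \<mu>
    unfolding weight_space_def Q.wspace_def by (simp add: act[OF rep_K] act[OF rep_kB] qa fsV_def[OF irr(1)])

  obtain N \<phi> where N: "is_F_lambda m n q lam N"
    "\<phi> \<in> smod_hom (Uq m n q) (induced_module (Uq m n q) (Uq_ge0 m n q) N) V"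
    "\<phi> ` carrier (induced_module (Uq m n q) (Uq_ge0 m n q) N) = carrier V"
    using assms(6) unfolding is_L_def by (elim conjE exE bexE) 
  obtain w where w: "w \<in> Q.wspace lam" "w \<noteq> \<zero>\<^bsub>V\<^esub>"
    and wE': "\<forall>i\<in>{1..<m+n}. \<forall>M>0. elq m n q (divpow (xE i) M) \<odot>\<^bsub>V\<^esub> w = \<zero>\<^bsub>V\<^esub>"
    using highest_weight_vector[OF N(1) irr(1,2) N(2,3)] unfolding ws by (elim bexE conjE)
  have wE: "actV m n q V (Q.eD i M) w = \<zero>\<^bsub>V\<^esub>" if "i \<in> {1..<m+n}" "M > 0" for i M
    unfolding act[OF rep_eD[OF that(1)], symmetric] using wE' that by simp
  have wc: "w \<in> carrier V" using w(1) by (rule Q.wspace_carrier)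
  have wX: "actV m n q V (Q.RE a b) w = \<zero>\<^bsub>V\<^esub>" if "1 \<le> a" "a < b" "b \<le> m + n" for a b
    by (rule Q.act_RE_zero[OF wc that(1)]) (use wE[of _ "Suc 0"] that in \<open>auto simp: Q.eD_1\<close>)
  have wS: "w \<in> Q.singular 0 lam"
    unfolding Q.singular_def
  proof (intro CollectI conjI Q.killedI)
    show "actV m n q V (Q.eD i (Suc M)) w = \<zero>\<^bsub>V\<^esub>" if "i \<in> {1..<m+n}" for i M using wE[OF that] by simp
    show "actV m n q V (Q.RE a b) w = \<zero>\<^bsub>V\<^esub>" if "Q.oddpos a b" for a b
      using that wX unfolding Q.oddpos_def by simp
    show "actV m n q V (Q.RF a b) w = \<zero>\<^bsub>V\<^esub>" if "Q.odd_rank a b \<le> 0" for a b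
      using that by (simp add: Q.odd_rank_def)
  qed (rule w)

  \<comment> \<open>the given ordering of the odd roots is the one of \<open>odd_rank\<close>\<close>
  have root: "Q.oddpos (beta_fst m (Suc k)) (beta_snd m (Suc k))" "Q.odd_rank (beta_fst m (Suc k)) (beta_snd m (Suc k)) = Suc k"
    if "k < m * n" for k
  proof -
    have m: "m > 0" using that by (cases m) auto
    have "k div m < n" using that m by (simp add: less_mult_imp_div_less mult.commute)
    thus "Q.oddpos (beta_fst m (Suc k)) (beta_snd m (Suc k))"
      using m mod_less_divisor[OF m, of k] by (simp add: Q.oddpos_def beta_fst_def beta_snd_def del: mod_less_divisor)
    have "m - (m - k mod m) = k mod m" using mod_less_divisor[OF m, of k] by simp
    thus "Q.odd_rank (beta_fst m (Suc k)) (beta_snd m (Suc k)) = Suc k"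
      by (simp add: Q.odd_rank_def beta_fst_def beta_snd_def)
  qed
  have Em: "E_minus_beta m n q (Suc k) \<odot>\<^bsub>V\<^esub> x = actV m n q V (Q.RF (beta_fst m (Suc k)) (beta_snd m (Suc k))) x"
    and Ep: "E_beta m n q (Suc k) \<odot>\<^bsub>V\<^esub> x = actV m n q V (Q.RE (beta_fst m (Suc k)) (beta_snd m (Suc k))) x" if "k < m * n" for k x
    using root(1)[OF that] unfolding E_minus_beta_def E_beta_def Q.oddpos_def
    by (auto intro!: act rep_RE rep_RF)

  have main: "\<exists>\<nu>. odd_vec m n q l V v k \<in> Q.singular k \<nu> \<and> odd_vec m n q l V v k \<noteq> \<zero>\<^bsub>V\<^esub>" if "k \<le> m * n" for k
    using that
  proof (induction k)
    case 0
    have "v \<in> Q.singular 0 lam" by (rule Q.singular_weight_space[OF wS w(2)]) (use assms(7) ws in simp)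
    thus ?case using assms(8) by auto
  next
    case (Suc k)
    let ?u = "odd_vec m n q l V v k" and ?c = "beta_fst m (Suc k)" and ?d = "beta_snd m (Suc k)"
    have k: "k < m * n" using Suc.prems by simp
    obtain \<nu> where u: "?u \<in> Q.singular k \<nu>" "?u \<noteq> \<zero>\<^bsub>V\<^esub>" using Suc by auto
    have uV: "?u \<in> Q.wspace \<nu>" using u by (simp add: Q.singular_def)
    note r = root[OF k]
    have cd: "1 \<le> ?c" "?c \<le> m" "m < ?d" "?d \<le> m + n" using r(1) by (auto simp: Q.oddpos_def)
    define \<mu> where "\<mu> = wt m n q V ?u"
    have "restrict \<nu> {1..m+n} \<in> wlat m n \<and> ?u \<in> weight_space m n q V (restrict \<nu> {1..m+n})"
      unfolding ws wlat_def using Q.wspace_cong[OF uV, of "restrict \<nu> {1..m+n}"] by simp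
    hence "\<mu> \<in> wlat m n \<and> ?u \<in> weight_space m n q V \<mu>" unfolding \<mu>_def wt_def
      by (rule someI[where P = "\<lambda>\<mu>. \<mu> \<in> wlat m n \<and> ?u \<in> weight_space m n q V \<mu>"])
    hence \<mu>: "?u \<in> Q.wspace \<mu>" by (simp add: ws)
    have eig: "Q.qa a powi \<mu> a = Q.qa a powi \<nu> a" if "a \<in> {1..m+n}" for a
      using Q.wspace_K[OF \<mu> that] Q.wspace_K[OF uV that] by (intro Q.fs_inj[OF Q.wspace_carrier[OF uV] u(2)]) simp
    have "q powi \<mu> ?c = q powi \<nu> ?c" using eig[of ?c] cd by (simp add: Q.qa_def)
    moreover have "q powi \<mu> ?d = q powi \<nu> ?d" using eig[of ?d] cd q0 by (simp add: Q.qa_def power_int_inverse)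
    ultimately have s: "q powi (\<mu> ?c + \<mu> ?d) = q powi (\<nu> ?c + \<nu> ?d)" using q0 by (simp add: power_int_add)
    have dvd: "int l dvd sform m n (wt m n q V ?u) (beta m n (Suc k)) \<longleftrightarrow> q powi (\<nu> ?c + \<nu> ?d) = q powi (- (\<nu> ?c + \<nu> ?d))"
      unfolding \<mu>_def[symmetric] beta_def sform_alpha[OF cd] quantum_char_dvd[OF qc q0] using s
      by (simp only: power_int_minus)
    show ?case
    proof (cases "int l dvd sform m n (wt m n q V ?u) (beta m n (Suc k))")
      case True
      thus ?thesis using Q.odd_reflection(2)[OF u r] dvd u(2) by (auto simp: Let_def)
    next
      case False
      thus ?thesis using Q.odd_reflection(1)[OF u r] dvd by (auto simp: Let_def Em[OF k])
    qed
  qed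
  show ?thesis
  proof (intro allI impI)
    fix k assume "k \<le> m * n"
    then obtain \<nu> where u: "odd_vec m n q l V v k \<in> Q.singular k \<nu>" "odd_vec m n q l V v k \<noteq> \<zero>\<^bsub>V\<^esub>" using main by blast
    let ?u = "odd_vec m n q l V v k"
    have s: "Q.killed k ?u" using u by (simp add: Q.singular_def)
    have "elq m n q (divpow (rootvec m i (i+1)) M) \<odot>\<^bsub>V\<^esub> ?u = \<zero>\<^bsub>V\<^esub>" if "M > 0" "1 \<le> i \<and> i \<le> m + n - 1 \<and> i \<noteq> m" for M i
    proof -
      have i: "i \<in> {1..<m+n}" "i \<noteq> m" using that by auto
      have "rootvec m i (i+1) = xE i" by (subst rootvec.simps) simp
      thus ?thesis using Q.killed_eD[OF s i that(1)] act[OF rep_eD[OF i(1)]] by simp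
    qed
    moreover have "E_minus_beta m n q i \<odot>\<^bsub>V\<^esub> ?u = \<zero>\<^bsub>V\<^esub>" if i: "1 \<le> i \<and> i \<le> k" for i
    proof -
      obtain j where j: "i = Suc j" "j < m * n" using i \<open>k \<le> m * n\<close> by (cases i) auto
      show ?thesis unfolding j(1) Em[OF j(2)] by (rule Q.killed_RF[OF s root(1)[OF j(2)]]) (use root(2)[OF j(2)] j i in simp)
    qed
    moreover have "E_beta m n q j \<odot>\<^bsub>V\<^esub> ?u = \<zero>\<^bsub>V\<^esub>" if j: "k < j \<and> j \<le> m * n" for j
    proof -
      obtain i where i: "j = Suc i" "i < m * n" using j by (cases j) auto
      show ?thesis unfolding i(1) Ep[OF i(2)] by (rule Q.killed_RE[OF s root(1)[OF i(2)]]) (use root(2)[OF i(2)] i j in simp)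
    qed
    ultimately show "?u \<noteq> \<zero>\<^bsub>V\<^esub> \<and>
     (\<forall>M>0. \<forall>i. 1 \<le> i \<and> i \<le> m + n - 1 \<and> i \<noteq> m \<longrightarrow>
        elq m n q (divpow (rootvec m i (i+1)) M) \<odot>\<^bsub>V\<^esub> ?u = \<zero>\<^bsub>V\<^esub>) \<and>
     (\<forall>i. 1 \<le> i \<and> i \<le> k \<longrightarrow> E_minus_beta m n q i \<odot>\<^bsub>V\<^esub> ?u = \<zero>\<^bsub>V\<^esub>) \<and>
     (\<forall>j. k < j \<and> j \<le> m*n \<longrightarrow> E_beta m n q j \<odot>\<^bsub>V\<^esub> ?u = \<zero>\<^bsub>V\<^esub>)"
      using u(2) by blast
  qed
qed

end
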